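(* For each $g\geq 1$ and $n\geq 1$ there exist examples of finitely presented groups $G_{n,g}$ with $\operatorname{def}(G_{n,g})\leq 0$ and $\beta_1(G_{n,g})=1$ such that $\bar\delta_0(\psi)=2g$, $\bar\delta_i(\psi)=2g-1$ for $1\leq i\leq n-1$, and $\bar\delta_n(\psi)=0$ whenever $\psi$ is a generator of $H^1(G_{n,g};\mathbb{Z})$.
   Context: The deficiency $\operatorname{def}(G)$ of a finitely presented group $G$ is the maximum, over all finite presentations of $G$, of (number of generators) $-$ (number of relations). $\beta_1(G)$ is the rank of the abelianization of $G$, and $H^1(G;\mathbb{Z})=\operatorname{Hom}(G,\mathbb{Z})$. A group $\Gamma$ is poly-torsion-free-abelian (PTFA) if it admits a normal series $\{1\}=G_0\vartriangleleft G_1\vartriangleleft\cdots\vartriangleleft G_n=\Gamma$ such that each factor $G_{i+1}/G_i$ is torsion-free abelian. If $\Gamma$ is PTFA then $\mathbb{Z}\Gamma$ is an Ore domain and embeds in its right ring of quotients $\mathcal{K}_\Gamma=\mathbb{Z}\Gamma(\mathbb{Z}\Gamma-\{0\})^{-1}$, which is a skew field. Rank over a skew field means dimension. All modules are right modules. Subgroups of PTFA groups are PTFA. Let $G$ be a finitely generated group, $\phi_\Gamma:G\twoheadrightarrow\Gamma$ a surjection onto a PTFA group and $\psi:G\twoheadrightarrow\mathbb{Z}$ a surjection with $\psi=\alpha_{\Gamma,\mathbb{Z}}\circ\phi_\Gamma$ for a surjection $\alpha_{\Gamma,\mathbb{Z}}:\Gamma\twoheadrightarrow\mathbb{Z}$.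 Put $\Gamma'=\ker\alpha_{\Gamma,\mathbb{Z}}$ and let $\mathbb{K}_\Gamma$ be the right ring of quotients (a skew field) of $\mathbb{Z}\Gamma'$. The abelian group $\ker\phi_\Gamma/[\ker\phi_\Gamma,\ker\phi_\Gamma]$ is a right $\mathbb{Z}\Gamma$-module via $[g]\gamma=[\gamma^{-1}g\gamma]$ (using any lift of $\gamma$ to $G$), hence a right $\mathbb{Z}\Gamma'$-module. Define $$\operatorname{r}_\Gamma(G)=\operatorname{rank}_{\mathcal{K}_\Gamma}\Big(\tfrac{\ker\phi_\Gamma}{[\ker\phi_\Gamma,\ker\phi_\Gamma]}\otimes_{\mathbb{Z}\Gamma}\mathcal{K}_\Gamma\Big),\qquad \bar\delta_\Gamma(\psi)=\operatorname{rank}_{\mathbb{K}_\Gamma}\Big(\tfrac{\ker\phi_\Gamma}{[\ker\phi_\Gamma,\ker\phi_\Gamma]}\otimes_{\mathbb{Z}\Gamma'}\mathbb{K}_\Gamma\Big)$$ the latter if $\operatorname{r}_\Gamma(G)=0$, and $\bar\delta_\Gamma(\psi)=0$ if $\operatorname{r}_\Gamma(G)\neq0$. The rational derived series of $G$ is $G_r^{(0)}=G$ and, for $n\geq1$, $G_r^{(n)}=\{g\in G_r^{(n-1)} : g^k\in[G_r^{(n-1)},G_r^{(n-1)}]\text{ for some }k\in\mathbb{Z}-\{0\}\}$. The quotient $\Gamma_n=G/G_r^{(n+1)}$ is PTFA; let $\phi_{\Gamma_n}:G\twoheadrightarrow\Gamma_n$ be the projection. For $\psi:G\to\mathbb{Z}$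 surjective (which always factors through $\Gamma_n$) the $n$th-order degree is $\bar\delta_n(\psi)=\bar\delta_{\Gamma_n}(\psi)$. *)

theory Defs
  imports "HOL-Algebra.Algebra" "HOL-Library.Extended_Nat"
begin

section \<open>Finite presentations, deficiency, first Betti number, first cohomology\<close>

text \<open>The letter \<open>(i, True)\<close> is the generator \<open>x_i\<close> and \<open>(i, False)\<close> is its inverse.\<close>

type_synonym word = "(nat \<times> bool) list"

definition words :: "nat \<Rightarrow> word set" where
  "words m = lists ({..<m} \<times> UNIV)"

definition deletion_step :: "nat \<Rightarrow> word set \<Rightarrow> (word \<times> word) set" where
  "deletion_step m R =
    {(u @ s @ v, u @ v) | u s v. u \<in> words m \<and> v \<in> words m \<and>
       s \<in> R \<union> {[(i, b), (i, \<not> b)] | i b. i < m}}"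

definition pres_rel :: "nat \<Rightarrow> word set \<Rightarrow> (word \<times> word) set" where
  "pres_rel m R = (deletion_step m R \<union> (deletion_step m R)\<inverse>)\<^sup>*"

text \<open>The group \<open>\<langle>x_0, \<dots>, x_(m-1) | R\<rangle>\<close>.\<close>

definition presented_group :: "nat \<Rightarrow> word set \<Rightarrow> word set monoid" where
  "presented_group m R =
    \<lparr>carrier = words m // pres_rel m R,
     monoid.mult = (\<lambda>C D. \<Union>u\<in>C. \<Union>v\<in>D. pres_rel m R `` {u @ v}),
     one = pres_rel m R `` {[]}\<rparr>"

definition finite_presentation ::
    "('a, 'b) monoid_scheme \<Rightarrow> nat \<Rightarrow> word set \<Rightarrow> bool" where
  "finite_presentation G m R \<longleftrightarrow>
     finite R \<and> R \<subseteq> words m \<and> presented_group m R \<cong> G"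

definition finitely_presented :: "('a, 'b) monoid_scheme \<Rightarrow> bool" where
  "finitely_presented G \<longleftrightarrow> group G \<and> (\<exists>m R. finite_presentation G m R)"

text \<open>For a finitely presented group the maximum exists: every value is bounded above by the
  first Betti number.\<close>

definition deficiency :: "('a, 'b) monoid_scheme \<Rightarrow> int" where
  "deficiency G =
    (GREATEST d. \<exists>m R. finite_presentation G m R \<and> d = int m - int (card R))"

definition Z_independent :: "('a, 'b) monoid_scheme \<Rightarrow> 'a set \<Rightarrow> bool" where
  "Z_independent A B \<longleftrightarrow> finite B \<and> B \<subseteq> carrier A \<and>
    (\<forall>c :: 'a \<Rightarrow> int. finprod A (\<lambda>b. b [^]\<^bsub>A\<^esub> c b) B = \<one>\<^bsub>A\<^esub> \<longrightarrow> (\<forall>b\<in>B. c b = 0))"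

definition abelian_rank :: "('a, 'b) monoid_scheme \<Rightarrow> enat" where
  "abelian_rank A = Sup {enat (card B) | B. Z_independent A B}"

definition first_betti :: "('a, 'b) monoid_scheme \<Rightarrow> enat" where
  "first_betti G = abelian_rank (G Mod derived G (carrier G))"

text \<open>Extensionality makes the elements honest functions on \<open>carrier G\<close>.\<close>

definition first_cohomology :: "('a, 'b) monoid_scheme \<Rightarrow> ('a \<Rightarrow> int) monoid" where
  "first_cohomology G =
    \<lparr>carrier = hom G integer_group \<inter> extensional (carrier G),
     monoid.mult = (\<lambda>f h. \<lambda>x\<in>carrier G. f x + h x),
     one = (\<lambda>x\<in>carrier G. 0)\<rparr>"

definition generates_first_cohomology ::
    "('a, 'b) monoid_scheme \<Rightarrow> ('a \<Rightarrow> int) \<Rightarrow> bool" where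
  "generates_first_cohomology G \<psi> \<longleftrightarrow>
     \<psi> \<in> carrier (first_cohomology G) \<and>
     generate (first_cohomology G) {\<psi>} = carrier (first_cohomology G)"


section \<open>Integral group rings and right rings of quotients\<close>

definition group_ring :: "('a, 'b) monoid_scheme \<Rightarrow> ('a \<Rightarrow>\<^sub>0 int) ring" where
  "group_ring \<Gamma> =
    \<lparr>carrier = {a. Poly_Mapping.keys a \<subseteq> carrier \<Gamma>},
     monoid.mult = (\<lambda>a b. frag_extend (\<lambda>x. frag_extend (\<lambda>y. frag_of (x \<otimes>\<^bsub>\<Gamma>\<^esub> y)) b) a),
     one = frag_of \<one>\<^bsub>\<Gamma>\<^esub>,
     ring.zero = 0,
     ring.add = (+)\<rparr>"

text \<open>For a right Ore domain \<open>R\<close>, the pair \<open>(a, s)\<close> stands for the fraction \<open>a s\<^sup>-\<^sup>1\<close>;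
  two fractions are equal iff they can be brought to a common form by expanding on the right.
  A product \<open>a s\<^sup>-\<^sup>1 b t\<^sup>-\<^sup>1\<close> is rewritten using \<open>s\<^sup>-\<^sup>1 b = c u\<^sup>-\<^sup>1\<close>, where \<open>b u = s c\<close>, and a sum is
  formed over a common denominator \<open>s c = t d\<close>. The operations take the union over all
  choices; in a right Ore domain all of them give the same class.\<close>

definition nonzeros :: "('a, 'b) ring_scheme \<Rightarrow> 'a set" where
  "nonzeros R = carrier R - {\<zero>\<^bsub>R\<^esub>}"

definition frac_rel :: "('a, 'b) ring_scheme \<Rightarrow> (('a \<times> 'a) \<times> ('a \<times> 'a)) set" where
  "frac_rel R =
    {((a, s), (b, t)) | a s b t.
       a \<in> carrier R \<and> s \<in> nonzeros R \<and> b \<in> carrier R \<and> t \<in> nonzeros R \<and>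
       (\<exists>u\<in>nonzeros R. \<exists>v\<in>nonzeros R.
          a \<otimes>\<^bsub>R\<^esub> u = b \<otimes>\<^bsub>R\<^esub> v \<and> s \<otimes>\<^bsub>R\<^esub> u = t \<otimes>\<^bsub>R\<^esub> v)}"

definition fraction :: "('a, 'b) ring_scheme \<Rightarrow> 'a \<Rightarrow> 'a \<Rightarrow> ('a \<times> 'a) set" where
  "fraction R a s = frac_rel R `` {(a, s)}"

definition right_quotients :: "('a, 'b) ring_scheme \<Rightarrow> ('a \<times> 'a) set ring" where
  "right_quotients R =
    \<lparr>carrier = (carrier R \<times> nonzeros R) // frac_rel R,
     monoid.mult = (\<lambda>C D. \<Union>{fraction R (a \<otimes>\<^bsub>R\<^esub> c) (t \<otimes>\<^bsub>R\<^esub> u) | a s b t c u.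
         (a, s) \<in> C \<and> (b, t) \<in> D \<and> c \<in> carrier R \<and> u \<in> nonzeros R \<and>
         b \<otimes>\<^bsub>R\<^esub> u = s \<otimes>\<^bsub>R\<^esub> c}),
     one = fraction R \<one>\<^bsub>R\<^esub> \<one>\<^bsub>R\<^esub>,
     ring.zero = fraction R \<zero>\<^bsub>R\<^esub> \<one>\<^bsub>R\<^esub>,
     ring.add = (\<lambda>C D. \<Union>{fraction R (a \<otimes>\<^bsub>R\<^esub> c \<oplus>\<^bsub>R\<^esub> b \<otimes>\<^bsub>R\<^esub> d) (s \<otimes>\<^bsub>R\<^esub> c) | a s b t c d.
         (a, s) \<in> C \<and> (b, t) \<in> D \<and> c \<in> nonzeros R \<and> d \<in> nonzeros R \<and>
         s \<otimes>\<^bsub>R\<^esub> c = t \<otimes>\<^bsub>R\<^esub> d})\<rparr>"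


section \<open>Right modules, extension of scalars, rank\<close>

text \<open>The module \<open>Module\<close> of the library is a left module over a commutative ring. Here the
  underlying abelian group is written multiplicatively, and \<open>act M x r\<close> is \<open>x r\<close>.\<close>

record ('r, 'm) right_module = "'m monoid" +
  act :: "'m \<Rightarrow> 'r \<Rightarrow> 'm"

text \<open>\<open>M \<otimes>\<^sub>R K\<close>, where the ring \<open>K\<close> is a left \<open>R\<close>-module along \<open>\<iota> : R \<rightarrow> K\<close>: the free abelian group
  on the pairs \<open>(x, k)\<close> modulo the tensor relations.\<close>

definition tensor_relators ::
    "('r, 'x) ring_scheme \<Rightarrow> ('r \<Rightarrow> 'k) \<Rightarrow> ('k, 'y) ring_scheme \<Rightarrow>
     ('r, 'm, 'z) right_module_scheme \<Rightarrow> ('m \<times> 'k \<Rightarrow>\<^sub>0 int) set" where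
  "tensor_relators R \<iota> K M =
     {frag_of (x \<otimes>\<^bsub>M\<^esub> y, k) - frag_of (x, k) - frag_of (y, k) | x y k.
        x \<in> carrier M \<and> y \<in> carrier M \<and> k \<in> carrier K} \<union>
     {frag_of (x, k \<oplus>\<^bsub>K\<^esub> l) - frag_of (x, k) - frag_of (x, l) | x k l.
        x \<in> carrier M \<and> k \<in> carrier K \<and> l \<in> carrier K} \<union>
     {frag_of (act M x r, k) - frag_of (x, \<iota> r \<otimes>\<^bsub>K\<^esub> k) | x r k.
        x \<in> carrier M \<and> r \<in> carrier R \<and> k \<in> carrier K}"

definition extend_scalars ::
    "('r, 'x) ring_scheme \<Rightarrow> ('r \<Rightarrow> 'k) \<Rightarrow> ('k, 'y) ring_scheme \<Rightarrow>
     ('r, 'm, 'z) right_module_scheme \<Rightarrow> ('k, ('m \<times> 'k \<Rightarrow>\<^sub>0 int) set) right_module" where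
  "extend_scalars R \<iota> K M =
    (let F = free_Abelian_group (carrier M \<times> carrier K);
         N = generate F (tensor_relators R \<iota> K M)
     in \<lparr>carrier = carrier (F Mod N),
         monoid.mult = monoid.mult (F Mod N),
         one = \<one>\<^bsub>F Mod N\<^esub>,
         act = (\<lambda>C k. \<Union>c\<in>C. N #>\<^bsub>F\<^esub> frag_extend (\<lambda>(x, l). frag_of (x, l \<otimes>\<^bsub>K\<^esub> k)) c)\<rparr>)"

definition finite_basis ::
    "('k, 'y) ring_scheme \<Rightarrow> ('k, 'm, 'z) right_module_scheme \<Rightarrow> 'm set \<Rightarrow> bool" where
  "finite_basis K V B \<longleftrightarrow> finite B \<and> B \<subseteq> carrier V \<and>
     (\<forall>v\<in>carrier V. \<exists>!c. c \<in> B \<rightarrow>\<^sub>E carrier K \<and> v = finprod V (\<lambda>b. act V b (c b)) B)"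

text \<open>Over a skew field all bases have the same cardinality, so the infimum is that cardinality,
  or \<open>\<infinity>\<close> if there is no finite basis.\<close>

definition rank :: "('k, 'y) ring_scheme \<Rightarrow> ('k, 'm, 'z) right_module_scheme \<Rightarrow> enat" where
  "rank K V = Inf {enat (card B) | B. finite_basis K V B}"

text \<open>The rank of \<open>M \<otimes>\<^sub>R K\<close> over the right ring of quotients \<open>K\<close> of \<open>R\<close>.\<close>

definition quotient_rank ::
    "('r, 'x) ring_scheme \<Rightarrow> ('r, 'm, 'z) right_module_scheme \<Rightarrow> enat" where
  "quotient_rank R M =
     rank (right_quotients R)
       (extend_scalars R (\<lambda>r. fraction R r \<one>\<^bsub>R\<^esub>) (right_quotients R) M)"


section \<open>Higher-order degrees\<close>

text \<open>In this section \<open>\<phi> : G \<rightarrow> \<Gamma>\<close> and \<open>\<psi> : G \<rightarrow> \<int>\<close> are meant to be surjective, \<open>\<Gamma>\<close> to be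
  poly-torsion-free-abelian, and \<open>\<psi>\<close> to factor through \<open>\<phi>\<close>. All of this holds for the quotients
  by the rational derived series used below.\<close>

definition kernel_ab ::
    "('a, 'x) monoid_scheme \<Rightarrow> ('b, 'y) monoid_scheme \<Rightarrow> ('a \<Rightarrow> 'b) \<Rightarrow> 'a set monoid" where
  "kernel_ab G \<Gamma> \<phi> =
     (G\<lparr>carrier := kernel G \<Gamma> \<phi>\<rparr>) Mod derived G (kernel G \<Gamma> \<phi>)"

text \<open>\<open>[g] \<gamma> = [h\<^sup>-\<^sup>1 g h]\<close> for every lift \<open>h\<close> of \<open>\<gamma>\<close>; conjugation by \<open>h\<close> permutes the cosets of the
  commutator subgroup, and the resulting coset does not depend on \<open>h\<close>.\<close>

definition conj_act ::
    "('a, 'x) monoid_scheme \<Rightarrow> ('a \<Rightarrow> 'b) \<Rightarrow> 'a set \<Rightarrow> 'b \<Rightarrow> 'a set" where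
  "conj_act G \<phi> C \<gamma> =
     {inv\<^bsub>G\<^esub> h \<otimes>\<^bsub>G\<^esub> g \<otimes>\<^bsub>G\<^esub> h | g h. g \<in> C \<and> h \<in> carrier G \<and> \<phi> h = \<gamma>}"

text \<open>The same structure serves as a module over \<open>\<int>\<Gamma>\<close> and over the subring \<open>\<int>\<Gamma>'\<close>, since the
  scalars enter only as elements of the type \<open>'b \<Rightarrow>\<^sub>0 int\<close>.\<close>

definition kernel_module ::
    "('a, 'x) monoid_scheme \<Rightarrow> ('b, 'y) monoid_scheme \<Rightarrow> ('a \<Rightarrow> 'b) \<Rightarrow>
     ('b \<Rightarrow>\<^sub>0 int, 'a set) right_module" where
  "kernel_module G \<Gamma> \<phi> =
    (let A = kernel_ab G \<Gamma> \<phi>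
     in \<lparr>carrier = carrier A, monoid.mult = monoid.mult A, one = \<one>\<^bsub>A\<^esub>,
         act = (\<lambda>C r. finprod A (\<lambda>\<gamma>. conj_act G \<phi> C \<gamma> [^]\<^bsub>A\<^esub> Poly_Mapping.lookup r \<gamma>)
                        (Poly_Mapping.keys r))\<rparr>)"

definition r_rank ::
    "('a, 'x) monoid_scheme \<Rightarrow> ('b, 'y) monoid_scheme \<Rightarrow> ('a \<Rightarrow> 'b) \<Rightarrow> enat" where
  "r_rank G \<Gamma> \<phi> = quotient_rank (group_ring \<Gamma>) (kernel_module G \<Gamma> \<phi>)"

text \<open>The map \<open>\<alpha> : \<Gamma> \<rightarrow> \<int>\<close> with \<open>\<psi> = \<alpha> \<circ> \<phi>\<close>.\<close>

definition factor_map ::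
    "('a, 'x) monoid_scheme \<Rightarrow> ('a \<Rightarrow> 'b) \<Rightarrow> ('a \<Rightarrow> int) \<Rightarrow> 'b \<Rightarrow> int" where
  "factor_map G \<phi> \<psi> \<gamma> = the_elem (\<psi> ` {h \<in> carrier G. \<phi> h = \<gamma>})"

definition degree_bar ::
    "('a, 'x) monoid_scheme \<Rightarrow> ('b, 'y) monoid_scheme \<Rightarrow> ('a \<Rightarrow> 'b) \<Rightarrow> ('a \<Rightarrow> int) \<Rightarrow> enat" where
  "degree_bar G \<Gamma> \<phi> \<psi> =
    (if r_rank G \<Gamma> \<phi> = 0
     then quotient_rank
            (group_ring (\<Gamma>\<lparr>carrier := kernel \<Gamma> integer_group (factor_map G \<phi> \<psi>)\<rparr>))
            (kernel_module G \<Gamma> \<phi>)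
     else 0)"

primrec rational_derived :: "('a, 'x) monoid_scheme \<Rightarrow> nat \<Rightarrow> 'a set" where
  "rational_derived G 0 = carrier G"
| "rational_derived G (Suc n) =
     {g \<in> rational_derived G n.
        \<exists>k :: int. k \<noteq> 0 \<and> g [^]\<^bsub>G\<^esub> k \<in> derived G (rational_derived G n)}"

definition nth_degree :: "('a, 'x) monoid_scheme \<Rightarrow> nat \<Rightarrow> ('a \<Rightarrow> int) \<Rightarrow> enat" where
  "nth_degree G n \<psi> =
     degree_bar G (G Mod rational_derived G (Suc n))
       (\<lambda>g. rational_derived G (Suc n) #>\<^bsub>G\<^esub> g) \<psi>"

end

theory Submission
  imports Defs
begin

text \<open>Let \<open>F\<close> be free on \<open>x\<^sub>0, \<dots>, x\<^sub>e\<close>, where \<open>e = d - 1\<close> and \<open>d = 2 g\<close>, and let \<open>N\<close> be the \<open>n\<close>th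
  term of its rational derived series. Since \<open>\<int>[F / N]\<close> is an Ore domain, there are words \<open>\<rho>\<^sub>1, \<dots>, \<rho>\<^sub>e\<close>
  in \<open>N\<close> whose Fox derivatives form a diagonal matrix with nonzero diagonal, so that they span
  \<open>N / [N, N]\<close> up to torsion. Take the group \<open>G\<close> generated by the \<open>x\<^sub>i\<close>, an element \<open>t\<close> inverting every
  \<open>x\<^sub>i\<close>, and a central involution \<open>b\<close>, and impose \<open>\<rho>\<^sub>j = 1\<close>. The kernel of \<open>\<psi>\<close> is, up to \<open>b\<close>, a quotient of
  \<open>F\<close> by a subgroup of \<open>N\<close>, and \<open>t\<^sup>2\<close> centralises it. So \<open>t\<^sup>2 - 1\<close> kills all the modules and
  \<open>r\<^sub>\<Gamma> = 0\<close>. Up to \<open>b\<close>, the \<open>(i + 1)\<close>st term of the series of \<open>G\<close> is the image of the \<open>i\<close>th term of the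
  series of \<open>F\<close>, the shift being due to \<open>t\<close>. By the Magnus embedding the
  rank of the abelianisation of the latter is \<open>d\<close> for \<open>i = 0\<close> and \<open>d - 1\<close> for \<open>1 \<le> i < n\<close>, whereas the
  relators \<open>\<rho>\<^sub>j\<close> make it vanish for \<open>i = n\<close>.

  For the deficiency, lift \<open>t\<close> and \<open>b\<close> from \<open>\<int> \<times> \<int>/2\<close> to a Heisenberg group, where they do not commute.
  Given any presentation of \<open>G\<close>, write \<open>[t, b]\<close> as a product of conjugates of relators; then some relator
  occurs with odd total exponent, while the exponent sums of \<open>[t, b]\<close> vanish. So in the free abelian group
  on the generators this relator is a rational combination of the others. If there were fewer relators
  than generators, there would be a nonzero homomorphism from \<open>G\<close> to \<open>\<int>\<close> killing \<open>t\<close>.\<close>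

section \<open>Right Ore domains and their right rings of quotients\<close>

text \<open>The element \<open>b\<close> is there for the deficiency. In general the deficiency is
  at most the first Betti number minus the number of generators of H_2; with Betti number one, a
  nonzero class in H_2 suffices, and the commuting pair \<open>t\<close>, \<open>b\<close> supplies
  it. Having order two, \<open>b\<close> lies in every term of the rational derived series and is
  killed by the scalar 2, so it does not affect the ranks. Inverting the generators has two further
  merits: it makes the fibre 2-torsion in the abelianisation, which gives Betti number one, and,
  like every endomorphism of \<open>F\<close>, it preserves the rational derived series, so imposing
  the relators \<open>\<rho> j\<close> kills nothing outside \<open>N\<close>. The obstacle is level
  \<open>n\<close>: the relators have nonzero Fox derivatives, so derivatives are no longer
  functions on the module. Below \<open>n\<close> they serve as dual coordinates; at
  \<open>n\<close> the argument goes through an explicit inverse of the Magnus embedding, which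
  makes sense whatever relations hold. One relator fewer than there are generators is enough,
  because the boundary relation of Fox calculus determines the remaining coordinate.\<close>

locale right_ore_domain = ring R for R (structure) +
  assumes one_not_zero [simp]: "\<one> \<noteq> \<zero>"
    and integral: "\<lbrakk>a \<otimes> b = \<zero>; a \<in> carrier R; b \<in> carrier R\<rbrakk> \<Longrightarrow> a = \<zero> \<or> b = \<zero>"
    and ore: "\<lbrakk>a \<in> nonzeros R; b \<in> nonzeros R\<rbrakk> \<Longrightarrow>
      \<exists>c\<in>nonzeros R. \<exists>d\<in>nonzeros R. a \<otimes> c = b \<otimes> d"
begin

lemma nonzeros_iff: "a \<in> nonzeros R \<longleftrightarrow> a \<in> carrier R \<and> a \<noteq> \<zero>"
  by (auto simp: nonzeros_def)

lemma nonzeros_carrier [simp, intro]: "a \<in> nonzeros R \<Longrightarrow> a \<in> carrier R"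
  by (simp add: nonzeros_iff)

lemma one_nonzeros [simp]: "\<one> \<in> nonzeros R"
  by (simp add: nonzeros_iff)

lemma nonzeros_mult [simp]: "\<lbrakk>a \<in> nonzeros R; b \<in> nonzeros R\<rbrakk> \<Longrightarrow> a \<otimes> b \<in> nonzeros R"
  using integral by (auto simp: nonzeros_iff)

lemma nonzeros_l_cancel:
  assumes "a \<in> nonzeros R" "x \<in> carrier R" "y \<in> carrier R" "a \<otimes> x = a \<otimes> y"
  shows "x = y"
proof -
  have "a \<otimes> (x \<ominus> y) = \<zero>"
    using assms by (simp add: minus_eq r_distr r_minus r_neg)
  then have "x \<ominus> y = \<zero>"
    using integral[of a "x \<ominus> y"] assms by (auto simp: nonzeros_iff)
  then show ?thesis using assms by simp
qed

lemma nonzeros_r_cancel: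
  assumes "a \<in> nonzeros R" "x \<in> carrier R" "y \<in> carrier R" "x \<otimes> a = y \<otimes> a"
  shows "x = y"
proof -
  have "(x \<ominus> y) \<otimes> a = \<zero>"
    using assms by (simp add: minus_eq l_distr l_minus r_neg)
  then have "x \<ominus> y = \<zero>"
    using integral[of "x \<ominus> y" a] assms by (auto simp: nonzeros_iff)
  then show ?thesis using assms by simp
qed

lemma ore_carrier:
  assumes "a \<in> carrier R" "b \<in> nonzeros R"
  shows "\<exists>c\<in>carrier R. \<exists>d\<in>nonzeros R. a \<otimes> d = b \<otimes> c"
proof (cases "a = \<zero>")
  case True
  then show ?thesis using assms by (intro bexI[of _ \<zero>] bexI[of _ \<one>]) auto
next
  case False
  then show ?thesis using ore[of a b] assms by (metis nonzeros_carrier nonzeros_iff)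
qed

text \<open>Induction on \<open>I\<close>: a new pair forces a further right factor \<open>d\<close>
  on the common multiplier, which the earlier \<open>c i\<close> absorb. It clears all denominators
  of a finite system of coordinates at once.\<close>

lemma ore_common_denominator:
  assumes "finite I" "\<And>i. i \<in> I \<Longrightarrow> a i \<in> carrier R" "\<And>i. i \<in> I \<Longrightarrow> b i \<in> nonzeros R"
  shows "\<exists>s\<in>nonzeros R. \<exists>c. \<forall>i\<in>I. c i \<in> carrier R \<and> a i \<otimes> s = b i \<otimes> c i"
  using assms
proof (induction I rule: finite_induct)
  case empty
  then show ?case using one_nonzeros by blast
next
  case (insert j I)
  then have "\<exists>s\<in>nonzeros R. \<exists>c. \<forall>i\<in>I. c i \<in> carrier R \<and> a i \<otimes> s = b i \<otimes> c i"
    by simp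
  then obtain s c where s: "s \<in> nonzeros R" "\<And>i. i \<in> I \<Longrightarrow> c i \<in> carrier R \<and> a i \<otimes> s = b i \<otimes> c i"
    by blast
  obtain e d where e: "e \<in> carrier R" "d \<in> nonzeros R" "(a j \<otimes> s) \<otimes> d = b j \<otimes> e"
    using ore_carrier[of "a j \<otimes> s" "b j"] insert.prems s(1) by auto
  let ?c = "\<lambda>i. if i = j then e else c i \<otimes> d"
  have "?c i \<in> carrier R \<and> a i \<otimes> (s \<otimes> d) = b i \<otimes> ?c i" if i: "i \<in> insert j I" for i
  proof -
    have cl: "a i \<in> carrier R" "b i \<in> carrier R" "s \<in> carrier R" "d \<in> carrier R"
      using insert.prems i s(1) e(2) by auto
    show ?thesis
    proof (cases "i = j")
      case True
      then show ?thesis using e cl by (simp add: m_assoc)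
    next
      case False
      then have "c i \<in> carrier R" "a i \<otimes> s = b i \<otimes> c i" using s(2) i by auto
      then show ?thesis using False cl e(1) by (simp flip: m_assoc)
    qed
  qed
  then show ?case
    by (intro bexI[OF _ nonzeros_mult[OF s(1) e(2)]] exI[of _ ?c] ballI)
qed

text \<open>Gaussian elimination: the pivot row eliminates the unknown \<open>c\<^sub>p\<close>, after scaling the other unknowns
  so that the elimination needs no division.\<close>

lemma homogeneous_system:
  assumes "finite E" "finite U" "card E < card U"
    and "\<And>e u. \<lbrakk>e \<in> E; u \<in> U\<rbrakk> \<Longrightarrow> A e u \<in> carrier R"
  shows "\<exists>c. (\<forall>u\<in>U. c u \<in> carrier R) \<and> (\<exists>u\<in>U. c u \<noteq> \<zero>) \<and>
    (\<forall>e\<in>E. (\<Oplus>u\<in>U. A e u \<otimes> c u) = \<zero>)"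
  using assms
proof (induction E arbitrary: U A rule: finite_induct)
  case empty
  then obtain u where "u \<in> U" by fastforce
  then show ?case by (intro exI[of _ "\<lambda>_. \<one>"]) auto
next
  case (insert e E)
  show ?case
  proof (cases "\<forall>u\<in>U. A e u = \<zero>")
    case True
    obtain c where c: "\<forall>u\<in>U. c u \<in> carrier R" "\<exists>u\<in>U. c u \<noteq> \<zero>"
      "\<forall>e\<in>E. (\<Oplus>u\<in>U. A e u \<otimes> c u) = \<zero>"
      using insert.IH[of U A] insert.prems insert.hyps by auto
    have "(\<Oplus>u\<in>U. A e u \<otimes> c u) = (\<Oplus>u\<in>U. \<zero>)"
      using True c by (intro finsum_cong') auto
    then show ?thesis using c by (intro exI[of _ c]) auto
  next
    case False
    then obtain p where p: "p \<in> U" "A e p \<in> nonzeros R"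
      using insert.prems by (auto simp: nonzeros_iff)
    have "\<forall>u\<in>U. \<exists>\<alpha> \<beta>. \<alpha> \<in> carrier R \<and> \<beta> \<in> nonzeros R \<and> A e u \<otimes> \<beta> = A e p \<otimes> \<alpha>"
      using ore_carrier p insert.prems by (meson insertI1)
    then obtain \<alpha> \<beta> where ab: "\<And>u. u \<in> U \<Longrightarrow> \<alpha> u \<in> carrier R" "\<And>u. u \<in> U \<Longrightarrow> \<beta> u \<in> nonzeros R"
      "\<And>u. u \<in> U \<Longrightarrow> A e u \<otimes> \<beta> u = A e p \<otimes> \<alpha> u" by metis
    have bc: "\<And>u. u \<in> U \<Longrightarrow> \<beta> u \<in> carrier R" using ab by auto
    let ?V = "U - {p}"
    let ?B = "\<lambda>e' u. A e' u \<otimes> \<beta> u \<ominus> A e' p \<otimes> \<alpha> u"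
    have A: "\<And>e' u. \<lbrakk>e' \<in> insert e E; u \<in> U\<rbrakk> \<Longrightarrow> A e' u \<in> carrier R"
      using insert.prems by blast
    have "\<exists>c. (\<forall>u\<in>?V. c u \<in> carrier R) \<and> (\<exists>u\<in>?V. c u \<noteq> \<zero>) \<and>
      (\<forall>e'\<in>E. (\<Oplus>u\<in>?V. ?B e' u \<otimes> c u) = \<zero>)"
    proof (rule insert.IH)
      show "card E < card ?V" using insert.prems insert.hyps p by simp
      show "?B e' u \<in> carrier R" if "e' \<in> E" "u \<in> ?V" for e' u
        using that A ab bc p by auto
    qed (use insert.prems in auto)
    then obtain c where c: "\<forall>u\<in>?V. c u \<in> carrier R" "\<exists>u\<in>?V. c u \<noteq> \<zero>"
      "\<forall>e'\<in>E. (\<Oplus>u\<in>?V. ?B e' u \<otimes> c u) = \<zero>" by auto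
    \<comment> \<open>The eliminated unknown becomes \<open>\<ominus> s\<close>; row
      \<open>e\<close> then vanishes because
      \<open>A e u \<otimes> \<beta> u = A e p \<otimes> \<alpha> u\<close>.\<close>
    define s where "s = (\<Oplus>u\<in>?V. \<alpha> u \<otimes> c u)"
    have s: "s \<in> carrier R" using c ab by (auto simp: s_def)
    let ?c = "\<lambda>u. if u = p then \<ominus> s else \<beta> u \<otimes> c u"
    have split: "(\<Oplus>u\<in>U. A e' u \<otimes> ?c u) = (\<Oplus>u\<in>?V. ?B e' u \<otimes> c u)" if e': "e' \<in> insert e E" for e'
    proof -
      have fin: "finite ?V" using insert.prems by simp
      have "(\<Oplus>u\<in>U. A e' u \<otimes> ?c u) = (\<Oplus>u\<in>insert p ?V. A e' u \<otimes> ?c u)"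
        using p by (simp add: insert_absorb)
      also have "\<dots> = A e' p \<otimes> (\<ominus> s) \<oplus> (\<Oplus>u\<in>?V. A e' u \<otimes> ?c u)"
        using fin e' A s c ab bc p by (subst finsum_insert) (auto)
      also have "(\<Oplus>u\<in>?V. A e' u \<otimes> ?c u) = (\<Oplus>u\<in>?V. ?B e' u \<otimes> c u \<oplus> A e' p \<otimes> (\<alpha> u \<otimes> c u))"
      proof (rule finsum_cong')
        fix u assume u: "u \<in> ?V"
        have cl: "A e' u \<in> carrier R" "A e' p \<in> carrier R" "\<alpha> u \<in> carrier R" "\<beta> u \<in> carrier R"
          "c u \<in> carrier R" using u e' A ab bc c p by auto
        have "?B e' u \<otimes> c u \<oplus> A e' p \<otimes> (\<alpha> u \<otimes> c u) =
          (A e' u \<otimes> \<beta> u \<ominus> A e' p \<otimes> \<alpha> u \<oplus> A e' p \<otimes> \<alpha> u) \<otimes> c u"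
          using cl by (simp add: l_distr m_assoc)
        also have "A e' u \<otimes> \<beta> u \<ominus> A e' p \<otimes> \<alpha> u \<oplus> A e' p \<otimes> \<alpha> u = A e' u \<otimes> \<beta> u"
          using cl by (simp add: minus_eq a_assoc l_neg)
        finally show "A e' u \<otimes> ?c u = ?B e' u \<otimes> c u \<oplus> A e' p \<otimes> (\<alpha> u \<otimes> c u)"
          using u cl by (simp add: m_assoc)
      qed (use e' A ab bc c p in auto)
      also have "\<dots> = (\<Oplus>u\<in>?V. ?B e' u \<otimes> c u) \<oplus> (\<Oplus>u\<in>?V. A e' p \<otimes> (\<alpha> u \<otimes> c u))"
        using e' A ab bc c p by (intro finsum_addf) auto
      also have "(\<Oplus>u\<in>?V. A e' p \<otimes> (\<alpha> u \<otimes> c u)) = A e' p \<otimes> s"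
        using fin e' A ab c p unfolding s_def by (intro finsum_rdistr[symmetric]) auto
      finally have eq: "(\<Oplus>u\<in>U. A e' u \<otimes> ?c u) =
        A e' p \<otimes> (\<ominus> s) \<oplus> ((\<Oplus>u\<in>?V. ?B e' u \<otimes> c u) \<oplus> A e' p \<otimes> s)" .
      have cl: "(\<Oplus>u\<in>?V. ?B e' u \<otimes> c u) \<in> carrier R" "A e' p \<in> carrier R"
        using e' A ab bc c p by auto
      have "\<ominus> x \<oplus> (y \<oplus> x) = y" if "x \<in> carrier R" "y \<in> carrier R" for x y
        using that by (simp add: a_comm[of y] r_neg1)
      then show ?thesis unfolding eq using cl s by (simp add: r_minus)
    qed
    have z: "(\<Oplus>u\<in>?V. ?B e u \<otimes> c u) = \<zero>"
    proof -
      have "?B e u = \<zero>" if "u \<in> ?V" for u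
        using ab(1)[of u] ab(3)[of u] A[of e p] that p(1) by (simp add: minus_eq r_neg)
      then have "(\<Oplus>u\<in>?V. ?B e u \<otimes> c u) = (\<Oplus>u\<in>?V. \<zero>)"
        using c by (intro finsum_cong') auto
      then show ?thesis by simp
    qed
    obtain w where w: "w \<in> ?V" "c w \<noteq> \<zero>" using c by auto
    have "w \<noteq> p" "c w \<in> carrier R" "\<beta> w \<in> nonzeros R" using w c(1) ab(2) by auto
    then have "?c w \<noteq> \<zero>" using w(2) integral[of "\<beta> w" "c w"] by (auto simp: nonzeros_iff)
    then have nz: "\<exists>u\<in>U. ?c u \<noteq> \<zero>" using w(1) by blast
    have "(\<Oplus>u\<in>U. A e' u \<otimes> ?c u) = \<zero>" if "e' \<in> insert e E" for e'
      using split[OF that] z c(3) that by auto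
    moreover have "?c u \<in> carrier R" if "u \<in> U" for u
      using that c(1) bc s by auto
    ultimately show ?thesis using nz by (intro exI[of _ ?c] conjI) blast+
  qed
qed


section \<open>The skew field of right fractions\<close>

lemma fracI:
  assumes "a \<in> carrier R" "s \<in> nonzeros R" "b \<in> carrier R" "t \<in> nonzeros R"
    "u \<in> nonzeros R" "v \<in> nonzeros R" "a \<otimes> u = b \<otimes> v" "s \<otimes> u = t \<otimes> v"
  shows "((a, s), (b, t)) \<in> frac_rel R"
  unfolding frac_rel_def mem_Collect_eq
  by (intro exI conjI bexI[of _ u] bexI[of _ v], rule refl) (use assms in simp_all)

text \<open>A fraction \<open>a s\<^sup>-\<^sup>1\<close> is the partial right-linear map \<open>s x \<mapsto> a x\<close>; this lemma says that equal fractions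
  agree wherever both are defined, from which the well-definedness of the operations follows.\<close>

lemma frac_relD:
  assumes r: "((a, s), (b, t)) \<in> frac_rel R" and xy: "x \<in> carrier R" "y \<in> carrier R" "s \<otimes> x = t \<otimes> y"
  shows "a \<otimes> x = b \<otimes> y"
proof -
  obtain u v where u: "a \<in> carrier R" "s \<in> nonzeros R" "b \<in> carrier R" "t \<in> nonzeros R"
    "u \<in> nonzeros R" "v \<in> nonzeros R" "a \<otimes> u = b \<otimes> v" "s \<otimes> u = t \<otimes> v"
    using r unfolding frac_rel_def by auto
  obtain q p where p: "q \<in> carrier R" "p \<in> nonzeros R" "x \<otimes> p = u \<otimes> q"
    using ore_carrier[of x u] xy u by blast
  note cl = xy(1,2) u(1,3) p(1) nonzeros_carrier[OF u(2)] nonzeros_carrier[OF u(4)]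
    nonzeros_carrier[OF u(5)] nonzeros_carrier[OF u(6)] nonzeros_carrier[OF p(2)]
  have "t \<otimes> (y \<otimes> p) = s \<otimes> x \<otimes> p" using xy cl by (simp add: m_assoc)
  also have "\<dots> = s \<otimes> u \<otimes> q" using p cl by (simp add: m_assoc)
  also have "\<dots> = t \<otimes> (v \<otimes> q)" using u(8) cl by (simp add: m_assoc)
  finally have yp: "y \<otimes> p = v \<otimes> q" using nonzeros_l_cancel[OF u(4)] cl by auto
  have "a \<otimes> x \<otimes> p = a \<otimes> u \<otimes> q" using p cl by (simp add: m_assoc)
  also have "\<dots> = b \<otimes> y \<otimes> p" using u(7) yp cl by (simp add: m_assoc)
  finally show ?thesis using nonzeros_r_cancel[OF p(2)] cl by auto
qed

lemma equiv_frac_rel: "equiv (carrier R \<times> nonzeros R) (frac_rel R)"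
proof (rule equivI)
  show "frac_rel R \<subseteq> (carrier R \<times> nonzeros R) \<times> (carrier R \<times> nonzeros R)"
    by (auto simp: frac_rel_def)
  show "refl_on (carrier R \<times> nonzeros R) (frac_rel R)"
    by (rule refl_onI) (auto intro: fracI[of _ _ _ _ \<one> \<one>])
  show "sym (frac_rel R)"
  proof (rule symI, clarify)
    fix a s b t assume "((a, s), (b, t)) \<in> frac_rel R"
    then obtain u v where "a \<in> carrier R" "s \<in> nonzeros R" "b \<in> carrier R" "t \<in> nonzeros R"
      "u \<in> nonzeros R" "v \<in> nonzeros R" "a \<otimes> u = b \<otimes> v" "s \<otimes> u = t \<otimes> v"
      unfolding frac_rel_def by auto
    then show "((b, t), (a, s)) \<in> frac_rel R"
      by (intro fracI[of _ _ _ _ v u]) simp_all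
  qed
  show "trans (frac_rel R)"
  proof (rule transI, clarify)
    fix a s b t c r
    assume 1: "((a, s), (b, t)) \<in> frac_rel R" and 2: "((b, t), (c, r)) \<in> frac_rel R"
    then have cl: "a \<in> carrier R" "s \<in> nonzeros R" "b \<in> carrier R" "t \<in> nonzeros R"
      "c \<in> carrier R" "r \<in> nonzeros R" by (auto simp: frac_rel_def)
    \<comment> \<open>A common multiple of the three denominators, on which \<open>frac_relD\<close>
      compares the numerators.\<close>
    obtain x z where xz: "x \<in> nonzeros R" "z \<in> nonzeros R" "s \<otimes> x = t \<otimes> z"
      using ore[of s t] cl by blast
    obtain p q where pq: "p \<in> nonzeros R" "q \<in> nonzeros R" "t \<otimes> z \<otimes> p = r \<otimes> q"
      using ore[of "t \<otimes> z" r] cl xz by auto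
    have "a \<otimes> x = b \<otimes> z" "b \<otimes> (z \<otimes> p) = c \<otimes> q"
      using frac_relD[OF 1, of x z] frac_relD[OF 2, of "z \<otimes> p" q] xz pq cl
      by (auto simp: m_assoc)
    then have "a \<otimes> (x \<otimes> p) = c \<otimes> q"
      using xz pq cl by (simp flip: m_assoc)
    moreover have "s \<otimes> (x \<otimes> p) = r \<otimes> q"
      using xz pq cl by (simp add: m_assoc[symmetric])
    ultimately show "((a, s), (c, r)) \<in> frac_rel R"
      using cl xz pq by (intro fracI[of _ _ _ _ "x \<otimes> p" q]) auto
  qed
qed

abbreviation K where "K \<equiv> right_quotients R"

lemma fraction_eq_iff:
  assumes "a \<in> carrier R" "s \<in> nonzeros R" "b \<in> carrier R" "t \<in> nonzeros R"
  shows "fraction R a s = fraction R b t \<longleftrightarrow> ((a, s), (b, t)) \<in> frac_rel R"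
  unfolding fraction_def using eq_equiv_class_iff[OF equiv_frac_rel] assms by simp

lemma fraction_eqI:
  assumes "a \<in> carrier R" "s \<in> nonzeros R" "b \<in> carrier R" "t \<in> nonzeros R"
    "u \<in> nonzeros R" "v \<in> nonzeros R" "a \<otimes> u = b \<otimes> v" "s \<otimes> u = t \<otimes> v"
  shows "fraction R a s = fraction R b t"
  unfolding fraction_eq_iff[OF assms(1-4)] using assms by (rule fracI)

lemma fraction_expand:
  assumes "a \<in> carrier R" "s \<in> nonzeros R" "u \<in> nonzeros R"
  shows "fraction R a s = fraction R (a \<otimes> u) (s \<otimes> u)"
  using assms by (intro fraction_eqI[of _ _ _ _ u \<one>]) auto

lemma fraction_closed [simp]:
  "\<lbrakk>a \<in> carrier R; s \<in> nonzeros R\<rbrakk> \<Longrightarrow> fraction R a s \<in> carrier K"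
  unfolding right_quotients_def fraction_def by (auto intro: quotientI)

lemma K_cases:
  assumes "C \<in> carrier K"
  obtains a s where "a \<in> carrier R" "s \<in> nonzeros R" "C = fraction R a s"
  using assms unfolding right_quotients_def fraction_def by (auto elim!: quotientE)

lemma mem_fraction:
  "\<lbrakk>a \<in> carrier R; s \<in> nonzeros R\<rbrakk> \<Longrightarrow> (a, s) \<in> fraction R a s"
  unfolding fraction_def using equiv_class_self[OF equiv_frac_rel, of "(a, s)"] by simp

lemma K_zero: "\<zero>\<^bsub>K\<^esub> = fraction R \<zero> \<one>" and K_one: "\<one>\<^bsub>K\<^esub> = fraction R \<one> \<one>"
  by (simp_all add: right_quotients_def)

text \<open>The union over all choices in the definition collapses to one class: two choices are
  compared on a common multiple of their denominators, where \<open>frac_relD\<close> is applied to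
  the right factor and then to the left one.\<close>

lemma fraction_mult:
  assumes a: "a \<in> carrier R" "s \<in> nonzeros R" "b \<in> carrier R" "t \<in> nonzeros R"
    and c: "c \<in> carrier R" "u \<in> nonzeros R" "b \<otimes> u = s \<otimes> c"
  shows "fraction R a s \<otimes>\<^bsub>K\<^esub> fraction R b t = fraction R (a \<otimes> c) (t \<otimes> u)"
proof -
  have eq: "fraction R (a' \<otimes> c') (t' \<otimes> u') = fraction R (a \<otimes> c) (t \<otimes> u)"
    if h: "(a', s') \<in> fraction R a s" "(b', t') \<in> fraction R b t"
      "c' \<in> carrier R" "u' \<in> nonzeros R" "b' \<otimes> u' = s' \<otimes> c'" for a' s' b' t' c' u'
  proof -
    have 1: "((a, s), (a', s')) \<in> frac_rel R" and 2: "((b, t), (b', t')) \<in> frac_rel R"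
      using h by (auto simp: fraction_def)
    then have cl: "a' \<in> carrier R" "s' \<in> nonzeros R" "b' \<in> carrier R" "t' \<in> nonzeros R"
      by (auto simp: frac_rel_def)
    obtain v v' where v: "v \<in> nonzeros R" "v' \<in> nonzeros R" "t \<otimes> u \<otimes> v = t' \<otimes> u' \<otimes> v'"
      using ore[of "t \<otimes> u" "t' \<otimes> u'"] nonzeros_mult[OF a(4) c(2)] nonzeros_mult[OF cl(4) h(4)] by blast
    have "b \<otimes> (u \<otimes> v) = b' \<otimes> (u' \<otimes> v')"
      using frac_relD[OF 2, of "u \<otimes> v" "u' \<otimes> v'"] v cl h a c by (auto simp: m_assoc)
    then have "s \<otimes> (c \<otimes> v) = s' \<otimes> (c' \<otimes> v')"
      using v cl h a c by (simp flip: m_assoc)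
    then have "a \<otimes> (c \<otimes> v) = a' \<otimes> (c' \<otimes> v')"
      using frac_relD[OF 1, of "c \<otimes> v" "c' \<otimes> v'"] v cl h a c by auto
    then show ?thesis using v cl h a c
      by (intro fraction_eqI[of _ _ _ _ v' v]) (auto simp: m_assoc)
  qed
  have "{fraction R (a' \<otimes> c') (t' \<otimes> u') | a' s' b' t' c' u'.
      (a', s') \<in> fraction R a s \<and> (b', t') \<in> fraction R b t \<and> c' \<in> carrier R \<and>
      u' \<in> nonzeros R \<and> b' \<otimes> u' = s' \<otimes> c'} = {fraction R (a \<otimes> c) (t \<otimes> u)}"
  proof (intro equalityI subsetI)
    fix Y assume "Y \<in> {fraction R (a \<otimes> c) (t \<otimes> u)}"
    then show "Y \<in> {fraction R (a' \<otimes> c') (t' \<otimes> u') | a' s' b' t' c' u'.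
      (a', s') \<in> fraction R a s \<and> (b', t') \<in> fraction R b t \<and> c' \<in> carrier R \<and>
      u' \<in> nonzeros R \<and> b' \<otimes> u' = s' \<otimes> c'}"
      using mem_fraction[OF a(1,2)] mem_fraction[OF a(3,4)] c by blast
  qed (use eq in blast)
  then show ?thesis by (simp add: right_quotients_def)
qed

lemma fraction_add:
  assumes a: "a \<in> carrier R" "s \<in> nonzeros R" "b \<in> carrier R" "t \<in> nonzeros R"
    and c: "c \<in> nonzeros R" "d \<in> nonzeros R" "s \<otimes> c = t \<otimes> d"
  shows "fraction R a s \<oplus>\<^bsub>K\<^esub> fraction R b t = fraction R (a \<otimes> c \<oplus> b \<otimes> d) (s \<otimes> c)"
proof -
  have eq: "fraction R (a' \<otimes> c' \<oplus> b' \<otimes> d') (s' \<otimes> c') = fraction R (a \<otimes> c \<oplus> b \<otimes> d) (s \<otimes> c)"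
    if h: "(a', s') \<in> fraction R a s" "(b', t') \<in> fraction R b t"
      "c' \<in> nonzeros R" "d' \<in> nonzeros R" "s' \<otimes> c' = t' \<otimes> d'" for a' s' b' t' c' d'
  proof -
    have 1: "((a, s), (a', s')) \<in> frac_rel R" and 2: "((b, t), (b', t')) \<in> frac_rel R"
      using h by (auto simp: fraction_def)
    then have cl: "a' \<in> carrier R" "s' \<in> nonzeros R" "b' \<in> carrier R" "t' \<in> nonzeros R"
      by (auto simp: frac_rel_def)
    obtain v v' where v: "v \<in> nonzeros R" "v' \<in> nonzeros R" "s \<otimes> c \<otimes> v = s' \<otimes> c' \<otimes> v'"
      using ore[of "s \<otimes> c" "s' \<otimes> c'"] nonzeros_mult[OF a(2) c(1)] nonzeros_mult[OF cl(2) h(3)] by blast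
    have "t \<otimes> d \<otimes> v = t' \<otimes> d' \<otimes> v'" using v c h by simp
    then have "a \<otimes> (c \<otimes> v) = a' \<otimes> (c' \<otimes> v')" "b \<otimes> (d \<otimes> v) = b' \<otimes> (d' \<otimes> v')"
      using frac_relD[OF 1, of "c \<otimes> v" "c' \<otimes> v'"] frac_relD[OF 2, of "d \<otimes> v" "d' \<otimes> v'"]
        v cl h(3,4) a c(1,2) by (auto simp: m_assoc)
    then show ?thesis using v cl h a c
      by (intro fraction_eqI[of _ _ _ _ v' v]) (auto simp: m_assoc l_distr)
  qed
  have "{fraction R (a' \<otimes> c' \<oplus> b' \<otimes> d') (s' \<otimes> c') | a' s' b' t' c' d'.
      (a', s') \<in> fraction R a s \<and> (b', t') \<in> fraction R b t \<and> c' \<in> nonzeros R \<and>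
      d' \<in> nonzeros R \<and> s' \<otimes> c' = t' \<otimes> d'} = {fraction R (a \<otimes> c \<oplus> b \<otimes> d) (s \<otimes> c)}"
  proof (intro equalityI subsetI)
    fix Y assume "Y \<in> {fraction R (a \<otimes> c \<oplus> b \<otimes> d) (s \<otimes> c)}"
    then show "Y \<in> {fraction R (a' \<otimes> c' \<oplus> b' \<otimes> d') (s' \<otimes> c') | a' s' b' t' c' d'.
      (a', s') \<in> fraction R a s \<and> (b', t') \<in> fraction R b t \<and> c' \<in> nonzeros R \<and>
      d' \<in> nonzeros R \<and> s' \<otimes> c' = t' \<otimes> d'}"
      using mem_fraction[OF a(1,2)] mem_fraction[OF a(3,4)] c by blast
  qed (use eq in blast)
  then show ?thesis by (simp add: right_quotients_def)
qed

lemma fraction_add_same: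
  assumes "a \<in> carrier R" "s \<in> nonzeros R" "b \<in> carrier R"
  shows "fraction R a s \<oplus>\<^bsub>K\<^esub> fraction R b s = fraction R (a \<oplus> b) s"
  using fraction_add[of a s b s \<one> \<one>] assms by simp

lemma fraction_mult_cancel:
  assumes "a \<in> carrier R" "s \<in> nonzeros R" "t \<in> nonzeros R"
  shows "fraction R a s \<otimes>\<^bsub>K\<^esub> fraction R s t = fraction R a t"
  using fraction_mult[of a s s t \<one> \<one>] assms by simp

lemma K_cases2:
  assumes "C \<in> carrier K" "D \<in> carrier K"
  obtains a b s where "a \<in> carrier R" "b \<in> carrier R" "s \<in> nonzeros R"
    "C = fraction R a s" "D = fraction R b s"
proof -
  obtain a s where a: "a \<in> carrier R" "s \<in> nonzeros R" "C = fraction R a s"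
    using assms K_cases by blast
  obtain b t where b: "b \<in> carrier R" "t \<in> nonzeros R" "D = fraction R b t"
    using assms K_cases by blast
  obtain c d where "c \<in> nonzeros R" "d \<in> nonzeros R" "s \<otimes> c = t \<otimes> d"
    using ore a b by blast
  then show thesis
    using that[of "a \<otimes> c" "b \<otimes> d" "s \<otimes> c"] fraction_expand[of a s c] fraction_expand[of b t d] a b
    by auto
qed

lemma K_cases3:
  assumes "C \<in> carrier K" "D \<in> carrier K" "E \<in> carrier K"
  obtains a b e s where "a \<in> carrier R" "b \<in> carrier R" "e \<in> carrier R" "s \<in> nonzeros R"
    "C = fraction R a s" "D = fraction R b s" "E = fraction R e s"
proof -
  obtain a b s where a: "a \<in> carrier R" "b \<in> carrier R" "s \<in> nonzeros R"
    "C = fraction R a s" "D = fraction R b s"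
    by (rule K_cases2[OF assms(1,2)])
  obtain e t where b: "e \<in> carrier R" "t \<in> nonzeros R" "E = fraction R e t"
    using assms K_cases by blast
  obtain c d where "c \<in> nonzeros R" "d \<in> nonzeros R" "s \<otimes> c = t \<otimes> d"
    using ore a b by blast
  then show thesis
    using that[of "a \<otimes> c" "b \<otimes> c" "e \<otimes> d" "s \<otimes> c"] fraction_expand[of a s c]
      fraction_expand[of b s c] fraction_expand[of e t d] a b
    by auto
qed

lemma fraction_zero: "s \<in> nonzeros R \<Longrightarrow> fraction R \<zero> s = \<zero>\<^bsub>K\<^esub>"
  unfolding K_zero by (intro fraction_eqI[of _ _ _ _ \<one> s]) auto

lemma fraction_eq_zero_iff:
  assumes "a \<in> carrier R" "s \<in> nonzeros R"
  shows "fraction R a s = \<zero>\<^bsub>K\<^esub> \<longleftrightarrow> a = \<zero>"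
proof
  assume "fraction R a s = \<zero>\<^bsub>K\<^esub>"
  then have "((a, s), (\<zero>, \<one>)) \<in> frac_rel R"
    using fraction_eq_iff assms by (simp add: K_zero)
  from frac_relD[OF this, of \<one> s] show "a = \<zero>" using assms by simp
qed (simp add: fraction_zero assms)

lemma abelian_group_K: "abelian_group K"
proof (rule abelian_groupI)
  fix C D assume CD: "C \<in> carrier K" "D \<in> carrier K"
  then obtain a b s where ab: "a \<in> carrier R" "b \<in> carrier R" "s \<in> nonzeros R"
    "C = fraction R a s" "D = fraction R b s" by (rule K_cases2)
  show "C \<oplus>\<^bsub>K\<^esub> D \<in> carrier K" "C \<oplus>\<^bsub>K\<^esub> D = D \<oplus>\<^bsub>K\<^esub> C"
    using ab by (simp_all add: fraction_add_same a_comm)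
next
  fix C D E assume "C \<in> carrier K" "D \<in> carrier K" "E \<in> carrier K"
  then obtain a b e s where "a \<in> carrier R" "b \<in> carrier R" "e \<in> carrier R" "s \<in> nonzeros R"
    "C = fraction R a s" "D = fraction R b s" "E = fraction R e s" by (rule K_cases3)
  then show "C \<oplus>\<^bsub>K\<^esub> D \<oplus>\<^bsub>K\<^esub> E = C \<oplus>\<^bsub>K\<^esub> (D \<oplus>\<^bsub>K\<^esub> E)"
    by (simp add: fraction_add_same a_assoc)
next
  fix C assume "C \<in> carrier K"
  then obtain a s where a: "a \<in> carrier R" "s \<in> nonzeros R" "C = fraction R a s"
    by (rule K_cases)
  then show "\<zero>\<^bsub>K\<^esub> \<oplus>\<^bsub>K\<^esub> C = C"
    by (simp add: fraction_zero[of s, symmetric] fraction_add_same)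
  show "\<exists>D\<in>carrier K. D \<oplus>\<^bsub>K\<^esub> C = \<zero>\<^bsub>K\<^esub>"
    using a by (intro bexI[of _ "fraction R (\<ominus> a) s"]) (auto simp: fraction_add_same l_neg fraction_zero)
qed (simp add: K_zero)

lemma monoid_K: "monoid K"
proof (rule monoidI)
  fix C D assume CD: "C \<in> carrier K" "D \<in> carrier K"
  then obtain a b s where ab: "a \<in> carrier R" "b \<in> carrier R" "s \<in> nonzeros R"
    "C = fraction R a s" "D = fraction R b s" by (rule K_cases2)
  then obtain c u where c: "c \<in> carrier R" "u \<in> nonzeros R" "b \<otimes> u = s \<otimes> c" using ore_carrier by metis
  show "C \<otimes>\<^bsub>K\<^esub> D \<in> carrier K"
    using ab c fraction_mult[of a s b s c u] by simp
next
  fix C D E assume "C \<in> carrier K" "D \<in> carrier K" "E \<in> carrier K"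
  then obtain a s b t e r where a: "a \<in> carrier R" "s \<in> nonzeros R" "C = fraction R a s"
    and b: "b \<in> carrier R" "t \<in> nonzeros R" "D = fraction R b t"
    and e: "e \<in> carrier R" "r \<in> nonzeros R" "E = fraction R e r" by (elim K_cases)
  obtain c u where c: "c \<in> carrier R" "u \<in> nonzeros R" "e \<otimes> u = t \<otimes> c"
    using ore_carrier b e by metis
  obtain f v where f: "f \<in> carrier R" "v \<in> nonzeros R" "(b \<otimes> c) \<otimes> v = s \<otimes> f"
    using ore_carrier[of "b \<otimes> c" s] a b c by auto
  have DE: "D \<otimes>\<^bsub>K\<^esub> E = fraction R (b \<otimes> c) (r \<otimes> u)"
    using b e c by (simp add: fraction_mult)
  have C_DE: "C \<otimes>\<^bsub>K\<^esub> (D \<otimes>\<^bsub>K\<^esub> E) = fraction R (a \<otimes> f) (r \<otimes> u \<otimes> v)"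
    unfolding DE unfolding a(3) using a b c e f by (intro fraction_mult) auto
  show "C \<otimes>\<^bsub>K\<^esub> D \<otimes>\<^bsub>K\<^esub> E = C \<otimes>\<^bsub>K\<^esub> (D \<otimes>\<^bsub>K\<^esub> E)"
  \<comment> \<open>The denominator to which \<open>C\<close> times \<open>D\<close> is expanded
    contains \<open>c\<close>, so the case \<open>c = \<zero>\<close>, in which \<open>E\<close>
    vanishes, is separate.\<close>
  proof (cases "c = \<zero>")
    case True
    then have "e \<otimes> u = \<zero>" using c b by simp
    then have "e = \<zero>" using c e integral[of e u] by (auto simp: nonzeros_iff)
    then have E: "E = fraction R \<zero> r" using e by simp
    have "s \<otimes> f = \<zero>" using f True a b by simp
    then have "f = \<zero>" using f a integral[of s f] by (auto simp: nonzeros_iff)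
    then have "C \<otimes>\<^bsub>K\<^esub> (D \<otimes>\<^bsub>K\<^esub> E) = \<zero>\<^bsub>K\<^esub>"
      using C_DE a c e f by (simp add: fraction_zero)
    moreover have "Y \<otimes>\<^bsub>K\<^esub> E = \<zero>\<^bsub>K\<^esub>" if Y: "Y \<in> carrier K" for Y
    proof -
      obtain x y where "x \<in> carrier R" "y \<in> nonzeros R" "Y = fraction R x y" using Y by (rule K_cases)
      then show ?thesis using fraction_mult[of x y \<zero> r \<zero> \<one>] e E by (simp add: fraction_zero)
    qed
    moreover have "C \<otimes>\<^bsub>K\<^esub> D \<in> carrier K"
    proof -
      obtain c' u' where "c' \<in> carrier R" "u' \<in> nonzeros R" "b \<otimes> u' = s \<otimes> c'"
        using ore_carrier a b by metis
      then show ?thesis using a b fraction_mult[of a s b t c' u'] by simp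
    qed
    ultimately show ?thesis by simp
  next
    case False
    then have cv: "c \<otimes> v \<in> nonzeros R" using c f by (simp add: nonzeros_iff[of c])
    have "C \<otimes>\<^bsub>K\<^esub> D = fraction R (a \<otimes> f) (t \<otimes> (c \<otimes> v))"
      unfolding a(3) b(3) using a b c f cv nonzeros_mult[OF b(2) cv]
      by (intro fraction_mult) (auto simp: m_assoc)
    moreover have "fraction R (a \<otimes> f) (t \<otimes> (c \<otimes> v)) \<otimes>\<^bsub>K\<^esub> E =
      fraction R (a \<otimes> f \<otimes> \<one>) (r \<otimes> (u \<otimes> v))"
      unfolding e(3) using a b c e f cv nonzeros_mult[OF b(2) cv]
      by (intro fraction_mult) (auto simp flip: m_assoc)
    ultimately show ?thesis using C_DE a b c e f by (simp add: m_assoc)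
  qed
next
  fix C assume "C \<in> carrier K"
  then obtain a s where a: "a \<in> carrier R" "s \<in> nonzeros R" "C = fraction R a s"
    by (rule K_cases)
  then show "\<one>\<^bsub>K\<^esub> \<otimes>\<^bsub>K\<^esub> C = C" "C \<otimes>\<^bsub>K\<^esub> \<one>\<^bsub>K\<^esub> = C"
    using fraction_mult[of \<one> \<one> a s a \<one>] fraction_mult[of a s \<one> \<one> \<one> s] by (simp_all add: K_one)
qed (simp add: K_one)

lemma ring_K: "ring K"
proof (rule ringI[OF abelian_group_K monoid_K])
  fix C D E assume "C \<in> carrier K" "D \<in> carrier K" "E \<in> carrier K"
  then obtain a b e s where ab: "a \<in> carrier R" "b \<in> carrier R" "e \<in> carrier R" "s \<in> nonzeros R"
    "C = fraction R a s" "D = fraction R b s" "E = fraction R e s" by (rule K_cases3)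
  obtain c u where c: "c \<in> carrier R" "u \<in> nonzeros R" "e \<otimes> u = s \<otimes> c" using ore_carrier ab by metis
  show "(C \<oplus>\<^bsub>K\<^esub> D) \<otimes>\<^bsub>K\<^esub> E = C \<otimes>\<^bsub>K\<^esub> E \<oplus>\<^bsub>K\<^esub> D \<otimes>\<^bsub>K\<^esub> E"
    using ab c by (simp add: fraction_add_same fraction_mult[of _ s _ s c u] l_distr)
  obtain d v where d: "d \<in> carrier R" "v \<in> nonzeros R" "a \<otimes> u \<otimes> v = s \<otimes> d"
    using ore_carrier[of "a \<otimes> u" s] ab c by auto
  have "a \<otimes> (u \<otimes> v) = s \<otimes> d" "b \<otimes> (u \<otimes> v) \<in> carrier R" using ab c d by (simp_all add: m_assoc)
  obtain f w where f: "f \<in> carrier R" "w \<in> nonzeros R" "b \<otimes> (u \<otimes> v) \<otimes> w = s \<otimes> f"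
    using ore_carrier[of "b \<otimes> (u \<otimes> v)" s] ab c d by auto
  \<comment> \<open>One multiplier \<open>?u\<close> serves \<open>a\<close>, \<open>b\<close> and
    their sum, so that all three products get the same denominator.\<close>
  let ?u = "u \<otimes> v \<otimes> w"
  have 1: "a \<otimes> ?u = s \<otimes> (d \<otimes> w)" "b \<otimes> ?u = s \<otimes> f"
    using ab c d f by (simp_all flip: m_assoc)
  have 2: "E \<otimes>\<^bsub>K\<^esub> C = fraction R (e \<otimes> (d \<otimes> w)) (s \<otimes> ?u)"
    "E \<otimes>\<^bsub>K\<^esub> D = fraction R (e \<otimes> f) (s \<otimes> ?u)"
    using fraction_mult[of e s a s "d \<otimes> w" ?u] fraction_mult[of e s b s f ?u] 1 ab c d f by auto
  have "(a \<oplus> b) \<otimes> ?u = s \<otimes> (d \<otimes> w \<oplus> f)"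
    using 1 ab c d f by (simp add: l_distr r_distr)
  then have 3: "E \<otimes>\<^bsub>K\<^esub> (C \<oplus>\<^bsub>K\<^esub> D) = fraction R (e \<otimes> (d \<otimes> w \<oplus> f)) (s \<otimes> ?u)"
    unfolding ab(5-7) using ab c d f
    by (simp add: fraction_add_same del: m_assoc) (intro fraction_mult; simp)
  show "E \<otimes>\<^bsub>K\<^esub> (C \<oplus>\<^bsub>K\<^esub> D) = E \<otimes>\<^bsub>K\<^esub> C \<oplus>\<^bsub>K\<^esub> E \<otimes>\<^bsub>K\<^esub> D"
    unfolding 2 3 using ab c d f by (simp add: fraction_add_same r_distr)
qed

lemma K_inverse:
  assumes "C \<in> nonzeros K"
  shows "\<exists>D\<in>nonzeros K. C \<otimes>\<^bsub>K\<^esub> D = \<one>\<^bsub>K\<^esub> \<and> D \<otimes>\<^bsub>K\<^esub> C = \<one>\<^bsub>K\<^esub>"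
proof -
  obtain a s where a: "a \<in> carrier R" "s \<in> nonzeros R" "C = fraction R a s"
    using K_cases assms by (auto simp: nonzeros_def)
  have "a \<noteq> \<zero>" using assms a fraction_zero by (auto simp: nonzeros_def)
  then have a': "a \<in> nonzeros R" using a by (simp add: nonzeros_iff)
  have one: "fraction R x x = \<one>\<^bsub>K\<^esub>" if "x \<in> nonzeros R" for x
    using that fraction_expand[of \<one> \<one> x] by (simp add: K_one)
  have "fraction R s a \<in> nonzeros K"
    using a a' fraction_eq_zero_iff[of s a] by (auto simp: nonzeros_def)
  then show ?thesis using a a' one
    by (intro bexI[of _ "fraction R s a"]) (auto simp: fraction_mult_cancel)
qed

text \<open>Nonzero elements are invertible, so any two have the common right multiple one. Stated
  so that elimination, and hence the comparison of bases, runs over the skew field too.\<close>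

lemma right_ore_domain_K: "right_ore_domain K"
proof -
  interpret K: ring K by (rule ring_K)
  have inv: "\<exists>D\<in>carrier K. D \<otimes>\<^bsub>K\<^esub> C = \<one>\<^bsub>K\<^esub>" if "C \<in> carrier K" "C \<noteq> \<zero>\<^bsub>K\<^esub>" for C
    using K_inverse[of C] that by (auto simp: nonzeros_def)
  show ?thesis
  proof
    show "\<one>\<^bsub>K\<^esub> \<noteq> \<zero>\<^bsub>K\<^esub>" using fraction_eq_zero_iff[of \<one> \<one>] by (simp add: K_one)
    fix a b assume ab: "a \<otimes>\<^bsub>K\<^esub> b = \<zero>\<^bsub>K\<^esub>" "a \<in> carrier K" "b \<in> carrier K"
    show "a = \<zero>\<^bsub>K\<^esub> \<or> b = \<zero>\<^bsub>K\<^esub>"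
    proof (rule disjCI)
      assume "b \<noteq> \<zero>\<^bsub>K\<^esub>"
      then obtain c where "c \<in> carrier K" "b \<otimes>\<^bsub>K\<^esub> c = \<one>\<^bsub>K\<^esub>"
        using K_inverse[of b] ab by (auto simp: nonzeros_def)
      then show "a = \<zero>\<^bsub>K\<^esub>" using ab K.m_assoc[of a b c] by simp
    qed
  next
    fix a b assume ab: "a \<in> nonzeros K" "b \<in> nonzeros K"
    obtain c where c: "c \<in> nonzeros K" "a \<otimes>\<^bsub>K\<^esub> c = \<one>\<^bsub>K\<^esub>" using K_inverse[OF ab(1)] by blast
    obtain d where d: "d \<in> nonzeros K" "b \<otimes>\<^bsub>K\<^esub> d = \<one>\<^bsub>K\<^esub>" using K_inverse[OF ab(2)] by blast
    have "a \<otimes>\<^bsub>K\<^esub> c = b \<otimes>\<^bsub>K\<^esub> d" using c d by simp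
    then show "\<exists>c\<in>nonzeros K. \<exists>d\<in>nonzeros K. a \<otimes>\<^bsub>K\<^esub> c = b \<otimes>\<^bsub>K\<^esub> d"
      using c(1) d(1) by blast
  qed
qed

end

section \<open>Right modules and the rank of an extension of scalars\<close>

lemma (in comm_monoid) finprod_swap:
  assumes "finite I" "finite J" "\<And>i j. \<lbrakk>i \<in> I; j \<in> J\<rbrakk> \<Longrightarrow> f i j \<in> carrier G"
  shows "(\<Otimes>i\<in>I. \<Otimes>j\<in>J. f i j) = (\<Otimes>j\<in>J. \<Otimes>i\<in>I. f i j)"
  using assms(1,3)
proof (induction I rule: finite_induct)
  case (insert i I)
  have "(\<Otimes>j\<in>J. \<Otimes>i\<in>insert i I. f i j) = (\<Otimes>j\<in>J. f i j \<otimes> (\<Otimes>i\<in>I. f i j))"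
    using insert by (intro finprod_cong' refl) auto
  also have "\<dots> = (\<Otimes>j\<in>J. f i j) \<otimes> (\<Otimes>j\<in>J. \<Otimes>i\<in>I. f i j)"
    using insert by (intro finprod_multf) auto
  finally show ?case using insert by simp
qed simp

locale right_mod = R: ring R + M: comm_group M
  for R :: "('r, 'x) ring_scheme" (structure) and M :: "('r, 'm, 'z) right_module_scheme" +
  assumes act_closed [simp, intro]: "\<lbrakk>x \<in> carrier M; r \<in> carrier R\<rbrakk> \<Longrightarrow> act M x r \<in> carrier M"
    and act_mult: "\<lbrakk>x \<in> carrier M; y \<in> carrier M; r \<in> carrier R\<rbrakk> \<Longrightarrow>
      act M (x \<otimes>\<^bsub>M\<^esub> y) r = act M x r \<otimes>\<^bsub>M\<^esub> act M y r"
    and act_add: "\<lbrakk>x \<in> carrier M; r \<in> carrier R; s \<in> carrier R\<rbrakk> \<Longrightarrow>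
      act M x (r \<oplus> s) = act M x r \<otimes>\<^bsub>M\<^esub> act M x s"
    and act_assoc: "\<lbrakk>x \<in> carrier M; r \<in> carrier R; s \<in> carrier R\<rbrakk> \<Longrightarrow>
      act M x (r \<otimes> s) = act M (act M x r) s"
    and act_one [simp]: "x \<in> carrier M \<Longrightarrow> act M x \<one> = x"
begin

lemma act_hom: "r \<in> carrier R \<Longrightarrow> (\<lambda>x. act M x r) \<in> hom M M"
  by (auto simp: hom_def act_mult)

lemma act_hom_scalar: "x \<in> carrier M \<Longrightarrow> act M x \<in> hom (add_monoid R) M"
  by (auto simp: hom_def act_add)

lemma group_hom_act: "r \<in> carrier R \<Longrightarrow> group_hom M M (\<lambda>x. act M x r)"
  by (simp add: group_hom_def group_hom_axioms_def act_hom M.group_axioms)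

lemma group_hom_act_scalar: "x \<in> carrier M \<Longrightarrow> group_hom (add_monoid R) M (act M x)"
  by (simp add: group_hom_def group_hom_axioms_def act_hom_scalar M.group_axioms R.add.group_axioms)

lemma act_one_left [simp]: "r \<in> carrier R \<Longrightarrow> act M \<one>\<^bsub>M\<^esub> r = \<one>\<^bsub>M\<^esub>"
  using group_hom.hom_one[OF group_hom_act] by simp

lemma act_zero [simp]: "x \<in> carrier M \<Longrightarrow> act M x \<zero> = \<one>\<^bsub>M\<^esub>"
  using group_hom.hom_one[OF group_hom_act_scalar] by simp

lemma act_inv: "\<lbrakk>x \<in> carrier M; r \<in> carrier R\<rbrakk> \<Longrightarrow> act M (inv\<^bsub>M\<^esub> x) r = inv\<^bsub>M\<^esub> act M x r"
  using group_hom.hom_inv[OF group_hom_act] by simp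

lemma act_minus: "\<lbrakk>x \<in> carrier M; r \<in> carrier R\<rbrakk> \<Longrightarrow> act M x (\<ominus> r) = inv\<^bsub>M\<^esub> act M x r"
  using group_hom.hom_inv[OF group_hom_act_scalar, of x r] by (simp add: a_inv_def)

lemma act_finprod:
  assumes "\<And>i. i \<in> I \<Longrightarrow> x i \<in> carrier M" "r \<in> carrier R"
  shows "act M (finprod M x I) r = finprod M (\<lambda>i. act M (x i) r) I"
  using assms(1)
proof (induction I rule: infinite_finite_induct)
  case (insert i I)
  then show ?case using assms(2) by (simp add: act_mult)
qed (use assms(2) in auto)

lemma act_finsum:
  assumes "\<And>i. i \<in> I \<Longrightarrow> r i \<in> carrier R" "x \<in> carrier M"
  shows "act M x (finsum R r I) = finprod M (\<lambda>i. act M x (r i)) I"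
  using assms(1)
proof (induction I rule: infinite_finite_induct)
  case (insert i I)
  then show ?case using assms(2) by (simp add: act_add)
qed (use assms(2) in auto)

definition lincomb :: "('i \<Rightarrow> 'm) \<Rightarrow> 'i set \<Rightarrow> ('i \<Rightarrow> 'r) \<Rightarrow> 'm" where
  "lincomb v J c = finprod M (\<lambda>j. act M (v j) (c j)) J"

lemma lincomb_closed:
  "\<lbrakk>v \<in> J \<rightarrow> carrier M; c \<in> J \<rightarrow> carrier R\<rbrakk> \<Longrightarrow> lincomb v J c \<in> carrier M"
  unfolding lincomb_def by (intro M.finprod_closed) auto

lemma lincomb_add:
  assumes "v \<in> J \<rightarrow> carrier M" "c \<in> J \<rightarrow> carrier R" "d \<in> J \<rightarrow> carrier R"
  shows "lincomb v J c \<otimes>\<^bsub>M\<^esub> lincomb v J d = lincomb v J (\<lambda>j. c j \<oplus> d j)"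
proof -
  have "lincomb v J (\<lambda>j. c j \<oplus> d j) = finprod M (\<lambda>j. act M (v j) (c j) \<otimes>\<^bsub>M\<^esub> act M (v j) (d j)) J"
    unfolding lincomb_def using assms by (intro M.finprod_cong') (auto simp: act_add Pi_iff)
  also have "\<dots> = lincomb v J c \<otimes>\<^bsub>M\<^esub> lincomb v J d"
    unfolding lincomb_def using assms by (intro M.finprod_multf) auto
  finally show ?thesis by simp
qed

lemma lincomb_zero:
  assumes "v \<in> J \<rightarrow> carrier M" "\<And>j. j \<in> J \<Longrightarrow> c j = \<zero>"
  shows "lincomb v J c = \<one>\<^bsub>M\<^esub>"
  unfolding lincomb_def using assms by (intro M.finprod_one_eqI) (auto simp: Pi_iff)

lemma lincomb_minus:
  assumes "v \<in> J \<rightarrow> carrier M" "c \<in> J \<rightarrow> carrier R"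
  shows "lincomb v J (\<lambda>j. \<ominus> c j) = inv\<^bsub>M\<^esub> lincomb v J c"
proof -
  have "lincomb v J (\<lambda>j. \<ominus> c j) \<otimes>\<^bsub>M\<^esub> lincomb v J c = \<one>\<^bsub>M\<^esub>"
    using assms by (subst lincomb_add) (auto intro!: lincomb_zero simp: R.l_neg Pi_iff)
  then show ?thesis using assms by (intro M.inv_equality[symmetric] lincomb_closed) auto
qed

definition independent :: "('i \<Rightarrow> 'm) \<Rightarrow> 'i set \<Rightarrow> bool" where
  "independent v J \<longleftrightarrow> v \<in> J \<rightarrow> carrier M \<and>
    (\<forall>c \<in> J \<rightarrow> carrier R. lincomb v J c = \<one>\<^bsub>M\<^esub> \<longrightarrow> (\<forall>j\<in>J. c j = \<zero>))"

end

text \<open>With more vectors than basis elements the coefficient matrix would have fewer rows than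
  columns, and \<open>homogeneous_system\<close> would yield a nontrivial relation.\<close>

lemma independent_card_le_basis:
  assumes "right_mod K V" "right_ore_domain K" "finite_basis K V B" "finite J"
    and ind: "right_mod.independent K V v J"
  shows "card J \<le> card B"
proof (rule ccontr)
  interpret right_mod K V by fact
  interpret right_ore_domain K by fact
  assume "\<not> card J \<le> card B"
  then have lt: "card B < card J" by simp
  have B: "finite B" "B \<subseteq> carrier V"
    "\<And>x. x \<in> carrier V \<Longrightarrow> \<exists>c. c \<in> B \<rightarrow>\<^sub>E carrier K \<and> x = finprod V (\<lambda>b. act V b (c b)) B"
    using assms(3) unfolding finite_basis_def by blast+
  have v: "v j \<in> carrier V" if "j \<in> J" for j using ind that unfolding independent_def by auto
  have "\<forall>j\<in>J. \<exists>c. c \<in> B \<rightarrow>\<^sub>E carrier K \<and> v j = finprod V (\<lambda>b. act V b (c b)) B"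
    using B(3) v by blast
  from bchoice[OF this] obtain q where q: "\<And>j. j \<in> J \<Longrightarrow> q j \<in> B \<rightarrow>\<^sub>E carrier K"
    "\<And>j. j \<in> J \<Longrightarrow> v j = finprod V (\<lambda>b. act V b (q j b)) B" by blast
  have qc: "q j b \<in> carrier K" if "j \<in> J" "b \<in> B" for j b using q(1)[OF that(1)] that(2) by auto
  have bc: "b \<in> carrier V" if "b \<in> B" for b using that B(2) by auto
  obtain c where c: "\<And>j. j \<in> J \<Longrightarrow> c j \<in> carrier K" "\<exists>j\<in>J. c j \<noteq> \<zero>\<^bsub>K\<^esub>"
    "\<And>b. b \<in> B \<Longrightarrow> finsum K (\<lambda>j. q j b \<otimes>\<^bsub>K\<^esub> c j) J = \<zero>\<^bsub>K\<^esub>"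
    using homogeneous_system[OF B(1) assms(4) lt, of "\<lambda>b j. q j b"] qc by blast
  have "lincomb v J c = finprod V (\<lambda>j. finprod V (\<lambda>b. act V b (q j b \<otimes>\<^bsub>K\<^esub> c j)) B) J"
    unfolding lincomb_def
  proof (rule M.finprod_cong'[OF refl])
    fix j assume j: "j \<in> J"
    have "act V (v j) (c j) = finprod V (\<lambda>b. act V (act V b (q j b)) (c j)) B"
      unfolding q(2)[OF j] by (rule act_finprod) (use j qc c bc in auto)
    also have "\<dots> = finprod V (\<lambda>b. act V b (q j b \<otimes>\<^bsub>K\<^esub> c j)) B"
      by (rule M.finprod_cong'[OF refl]) (use j qc c bc in \<open>auto simp: act_assoc\<close>)
    finally show "act V (v j) (c j) = finprod V (\<lambda>b. act V b (q j b \<otimes>\<^bsub>K\<^esub> c j)) B" .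
  qed (use qc c bc in \<open>auto intro!: M.finprod_closed\<close>)
  also have "\<dots> = finprod V (\<lambda>b. finprod V (\<lambda>j. act V b (q j b \<otimes>\<^bsub>K\<^esub> c j)) J) B"
    by (rule M.finprod_swap) (use assms(4) B qc c bc in auto)
  also have "\<dots> = \<one>\<^bsub>V\<^esub>"
  proof (rule M.finprod_one_eqI)
    fix b assume b: "b \<in> B"
    have "finprod V (\<lambda>j. act V b (q j b \<otimes>\<^bsub>K\<^esub> c j)) J = act V b (finsum K (\<lambda>j. q j b \<otimes>\<^bsub>K\<^esub> c j) J)"
      by (rule act_finsum[symmetric]) (use b qc c bc in auto)
    then show "finprod V (\<lambda>j. act V b (q j b \<otimes>\<^bsub>K\<^esub> c j)) J = \<one>\<^bsub>V\<^esub>"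
      using c(3)[OF b] bc[OF b] by simp
  qed
  finally show False using ind c(1,2) unfolding independent_def by blast
qed

text \<open>A repeated vector would give a relation with coefficients one and minus one. Bases are
  sets, so this is what makes the image of a family as large as its index set.\<close>

lemma (in right_mod) independent_inj_on:
  assumes "finite J" "independent v J" "\<one> \<noteq> \<zero>"
  shows "inj_on v J"
proof (rule inj_onI, rule ccontr)
  fix i j assume ij: "i \<in> J" "j \<in> J" "v i = v j" "i \<noteq> j"
  define c where "c k = (if k = i then \<one> else if k = j then \<ominus> \<one> else \<zero>)" for k
  have v: "v k \<in> carrier M" if "k \<in> J" for k using assms(2) that unfolding independent_def by auto
  have c: "c \<in> J \<rightarrow> carrier R" by (auto simp: c_def)
  have "lincomb v J c = finprod M (\<lambda>k. act M (v k) (c k)) {i, j}"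
    unfolding lincomb_def
    using assms(1) ij v c by (intro M.finprod_mono_neutral_cong_right) (auto simp: c_def)
  also have "\<dots> = \<one>\<^bsub>M\<^esub>"
    using ij v by (simp add: c_def act_minus)
  finally have "c i = \<zero>"
    using assms(2) c ij(1) unfolding independent_def by blast
  then show False using assms(3) by (simp add: c_def)
qed

text \<open>An independent spanning family is a basis, and by
  \<open>independent_card_le_basis\<close> no basis is smaller, so it attains the infimum in
  \<open>rank\<close>.\<close>

lemma rank_eqI:
  assumes "right_mod K V" "right_ore_domain K" "finite J"
    and ind: "right_mod.independent K V v J"
    and span: "\<And>x. x \<in> carrier V \<Longrightarrow> \<exists>c \<in> J \<rightarrow> carrier K. x = right_mod.lincomb V v J c"
  shows "rank K V = enat (card J)"
proof -
  interpret right_mod K V by fact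
  interpret right_ore_domain K by fact
  have v: "v \<in> J \<rightarrow> carrier V" using ind unfolding independent_def by auto
  have inj: "inj_on v J" using independent_inj_on[OF assms(3) ind one_not_zero] .
  have lin: "finprod V (\<lambda>b. act V b (c b)) (v ` J) = lincomb v J (\<lambda>j. c (v j))"
    if "c \<in> v ` J \<rightarrow> carrier K" for c
    unfolding lincomb_def using that v inj by (intro M.finprod_reindex) auto
  have "finite_basis K V (v ` J)"
    unfolding finite_basis_def
  proof (intro conjI ballI ex_ex1I)
    fix x assume "x \<in> carrier V"
    then obtain c where c: "c \<in> J \<rightarrow> carrier K" "x = lincomb v J c" using span by blast
    define c' where "c' = (\<lambda>b\<in>v ` J. c (inv_into J v b))"
    have c': "c' \<in> v ` J \<rightarrow>\<^sub>E carrier K" using c(1) inj by (auto simp: c'_def)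
    have "lincomb v J c = lincomb v J (\<lambda>j. c' (v j))"
      unfolding lincomb_def using c v inj
      by (intro M.finprod_cong') (auto simp: c'_def Pi_iff)
    then show "\<exists>c. c \<in> v ` J \<rightarrow>\<^sub>E carrier K \<and> x = finprod V (\<lambda>b. act V b (c b)) (v ` J)"
      using c' c(2) lin[OF c'[unfolded PiE_def, THEN IntD1]] by (intro exI[of _ c'] conjI) auto
  next
    fix x c d
    assume c: "c \<in> v ` J \<rightarrow>\<^sub>E carrier K \<and> x = finprod V (\<lambda>b. act V b (c b)) (v ` J)"
      and d: "d \<in> v ` J \<rightarrow>\<^sub>E carrier K \<and> x = finprod V (\<lambda>b. act V b (d b)) (v ` J)"
    have cd: "(\<lambda>j. c (v j)) \<in> J \<rightarrow> carrier K" "(\<lambda>j. d (v j)) \<in> J \<rightarrow> carrier K" using c d by auto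
    have "lincomb v J (\<lambda>j. c (v j)) = x" using lin[of c] c by (auto simp: PiE_def)
    moreover have "lincomb v J (\<lambda>j. d (v j)) = x" using lin[of d] d by (auto simp: PiE_def)
    moreover have "lincomb v J (\<lambda>j. c (v j)) \<otimes>\<^bsub>V\<^esub> inv\<^bsub>V\<^esub> lincomb v J (\<lambda>j. d (v j)) =
      lincomb v J (\<lambda>j. c (v j) \<oplus>\<^bsub>K\<^esub> (\<ominus>\<^bsub>K\<^esub> d (v j)))"
      using v cd by (subst lincomb_minus[symmetric], simp, simp, subst lincomb_add) auto
    moreover have "lincomb v J (\<lambda>j. c (v j)) \<in> carrier V" using lincomb_closed v cd by blast
    ultimately have "lincomb v J (\<lambda>j. c (v j) \<oplus>\<^bsub>K\<^esub> (\<ominus>\<^bsub>K\<^esub> d (v j))) = \<one>\<^bsub>V\<^esub>" by simp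
    then have "\<forall>j\<in>J. c (v j) \<oplus>\<^bsub>K\<^esub> (\<ominus>\<^bsub>K\<^esub> d (v j)) = \<zero>\<^bsub>K\<^esub>"
      using ind cd unfolding independent_def by (auto simp: Pi_iff)
    then have "\<forall>j\<in>J. c (v j) = d (v j)"
      using cd by (metis (no_types, lifting) PiE R.r_right_minus_eq a_minus_def)
    then show "c = d"
      using c d by (intro PiE_ext[of c "v ` J" "\<lambda>_. carrier K" d]) auto
  qed (use assms(3) v in auto)
  moreover have "card (v ` J) = card J" using inj by (rule card_image)
  moreover have "card J \<le> card B" if "finite_basis K V B" for B
    using independent_card_le_basis assms that by blast
  ultimately have "enat (card J) \<in> {enat (card B) |B. finite_basis K V B}"
    "\<And>e. e \<in> {enat (card B) |B. finite_basis K V B} \<Longrightarrow> enat (card J) \<le> e"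
    by (auto intro!: exI[of _ "v ` J"])
  then show ?thesis unfolding rank_def by (intro antisym Inf_lower Inf_greatest)
qed

section \<open>Extension of scalars as a quotient of a free abelian group\<close>

locale scalar_extension = right_mod R M + K: ring K
  for R :: "('r, 'x) ring_scheme" (structure) and M :: "('r, 'm, 'z) right_module_scheme"
    and K :: "('k, 'y) ring_scheme" and \<iota> :: "'r \<Rightarrow> 'k" +
  assumes iota_closed [simp]: "r \<in> carrier R \<Longrightarrow> \<iota> r \<in> carrier K"
    and iota_add: "\<lbrakk>r \<in> carrier R; s \<in> carrier R\<rbrakk> \<Longrightarrow> \<iota> (r \<oplus> s) = \<iota> r \<oplus>\<^bsub>K\<^esub> \<iota> s"
    and iota_mult: "\<lbrakk>r \<in> carrier R; s \<in> carrier R\<rbrakk> \<Longrightarrow> \<iota> (r \<otimes> s) = \<iota> r \<otimes>\<^bsub>K\<^esub> \<iota> s"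
begin

abbreviation S where "S \<equiv> carrier M \<times> carrier K"
abbreviation F where "F \<equiv> free_Abelian_group S"
abbreviation V where "V \<equiv> extend_scalars R \<iota> K M"
definition N where "N = generate F (tensor_relators R \<iota> K M)"
definition ext :: "'k \<Rightarrow> ('m \<times> 'k \<Rightarrow>\<^sub>0 int) \<Rightarrow> ('m \<times> 'k \<Rightarrow>\<^sub>0 int)" where
  "ext k = frag_extend (\<lambda>(x, l). frag_of (x, l \<otimes>\<^bsub>K\<^esub> k))"

sublocale F: comm_group F by (rule abelian_free_Abelian_group)

lemma diff_in_F: "\<lbrakk>a \<in> carrier F; b \<in> carrier F\<rbrakk> \<Longrightarrow> a - b \<in> carrier F"
  using keys_diff[of a b] by auto

lemma relators_closed: "tensor_relators R \<iota> K M \<subseteq> carrier F"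
  unfolding tensor_relators_def
  by (auto simp del: carrier_free_Abelian_group_iff intro!: diff_in_F)

lemma N_subgroup: "subgroup N F"
  unfolding N_def by (rule F.generate_is_subgroup[OF relators_closed])

lemma N_normal: "N \<lhd> F"
  by (rule F.subgroup_imp_normal[OF N_subgroup])

lemma V_simps: "carrier V = carrier (F Mod N)" "x \<otimes>\<^bsub>V\<^esub> y = x \<otimes>\<^bsub>F Mod N\<^esub> y" "\<one>\<^bsub>V\<^esub> = \<one>\<^bsub>F Mod N\<^esub>"
  "act V C k = (\<Union>c\<in>C. N #>\<^bsub>F\<^esub> ext k c)"
  unfolding extend_scalars_def Let_def N_def ext_def by simp_all

lemma V_comm_group: "comm_group V"
proof -
  interpret N: normal N F by (rule N_normal)
  interpret Q: comm_group "F Mod N"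
    by (rule F.abelian_FactGroup[OF N_subgroup])
  show ?thesis
  proof (rule comm_groupI)
    fix x assume "x \<in> carrier V"
    then show "\<exists>y\<in>carrier V. y \<otimes>\<^bsub>V\<^esub> x = \<one>\<^bsub>V\<^esub>"
      using Q.l_inv_ex by (simp add: V_simps del: mult_FactGroup one_FactGroup)
  qed (simp_all add: V_simps Q.m_ac del: mult_FactGroup one_FactGroup)
qed

definition coset :: "('m \<times> 'k \<Rightarrow>\<^sub>0 int) \<Rightarrow> ('m \<times> 'k \<Rightarrow>\<^sub>0 int) set" where
  "coset c = N #>\<^bsub>F\<^esub> c"

lemma coset_closed [simp]: "c \<in> carrier F \<Longrightarrow> coset c \<in> carrier V"
  unfolding V_simps coset_def FactGroup_def RCOSETS_def by auto

lemma V_cases: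
  assumes "C \<in> carrier V" obtains c where "c \<in> carrier F" "C = coset c"
  using assms unfolding V_simps coset_def FactGroup_def RCOSETS_def by auto

lemma coset_add: "\<lbrakk>c \<in> carrier F; d \<in> carrier F\<rbrakk> \<Longrightarrow> coset c \<otimes>\<^bsub>V\<^esub> coset d = coset (c + d)"
  using normal.rcos_sum[OF N_normal, of c d] by (simp add: V_simps coset_def)

lemma coset_zero: "coset 0 = \<one>\<^bsub>V\<^esub>"
  using F.coset_mult_one[of N] subgroup.subset[OF N_subgroup] by (simp add: V_simps coset_def)

lemma coset_hom: "coset \<in> hom F V"
  by (auto simp: hom_def coset_add simp del: carrier_free_Abelian_group_iff)

lemma group_hom_coset: "group_hom F V coset"
  using coset_hom V_comm_group by (simp add: group_hom_def group_hom_axioms_def comm_group_def F.group_axioms)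

lemma coset_minus: "c \<in> carrier F \<Longrightarrow> coset (- c) = inv\<^bsub>V\<^esub> coset c"
  using group_hom.hom_inv[OF group_hom_coset, of c] by simp

lemma coset_diff:
  assumes "c \<in> carrier F" "d \<in> carrier F"
  shows "coset (c - d) = coset c \<otimes>\<^bsub>V\<^esub> inv\<^bsub>V\<^esub> coset d"
  using assms coset_add[of c "- d"] by (simp add: coset_minus)

lemma coset_eq_one_iff: "c \<in> carrier F \<Longrightarrow> coset c = \<one>\<^bsub>V\<^esub> \<longleftrightarrow> c \<in> N"
  unfolding coset_zero[symmetric]
  using F.coset_join1[of N c] F.coset_join2[of c N] N_subgroup subgroup.subset[OF N_subgroup]
    F.coset_mult_one[of N]
  by (auto simp: coset_def)

lemma ext_simps [simp]: "ext k 0 = 0" "ext k (frag_of (x, l)) = frag_of (x, l \<otimes>\<^bsub>K\<^esub> k)"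
  "ext k (c + d) = ext k c + ext k d" "ext k (c - d) = ext k c - ext k d" "ext k (- c) = - ext k c"
  by (simp_all add: ext_def frag_extend_add frag_extend_diff frag_extend_minus)

lemma ext_closed:
  assumes "c \<in> carrier F" "k \<in> carrier K" shows "ext k c \<in> carrier F"
  using keys_frag_extend[of "\<lambda>(x, l). frag_of (x, l \<otimes>\<^bsub>K\<^esub> k)" c] assms by (fastforce simp: ext_def)

lemma ext_relators:
  assumes "c \<in> tensor_relators R \<iota> K M" "k \<in> carrier K"
  shows "ext k c \<in> tensor_relators R \<iota> K M"
  using assms(1) unfolding tensor_relators_def
proof (elim UnE CollectE exE conjE, goal_cases)
  case (1 x y l)
  then have "ext k c = frag_of (x \<otimes>\<^bsub>M\<^esub> y, l \<otimes>\<^bsub>K\<^esub> k) - frag_of (x, l \<otimes>\<^bsub>K\<^esub> k) - frag_of (y, l \<otimes>\<^bsub>K\<^esub> k)"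
    by simp
  then show ?case using 1 assms(2) K.m_closed by blast
next
  case (2 x l l')
  then have "ext k c = frag_of (x, l \<otimes>\<^bsub>K\<^esub> k \<oplus>\<^bsub>K\<^esub> l' \<otimes>\<^bsub>K\<^esub> k) - frag_of (x, l \<otimes>\<^bsub>K\<^esub> k) - frag_of (x, l' \<otimes>\<^bsub>K\<^esub> k)"
    using assms(2) by (simp add: K.l_distr)
  then show ?case using 2 assms(2) K.m_closed by blast
next
  case (3 x r l)
  then have "ext k c = frag_of (act M x r, l \<otimes>\<^bsub>K\<^esub> k) - frag_of (x, \<iota> r \<otimes>\<^bsub>K\<^esub> (l \<otimes>\<^bsub>K\<^esub> k))"
    using assms(2) by (simp add: K.m_assoc)
  then show ?case using 3 assms(2) K.m_closed by blast
qed

text \<open>Multiplying the second component by \<open>k\<close> sends each tensor relator to a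
  tensor relator; this is what lets the right action of \<open>K\<close> descend to the
  quotient.\<close>

lemma ext_N:
  assumes "c \<in> N" "k \<in> carrier K" shows "ext k c \<in> N"
  using assms(1) unfolding N_def
proof (induction c rule: generate.induct)
  case one
  then show ?case using generate.one[of F] by simp
next
  case (incl h)
  then show ?case using ext_relators assms(2) by (auto intro: generate.incl)
next
  case (inv h)
  then have h: "h \<in> carrier F" "ext k h \<in> carrier F"
    using relators_closed ext_closed assms(2) by blast+
  have "inv\<^bsub>F\<^esub> (ext k h) \<in> generate F (tensor_relators R \<iota> K M)"
    using inv ext_relators assms(2) by (auto intro: generate.inv)
  then show ?case using h by simp
next
  case (eng h1 h2)
  then show ?case using generate.eng[of _ F] by simp
qed

text \<open>Representatives of one coset differ by elements of \<open>N\<close>, which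
  \<open>ext k\<close> preserves, so the union in \<open>act\<close> is over copies of a single
  coset.\<close>

lemma act_coset:
  assumes "c \<in> carrier F" "k \<in> carrier K"
  shows "act V (coset c) k = coset (ext k c)"
proof -
  have "coset (ext k d) = coset (ext k c)" if d: "d \<in> coset c" for d
  proof -
    obtain n where n: "n \<in> N" "d = n + c" using d by (auto simp: coset_def r_coset_def)
    have nF: "n \<in> carrier F" using n subgroup.subset[OF N_subgroup] by blast
    have "coset (ext k d) = coset (ext k n) \<otimes>\<^bsub>V\<^esub> coset (ext k c)"
      using n(2) nF assms by (subst coset_add) (auto intro!: ext_closed simp del: carrier_free_Abelian_group_iff)
    also have "coset (ext k n) = \<one>\<^bsub>V\<^esub>"
      using ext_N[OF n(1) assms(2)] ext_closed[OF nF assms(2)] coset_eq_one_iff by blast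
    finally show ?thesis
      using V_comm_group coset_closed[OF ext_closed[OF assms]]
      by (simp add: comm_group_def group.is_monoid monoid.l_one)
  qed
  moreover have "c \<in> coset c"
    using F.rcos_self[OF assms(1) N_subgroup] by (simp add: coset_def)
  ultimately show ?thesis unfolding V_simps coset_def[symmetric] by blast
qed

lemma coset_eqI:
  assumes "a \<in> carrier F" "b \<in> carrier F" "a - b \<in> N" shows "coset a = coset b"
proof -
  interpret V: comm_group V by (rule V_comm_group)
  have "coset a \<otimes>\<^bsub>V\<^esub> inv\<^bsub>V\<^esub> coset b = \<one>\<^bsub>V\<^esub>"
    using coset_diff[of a b] coset_eq_one_iff[of "a - b"] assms diff_in_F by simp
  then show ?thesis using assms by (metis V.inv_closed V.inv_equality V.inv_inv coset_closed)
qed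

definition ten :: "'m \<Rightarrow> 'k \<Rightarrow> ('m \<times> 'k \<Rightarrow>\<^sub>0 int) set" where
  "ten x k = coset (frag_of (x, k))"

lemma ten_closed [simp]: "\<lbrakk>x \<in> carrier M; k \<in> carrier K\<rbrakk> \<Longrightarrow> ten x k \<in> carrier V"
  by (simp add: ten_def)

lemma act_ten: "\<lbrakk>x \<in> carrier M; k \<in> carrier K; l \<in> carrier K\<rbrakk> \<Longrightarrow> act V (ten x k) l = ten x (k \<otimes>\<^bsub>K\<^esub> l)"
  by (simp add: ten_def act_coset)

lemma ten_mult:
  assumes "x \<in> carrier M" "y \<in> carrier M" "k \<in> carrier K"
  shows "ten (x \<otimes>\<^bsub>M\<^esub> y) k = ten x k \<otimes>\<^bsub>V\<^esub> ten y k"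
proof -
  have "frag_of (x \<otimes>\<^bsub>M\<^esub> y, k) - frag_of (x, k) - frag_of (y, k) \<in> tensor_relators R \<iota> K M"
    unfolding tensor_relators_def using assms by blast
  then have "frag_of (x \<otimes>\<^bsub>M\<^esub> y, k) - (frag_of (x, k) + frag_of (y, k)) \<in> N"
    unfolding N_def by (simp add: generate.incl algebra_simps)
  then show ?thesis
    unfolding ten_def using assms keys_add[of "frag_of (x, k)" "frag_of (y, k)"]
    by (subst coset_add, simp, simp, intro coset_eqI) auto
qed

lemma ten_add:
  assumes "x \<in> carrier M" "k \<in> carrier K" "l \<in> carrier K"
  shows "ten x (k \<oplus>\<^bsub>K\<^esub> l) = ten x k \<otimes>\<^bsub>V\<^esub> ten x l"
proof -
  have "frag_of (x, k \<oplus>\<^bsub>K\<^esub> l) - frag_of (x, k) - frag_of (x, l) \<in> tensor_relators R \<iota> K M"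
    unfolding tensor_relators_def using assms by blast
  then have "frag_of (x, k \<oplus>\<^bsub>K\<^esub> l) - (frag_of (x, k) + frag_of (x, l)) \<in> N"
    unfolding N_def by (simp add: generate.incl algebra_simps)
  then show ?thesis
    unfolding ten_def using assms keys_add[of "frag_of (x, k)" "frag_of (x, l)"]
    by (subst coset_add, simp, simp, intro coset_eqI) auto
qed

lemma ten_act:
  assumes "x \<in> carrier M" "r \<in> carrier R" "k \<in> carrier K"
  shows "ten (act M x r) k = ten x (\<iota> r \<otimes>\<^bsub>K\<^esub> k)"
proof -
  have "frag_of (act M x r, k) - frag_of (x, \<iota> r \<otimes>\<^bsub>K\<^esub> k) \<in> tensor_relators R \<iota> K M"
    unfolding tensor_relators_def using assms by blast
  then have "frag_of (act M x r, k) - frag_of (x, \<iota> r \<otimes>\<^bsub>K\<^esub> k) \<in> N"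
    unfolding N_def by (rule generate.incl)
  then show ?thesis unfolding ten_def using assms by (intro coset_eqI) auto
qed

text \<open>Pure tensors generate \<open>V\<close> as a group. Closure under quotients covers
  products and inverses in one case.\<close>

lemma V_induct [consumes 1, case_names one ten diff]:
  assumes "C \<in> carrier V"
    and "P \<one>\<^bsub>V\<^esub>" "\<And>x k. \<lbrakk>x \<in> carrier M; k \<in> carrier K\<rbrakk> \<Longrightarrow> P (ten x k)"
    and "\<And>C D. \<lbrakk>C \<in> carrier V; D \<in> carrier V; P C; P D\<rbrakk> \<Longrightarrow> P (C \<otimes>\<^bsub>V\<^esub> inv\<^bsub>V\<^esub> D)"
  shows "P C"
proof -
  obtain c where c: "c \<in> carrier F" "C = coset c" using V_cases[OF assms(1)] .
  have "P (coset c)"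
  proof (rule free_Abelian_group_induct[of c S "\<lambda>c. P (coset c)"], goal_cases)
    case 1
    then show ?case using c(1) by simp
  next
    case 2
    then show ?case using assms(2) by (simp add: coset_zero)
  next
    case (3 x y)
    then show ?case using assms(4) by (simp add: coset_diff)
  next
    case (4 a)
    then show ?case using assms(3) by (cases a) (auto simp: ten_def)
  qed
  then show ?thesis using c by simp
qed

lemma right_mod_V: "right_mod K V"
proof -
  interpret V: comm_group V by (rule V_comm_group)
  have act_mult: "act V (C \<otimes>\<^bsub>V\<^esub> D) r = act V C r \<otimes>\<^bsub>V\<^esub> act V D r"
    if CD: "C \<in> carrier V" "D \<in> carrier V" and r: "r \<in> carrier K" for C D r
  proof -
    obtain c d where c: "c \<in> carrier F" "C = coset c" "d \<in> carrier F" "D = coset d"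
      using V_cases CD by metis
    then have "c + d \<in> carrier F" using F.m_closed[of c d] by simp
    then show ?thesis using c r ext_closed
      by (simp add: coset_add act_coset del: carrier_free_Abelian_group_iff)
  qed
  have act_closed: "act V C r \<in> carrier V" if "C \<in> carrier V" "r \<in> carrier K" for C r
    using that V_cases[OF that(1)] by (metis act_coset coset_closed ext_closed)
  have act_hom: "group_hom V V (\<lambda>C. act V C r)" if "r \<in> carrier K" for r
    using that act_mult act_closed
    by (auto simp: group_hom_def group_hom_axioms_def hom_def V.group_axioms)
  have act_diff: "act V (C \<otimes>\<^bsub>V\<^esub> inv\<^bsub>V\<^esub> D) r = act V C r \<otimes>\<^bsub>V\<^esub> inv\<^bsub>V\<^esub> act V D r"
    if "C \<in> carrier V" "D \<in> carrier V" "r \<in> carrier K" for C D r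
    using that act_mult group_hom.hom_inv[OF act_hom] by simp
  have act_one: "act V \<one>\<^bsub>V\<^esub> r = \<one>\<^bsub>V\<^esub>" if "r \<in> carrier K" for r
    using group_hom.hom_one[OF act_hom[OF that]] .
  show ?thesis
  proof (unfold_locales)
    fix C r s assume C: "C \<in> carrier V" and rs: "r \<in> carrier K" "s \<in> carrier K"
    show "act V C (r \<oplus>\<^bsub>K\<^esub> s) = act V C r \<otimes>\<^bsub>V\<^esub> act V C s"
      using C
    proof (induction rule: V_induct)
      case (ten x k)
      then show ?case using rs by (simp add: act_ten K.r_distr ten_add)
    next
      case (diff C D)
      then show ?case using rs
        by (simp add: act_diff act_closed V.inv_mult_group V.m_ac)
    qed (use rs in \<open>simp add: act_one\<close>)
    show "act V C (r \<otimes>\<^bsub>K\<^esub> s) = act V (act V C r) s"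
      using C
    proof (induction rule: V_induct)
      case (ten x k)
      then show ?case using rs by (simp add: act_ten K.m_assoc)
    next
      case (diff C D)
      then show ?case using rs by (simp add: act_diff act_closed)
    qed (use rs in \<open>simp add: act_one\<close>)
  next
    fix C assume "C \<in> carrier V"
    then show "act V C \<one>\<^bsub>K\<^esub> = C"
      by (induction rule: V_induct) (simp_all add: act_one act_ten act_diff)
  qed (use act_closed act_mult in auto)
qed

text \<open>The universal property of the tensor product for the balanced map that sends
  \<open>(x, k)\<close> to \<open>\<iota> (D x)\<close> times \<open>k\<close>. It carries a linear
  functional over \<open>R\<close> to an additive map on \<open>V\<close>, from which coefficients
  can be read off.\<close>

lemma balanced_lift:
  fixes D :: "'m \<Rightarrow> 'r"
  assumes D: "\<And>x. x \<in> carrier M \<Longrightarrow> D x \<in> carrier R"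
    "\<And>x y. \<lbrakk>x \<in> carrier M; y \<in> carrier M\<rbrakk> \<Longrightarrow> D (x \<otimes>\<^bsub>M\<^esub> y) = D x \<oplus> D y"
    "\<And>x r. \<lbrakk>x \<in> carrier M; r \<in> carrier R\<rbrakk> \<Longrightarrow> D (act M x r) = D x \<otimes> r"
  obtains h where "h \<in> hom V (add_monoid K)"
    "\<And>x k. \<lbrakk>x \<in> carrier M; k \<in> carrier K\<rbrakk> \<Longrightarrow> h (ten x k) = \<iota> (D x) \<otimes>\<^bsub>K\<^esub> k"
proof -
  have "(\<lambda>(x, k). \<iota> (D x) \<otimes>\<^bsub>K\<^esub> k) ` S \<subseteq> carrier (add_monoid K)" using D by auto
  from comm_group.free_Abelian_group_universal[OF K.a_comm_group this]
  obtain f where f: "f \<in> hom F (add_monoid K)"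
    "\<And>p. p \<in> S \<Longrightarrow> f (frag_of p) = (\<lambda>(x, k). \<iota> (D x) \<otimes>\<^bsub>K\<^esub> k) p" by metis
  interpret f: group_hom F "add_monoid K" f
    using f(1) by (simp add: group_hom_def group_hom_axioms_def F.group_axioms K.add.group_axioms)
  have f_of: "f (frag_of (x, k)) = \<iota> (D x) \<otimes>\<^bsub>K\<^esub> k" if "x \<in> carrier M" "k \<in> carrier K" for x k
    using f(2)[of "(x, k)"] that by simp
  have f_diff: "f (a - b) = f a \<ominus>\<^bsub>K\<^esub> f b" if "a \<in> carrier F" "b \<in> carrier F" for a b
    using that f.hom_mult[of a "- b"] f.hom_inv[of b] by (simp add: a_minus_def a_inv_def)
  have cancel: "(a \<oplus>\<^bsub>K\<^esub> b) \<ominus>\<^bsub>K\<^esub> a \<ominus>\<^bsub>K\<^esub> b = \<zero>\<^bsub>K\<^esub>"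
    if "a \<in> carrier K" "b \<in> carrier K" for a b
    using that by (simp add: K.a_comm[of a b] K.minus_eq K.a_assoc K.r_neg2 K.r_neg)
  have rel: "f c = \<zero>\<^bsub>K\<^esub>" if "c \<in> tensor_relators R \<iota> K M" for c
    using that unfolding tensor_relators_def
  proof (elim UnE CollectE exE conjE, goal_cases)
    case (1 x y k)
    have "f c = (\<iota> (D x) \<oplus>\<^bsub>K\<^esub> \<iota> (D y)) \<otimes>\<^bsub>K\<^esub> k \<ominus>\<^bsub>K\<^esub> \<iota> (D x) \<otimes>\<^bsub>K\<^esub> k \<ominus>\<^bsub>K\<^esub> \<iota> (D y) \<otimes>\<^bsub>K\<^esub> k"
      using 1 D diff_in_F
      by (simp add: f_diff f_of iota_add)
    then show ?case using 1 D
      by (simp add: K.l_distr cancel)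
  next
    case (2 x k l)
    have "f c = \<iota> (D x) \<otimes>\<^bsub>K\<^esub> (k \<oplus>\<^bsub>K\<^esub> l) \<ominus>\<^bsub>K\<^esub> \<iota> (D x) \<otimes>\<^bsub>K\<^esub> k \<ominus>\<^bsub>K\<^esub> \<iota> (D x) \<otimes>\<^bsub>K\<^esub> l"
      using 2 D diff_in_F by (simp add: f_diff f_of)
    then show ?case using 2 D
      by (simp add: K.r_distr cancel)
  next
    case (3 x r k)
    then show ?case using D by (simp add: f_diff f_of iota_mult K.m_assoc K.minus_eq K.r_neg)
  qed
  have fN: "f c = \<zero>\<^bsub>K\<^esub>" if "c \<in> N" for c
    using that unfolding N_def
  proof (induction rule: generate.induct)
    case (inv h)
    then have "h \<in> carrier F" using relators_closed by blast
    then show ?case using rel[OF inv] f.hom_inv[of h] K.add.inv_one by simp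
  next
    case (eng a b)
    then have "a \<in> carrier F" "b \<in> carrier F"
      using F.generate_incl[OF relators_closed] by blast+
    then show ?case using eng f.hom_mult[of a b] by simp
  qed (use rel f.hom_one in auto)
  \<comment> \<open>The choice of a representative is harmless because \<open>f\<close> vanishes on
    \<open>N\<close>.\<close>
  define h where "h C = f (SOME c. c \<in> carrier F \<and> C = coset c)" for C
  have h: "h (coset c) = f c" if c: "c \<in> carrier F" for c
  proof -
    define d where "d = (SOME d. d \<in> carrier F \<and> coset c = coset d)"
    have d: "d \<in> carrier F" "coset c = coset d"
      unfolding d_def using someI[of "\<lambda>d. d \<in> carrier F \<and> coset c = coset d" c] c by auto
    interpret V: comm_group V by (rule V_comm_group)
    have "coset (c - d) = \<one>\<^bsub>V\<^esub>" using coset_diff[OF c d(1)] d c by simp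
    then have "f (c - d) = \<zero>\<^bsub>K\<^esub>" using fN coset_eq_one_iff diff_in_F c d by blast
    then show ?thesis
      using f_diff[OF c d(1)] f.hom_closed c d(1) unfolding h_def d_def[symmetric] by simp
  qed
  show thesis
  proof
    show "h \<in> hom V (add_monoid K)"
    proof (rule homI)
      fix C E assume "C \<in> carrier V" "E \<in> carrier V"
      then obtain c e where c: "c \<in> carrier F" "C = coset c" "e \<in> carrier F" "E = coset e"
        using V_cases by metis
      then have "c + e \<in> carrier F" using F.m_closed[of c e] by simp
      then show "h (C \<otimes>\<^bsub>V\<^esub> E) = h C \<otimes>\<^bsub>add_monoid K\<^esub> h E"
        using c f.hom_mult[of c e] by (simp add: coset_add h del: carrier_free_Abelian_group_iff)
    next
      fix C assume "C \<in> carrier V"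
      then show "h C \<in> carrier (add_monoid K)"
        using V_cases h f.hom_closed by metis
    qed
    show "h (ten x k) = \<iota> (D x) \<otimes>\<^bsub>K\<^esub> k" if "x \<in> carrier M" "k \<in> carrier K" for x k
      using that h[of "frag_of (x, k)"] f_of by (simp add: ten_def)
  qed
qed

end


lemma (in right_ore_domain) scalar_extension_quotients:
  assumes "right_mod R M"
  shows "scalar_extension R M (right_quotients R) (\<lambda>r. fraction R r \<one>)"
proof -
  interpret M: right_mod R M by fact
  interpret K: ring K by (rule ring_K)
  show ?thesis
    by unfold_locales
      (use fraction_mult[of _ \<one> _ \<one> _ \<one>] in \<open>simp_all add: fraction_add_same\<close>)
qed

text \<open>The functionals \<open>D j\<close> form a system dual to \<open>m\<close> up to nonzero scalars, and are jointly
  injective modulo torsion.\<close>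

theorem quotient_rank_eq:
  fixes M :: "('r, 'm, 'z) right_module_scheme"
  assumes "right_ore_domain R" "right_mod R M" "finite J"
    and m: "\<And>j. j \<in> J \<Longrightarrow> m j \<in> carrier M"
    and D_closed: "\<And>j x. \<lbrakk>j \<in> J; x \<in> carrier M\<rbrakk> \<Longrightarrow> D j x \<in> carrier R"
    and D_mult: "\<And>j x y. \<lbrakk>j \<in> J; x \<in> carrier M; y \<in> carrier M\<rbrakk> \<Longrightarrow>
      D j (x \<otimes>\<^bsub>M\<^esub> y) = D j x \<oplus>\<^bsub>R\<^esub> D j y"
    and D_act: "\<And>j x r. \<lbrakk>j \<in> J; x \<in> carrier M; r \<in> carrier R\<rbrakk> \<Longrightarrow>
      D j (act M x r) = D j x \<otimes>\<^bsub>R\<^esub> r"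
    and D_diag: "\<And>j. j \<in> J \<Longrightarrow> D j (m j) \<noteq> \<zero>\<^bsub>R\<^esub>"
    and D_off: "\<And>i j. \<lbrakk>i \<in> J; j \<in> J; i \<noteq> j\<rbrakk> \<Longrightarrow> D i (m j) = \<zero>\<^bsub>R\<^esub>"
    and torsion: "\<And>x. \<lbrakk>x \<in> carrier M; \<And>j. j \<in> J \<Longrightarrow> D j x = \<zero>\<^bsub>R\<^esub>\<rbrakk> \<Longrightarrow>
      \<exists>s\<in>nonzeros R. act M x s = \<one>\<^bsub>M\<^esub>"
  shows "quotient_rank R M = enat (card J)"
proof -
  let ?K = "right_quotients R"
  let ?i = "\<lambda>r. fraction R r \<one>\<^bsub>R\<^esub>"
  interpret R: right_ore_domain R by fact
  interpret scalar_extension R M ?K ?i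
    by (rule R.scalar_extension_quotients) fact
  interpret V: right_mod ?K V by (rule right_mod_V)
  interpret KO: right_ore_domain ?K by (rule R.right_ore_domain_K)
  have iota_zero: "?i \<zero>\<^bsub>R\<^esub> = \<zero>\<^bsub>?K\<^esub>" by (simp add: R.fraction_zero)
  have iota_nonzero: "?i r \<in> nonzeros ?K" if "r \<in> nonzeros R" for r
    using that R.fraction_eq_zero_iff[of r "\<one>\<^bsub>R\<^esub>"] by (auto simp: KO.nonzeros_iff R.nonzeros_iff)
  define v where "v j = ten (m j) \<one>\<^bsub>?K\<^esub>" for j
  have v: "v \<in> J \<rightarrow> carrier V" using m by (auto simp: v_def)
  have act_v: "act V (v j) k = ten (m j) k" if "j \<in> J" "k \<in> carrier ?K" for j k
    using that m by (simp add: v_def act_ten)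
  have ind: "V.independent v J"
    unfolding V.independent_def
  proof (intro conjI ballI impI v)
    fix c i assume c: "c \<in> J \<rightarrow> carrier ?K" "V.lincomb v J c = \<one>\<^bsub>V\<^esub>" and i: "i \<in> J"
    obtain h where h: "h \<in> hom V (add_monoid ?K)"
      "\<And>x k. \<lbrakk>x \<in> carrier M; k \<in> carrier ?K\<rbrakk> \<Longrightarrow> h (ten x k) = ?i (D i x) \<otimes>\<^bsub>?K\<^esub> k"
      using balanced_lift[of "D i"] D_closed[OF i] D_mult[OF i] D_act[OF i] by blast
    interpret h: group_hom V "add_monoid ?K" h
      using h(1) V.M.group_axioms K.a_group by (intro group_hom.intro group_hom_axioms.intro)
    have h_lin: "h (V.lincomb v I c) = finsum ?K (\<lambda>j. ?i (D i (m j)) \<otimes>\<^bsub>?K\<^esub> c j) I"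
      if "I \<subseteq> J" for I
      using finite_subset[OF that assms(3)] that
    proof (induction I rule: finite_induct)
      case empty
      then show ?case using h.hom_one by (simp add: V.lincomb_def)
    next
      case (insert j I)
      have cl: "c k \<in> carrier ?K" "m k \<in> carrier M" "D i (m k) \<in> carrier R" if "k \<in> insert j I" for k
        using insert.prems that c(1) m D_closed[OF i] by auto
      have "V.lincomb v (insert j I) c = act V (v j) (c j) \<otimes>\<^bsub>V\<^esub> V.lincomb v I c"
        unfolding V.lincomb_def using insert v cl
        by (intro V.M.finprod_insert) (auto simp: Pi_iff)
      also have "h \<dots> = h (act V (v j) (c j)) \<oplus>\<^bsub>?K\<^esub> h (V.lincomb v I c)"
      proof -
        have "act V (v j) (c j) \<in> carrier V" using v cl insert.prems by auto
        moreover have "V.lincomb v I c \<in> carrier V"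
          using v cl insert.prems by (intro V.lincomb_closed) auto
        ultimately show ?thesis using h.hom_mult by simp
      qed
      finally show ?case
        using insert cl act_v[of j "c j"] h(2)[of "m j" "c j"]
        by (subst K.finsum_insert) (auto intro!: K.m_closed iota_closed)
    qed
    have "\<zero>\<^bsub>?K\<^esub> = finsum ?K (\<lambda>j. ?i (D i (m j)) \<otimes>\<^bsub>?K\<^esub> c j) J"
      using h_lin[of J] c(2) h.hom_one by simp
    also have "\<dots> = finsum ?K (\<lambda>j. if i = j then ?i (D i (m i)) \<otimes>\<^bsub>?K\<^esub> c i else \<zero>\<^bsub>?K\<^esub>) J"
      using c(1) i m D_closed D_off by (intro K.finsum_cong') (auto simp: iota_zero Pi_iff)
    also have "\<dots> = ?i (D i (m i)) \<otimes>\<^bsub>?K\<^esub> c i"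
      using i assms(3) c(1) m D_closed
      by (intro K.add.finprod_singleton) auto
    finally have z: "?i (D i (m i)) \<otimes>\<^bsub>?K\<^esub> c i = \<zero>\<^bsub>?K\<^esub>" by simp
    have nz: "?i (D i (m i)) \<in> nonzeros ?K"
      using i m D_closed D_diag by (intro iota_nonzero) (auto simp: R.nonzeros_iff)
    have "c i \<in> carrier ?K" using c(1) i by auto
    then show "c i = \<zero>\<^bsub>?K\<^esub>"
      using KO.integral[OF z KO.nonzeros_carrier[OF nz]] nz unfolding KO.nonzeros_iff by blast
  qed
  define sp where "sp = {x. \<exists>c \<in> J \<rightarrow> carrier ?K. x = V.lincomb v J c}"
  have sp_mult: "x \<otimes>\<^bsub>V\<^esub> y \<in> sp" if xy: "x \<in> sp" "y \<in> sp" for x y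
  proof -
    obtain c d where "c \<in> J \<rightarrow> carrier ?K" "x = V.lincomb v J c"
      "d \<in> J \<rightarrow> carrier ?K" "y = V.lincomb v J d" using xy unfolding sp_def by blast
    then show ?thesis unfolding sp_def
      by (auto simp: V.lincomb_add[OF v] Pi_iff intro!: bexI[of _ "\<lambda>j. c j \<oplus>\<^bsub>?K\<^esub> d j"])
  qed
  have sp_inv: "inv\<^bsub>V\<^esub> x \<in> sp" if x: "x \<in> sp" for x
  proof -
    obtain c where "c \<in> J \<rightarrow> carrier ?K" "x = V.lincomb v J c" using x unfolding sp_def by blast
    then show ?thesis unfolding sp_def
      by (auto simp: V.lincomb_minus[OF v, symmetric] Pi_iff intro!: bexI[of _ "\<lambda>j. \<ominus>\<^bsub>?K\<^esub> c j"])
  qed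
  have sp_ten: "ten x k \<in> sp" if x: "x \<in> carrier M" and k: "k \<in> carrier ?K" for x k
  proof -
    \<comment> \<open>Over the skew field the coefficient of \<open>m j\<close> would be the inverse
      of \<open>D j (m j)\<close> times \<open>D j x\<close>; the common right factor
      \<open>s\<close> brings all of these coefficients into \<open>R\<close>.\<close>
    have "\<exists>s\<in>nonzeros R. \<exists>e. \<forall>j\<in>J. e j \<in> carrier R \<and>
      D j x \<otimes>\<^bsub>R\<^esub> s = D j (m j) \<otimes>\<^bsub>R\<^esub> e j"
      by (rule R.ore_common_denominator[OF assms(3)])
        (use D_closed x m D_diag in \<open>simp_all add: R.nonzeros_iff\<close>)
    then obtain s e where s: "s \<in> nonzeros R" "\<And>j. j \<in> J \<Longrightarrow> e j \<in> carrier R"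
      "\<And>j. j \<in> J \<Longrightarrow> D j x \<otimes>\<^bsub>R\<^esub> s = D j (m j) \<otimes>\<^bsub>R\<^esub> e j"
      by metis
    have sc: "s \<in> carrier R" using s by auto
    let ?l = "lincomb m J e"
    have l: "?l \<in> carrier M" using m s(2) by (intro lincomb_closed) auto
    have D_one: "D i \<one>\<^bsub>M\<^esub> = \<zero>\<^bsub>R\<^esub>" if "i \<in> J" for i
      using D_act[OF that M.one_closed R.zero_closed] D_closed[OF that M.one_closed] by simp
    have D_inv: "D i (inv\<^bsub>M\<^esub> y) = \<ominus>\<^bsub>R\<^esub> D i y" if "i \<in> J" "y \<in> carrier M" for i y
    proof -
      have "D i (inv\<^bsub>M\<^esub> y) \<oplus>\<^bsub>R\<^esub> D i y = \<zero>\<^bsub>R\<^esub>"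
        using D_mult[OF that(1), of "inv\<^bsub>M\<^esub> y" y] that(2) D_one[OF that(1)] by simp
      then show ?thesis using D_closed that by (intro R.minus_equality[symmetric]) auto
    qed
    have D_lin: "D i (lincomb m I e) = finsum R (\<lambda>j. D i (m j) \<otimes>\<^bsub>R\<^esub> e j) I"
      if "i \<in> J" "I \<subseteq> J" for i I
      using finite_subset[OF that(2) assms(3)] that(2)
    proof (induction I rule: finite_induct)
      case empty
      then show ?case using D_one that by (simp add: lincomb_def)
    next
      case (insert j I)
      have cl: "e k \<in> carrier R" "m k \<in> carrier M" "D i (m k) \<in> carrier R" if "k \<in> insert j I" for k
        using insert.prems that \<open>i \<in> J\<close> s(2) m D_closed by auto
      have "lincomb m (insert j I) e = act M (m j) (e j) \<otimes>\<^bsub>M\<^esub> lincomb m I e"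
        unfolding lincomb_def using insert cl by (intro M.finprod_insert) auto
      also have "D i \<dots> = D i (m j) \<otimes>\<^bsub>R\<^esub> e j \<oplus>\<^bsub>R\<^esub> D i (lincomb m I e)"
        using D_mult[OF that(1)] D_act[OF that(1)] cl lincomb_closed[of m I e] by simp
      finally show ?case
        using insert cl by (subst R.finsum_insert) auto
    qed
    \<comment> \<open>The multiple of \<open>x\<close> by \<open>s\<close> and the combination
      \<open>?l\<close> have equal coordinates, so their quotient is torsion.\<close>
    have "D i (act M x s \<otimes>\<^bsub>M\<^esub> inv\<^bsub>M\<^esub> ?l) = \<zero>\<^bsub>R\<^esub>" if i: "i \<in> J" for i
    proof -
      have "D i ?l = finsum R (\<lambda>j. if i = j then D i (m i) \<otimes>\<^bsub>R\<^esub> e i else \<zero>\<^bsub>R\<^esub>) J"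
        unfolding D_lin[OF i subset_refl]
        using i s(2) m D_closed D_off by (intro R.finsum_cong') auto
      also have "\<dots> = D i (m i) \<otimes>\<^bsub>R\<^esub> e i"
        using i assms(3) s(2) m D_closed by (intro R.add.finprod_singleton) auto
      finally show ?thesis
        using i x sc l s(3)[OF i] D_closed m s(2)
        by (simp add: D_mult D_inv D_act R.r_neg)
    qed
    then obtain s' where s': "s' \<in> nonzeros R" "act M (act M x s \<otimes>\<^bsub>M\<^esub> inv\<^bsub>M\<^esub> ?l) s' = \<one>\<^bsub>M\<^esub>"
      using torsion[of "act M x s \<otimes>\<^bsub>M\<^esub> inv\<^bsub>M\<^esub> ?l"] x sc l by auto
    have s'c: "s' \<in> carrier R" using s' by auto
    have "act M (act M x s) s' \<otimes>\<^bsub>M\<^esub> inv\<^bsub>M\<^esub> act M ?l s' = \<one>\<^bsub>M\<^esub>"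
      using s'(2) x sc s'c l by (simp add: act_mult act_inv)
    then have eq: "act M x (s \<otimes>\<^bsub>R\<^esub> s') = act M ?l s'"
      using x sc s'c l by (metis M.inv_closed M.inv_equality M.inv_inv act_assoc act_closed)
    let ?u = "s \<otimes>\<^bsub>R\<^esub> s'"
    have "?u \<in> nonzeros R" using s(1) s'(1) by simp
    \<comment> \<open>As \<open>?u\<close> is invertible in \<open>?K\<close>, the tensor of
      \<open>x\<close> with \<open>k\<close> can be rewritten through the multiple of
      \<open>x\<close> by \<open>?u\<close>, which is a combination of the
      \<open>m j\<close>.\<close>
    then obtain w where w: "w \<in> nonzeros ?K" "?i ?u \<otimes>\<^bsub>?K\<^esub> w = \<one>\<^bsub>?K\<^esub>"
      using R.K_inverse[OF iota_nonzero] by blast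
    have wc: "w \<in> carrier ?K" using w by auto
    have "ten x k = ten x (?i ?u \<otimes>\<^bsub>?K\<^esub> (w \<otimes>\<^bsub>?K\<^esub> k))"
      using w wc k sc s'c by (simp flip: K.m_assoc)
    also have "\<dots> = ten (act M ?l s') (w \<otimes>\<^bsub>?K\<^esub> k)"
      using x sc s'c wc k by (simp add: ten_act[symmetric] eq)
    also have "\<dots> = ten ?l (?i s' \<otimes>\<^bsub>?K\<^esub> (w \<otimes>\<^bsub>?K\<^esub> k))"
      using l s'c wc k by (simp add: ten_act)
    finally have "ten x k = ten ?l (?i s' \<otimes>\<^bsub>?K\<^esub> (w \<otimes>\<^bsub>?K\<^esub> k))" .
    then obtain q where xk: "ten x k = ten ?l q" and kc: "q \<in> carrier ?K"
      using s'c wc k by (meson K.m_closed iota_closed)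
    have "ten (lincomb m I e) q = V.lincomb v I (\<lambda>j. ?i (e j) \<otimes>\<^bsub>?K\<^esub> q)" if "I \<subseteq> J" for I
      using finite_subset[OF that assms(3)] that
    proof (induction I rule: finite_induct)
      case empty
      \<comment> \<open>Writing the neutral element as itself times zero moves the zero across the
        tensor sign.\<close>
      have "ten \<one>\<^bsub>M\<^esub> q = ten (act M \<one>\<^bsub>M\<^esub> \<zero>\<^bsub>R\<^esub>) q" by simp
      also have "\<dots> = ten \<one>\<^bsub>M\<^esub> \<zero>\<^bsub>?K\<^esub>" using kc by (subst ten_act) (auto simp: iota_zero)
      also have "\<dots> = act V (ten \<one>\<^bsub>M\<^esub> \<zero>\<^bsub>?K\<^esub>) \<zero>\<^bsub>?K\<^esub>" by (simp add: act_ten del: V.act_zero)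
      also have "\<dots> = \<one>\<^bsub>V\<^esub>" by (rule V.act_zero) simp
      finally show ?case by (simp add: lincomb_def V.lincomb_def)
    next
      case (insert j I)
      have cl: "e k \<in> carrier R" "m k \<in> carrier M" "v k \<in> carrier V" if "k \<in> insert j I" for k
        using insert.prems that s(2) m v by auto
      have "lincomb m (insert j I) e = act M (m j) (e j) \<otimes>\<^bsub>M\<^esub> lincomb m I e"
        unfolding lincomb_def using insert cl by (intro M.finprod_insert) auto
      also have "ten \<dots> q = ten (act M (m j) (e j)) q \<otimes>\<^bsub>V\<^esub> ten (lincomb m I e) q"
        using cl lincomb_closed[of m I e] kc by (intro ten_mult) auto
      also have "ten (act M (m j) (e j)) q = act V (v j) (?i (e j) \<otimes>\<^bsub>?K\<^esub> q)"
        using cl kc insert.prems ten_act[of "m j" "e j" q] act_v[of j "?i (e j) \<otimes>\<^bsub>?K\<^esub> q"] by simp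
      also have "ten (lincomb m I e) q = V.lincomb v I (\<lambda>j. ?i (e j) \<otimes>\<^bsub>?K\<^esub> q)"
        using insert by auto
      finally show ?case
        unfolding V.lincomb_def using insert.hyps cl kc
        by (subst V.M.finprod_insert) (simp_all add: Pi_iff)
    qed
    then show ?thesis
      unfolding sp_def xk using s(2) kc
      by (auto intro!: bexI[of _ "\<lambda>j. ?i (e j) \<otimes>\<^bsub>?K\<^esub> q"])
  qed
  have "x \<in> sp" if "x \<in> carrier V" for x
    using that
  proof (induction rule: V_induct)
    case one
    show ?case unfolding sp_def
      using V.lincomb_zero[OF v, of "\<lambda>_. \<zero>\<^bsub>?K\<^esub>"] by (auto intro!: bexI[of _ "\<lambda>_. \<zero>\<^bsub>?K\<^esub>"])
  qed (use sp_ten sp_mult sp_inv in auto)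
  then show ?thesis
    unfolding quotient_rank_def
    by (intro rank_eqI[OF right_mod_V R.right_ore_domain_K assms(3) ind]) (auto simp: sp_def)
qed

section \<open>Integral group rings\<close>

lemma keys_frag_of_eq [simp]: "Poly_Mapping.keys (frag_of a) = {a}"
  by (rule keys_frag_of)

lemma frag_extend_fun_add: "frag_extend (\<lambda>x. f x + g x) a = frag_extend f a + frag_extend g a"
  by (simp add: frag_extend_def frag_cmul_distrib2 sum.distrib)

lemma frag_extend_fun_zero: "frag_extend (\<lambda>x. 0) a = 0"
  by (simp add: frag_extend_def)

lemma frag_extend_fun_minus: "frag_extend (\<lambda>x. - f x) a = - frag_extend f a"
  using frag_extend_fun_add[of f "\<lambda>x. - f x" a] by (simp add: frag_extend_fun_zero eq_neg_iff_add_eq_0 add.commute)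

lemma frag_extend_fun_diff: "frag_extend (\<lambda>x. f x - g x) a = frag_extend f a - frag_extend g a"
  using frag_extend_fun_add[of f "\<lambda>x. - g x" a] by (simp add: frag_extend_fun_minus)

lemma lookup_frag_extend:
  "Poly_Mapping.lookup (frag_extend f c) z =
    (\<Sum>x\<in>Poly_Mapping.keys c. Poly_Mapping.lookup c x * Poly_Mapping.lookup (f x) z)"
  by (simp add: frag_extend_def lookup_sum)

lemma keys_frag_extend_subset:
  assumes "\<And>x. x \<in> Poly_Mapping.keys c \<Longrightarrow> Poly_Mapping.keys (f x) \<subseteq> S"
  shows "Poly_Mapping.keys (frag_extend f c) \<subseteq> S"
  using keys_frag_extend[of f c] assms by blast

lemma keys_add_subset: "\<lbrakk>Poly_Mapping.keys a \<subseteq> S; Poly_Mapping.keys b \<subseteq> S\<rbrakk> \<Longrightarrow> Poly_Mapping.keys (a + b) \<subseteq> S"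
  using keys_add[of a b] by blast

lemma keys_diff_subset: "\<lbrakk>Poly_Mapping.keys a \<subseteq> S; Poly_Mapping.keys b \<subseteq> S\<rbrakk> \<Longrightarrow> Poly_Mapping.keys (a - b) \<subseteq> S"
  using keys_diff[of a b] by blast

lemma group_ring_simps [simp]:
  "a \<in> carrier (group_ring G) \<longleftrightarrow> Poly_Mapping.keys a \<subseteq> carrier G"
  "\<one>\<^bsub>group_ring G\<^esub> = frag_of \<one>\<^bsub>G\<^esub>" "\<zero>\<^bsub>group_ring G\<^esub> = 0" "a \<oplus>\<^bsub>group_ring G\<^esub> b = a + b"
  by (simp_all add: group_ring_def)

lemma group_ring_mult_of [simp]:
  "frag_of x \<otimes>\<^bsub>group_ring G\<^esub> frag_of y = frag_of (x \<otimes>\<^bsub>G\<^esub> y)"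
  by (simp add: group_ring_def)

lemma group_ring_mult_add:
  "(a + b) \<otimes>\<^bsub>group_ring G\<^esub> c = a \<otimes>\<^bsub>group_ring G\<^esub> c + b \<otimes>\<^bsub>group_ring G\<^esub> c"
  "c \<otimes>\<^bsub>group_ring G\<^esub> (a + b) = c \<otimes>\<^bsub>group_ring G\<^esub> a + c \<otimes>\<^bsub>group_ring G\<^esub> b"
  by (simp_all add: group_ring_def frag_extend_add frag_extend_fun_add)

lemma group_ring_mult_diff:
  "(a - b) \<otimes>\<^bsub>group_ring G\<^esub> c = a \<otimes>\<^bsub>group_ring G\<^esub> c - b \<otimes>\<^bsub>group_ring G\<^esub> c"
  "c \<otimes>\<^bsub>group_ring G\<^esub> (a - b) = c \<otimes>\<^bsub>group_ring G\<^esub> a - c \<otimes>\<^bsub>group_ring G\<^esub> b"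
  by (simp_all add: group_ring_def frag_extend_diff frag_extend_fun_diff)

lemma group_ring_mult_minus:
  "(- a) \<otimes>\<^bsub>group_ring G\<^esub> c = - (a \<otimes>\<^bsub>group_ring G\<^esub> c)"
  "c \<otimes>\<^bsub>group_ring G\<^esub> (- a) = - (c \<otimes>\<^bsub>group_ring G\<^esub> a)"
  by (simp_all add: group_ring_def frag_extend_minus frag_extend_fun_minus)

lemma group_ring_mult_zero:
  "0 \<otimes>\<^bsub>group_ring G\<^esub> c = 0" "c \<otimes>\<^bsub>group_ring G\<^esub> 0 = 0"
  by (simp_all add: group_ring_def frag_extend_fun_zero)

lemma group_ring_mult_sum:
  "sum f I \<otimes>\<^bsub>group_ring G\<^esub> c = (\<Sum>i\<in>I. f i \<otimes>\<^bsub>group_ring G\<^esub> c)"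
  "c \<otimes>\<^bsub>group_ring G\<^esub> sum f I = (\<Sum>i\<in>I. c \<otimes>\<^bsub>group_ring G\<^esub> f i)"
  by (induction I rule: infinite_finite_induct) (simp_all add: group_ring_mult_add group_ring_mult_zero)

text \<open>The product never consults the carrier, so the ring of a subgroup shares the product of
  the ambient ring, in which the computations are made.\<close>

lemma group_ring_mult_restrict:
  "a \<otimes>\<^bsub>group_ring (G\<lparr>carrier := S\<rparr>)\<^esub> b = a \<otimes>\<^bsub>group_ring G\<^esub> b"
  by (simp add: group_ring_def)

lemma group_ring_mult_eq:
  "a \<otimes>\<^bsub>group_ring G\<^esub> b = frag_extend (\<lambda>x. frag_extend (\<lambda>y. frag_of (x \<otimes>\<^bsub>G\<^esub> y)) b) a"
  by (simp add: group_ring_def)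

lemma keys_group_ring_mult:
  assumes "Poly_Mapping.keys a \<subseteq> A" "Poly_Mapping.keys b \<subseteq> B"
    "\<And>x y. \<lbrakk>x \<in> A; y \<in> B\<rbrakk> \<Longrightarrow> x \<otimes>\<^bsub>G\<^esub> y \<in> C"
  shows "Poly_Mapping.keys (a \<otimes>\<^bsub>group_ring G\<^esub> b) \<subseteq> C"
  unfolding group_ring_mult_eq using assms by (intro keys_frag_extend_subset) auto

text \<open>The device by which identities in the group ring are reduced to group elements, one
  variable at a time.\<close>

lemma additive_frag_eq [consumes 1, case_names minus1 minus2 of]:
  fixes f g :: "('a \<Rightarrow>\<^sub>0 int) \<Rightarrow> 'b::group_add"
  assumes "Poly_Mapping.keys a \<subseteq> S"
    and f: "\<And>a b. f (a - b) = f a - f b" and g: "\<And>a b. g (a - b) = g a - g b"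
    and of: "\<And>x. x \<in> S \<Longrightarrow> f (frag_of x) = g (frag_of x)"
  shows "f a = g a"
proof -
  have "f 0 = 0" "g 0 = 0" using f[of 0 0] g[of 0 0] by simp_all
  then show ?thesis
    using free_Abelian_group_induct[of a S "\<lambda>a. f a = g a"] assms by auto
qed

lemma group_ring_ring:
  assumes "monoid G" shows "ring (group_ring G)"
proof -
  interpret monoid G by fact
  let ?Z = "group_ring G"
  have closed: "a \<otimes>\<^bsub>?Z\<^esub> b \<in> carrier ?Z" if "a \<in> carrier ?Z" "b \<in> carrier ?Z" for a b
    using that keys_group_ring_mult[of a "carrier G" b "carrier G" G "carrier G"] by simp
  have assoc: "a \<otimes>\<^bsub>?Z\<^esub> b \<otimes>\<^bsub>?Z\<^esub> c = a \<otimes>\<^bsub>?Z\<^esub> (b \<otimes>\<^bsub>?Z\<^esub> c)"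
    if a: "a \<in> carrier ?Z" and b: "b \<in> carrier ?Z" and c: "c \<in> carrier ?Z" for a b c
  proof (rule additive_frag_eq[of a "carrier G" "\<lambda>a. a \<otimes>\<^bsub>?Z\<^esub> b \<otimes>\<^bsub>?Z\<^esub> c"])
    fix x assume x: "x \<in> carrier G"
    show "frag_of x \<otimes>\<^bsub>?Z\<^esub> b \<otimes>\<^bsub>?Z\<^esub> c = frag_of x \<otimes>\<^bsub>?Z\<^esub> (b \<otimes>\<^bsub>?Z\<^esub> c)"
    proof (rule additive_frag_eq[of b "carrier G" "\<lambda>b. frag_of x \<otimes>\<^bsub>?Z\<^esub> b \<otimes>\<^bsub>?Z\<^esub> c"])
      fix y assume y: "y \<in> carrier G"
      show "frag_of x \<otimes>\<^bsub>?Z\<^esub> frag_of y \<otimes>\<^bsub>?Z\<^esub> c = frag_of x \<otimes>\<^bsub>?Z\<^esub> (frag_of y \<otimes>\<^bsub>?Z\<^esub> c)"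
        by (rule additive_frag_eq[of c "carrier G"])
          (use c x y in \<open>simp_all add: group_ring_mult_diff m_assoc\<close>)
    qed (use b in \<open>simp_all add: group_ring_mult_diff\<close>)
  qed (use a in \<open>simp_all add: group_ring_mult_diff\<close>)
  have one: "\<one>\<^bsub>?Z\<^esub> \<otimes>\<^bsub>?Z\<^esub> a = a" "a \<otimes>\<^bsub>?Z\<^esub> \<one>\<^bsub>?Z\<^esub> = a" if "a \<in> carrier ?Z" for a
    using additive_frag_eq[of a "carrier G" "\<lambda>a. \<one>\<^bsub>?Z\<^esub> \<otimes>\<^bsub>?Z\<^esub> a" "\<lambda>a. a"]
      additive_frag_eq[of a "carrier G" "\<lambda>a. a \<otimes>\<^bsub>?Z\<^esub> \<one>\<^bsub>?Z\<^esub>" "\<lambda>a. a"] that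
    by (simp_all add: group_ring_mult_diff)
  show ?thesis
  proof (rule ringI)
    show "abelian_group ?Z"
    proof (rule abelian_groupI)
      fix a assume "a \<in> carrier ?Z"
      then show "\<exists>b\<in>carrier ?Z. b \<oplus>\<^bsub>?Z\<^esub> a = \<zero>\<^bsub>?Z\<^esub>"
        by (intro bexI[of _ "- a"]) simp_all
    qed (simp_all add: keys_add_subset algebra_simps)
    show "monoid ?Z"
      by (rule monoidI) (use closed assoc one in \<open>auto simp del: group_ring_simps(1)\<close>, simp)
  qed (simp_all add: group_ring_mult_add)
qed

lemma group_ring_finsum:
  assumes "monoid G" "finite I" "\<And>i. i \<in> I \<Longrightarrow> f i \<in> carrier (group_ring G)"
  shows "finsum (group_ring G) f I = sum f I"
  using assms(2,3)
proof (induction I rule: finite_induct)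
  case (insert i I)
  interpret ring "group_ring G" by (rule group_ring_ring) fact
  show ?case using insert by (subst finsum_insert) (auto simp: Pi_iff)
next
  case empty
  interpret ring "group_ring G" by (rule group_ring_ring) fact
  show ?case by simp
qed

lemma group_ring_a_inv:
  assumes "monoid G" "a \<in> carrier (group_ring G)"
  shows "\<ominus>\<^bsub>group_ring G\<^esub> a = - a"
proof -
  interpret ring "group_ring G" by (rule group_ring_ring) fact
  show ?thesis using assms minus_equality[of "- a" a] by simp
qed


section \<open>Left orderable groups\<close>

text \<open>\<open>P\<close> is the positive cone of a left-invariant total order, in which
  \<open>x\<close> lies below \<open>y\<close> iff \<open>inv x\<close> times \<open>y\<close>
  belongs to \<open>P\<close>.\<close>

definition left_orderable :: "('a, 'b) monoid_scheme \<Rightarrow> bool" where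
  "left_orderable G \<longleftrightarrow> (\<exists>P\<subseteq>carrier G. (\<forall>x\<in>P. \<forall>y\<in>P. x \<otimes>\<^bsub>G\<^esub> y \<in> P) \<and> \<one>\<^bsub>G\<^esub> \<notin> P \<and>
    (\<forall>x\<in>carrier G. x = \<one>\<^bsub>G\<^esub> \<or> x \<in> P \<or> inv\<^bsub>G\<^esub> x \<in> P))"

text \<open>If \<open>y\<^sub>0\<close> is the largest element of the support of \<open>b\<close>, then the largest product \<open>x y\<close> of support
  elements is attained only at \<open>y = y\<^sub>0\<close>, so its coefficient does not cancel.\<close>

lemma group_ring_no_zero_divisors:
  fixes G (structure)
  assumes "group G" "left_orderable G"
    and a: "a \<in> carrier (group_ring G)" "a \<noteq> 0" and b: "b \<in> carrier (group_ring G)" "b \<noteq> 0"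
  shows "a \<otimes>\<^bsub>group_ring G\<^esub> b \<noteq> 0"
proof -
  interpret group G by fact
  obtain P where P0: "P \<subseteq> carrier G" "\<forall>x\<in>P. \<forall>y\<in>P. x \<otimes> y \<in> P" "\<one> \<notin> P"
    "\<forall>x\<in>carrier G. x = \<one> \<or> x \<in> P \<or> inv x \<in> P"
    using assms(2) unfolding left_orderable_def by (elim exE conjE)
  have P: "P \<subseteq> carrier G" "\<And>x y. \<lbrakk>x \<in> P; y \<in> P\<rbrakk> \<Longrightarrow> x \<otimes> y \<in> P" "\<one> \<notin> P"
    "\<And>x. x \<in> carrier G \<Longrightarrow> x = \<one> \<or> x \<in> P \<or> inv x \<in> P"
    using P0 by simp_all
  define lt where "lt x y \<longleftrightarrow> inv x \<otimes> y \<in> P" for x y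
  have lt_trans: "lt x z" if "lt x y" "lt y z" "x \<in> carrier G" "y \<in> carrier G" "z \<in> carrier G" for x y z
  proof -
    have "inv x \<otimes> z = (inv x \<otimes> y) \<otimes> (inv y \<otimes> z)"
      using that by (simp add: m_assoc) (simp flip: m_assoc)
    then show ?thesis using P(2) that unfolding lt_def by simp
  qed
  have lt_irrefl: "\<not> lt x x" if "x \<in> carrier G" for x
    using that P(3) by (simp add: lt_def)
  have lt_total: "x = y \<or> lt x y \<or> lt y x" if "x \<in> carrier G" "y \<in> carrier G" for x y
  proof -
    have "inv (inv x \<otimes> y) = inv y \<otimes> x" using that by (simp add: inv_mult_group)
    moreover have "x = y" if "inv x \<otimes> y = \<one>"
      using that \<open>x \<in> carrier G\<close> \<open>y \<in> carrier G\<close> by (metis inv_closed inv_equality inv_inv)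
    ultimately show ?thesis using P(4)[of "inv x \<otimes> y"] that unfolding lt_def by auto
  qed
  have lt_mult: "lt (z \<otimes> x) (z \<otimes> y)" if "lt x y" "x \<in> carrier G" "y \<in> carrier G" "z \<in> carrier G" for x y z
  proof -
    have "inv (z \<otimes> x) \<otimes> (z \<otimes> y) = inv x \<otimes> (inv z \<otimes> z) \<otimes> y"
      using that by (simp only: inv_mult_group m_assoc m_closed inv_closed)
    then show ?thesis using that unfolding lt_def by simp
  qed
  have max: "\<exists>m\<in>T. \<forall>x\<in>T. x = m \<or> lt x m" if "finite T" "T \<noteq> {}" "T \<subseteq> carrier G" for T
    using that
  proof (induction T rule: finite_ne_induct)
    case (insert x T)
    then obtain m where m: "m \<in> T" "\<forall>y\<in>T. y = m \<or> lt y m" by auto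
    have cl: "x \<in> carrier G" "m \<in> carrier G" using insert.prems m by auto
    show ?case
    proof (cases "lt m x")
      case True
      have "lt y x" if y: "y \<in> T" for y
      proof -
        have "y \<in> carrier G" using y insert.prems by blast
        then show ?thesis using lt_trans[of y m x] m(2) y True cl by metis
      qed
      then show ?thesis by (intro bexI[of _ x]) simp_all
    next
      case False
      then have "x = m \<or> lt x m" using lt_total[OF cl] by simp
      then show ?thesis using m by (intro bexI[of _ m]) simp_all
    qed
  qed simp
  have ka: "Poly_Mapping.keys a \<subseteq> carrier G" "Poly_Mapping.keys b \<subseteq> carrier G"
    using a b by simp_all
  obtain y0 where y0: "y0 \<in> Poly_Mapping.keys b" "\<forall>y\<in>Poly_Mapping.keys b. y = y0 \<or> lt y y0"
    using max[of "Poly_Mapping.keys b"] ka b(2) by auto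
  have y0c: "y0 \<in> carrier G" using y0 ka by blast
  let ?T = "(\<lambda>x. x \<otimes> y0) ` Poly_Mapping.keys a"
  obtain x0 where x0: "x0 \<in> Poly_Mapping.keys a"
    "\<forall>x\<in>Poly_Mapping.keys a. x \<otimes> y0 = x0 \<otimes> y0 \<or> lt (x \<otimes> y0) (x0 \<otimes> y0)"
  proof -
    have "?T \<subseteq> carrier G" using ka y0c by auto
    then obtain m where "m \<in> ?T" "\<forall>x\<in>?T. x = m \<or> lt x m" using max[of ?T] a(2) by auto
    then show thesis using that by auto
  qed
  let ?m = "x0 \<otimes> y0"
  have x0c: "x0 \<in> carrier G" using x0 ka by blast
  have uniq: "x \<otimes> y = ?m \<longleftrightarrow> x = x0 \<and> y = y0"
    if "x \<in> Poly_Mapping.keys a" "y \<in> Poly_Mapping.keys b" for x y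
  proof
    assume eq: "x \<otimes> y = ?m"
    have cl: "x \<in> carrier G" "y \<in> carrier G" using that ka by auto
    have "y = y0"
    proof (rule ccontr)
      assume "y \<noteq> y0"
      then have "lt y y0" using y0 that by blast
      then have "lt ?m (x \<otimes> y0)" using lt_mult[of y y0 x] cl y0c eq by simp
      moreover have "x \<otimes> y0 = ?m \<or> lt (x \<otimes> y0) ?m" using x0 that by blast
      ultimately show False
        using lt_irrefl[of ?m] lt_trans[of ?m "x \<otimes> y0" ?m] cl x0c y0c by auto
    qed
    then show "x = x0 \<and> y = y0" using eq cl x0c y0c by simp
  qed simp
  have coeff: "Poly_Mapping.lookup (frag_of (x \<otimes> y)) ?m = (if x = x0 \<and> y = y0 then 1 else 0)"
    if "x \<in> Poly_Mapping.keys a" "y \<in> Poly_Mapping.keys b" for x y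
    using uniq[OF that] by (cases "x \<otimes> y = ?m") auto
  have "Poly_Mapping.lookup (a \<otimes>\<^bsub>group_ring G\<^esub> b) ?m =
    (\<Sum>x\<in>Poly_Mapping.keys a. Poly_Mapping.lookup a x *
      (\<Sum>y\<in>Poly_Mapping.keys b. Poly_Mapping.lookup b y * (if x = x0 \<and> y = y0 then 1 else 0)))"
    unfolding group_ring_mult_eq lookup_frag_extend
    by (intro sum.cong refl arg_cong2[of _ _ _ _ "(*)"] coeff)
  also have "\<dots> = (\<Sum>x\<in>Poly_Mapping.keys a. if x = x0 then Poly_Mapping.lookup a x0 * Poly_Mapping.lookup b y0 else 0)"
    using y0(1) by (intro sum.cong refl) (auto simp: if_distrib[of "(*) _"] sum.delta cong: if_cong)
  also have "\<dots> = Poly_Mapping.lookup a x0 * Poly_Mapping.lookup b y0"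
    using x0(1) by (simp add: sum.delta')
  also have "\<dots> \<noteq> 0" using x0(1) y0(1) by (simp add: in_keys_iff)
  finally show ?thesis by auto
qed

text \<open>The order lives on the ambient \<open>G\<close>. A subgroup ring inherits the absence of
  zero divisors from it, so only common multiples within the subgroup ring remain to be
  found.\<close>

lemma right_ore_domain_group_ringI:
  assumes "group G" "left_orderable G" "subgroup S G"
    and ore: "\<And>a b. \<lbrakk>Poly_Mapping.keys a \<subseteq> S; Poly_Mapping.keys b \<subseteq> S; a \<noteq> 0; b \<noteq> 0\<rbrakk> \<Longrightarrow>
      \<exists>c d. Poly_Mapping.keys c \<subseteq> S \<and> Poly_Mapping.keys d \<subseteq> S \<and> c \<noteq> 0 \<and> d \<noteq> 0 \<and>
        a \<otimes>\<^bsub>group_ring G\<^esub> c = b \<otimes>\<^bsub>group_ring G\<^esub> d"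
  shows "right_ore_domain (group_ring (G\<lparr>carrier := S\<rparr>))"
proof -
  interpret group G by fact
  interpret S: group "G\<lparr>carrier := S\<rparr>" by (rule subgroup_imp_group) fact
  interpret Z: ring "group_ring (G\<lparr>carrier := S\<rparr>)" by (rule group_ring_ring) (rule S.is_monoid)
  have SG: "S \<subseteq> carrier G" using assms(3) by (rule subgroup.subset)
  show ?thesis
  proof
    fix a b assume "a \<otimes>\<^bsub>group_ring (G\<lparr>carrier := S\<rparr>)\<^esub> b = \<zero>\<^bsub>group_ring (G\<lparr>carrier := S\<rparr>)\<^esub>"
      "a \<in> carrier (group_ring (G\<lparr>carrier := S\<rparr>))" "b \<in> carrier (group_ring (G\<lparr>carrier := S\<rparr>))"
    then show "a = \<zero>\<^bsub>group_ring (G\<lparr>carrier := S\<rparr>)\<^esub> \<or> b = \<zero>\<^bsub>group_ring (G\<lparr>carrier := S\<rparr>)\<^esub>"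
      using group_ring_no_zero_divisors[OF assms(1,2), of a b] SG
      by (auto simp: group_ring_mult_restrict)
  next
    fix a b assume "a \<in> nonzeros (group_ring (G\<lparr>carrier := S\<rparr>))" "b \<in> nonzeros (group_ring (G\<lparr>carrier := S\<rparr>))"
    then obtain c d where "Poly_Mapping.keys c \<subseteq> S" "Poly_Mapping.keys d \<subseteq> S" "c \<noteq> 0" "d \<noteq> 0"
        "a \<otimes>\<^bsub>group_ring G\<^esub> c = b \<otimes>\<^bsub>group_ring G\<^esub> d"
      using ore[of a b] by (auto simp: nonzeros_def)
    then show "\<exists>c\<in>nonzeros (group_ring (G\<lparr>carrier := S\<rparr>)). \<exists>d\<in>nonzeros (group_ring (G\<lparr>carrier := S\<rparr>)).
      a \<otimes>\<^bsub>group_ring (G\<lparr>carrier := S\<rparr>)\<^esub> c = b \<otimes>\<^bsub>group_ring (G\<lparr>carrier := S\<rparr>)\<^esub> d"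
      by (intro bexI[of _ c] bexI[of _ d]) (auto simp: nonzeros_def group_ring_mult_restrict)
  qed simp
qed

section \<open>Common multiples by a growth argument\<close>

lemma power_two_dominates: "\<exists>n::nat. (n + 1) ^ q < 2 ^ n"
proof -
  \<comment> \<open>For the witness \<open>n = 2 ^ m - 1\<close> the claim reads
    \<open>m * q < 2 ^ m - 1\<close>. Taking \<open>m = q + 5\<close> leaves room, as
    \<open>m * q + 1 \<le> m * m\<close> and squares lie below powers of two from 5 on.\<close>
  define m where "m = q + 5"
  have sq: "k\<^sup>2 < 2 ^ k" if "k \<ge> 5" for k :: nat
    using that
  proof (induction k rule: nat_induct_at_least)
    case (Suc k)
    have "(Suc k)\<^sup>2 = k\<^sup>2 + 2 * k + 1" by (simp add: power2_eq_square)
    moreover have "5 * k \<le> k\<^sup>2" using Suc(1) by (simp add: power2_eq_square)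
    ultimately have "(Suc k)\<^sup>2 < 2 ^ k + 2 ^ k" using Suc by linarith
    then show ?case by simp
  qed simp
  have "m * q + 1 \<le> m * m"
    unfolding m_def by (simp add: algebra_simps)
  then have "m * q < 2 ^ m - 1" using sq[of m] by (simp add: m_def power2_eq_square)
  then have "((2 ^ m - 1) + 1) ^ q < (2::nat) ^ (2 ^ m - 1)"
    by (simp add: power_mult[symmetric])
  then show ?thesis by blast
qed

text \<open>The sets of products with exponents at most \<open>n\<close> grow polynomially in \<open>n\<close>, hence cannot double
  at every step.\<close>

lemma (in comm_group) nondoubling_set:
  assumes "finite E" "E \<subseteq> carrier G"
  shows "\<exists>Q. finite Q \<and> Q \<noteq> {} \<and> Q \<subseteq> carrier G \<and> card (E <#> Q) < 2 * card Q"
proof (rule ccontr)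
  assume neg: "\<not> ?thesis"
  define pr where "pr k = (\<Otimes>e\<in>E. e [^] k e)" for k :: "'a \<Rightarrow> nat"
  define Q where "Q n = pr ` (E \<rightarrow>\<^sub>E {..n})" for n
  have pr: "pr k \<in> carrier G" for k
    unfolding pr_def using assms by (intro finprod_closed) auto
  have Q: "finite (Q n)" "Q n \<noteq> {}" "Q n \<subseteq> carrier G" for n
    unfolding Q_def using assms(1) pr by (auto intro!: finite_PiE simp: PiE_eq_empty_iff)
  have card_le: "card (Q n) \<le> (n + 1) ^ card E" for n
    unfolding Q_def using card_image_le[of "E \<rightarrow>\<^sub>E {..n}" pr] assms(1)
    by (simp add: finite_PiE card_PiE)
  have sub: "E <#> Q n \<subseteq> Q (Suc n)" for n
  proof
    fix z assume "z \<in> E <#> Q n"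
    then obtain e k where ek: "e \<in> E" "k \<in> E \<rightarrow>\<^sub>E {..n}" "z = e \<otimes> pr k"
      unfolding set_mult_def Q_def by auto
    define k' where "k' = k(e := Suc (k e))"
    have ec: "e \<in> carrier G" using ek assms by auto
    have "pr k' = (\<Otimes>x\<in>insert e (E - {e}). x [^] k' x)"
      unfolding pr_def using ek by (simp add: insert_absorb)
    also have "\<dots> = e [^] Suc (k e) \<otimes> (\<Otimes>x\<in>E - {e}. x [^] k' x)"
      using assms ec by (subst finprod_insert) (auto simp: k'_def)
    also have "(\<Otimes>x\<in>E - {e}. x [^] k' x) = (\<Otimes>x\<in>E - {e}. x [^] k x)"
      using assms by (intro finprod_cong') (auto simp: k'_def)
    also have "e [^] Suc (k e) \<otimes> \<dots> = e \<otimes> (e [^] k e \<otimes> (\<Otimes>x\<in>E - {e}. x [^] k x))"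
      using assms ec by (subst nat_pow_Suc2) (auto intro!: m_assoc finprod_closed)
    also have "e [^] k e \<otimes> (\<Otimes>x\<in>E - {e}. x [^] k x) = (\<Otimes>x\<in>insert e (E - {e}). x [^] k x)"
      using assms ec by (subst finprod_insert) auto
    also have "\<dots> = pr k" unfolding pr_def using ek by (simp add: insert_absorb)
    finally have "z = pr k'" using ek by simp
    moreover have "k' \<in> E \<rightarrow>\<^sub>E {..Suc n}"
      using ek by (auto simp: k'_def PiE_iff extensional_def intro: le_SucI)
    ultimately show "z \<in> Q (Suc n)" unfolding Q_def by blast
  qed
  have "2 ^ n \<le> card (Q n)" for n
  proof (induction n)
    case 0
    then show ?case using Q[of 0] by (simp add: Suc_leI card_gt_0_iff)
  next
    case (Suc n)
    have "2 * card (Q n) \<le> card (E <#> Q n)" using neg Q[of n] by (meson not_le)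
    also have "\<dots> \<le> card (Q (Suc n))" using sub Q by (intro card_mono) auto
    finally show ?case using Suc by simp
  qed
  then show False using power_two_dominates[of "card E"] card_le
    by (meson le_trans not_le)
qed

text \<open>For finitely supported \<open>a, b\<close> take the representatives of a set \<open>Q\<close> of cosets which hardly grows
  under multiplication by the supports: the \<open>2 |Q|\<close> elements \<open>a q, b q\<close> lie in a free right \<open>\<int>N\<close>-module
  of smaller rank, and a dependency between them gives a common right multiple of \<open>a\<close> and \<open>b\<close>.\<close>

lemma group_ring_ore_step:
  fixes \<Gamma> :: "('a, 'b) monoid_scheme" (structure)
  assumes "group \<Gamma>" "left_orderable \<Gamma>" "subgroup N \<Gamma>" "subgroup S \<Gamma>" "N \<subseteq> S"
    and comm: "\<And>x y. \<lbrakk>x \<in> S; y \<in> S\<rbrakk> \<Longrightarrow> x \<otimes> y \<otimes> inv x \<otimes> inv y \<in> N"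
    and oreN: "right_ore_domain (group_ring (\<Gamma>\<lparr>carrier := N\<rparr>))"
  shows "right_ore_domain (group_ring (\<Gamma>\<lparr>carrier := S\<rparr>))"
proof (rule right_ore_domain_group_ringI[OF assms(1,2,4)])
  interpret group \<Gamma> by fact
  let ?S = "\<Gamma>\<lparr>carrier := S\<rparr>"
  let ?Z = "group_ring \<Gamma>"
  interpret Z: ring ?Z by (rule group_ring_ring) (rule is_monoid)
  interpret S: group ?S by (rule subgroup_imp_group) fact
  interpret ZN: right_ore_domain "group_ring (\<Gamma>\<lparr>carrier := N\<rparr>)" by fact
  have SG: "S \<subseteq> carrier \<Gamma>" using assms(4) by (rule subgroup.subset)
  have sub_der: "derived ?S S \<subseteq> N"
  proof -
    have "derived ?S S = derived \<Gamma> S" by (rule derived_consistent[OF subset_refl assms(4)])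
    also have "\<dots> \<subseteq> N" unfolding derived_def
      by (rule generate_subgroup_incl[OF _ assms(3)]) (use comm in auto)
    finally show ?thesis .
  qed
  have NS: "N \<lhd> ?S"
  proof -
    have "subgroup N ?S" using subgroup_incl[OF assms(3,4,5)] .
    moreover have "x \<otimes> h \<otimes> inv x \<in> N" if "x \<in> S" "h \<in> N" for x h
    proof -
      have "x \<otimes> h \<otimes> inv x \<otimes> inv h \<otimes> h \<in> N"
        using comm[of x h] that assms(3,5) by (meson subgroup.m_closed subsetD)
      moreover have "x \<in> carrier \<Gamma>" "h \<in> carrier \<Gamma>" using that SG assms(5) by auto
      ultimately show ?thesis by (simp add: m_assoc)
    qed
    ultimately show ?thesis
      using S.normal_inv_iff[of N] m_inv_consistent[OF assms(4)] by simp
  qed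
  define A where "A = ?S Mod N"
  interpret NS: normal N ?S by fact
  interpret A: comm_group A
  proof -
    interpret AG: group A unfolding A_def by (rule NS.factorgroup_is_group)
    show "comm_group A"
    proof (rule AG.group_comm_groupI)
      fix C D assume "C \<in> carrier A" "D \<in> carrier A"
      then obtain x y where xy: "x \<in> S" "C = N #> x" "y \<in> S" "D = N #> y"
        unfolding A_def FactGroup_def RCOSETS_def by (auto simp: r_coset_def)
      have cl: "x \<in> carrier \<Gamma>" "y \<in> carrier \<Gamma>" using xy SG by auto
      have e: "x \<otimes> y = (x \<otimes> y \<otimes> inv x \<otimes> inv y) \<otimes> (y \<otimes> x)"
        using cl by (simp add: m_assoc) (simp flip: m_assoc)
      have n: "x \<otimes> y \<otimes> inv x \<otimes> inv y \<in> N" using comm xy by blast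
      have "N #> (x \<otimes> y) = (N #> (x \<otimes> y \<otimes> inv x \<otimes> inv y)) #> (y \<otimes> x)"
        using e cl n subgroup.subset[OF assms(3)] by (subst coset_mult_assoc) auto
      also have "N #> (x \<otimes> y \<otimes> inv x \<otimes> inv y) = N"
        using coset_join2[OF _ assms(3) n] cl by simp
      finally have "N #> (x \<otimes> y) = N #> (y \<otimes> x)" .
      then show "C \<otimes>\<^bsub>A\<^esub> D = D \<otimes>\<^bsub>A\<^esub> C"
        using NS.rcos_sum[of x y] NS.rcos_sum[of y x] xy unfolding A_def
        by (simp add: r_coset_def set_mult_def)
    qed
  qed
  define cl where "cl x = N #> x" for x
  have cl_S: "cl x \<in> carrier A" if "x \<in> S" for x
    using that unfolding A_def FactGroup_def RCOSETS_def cl_def by (auto simp: r_coset_def)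
  have cl_mult: "cl (x \<otimes> y) = cl x \<otimes>\<^bsub>A\<^esub> cl y" if "x \<in> S" "y \<in> S" for x y
    using NS.rcos_sum[of x y] that unfolding A_def cl_def by (simp add: r_coset_def set_mult_def)
  have cl_N: "cl x = \<one>\<^bsub>A\<^esub> \<longleftrightarrow> x \<in> N" if "x \<in> S" for x
    using coset_join1[OF _ _ assms(3), of x] coset_join2[OF _ assms(3), of x]
      that SG unfolding A_def cl_def by auto
  define rep where "rep k = (SOME x. x \<in> S \<and> cl x = k)" for k
  have rep: "rep k \<in> S" "cl (rep k) = k" if "k \<in> carrier A" for k
  proof -
    have "\<exists>x. x \<in> S \<and> cl x = k"
      using that unfolding A_def FactGroup_def RCOSETS_def cl_def by (auto simp: r_coset_def)
    from someI_ex[OF this] show "rep k \<in> S" "cl (rep k) = k" unfolding rep_def by auto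
  qed
  have repG: "rep k \<in> carrier \<Gamma>" if "k \<in> carrier A" for k using rep that SG by auto
  \<comment> \<open>\<open>part k\<close> keeps the terms in the coset \<open>k\<close>. It
    decomposes the ring of \<open>S\<close> into the summands \<open>rep k\<close> times the ring of
    \<open>N\<close>.\<close>
  define part where "part k = frag_extend (\<lambda>x. if cl x = k then frag_of x else 0)" for k
  have part_diff: "part k (a - b) = part k a - part k b" for k a b
    by (simp add: part_def frag_extend_diff)
  have part_of: "part k (frag_of x) = (if cl x = k then frag_of x else 0)" for k x
    by (simp add: part_def)
  have part_keys: "Poly_Mapping.keys (part k v) \<subseteq> {x \<in> Poly_Mapping.keys v. cl x = k}" for k v
    unfolding part_def by (rule keys_frag_extend_subset) auto
  have part_sum: "(\<Sum>k\<in>I. part k v) = v"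
    if "finite I" "\<And>x. x \<in> Poly_Mapping.keys v \<Longrightarrow> cl x \<in> I" for I v
  proof (rule additive_frag_eq[of v "Poly_Mapping.keys v"])
    fix x assume "x \<in> Poly_Mapping.keys v"
    then show "(\<Sum>k\<in>I. part k (frag_of x)) = frag_of x"
      using that by (simp add: part_of sum.delta')
  qed (simp_all add: part_diff sum_subtractf)
  have part_same: "part k v = v" if "\<And>x. x \<in> Poly_Mapping.keys v \<Longrightarrow> cl x = k" for k v
    using part_sum[of "{k}" v] that by simp
  have part_other: "part k v = 0" if "\<And>x. x \<in> Poly_Mapping.keys v \<Longrightarrow> cl x = k'" "k \<noteq> k'" for k k' v
    using part_keys[of k v] that by (metis (mono_tags, lifting) Collect_empty_eq keys_eq_empty subset_empty)
  have part_add: "part k (a + b) = part k a + part k b" for k a b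
    by (simp add: part_def frag_extend_add)
  have part_zero: "part k 0 = 0" for k by (simp add: part_def)
  have part_sum_distrib: "part k (sum f I) = (\<Sum>i\<in>I. part k (f i))" for k f and I :: "'a set set"
    by (induction I rule: infinite_finite_induct) (simp_all add: part_add part_zero)
  have mult_keys: "Poly_Mapping.keys (a \<otimes>\<^bsub>?Z\<^esub> b) \<subseteq> S"
    if "Poly_Mapping.keys a \<subseteq> S" "Poly_Mapping.keys b \<subseteq> S" for a b
    using keys_group_ring_mult[OF that, of \<Gamma> S] subgroup.m_closed[OF assms(4)] by blast
  have rep_c_keys: "cl x = q" if "x \<in> Poly_Mapping.keys (frag_of (rep q) \<otimes>\<^bsub>?Z\<^esub> c)"
    "Poly_Mapping.keys c \<subseteq> N" "q \<in> carrier A" for x c q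
  proof -
    have "Poly_Mapping.keys (frag_of (rep q) \<otimes>\<^bsub>?Z\<^esub> c) \<subseteq> {x. cl x = q}"
    proof (rule keys_group_ring_mult[of _ "{rep q}" _ N])
      fix x y assume "x \<in> {rep q}" "y \<in> N"
      then show "x \<otimes> y \<in> {x. cl x = q}"
        using cl_mult[of "rep q" y] rep[OF that(3)] assms(5) cl_N[of y] cl_S that(3) by auto
    qed (use that in auto)
    then show ?thesis using that(1) by blast
  qed
  fix a b :: "'a \<Rightarrow>\<^sub>0 int"
  assume a: "Poly_Mapping.keys a \<subseteq> S" "a \<noteq> 0" and b: "Poly_Mapping.keys b \<subseteq> S" "b \<noteq> 0"
  define E where "E = cl ` (Poly_Mapping.keys a \<union> Poly_Mapping.keys b)"
  have E: "finite E" "E \<subseteq> carrier A" using a b cl_S by (auto simp: E_def)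
  from A.nondoubling_set[OF this] obtain Q where Q: "finite Q" "Q \<noteq> {}" "Q \<subseteq> carrier A"
    "card (E <#>\<^bsub>A\<^esub> Q) < 2 * card Q" by blast
  define ab where "ab \<beta> = (if \<beta> then a else b)" for \<beta>
  have ab: "Poly_Mapping.keys (ab \<beta>) \<subseteq> S" "ab \<beta> \<noteq> 0" for \<beta> using a b by (auto simp: ab_def)
  \<comment> \<open>The Boolean selects \<open>a\<close> or \<open>b\<close>, so there are twice as
    many columns as elements of \<open>Q\<close>; \<open>M k u\<close> is the coordinate of
    \<open>v u\<close> at \<open>rep k\<close>.\<close>
  define v where "v = (\<lambda>(q, \<beta>). ab \<beta> \<otimes>\<^bsub>?Z\<^esub> frag_of (rep q))"
  define M where "M k u = frag_of (inv (rep k)) \<otimes>\<^bsub>?Z\<^esub> part k (v u)" for k u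
  have v_keys: "Poly_Mapping.keys (v (q, \<beta>)) \<subseteq> {x \<in> S. cl x \<in> E <#>\<^bsub>A\<^esub> Q}" if q: "q \<in> Q" for q \<beta>
    unfolding v_def prod.case
  proof (rule keys_group_ring_mult[of _ "Poly_Mapping.keys (ab \<beta>)" _ "{rep q}"])
    fix x y assume x: "x \<in> Poly_Mapping.keys (ab \<beta>)" and y: "y \<in> {rep q}"
    have "x \<in> S" "cl x \<in> E" "rep q \<in> S" "cl (rep q) = q"
      using x ab(1)[of \<beta>] q Q rep[of q] by (auto simp: E_def ab_def split: if_splits)
    then show "x \<otimes> y \<in> {x \<in> S. cl x \<in> E <#>\<^bsub>A\<^esub> Q}"
      using y q cl_mult[of x "rep q"] subgroup.m_closed[OF assms(4)] by (auto simp: set_mult_def)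
  qed auto
  have EQ: "finite (E <#>\<^bsub>A\<^esub> Q)" "E <#>\<^bsub>A\<^esub> Q \<subseteq> carrier A"
    using E Q by (auto simp: set_mult_def)
  have M_closed: "M k u \<in> carrier (group_ring (\<Gamma>\<lparr>carrier := N\<rparr>))"
    if k: "k \<in> E <#>\<^bsub>A\<^esub> Q" and u: "u \<in> Q \<times> UNIV" for k u
  proof -
    obtain q \<beta> where qb: "u = (q, \<beta>)" "q \<in> Q" using u by auto
    have kA: "k \<in> carrier A" using k EQ by auto
    have "Poly_Mapping.keys (M k u) \<subseteq> N"
      unfolding M_def
    proof (rule keys_group_ring_mult[of _ "{inv (rep k)}" _ "{x \<in> S. cl x = k}"])
      show "Poly_Mapping.keys (part k (v u)) \<subseteq> {x \<in> S. cl x = k}"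
        using part_keys[of k "v u"] v_keys[OF qb(2), of \<beta>] qb(1) by auto
      fix x y assume "x \<in> {inv (rep k)}" and y: "y \<in> {x \<in> S. cl x = k}"
      then have x: "x = inv (rep k)" "x \<in> S" using rep(1)[OF kA] subgroup.m_inv_closed[OF assms(4)] by auto
      have "cl (x \<otimes> y) = cl (x \<otimes> rep k)" using x y cl_mult rep[OF kA] by simp
      also have "\<dots> = \<one>\<^bsub>A\<^esub>" using x repG[OF kA] cl_N[of \<one>] assms(3,4)
        by (simp add: subgroup.one_closed)
      finally show "x \<otimes> y \<in> N" using cl_N[of "x \<otimes> y"] x y subgroup.m_closed[OF assms(4)] by auto
    qed simp
    then show ?thesis by simp
  qed
  have v_sum: "(\<Sum>k\<in>E <#>\<^bsub>A\<^esub> Q. frag_of (rep k) \<otimes>\<^bsub>?Z\<^esub> M k u) = v u" if u: "u \<in> Q \<times> UNIV" for u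
  proof -
    obtain q \<beta> where qb: "u = (q, \<beta>)" "q \<in> Q" using u by auto
    have vS: "Poly_Mapping.keys (v u) \<subseteq> S" using v_keys[OF qb(2), of \<beta>] qb(1) by auto
    have "frag_of (rep k) \<otimes>\<^bsub>?Z\<^esub> M k u = part k (v u)" if k: "k \<in> E <#>\<^bsub>A\<^esub> Q" for k
    proof -
      have kA: "k \<in> carrier A" using k EQ by auto
      have "part k (v u) \<in> carrier ?Z" using part_keys[of k "v u"] vS SG by auto
      moreover have "frag_of (rep k) \<otimes>\<^bsub>?Z\<^esub> frag_of (inv (rep k)) = \<one>\<^bsub>?Z\<^esub>"
        using repG[OF kA] by simp
      ultimately show ?thesis unfolding M_def
        using Z.m_assoc[of "frag_of (rep k)" "frag_of (inv (rep k))" "part k (v u)"] repG[OF kA]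
          Z.l_one[of "part k (v u)"] by (simp del: group_ring_mult_of)
    qed
    then have "(\<Sum>k\<in>E <#>\<^bsub>A\<^esub> Q. frag_of (rep k) \<otimes>\<^bsub>?Z\<^esub> M k u) = (\<Sum>k\<in>E <#>\<^bsub>A\<^esub> Q. part k (v u))"
      by (intro sum.cong) auto
    also have "\<dots> = v u" using v_keys[OF qb(2), of \<beta>] qb(1) EQ by (intro part_sum) auto
    finally show ?thesis .
  qed
  let ?ZN = "group_ring (\<Gamma>\<lparr>carrier := N\<rparr>)"
  have lt: "card (E <#>\<^bsub>A\<^esub> Q) < card (Q \<times> (UNIV :: bool set))"
    using Q by (simp add: card_cartesian_product)
  have "\<exists>c. (\<forall>u\<in>Q \<times> UNIV. c u \<in> carrier ?ZN) \<and> (\<exists>u\<in>Q \<times> (UNIV :: bool set). c u \<noteq> \<zero>\<^bsub>?ZN\<^esub>) \<and>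
    (\<forall>k\<in>E <#>\<^bsub>A\<^esub> Q. finsum ?ZN (\<lambda>u. M k u \<otimes>\<^bsub>?ZN\<^esub> c u) (Q \<times> UNIV) = \<zero>\<^bsub>?ZN\<^esub>)"
    by (rule ZN.homogeneous_system[OF EQ(1) _ lt M_closed]) (use Q(1) in simp)
  then obtain c where c: "\<forall>u\<in>Q \<times> UNIV. c u \<in> carrier ?ZN" "\<exists>u\<in>Q \<times> (UNIV :: bool set). c u \<noteq> \<zero>\<^bsub>?ZN\<^esub>"
    "\<forall>k\<in>E <#>\<^bsub>A\<^esub> Q. finsum ?ZN (\<lambda>u. M k u \<otimes>\<^bsub>?ZN\<^esub> c u) (Q \<times> UNIV) = \<zero>\<^bsub>?ZN\<^esub>"
    by (elim exE conjE)
  have cN: "Poly_Mapping.keys (c u) \<subseteq> N" if "u \<in> Q \<times> UNIV" for u using c(1) that by auto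
  have cZ: "c u \<in> carrier ?Z" if "u \<in> Q \<times> UNIV" for u using cN[OF that] subgroup.subset[OF assms(3)] by auto
  have Msum: "(\<Sum>u\<in>Q \<times> UNIV. M k u \<otimes>\<^bsub>?Z\<^esub> c u) = 0" if k: "k \<in> E <#>\<^bsub>A\<^esub> Q" for k
  proof -
    have mon: "monoid (\<Gamma>\<lparr>carrier := N\<rparr>)"
      using subgroup_imp_group[OF assms(3)] by (simp add: group.is_monoid)
    have "finsum ?ZN (\<lambda>u. M k u \<otimes>\<^bsub>?ZN\<^esub> c u) (Q \<times> UNIV) = (\<Sum>u\<in>Q \<times> UNIV. M k u \<otimes>\<^bsub>?ZN\<^esub> c u)"
    proof (rule group_ring_finsum[OF mon])
      fix u assume u: "u \<in> Q \<times> (UNIV :: bool set)"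
      show "M k u \<otimes>\<^bsub>?ZN\<^esub> c u \<in> carrier ?ZN"
        using M_closed[OF k u] bspec[OF c(1) u] by (rule ZN.m_closed)
    qed (use Q(1) in simp)
    then show ?thesis using c(3) k by (simp add: group_ring_mult_restrict)
  qed
  \<comment> \<open>The solution is regrouped into two multipliers, one for \<open>a\<close> and one
    for \<open>b\<close>.\<close>
  define C where "C \<beta> = (\<Sum>q\<in>Q. frag_of (rep q) \<otimes>\<^bsub>?Z\<^esub> c (q, \<beta>))" for \<beta>
  have C_S: "Poly_Mapping.keys (C \<beta>) \<subseteq> S" for \<beta>
  proof -
    have "Poly_Mapping.keys (frag_of (rep q) \<otimes>\<^bsub>?Z\<^esub> c (q, \<beta>)) \<subseteq> S" if q: "q \<in> Q" for q
    proof -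
      have "rep q \<in> S" using rep q Q(3) by auto
      then show ?thesis using cN[of "(q, \<beta>)"] q assms(5) by (intro mult_keys) auto
    qed
    then show ?thesis unfolding C_def by (intro order_trans[OF keys_sum] UN_least)
  qed
  have "(\<Sum>u\<in>Q \<times> UNIV. v u \<otimes>\<^bsub>?Z\<^esub> c u) = 0"
  proof -
    have "(\<Sum>u\<in>Q \<times> UNIV. v u \<otimes>\<^bsub>?Z\<^esub> c u) =
      (\<Sum>u\<in>Q \<times> UNIV. \<Sum>k\<in>E <#>\<^bsub>A\<^esub> Q. frag_of (rep k) \<otimes>\<^bsub>?Z\<^esub> (M k u \<otimes>\<^bsub>?Z\<^esub> c u))"
    proof (rule sum.cong[OF refl])
      fix u assume u: "u \<in> Q \<times> (UNIV :: bool set)"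
      have "v u \<otimes>\<^bsub>?Z\<^esub> c u = (\<Sum>k\<in>E <#>\<^bsub>A\<^esub> Q. frag_of (rep k) \<otimes>\<^bsub>?Z\<^esub> M k u \<otimes>\<^bsub>?Z\<^esub> c u)"
        by (simp only: v_sum[OF u, symmetric] group_ring_mult_sum)
      also have "\<dots> = (\<Sum>k\<in>E <#>\<^bsub>A\<^esub> Q. frag_of (rep k) \<otimes>\<^bsub>?Z\<^esub> (M k u \<otimes>\<^bsub>?Z\<^esub> c u))"
      proof (rule sum.cong[OF refl])
        fix k assume k: "k \<in> E <#>\<^bsub>A\<^esub> Q"
        have "M k u \<in> carrier ?Z" using M_closed[OF k u] subgroup.subset[OF assms(3)] by auto
        then show "frag_of (rep k) \<otimes>\<^bsub>?Z\<^esub> M k u \<otimes>\<^bsub>?Z\<^esub> c u = frag_of (rep k) \<otimes>\<^bsub>?Z\<^esub> (M k u \<otimes>\<^bsub>?Z\<^esub> c u)"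
          using cZ[OF u] repG k EQ(2) by (intro Z.m_assoc) auto
      qed
      finally show "v u \<otimes>\<^bsub>?Z\<^esub> c u = (\<Sum>k\<in>E <#>\<^bsub>A\<^esub> Q. frag_of (rep k) \<otimes>\<^bsub>?Z\<^esub> (M k u \<otimes>\<^bsub>?Z\<^esub> c u))" .
    qed
    also have "\<dots> = (\<Sum>k\<in>E <#>\<^bsub>A\<^esub> Q. frag_of (rep k) \<otimes>\<^bsub>?Z\<^esub> (\<Sum>u\<in>Q \<times> UNIV. M k u \<otimes>\<^bsub>?Z\<^esub> c u))"
      by (subst sum.swap) (simp only: group_ring_mult_sum)
    also have "\<dots> = 0" using Msum by (simp add: group_ring_mult_zero)
    finally show ?thesis .
  qed
  moreover have "(\<Sum>u\<in>Q \<times> UNIV. v u \<otimes>\<^bsub>?Z\<^esub> c u) = (\<Sum>\<beta>\<in>UNIV. ab \<beta> \<otimes>\<^bsub>?Z\<^esub> C \<beta>)"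
  proof -
    have "(\<Sum>u\<in>Q \<times> UNIV. v u \<otimes>\<^bsub>?Z\<^esub> c u) = (\<Sum>\<beta>\<in>UNIV. \<Sum>q\<in>Q. v (q, \<beta>) \<otimes>\<^bsub>?Z\<^esub> c (q, \<beta>))"
      by (subst sum.swap) (simp add: sum.cartesian_product)
    also have "\<dots> = (\<Sum>\<beta>\<in>UNIV. \<Sum>q\<in>Q. ab \<beta> \<otimes>\<^bsub>?Z\<^esub> (frag_of (rep q) \<otimes>\<^bsub>?Z\<^esub> c (q, \<beta>)))"
    proof (intro sum.cong refl)
      fix \<beta> q assume q: "q \<in> Q"
      have "ab \<beta> \<in> carrier ?Z" "rep q \<in> carrier \<Gamma>" "c (q, \<beta>) \<in> carrier ?Z"
        using ab(1)[of \<beta>] SG repG q Q(3) cZ by auto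
      then show "v (q, \<beta>) \<otimes>\<^bsub>?Z\<^esub> c (q, \<beta>) = ab \<beta> \<otimes>\<^bsub>?Z\<^esub> (frag_of (rep q) \<otimes>\<^bsub>?Z\<^esub> c (q, \<beta>))"
        unfolding v_def prod.case by (intro Z.m_assoc) auto
    qed
    finally show ?thesis by (simp only: C_def group_ring_mult_sum)
  qed
  ultimately have sum0: "a \<otimes>\<^bsub>?Z\<^esub> C True + b \<otimes>\<^bsub>?Z\<^esub> C False = 0"
    by (simp add: UNIV_bool ab_def add.commute)
  obtain q \<beta> where qb: "q \<in> Q" "c (q, \<beta>) \<noteq> 0" using c(2) by auto
  \<comment> \<open>Summands for different \<open>q\<close> lie in different cosets, so a nonzero
    coefficient cannot cancel.\<close>
  have "C \<beta> \<noteq> 0"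
  proof
    assume "C \<beta> = 0"
    then have "0 = part q (C \<beta>)" by (simp add: part_zero)
    also have "\<dots> = (\<Sum>p\<in>Q. part q (frag_of (rep p) \<otimes>\<^bsub>?Z\<^esub> c (p, \<beta>)))"
      unfolding C_def by (rule part_sum_distrib)
    also have "\<dots> = (\<Sum>p\<in>Q. if q = p then frag_of (rep q) \<otimes>\<^bsub>?Z\<^esub> c (q, \<beta>) else 0)"
    proof (rule sum.cong[OF refl])
      fix p assume p: "p \<in> Q"
      have "cl x = p" if "x \<in> Poly_Mapping.keys (frag_of (rep p) \<otimes>\<^bsub>?Z\<^esub> c (p, \<beta>))" for x
        using rep_c_keys[OF that] cN[of "(p, \<beta>)"] p Q(3) by auto
      then show "part q (frag_of (rep p) \<otimes>\<^bsub>?Z\<^esub> c (p, \<beta>)) =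
        (if q = p then frag_of (rep q) \<otimes>\<^bsub>?Z\<^esub> c (q, \<beta>) else 0)"
        using part_same[of "frag_of (rep p) \<otimes>\<^bsub>?Z\<^esub> c (p, \<beta>)" p]
          part_other[of "frag_of (rep p) \<otimes>\<^bsub>?Z\<^esub> c (p, \<beta>)" p q] by auto
    qed
    also have "\<dots> = frag_of (rep q) \<otimes>\<^bsub>?Z\<^esub> c (q, \<beta>)" using qb Q(1) by simp
    finally have "frag_of (rep q) \<otimes>\<^bsub>?Z\<^esub> c (q, \<beta>) = 0" by simp
    then show False
      using group_ring_no_zero_divisors[OF assms(1,2), of "frag_of (rep q)" "c (q, \<beta>)"]
        repG[of q] qb Q(3) cZ[of "(q, \<beta>)"] by auto
  qed
  have nz: "ab \<gamma> \<otimes>\<^bsub>?Z\<^esub> C \<gamma> = 0 \<longleftrightarrow> C \<gamma> = 0" for \<gamma>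
    using group_ring_no_zero_divisors[OF assms(1,2), of "ab \<gamma>" "C \<gamma>"] ab[of \<gamma>] C_S[of \<gamma>] SG
    by (auto simp: group_ring_mult_zero)
  \<comment> \<open>In the absence of zero divisors, \<open>sum0\<close> would make both multipliers
    vanish as soon as one does.\<close>
  have "C True \<noteq> 0 \<and> C False \<noteq> 0"
    using nz[of True] nz[of False] sum0 \<open>C \<beta> \<noteq> 0\<close> by (cases \<beta>) (auto simp: ab_def)
  moreover have "a \<otimes>\<^bsub>?Z\<^esub> C True = b \<otimes>\<^bsub>?Z\<^esub> (- C False)"
    using sum0 by (simp add: group_ring_mult_minus eq_neg_iff_add_eq_0)
  ultimately show "\<exists>c d. Poly_Mapping.keys c \<subseteq> S \<and> Poly_Mapping.keys d \<subseteq> S \<and> c \<noteq> 0 \<and> d \<noteq> 0 \<and>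
      a \<otimes>\<^bsub>?Z\<^esub> c = b \<otimes>\<^bsub>?Z\<^esub> d"
    using C_S by (intro exI[of _ "C True"] exI[of _ "- C False"]) auto
qed

section \<open>The rational derived series\<close>

lemma (in group) conj_hom: "x \<in> carrier G \<Longrightarrow> (\<lambda>g. x \<otimes> g \<otimes> inv x) \<in> hom G G"
  by (rule homI) (simp_all add: m_assoc inv_solve_left)

lemma (in group) conj_int_pow:
  assumes "x \<in> carrier G" "g \<in> carrier G"
  shows "(x \<otimes> g \<otimes> inv x) [^] (k::int) = x \<otimes> (g [^] k) \<otimes> inv x"
  using hom_int_pow[OF conj_hom[OF assms(1)] assms(2)] is_group by simp

lemma (in group) group_hom_coset_map:
  assumes "N \<lhd> G" shows "group_hom G (G Mod N) (\<lambda>x. N #> x)"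
proof -
  interpret normal N G by fact
  show ?thesis
    using r_coset_hom_Mod factorgroup_is_group is_group
    by (simp add: group_hom_def group_hom_axioms_def)
qed

lemma (in group) coset_eq_self_iff:
  assumes "subgroup N G" "x \<in> carrier G" shows "N #> x = N \<longleftrightarrow> x \<in> N"
  using coset_join1[OF _ assms(2,1)] coset_join2[OF assms(2,1)] by auto

lemma (in group) coset_eq_iff:
  assumes "subgroup N G" "x \<in> carrier G" "y \<in> carrier G"
  shows "N #> x = N #> y \<longleftrightarrow> x \<otimes> inv y \<in> N"
proof
  assume "N #> x = N #> y"
  then have "x \<in> N #> y" using rcos_self[OF assms(2,1)] by simp
  then obtain h where "h \<in> N" "x = h \<otimes> y" by (auto simp: r_coset_def)
  then show "x \<otimes> inv y \<in> N" using assms subgroup.mem_carrier[OF assms(1)] by (simp add: m_assoc)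
next
  assume *: "x \<otimes> inv y \<in> N"
  then have "x \<otimes> inv y \<otimes> y \<in> N #> y" by (auto simp: r_coset_def)
  then have "x \<in> N #> y" using assms by (simp add: m_assoc)
  then show "N #> x = N #> y" using repr_independence assms by metis
qed

lemma (in group) int_pow_mem_subgroup:
  "\<lbrakk>subgroup H G; x \<in> H\<rbrakk> \<Longrightarrow> x [^] (k::int) \<in> H"
  using int_pow_consistent[of H x k] subgroup_imp_group[of H] group.int_pow_closed[of "G\<lparr>carrier := H\<rparr>" x k]
  by simp

lemma (in group) derived_set_mem: "\<lbrakk>x \<in> H; y \<in> H\<rbrakk> \<Longrightarrow> x \<otimes> y \<otimes> inv x \<otimes> inv y \<in> derived G H"
  unfolding derived_def by (rule generate.incl) blast

text \<open>Modulo the commutators of \<open>H\<close> the elements \<open>x\<close> and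
  \<open>y\<close> commute, so there the power map is multiplicative.\<close>

lemma (in group) int_pow_mult_mod_derived:
  assumes H: "H \<lhd> G" and xy: "x \<in> H" "y \<in> H"
  shows "(x \<otimes> y) [^] (k::int) \<otimes> inv (x [^] k \<otimes> y [^] k) \<in> derived G H"
proof -
  let ?D = "derived G H"
  have D: "?D \<lhd> G" by (rule derived_is_normal[OF H])
  have Dsub: "subgroup ?D G" using D by (rule normal_imp_subgroup)
  interpret q: group_hom G "G Mod ?D" "\<lambda>x. ?D #> x" by (rule group_hom_coset_map[OF D])
  have cl: "x \<in> carrier G" "y \<in> carrier G"
    using subgroup.mem_carrier[OF normal_imp_subgroup[OF H]] xy by simp_all
  have "x \<otimes> y \<otimes> inv (y \<otimes> x) = x \<otimes> y \<otimes> inv x \<otimes> inv y"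
    using cl by (simp add: inv_mult_group m_assoc)
  then have "?D #> (x \<otimes> y) = ?D #> (y \<otimes> x)"
    using derived_set_mem[OF xy] coset_eq_iff[OF Dsub, of "x \<otimes> y" "y \<otimes> x"] cl by simp
  then have comm: "(?D #> x) \<otimes>\<^bsub>G Mod ?D\<^esub> (?D #> y) = (?D #> y) \<otimes>\<^bsub>G Mod ?D\<^esub> (?D #> x)"
    using cl q.hom_mult by metis
  have "?D #> ((x \<otimes> y) [^] k) = ?D #> (x [^] k \<otimes> y [^] k)"
    using cl q.H.int_pow_mult_distrib[OF comm] q.hom_int_pow q.hom_mult q.hom_closed
    by (metis int_pow_closed m_closed)
  moreover have "(x \<otimes> y) [^] k \<in> carrier G" "x [^] k \<otimes> y [^] k \<in> carrier G" using cl by auto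
  ultimately show ?thesis using coset_eq_iff[OF Dsub] by blast
qed

text \<open>This is the preimage of the torsion subgroup of \<open>H\<close> modulo its commutators;
  the product of the two exponents works for a product of elements.\<close>

lemma (in group) rational_closure_normal:
  assumes H: "H \<lhd> G"
  shows "{g \<in> H. \<exists>k::int. k \<noteq> 0 \<and> g [^] k \<in> derived G H} \<lhd> G" (is "?T \<lhd> G")
proof -
  let ?D = "derived G H"
  have Hs: "subgroup H G" using H by (rule normal_imp_subgroup)
  have D: "?D \<lhd> G" by (rule derived_is_normal[OF H])
  have Ds: "subgroup ?D G" using D by (rule normal_imp_subgroup)
  have HG: "H \<subseteq> carrier G" using Hs by (rule subgroup.subset)
  show ?thesis
    unfolding normal_inv_iff
  proof (intro conjI ballI subgroupI)
    show "?T \<subseteq> carrier G" using HG by auto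
    have "\<one> [^] (1::int) \<in> ?D" using subgroup.one_closed[OF Ds] by simp
    then have "\<one> \<in> ?T" using subgroup.one_closed[OF Hs] by (intro CollectI conjI exI[of _ 1]) auto
    then show "?T \<noteq> {}" by blast
  next
    fix a assume "a \<in> ?T"
    then obtain k :: int where k: "a \<in> H" "k \<noteq> 0" "a [^] k \<in> ?D" by blast
    then have "inv a [^] k \<in> ?D"
      using subgroup.m_inv_closed[OF Ds] int_pow_inv[of a k] HG by (metis subsetD)
    then show "inv a \<in> ?T"
      using k subgroup.m_inv_closed[OF Hs] by (intro CollectI conjI exI[of _ k]) auto
  next
    fix a b assume "a \<in> ?T" "b \<in> ?T"
    then obtain k l :: int where k: "a \<in> H" "k \<noteq> 0" "a [^] k \<in> ?D" "b \<in> H" "l \<noteq> 0" "b [^] l \<in> ?D"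
      by blast
    have cl: "a \<in> carrier G" "b \<in> carrier G" using k HG by auto
    have "a [^] (k * l) \<in> ?D" "b [^] (k * l) \<in> ?D"
      using int_pow_pow[OF cl(1), of k l] int_pow_pow[OF cl(2), of l k] k(3,6)
        int_pow_mem_subgroup[OF Ds] by (metis mult.commute)+
    then have 1: "a [^] (k * l) \<otimes> b [^] (k * l) \<in> ?D" by (rule subgroup.m_closed[OF Ds])
    have "(a \<otimes> b) [^] (k * l) =
      (a \<otimes> b) [^] (k * l) \<otimes> inv (a [^] (k * l) \<otimes> b [^] (k * l)) \<otimes> (a [^] (k * l) \<otimes> b [^] (k * l))"
      using cl by (simp add: m_assoc)
    also have "\<dots> \<in> ?D"
      using int_pow_mult_mod_derived[OF H k(1,4)] 1 by (rule subgroup.m_closed[OF Ds])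
    finally show "a \<otimes> b \<in> ?T"
      using k subgroup.m_closed[OF Hs] by (intro CollectI conjI exI[of _ "k * l"]) auto
  next
    fix x h assume x: "x \<in> carrier G" and h: "h \<in> ?T"
    then obtain k :: int where k: "h \<in> H" "k \<noteq> 0" "h [^] k \<in> ?D" by blast
    have "(x \<otimes> h \<otimes> inv x) [^] k \<in> ?D"
      using D k x HG by (subst conj_int_pow) (auto simp: normal_inv_iff)
    moreover have "x \<otimes> h \<otimes> inv x \<in> H" using H x k by (auto simp: normal_inv_iff)
    ultimately show "x \<otimes> h \<otimes> inv x \<in> ?T" using k by (intro CollectI conjI exI[of _ k]) auto
  qed
qed

lemma (in group) rational_derived_normal: "rational_derived G n \<lhd> G"
proof (induction n)
  case 0
  show ?case unfolding rational_derived.simps by (rule normal_self)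
next
  case (Suc n)
  then show ?case unfolding rational_derived.simps by (rule rational_closure_normal)
qed

lemma (in group) rational_derived_subgroup: "subgroup (rational_derived G n) G"
  using rational_derived_normal by (rule normal_imp_subgroup)

lemma (in group) rational_derived_carrier: "x \<in> rational_derived G n \<Longrightarrow> x \<in> carrier G"
  by (rule subgroup.mem_carrier[OF rational_derived_subgroup])

lemma (in group) derived_le_rational_derived:
  "derived G (rational_derived G n) \<subseteq> rational_derived G (Suc n)"
proof
  fix x assume x: "x \<in> derived G (rational_derived G n)"
  then have "x \<in> rational_derived G n"
    using derived_incl[OF subset_refl rational_derived_subgroup] by blast
  moreover have "x [^] (1::int) \<in> derived G (rational_derived G n)"
    using x rational_derived_carrier calculation by simp
  ultimately show "x \<in> rational_derived G (Suc n)"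
    unfolding rational_derived.simps by (intro CollectI conjI exI[of _ 1]) simp_all
qed

lemma (in group) rational_derived_antimono:
  "m \<le> n \<Longrightarrow> rational_derived G n \<subseteq> rational_derived G m"
  by (induction n rule: dec_induct) auto

lemma (in group) rational_derived_commutator:
  "\<lbrakk>x \<in> rational_derived G n; y \<in> rational_derived G n\<rbrakk> \<Longrightarrow>
    x \<otimes> y \<otimes> inv x \<otimes> inv y \<in> rational_derived G (Suc n)"
  using derived_set_mem derived_le_rational_derived by blast

text \<open>The quotients by the rational derived series are torsion-free: inductively a root
  already lies in the previous term, and then the exponents multiply.\<close>

lemma (in group) rational_derived_root:
  assumes "x \<in> carrier G" "x [^] (k::int) \<in> rational_derived G n" "k \<noteq> 0"
  shows "x \<in> rational_derived G n"
  using assms(2)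
proof (induction n)
  case 0
  then show ?case using assms by simp
next
  case (Suc n)
  then obtain l :: int where l: "l \<noteq> 0" "(x [^] k) [^] l \<in> derived G (rational_derived G n)" by auto
  then have "x [^] (k * l) \<in> derived G (rational_derived G n)" using int_pow_pow assms by simp
  moreover have "x \<in> rational_derived G n" using Suc by auto
  ultimately show ?case using l assms(3) by (auto intro!: exI[of _ "k * l"])
qed

declare rational_derived.simps(2) [simp del]

section \<open>Orderability of the quotients\<close>

text \<open>A maximal positive cone omitting \<open>x\<close> and \<open>x\<^sup>-\<^sup>1\<close> cannot be enlarged by either, so it contains a
  negative power of \<open>x\<close> and a positive one, and hence \<open>1\<close>.\<close>

lemma (in comm_group) torsion_free_left_orderable:
  assumes tf: "\<And>x (n::nat). \<lbrakk>x \<in> carrier G; n > 0; x [^] n = \<one>\<rbrakk> \<Longrightarrow> x = \<one>"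
  shows "left_orderable G"
proof -
  define \<P> where "\<P> = {P. P \<subseteq> carrier G \<and> (\<forall>x\<in>P. \<forall>y\<in>P. x \<otimes> y \<in> P) \<and> \<one> \<notin> P}"
  have "\<exists>M\<in>\<P>. \<forall>P\<in>\<P>. M \<subseteq> P \<longrightarrow> P = M"
  proof (rule subset_Zorn')
    fix C assume C: "subset.chain \<P> C"
    have "x \<otimes> y \<in> \<Union>C" if xy: "x \<in> \<Union>C" "y \<in> \<Union>C" for x y
    proof -
      obtain P P' where P: "P \<in> C" "x \<in> P" "P' \<in> C" "y \<in> P'" using xy by blast
      then have "P \<subseteq> P' \<or> P' \<subseteq> P" using C unfolding subset.chain_def by blast
      moreover have "P \<in> \<P>" "P' \<in> \<P>" using C P unfolding subset.chain_def by blast+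
      ultimately show ?thesis using P unfolding \<P>_def by blast
    qed
    moreover have "C \<subseteq> \<P>" using C unfolding subset.chain_def by blast
    ultimately show "\<Union>C \<in> \<P>" unfolding \<P>_def by blast
  qed
  then obtain P where P: "P \<in> \<P>" "\<And>Q. \<lbrakk>Q \<in> \<P>; P \<subseteq> Q\<rbrakk> \<Longrightarrow> Q = P" by metis
  have PG: "P \<subseteq> carrier G" and Pm: "\<And>x y. \<lbrakk>x \<in> P; y \<in> P\<rbrakk> \<Longrightarrow> x \<otimes> y \<in> P" and P1: "\<one> \<notin> P"
    using P(1) unfolding \<P>_def by auto
  have key: "\<exists>k::nat. k > 0 \<and> inv (x [^] k) \<in> P" if x: "x \<in> carrier G" "x \<noteq> \<one>" "x \<notin> P" for x
  proof (rule ccontr)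
    assume neg: "\<not> ?thesis"
    define Q where "Q = {y. \<exists>k::nat. \<exists>p. p \<in> insert \<one> P \<and> y = p \<otimes> x [^] k \<and> (k > 0 \<or> p \<in> P)}"
    have Pm': "p \<otimes> p' \<in> insert \<one> P \<and> (p \<in> P \<or> p' \<in> P \<longrightarrow> p \<otimes> p' \<in> P)"
      if "p \<in> insert \<one> P" "p' \<in> insert \<one> P" for p p'
      using that Pm PG by auto
    have PG': "p \<in> carrier G" if "p \<in> insert \<one> P" for p using that PG by auto
    have "Q \<in> \<P>"
      unfolding \<P>_def
    proof (intro CollectI conjI ballI)
      show "Q \<subseteq> carrier G" unfolding Q_def using PG' x by auto
      fix y z assume "y \<in> Q" "z \<in> Q"
      then obtain k l :: nat and p p' where
        y: "p \<in> insert \<one> P" "y = p \<otimes> x [^] k" "k > 0 \<or> p \<in> P" and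
        z: "p' \<in> insert \<one> P" "z = p' \<otimes> x [^] l" "l > 0 \<or> p' \<in> P"
        unfolding Q_def by blast
      have "y \<otimes> z = (p \<otimes> p') \<otimes> x [^] (k + l)"
        using PG'[OF y(1)] PG'[OF z(1)] x by (simp add: y(2) z(2) nat_pow_mult[symmetric] m_ac)
      then show "y \<otimes> z \<in> Q" unfolding Q_def using Pm'[OF y(1) z(1)] y(3) z(3) by auto
    next
      show "\<one> \<notin> Q"
      proof
        assume "\<one> \<in> Q"
        then obtain k :: nat and p where p: "p \<in> insert \<one> P" "\<one> = p \<otimes> x [^] k" "k > 0 \<or> p \<in> P"
          unfolding Q_def by blast
        have pe: "p = inv (x [^] k)"
          using inv_equality[of p "x [^] k"] p(2) PG'[OF p(1)] x by simp
        have k: "k > 0"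
        proof (rule ccontr)
          assume "\<not> k > 0"
          then have "k = 0" "p \<in> P" using p(3) by simp_all
          then show False using pe P1 by simp
        qed
        have "p \<noteq> \<one>"
        proof
          assume "p = \<one>"
          then have "x [^] k = \<one>" using pe x inv_eq_1_iff[of "x [^] k"] by simp
          then show False using tf[OF x(1) k] x by simp
        qed
        then have "inv (x [^] k) \<in> P" using p(1) pe by simp
        then show False using neg k by blast
      qed
    qed
    moreover have "P \<subseteq> Q"
    proof
      fix p assume "p \<in> P"
      then show "p \<in> Q" unfolding Q_def using PG x
        by (auto intro!: exI[of _ "0::nat"] exI[of _ p])
    qed
    ultimately have "Q = P" using P(2) by blast
    moreover have "x \<in> Q" unfolding Q_def using x by (auto intro!: exI[of _ "1::nat"] exI[of _ \<one>])
    ultimately show False using x by blast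
  qed
  have Ppow: "p [^] (Suc n) \<in> P" if "p \<in> P" for p and n :: nat
    using that PG by (induction n) (auto simp: Pm)
  have tot: "x = \<one> \<or> x \<in> P \<or> inv x \<in> P" if x: "x \<in> carrier G" for x
  proof (rule ccontr)
    assume n: "\<not> ?thesis"
    have ix: "inv x \<in> carrier G" "inv x \<noteq> \<one>" using n x by (auto simp: inv_eq_1_iff)
    obtain k :: nat where k: "k > 0" "inv (x [^] k) \<in> P" using key[OF x] n by auto
    obtain l :: nat where l: "l > 0" "inv (inv x [^] l) \<in> P" using key[OF ix] n by auto
    have "inv (inv x [^] l) = x [^] l" using x by (simp add: nat_pow_inv)
    then have l': "x [^] l \<in> P" using l by simp
    have "(inv (x [^] k)) [^] l \<in> P" "(x [^] l) [^] k \<in> P"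
      using Ppow[OF k(2), of "l - 1"] Ppow[OF l', of "k - 1"] k l by auto
    then have "(inv (x [^] k)) [^] l \<otimes> (x [^] l) [^] k \<in> P" by (rule Pm)
    moreover have "(inv (x [^] k)) [^] l \<otimes> (x [^] l) [^] k = \<one>"
      using x by (simp add: nat_pow_inv nat_pow_pow mult.commute)
    ultimately show False using P1 by simp
  qed
  show ?thesis unfolding left_orderable_def by (intro exI[of _ P] conjI ballI PG Pm P1 tot)
qed

lemma (in group) normal_in_subgroup:
  assumes "N \<lhd> G" "subgroup S G" "N \<subseteq> S" shows "N \<lhd> G\<lparr>carrier := S\<rparr>"
proof -
  interpret S: group "G\<lparr>carrier := S\<rparr>" by (rule subgroup_imp_group) fact
  have "subgroup N (G\<lparr>carrier := S\<rparr>)" using subgroup_incl[OF _ assms(2,3)] normal_imp_subgroup[OF assms(1)] .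
  then show ?thesis
    unfolding S.normal_inv_iff
    using assms(1) subgroup.subset[OF assms(2)] m_inv_consistent[OF assms(2)]
    by (auto simp: normal_inv_iff)
qed

text \<open>A lexicographic order: the sign of an element is decided in the first factor of the
  series where it is nontrivial. The cone is kept in \<open>G\<close>, saturated under the
  \<open>n\<close>th term, which avoids nested quotients in the induction.\<close>

lemma (in group) rational_derived_cone:
  "\<exists>P\<subseteq>carrier G. (\<forall>x\<in>P. \<forall>y\<in>P. x \<otimes> y \<in> P) \<and> (\<forall>x\<in>P. \<forall>s\<in>rational_derived G n. x \<otimes> s \<in> P \<and> s \<otimes> x \<in> P) \<and>
    P \<inter> rational_derived G n = {} \<and>
    (\<forall>x\<in>carrier G. x \<in> rational_derived G n \<or> x \<in> P \<or> inv x \<in> P)"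
proof (induction n)
  case 0
  show ?case by (intro exI[of _ "{}"]) simp
next
  case (Suc n)
  let ?S = "rational_derived G n" and ?N = "rational_derived G (Suc n)"
  obtain P where P: "P \<subseteq> carrier G" "\<forall>x\<in>P. \<forall>y\<in>P. x \<otimes> y \<in> P"
    "\<forall>x\<in>P. \<forall>s\<in>?S. x \<otimes> s \<in> P \<and> s \<otimes> x \<in> P" "P \<inter> ?S = {}"
    "\<forall>x\<in>carrier G. x \<in> ?S \<or> x \<in> P \<or> inv x \<in> P"
    using Suc by (elim exE conjE)
  have Ss: "subgroup ?S G" and Ns: "subgroup ?N G" by (rule rational_derived_subgroup)+
  have SG: "?S \<subseteq> carrier G" using Ss by (rule subgroup.subset)
  have NS: "?N \<subseteq> ?S" by (rule rational_derived_antimono) simp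
  have N: "?N \<lhd> G\<lparr>carrier := ?S\<rparr>" by (rule normal_in_subgroup[OF rational_derived_normal Ss NS])
  let ?A = "G\<lparr>carrier := ?S\<rparr> Mod ?N"
  interpret S: group "G\<lparr>carrier := ?S\<rparr>" by (rule subgroup_imp_group[OF Ss])
  interpret q: group_hom "G\<lparr>carrier := ?S\<rparr>" ?A "\<lambda>x. ?N #> x"
    using S.group_hom_coset_map[OF N] by (simp add: r_coset_def)
  have A_cases: "\<exists>x\<in>?S. C = ?N #> x" if "C \<in> carrier ?A" for C
    using that unfolding FactGroup_def RCOSETS_def by (auto simp: r_coset_def)
  have A_one: "?N #> x = \<one>\<^bsub>?A\<^esub> \<longleftrightarrow> x \<in> ?N" if "x \<in> ?S" for x
    using coset_eq_self_iff[OF Ns, of x] that SG by auto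
  interpret A: comm_group ?A
  proof (rule q.H.group_comm_groupI)
    fix C D assume "C \<in> carrier ?A" "D \<in> carrier ?A"
    then obtain x y where xy: "x \<in> ?S" "C = ?N #> x" "y \<in> ?S" "D = ?N #> y" using A_cases by metis
    have cl: "x \<in> carrier G" "y \<in> carrier G" using xy SG by auto
    have "x \<otimes> y \<otimes> inv (y \<otimes> x) = x \<otimes> y \<otimes> inv x \<otimes> inv y"
      using cl by (simp add: inv_mult_group m_assoc)
    then have "?N #> (x \<otimes> y) = ?N #> (y \<otimes> x)"
      using rational_derived_commutator[OF xy(1,3)] coset_eq_iff[OF Ns, of "x \<otimes> y" "y \<otimes> x"] cl by simp
    then show "C \<otimes>\<^bsub>?A\<^esub> D = D \<otimes>\<^bsub>?A\<^esub> C"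
      using q.hom_mult[of x y] q.hom_mult[of y x] xy by simp
  qed
  have "left_orderable ?A"
  proof (rule A.torsion_free_left_orderable)
    fix C and m :: nat assume C: "C \<in> carrier ?A" "m > 0" "C [^]\<^bsub>?A\<^esub> m = \<one>\<^bsub>?A\<^esub>"
    then obtain x where x: "x \<in> ?S" "C = ?N #> x" using A_cases by metis
    have "?N #> (x [^] m) = \<one>\<^bsub>?A\<^esub>"
      using C(3) x q.hom_nat_pow[of x m] nat_pow_consistent[of x m ?S] by simp
    moreover have "x [^] m \<in> ?S" using x S.nat_pow_closed[of x m] nat_pow_consistent[of x m ?S] by simp
    ultimately have "x [^] m \<in> ?N" using A_one by blast
    then have "x [^] int m \<in> ?N" by (simp add: int_pow_int)
    then have "x \<in> ?N" using rational_derived_root[of x "int m" "Suc n"] x SG C(2) by auto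
    then show "C = \<one>\<^bsub>?A\<^esub>" using A_one x by simp
  qed
  then obtain C where C: "C \<subseteq> carrier ?A" "\<forall>x\<in>C. \<forall>y\<in>C. x \<otimes>\<^bsub>?A\<^esub> y \<in> C" "\<one>\<^bsub>?A\<^esub> \<notin> C"
    "\<forall>x\<in>carrier ?A. x = \<one>\<^bsub>?A\<^esub> \<or> x \<in> C \<or> inv\<^bsub>?A\<^esub> x \<in> C"
    unfolding left_orderable_def by (elim exE conjE)
  \<comment> \<open>The positive elements of the new factor, pulled back to \<open>G\<close>; they
    decide the sign of the elements of \<open>?S\<close>, about which \<open>P\<close> says
    nothing.\<close>
  define Q where "Q = {x \<in> ?S. ?N #> x \<in> C}"
  have QS: "Q \<subseteq> ?S" by (auto simp: Q_def)
  have Qm: "x \<otimes> y \<in> Q" if "x \<in> Q" "y \<in> Q" for x y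
    using that C(2) q.hom_mult[of x y] subgroup.m_closed[OF Ss] by (auto simp: Q_def)
  have QN: "x \<otimes> s \<in> Q" "s \<otimes> x \<in> Q" if "x \<in> Q" "s \<in> ?N" for x s
  proof -
    have xs: "x \<in> ?S" "s \<in> ?S" "?N #> x \<in> C" using that NS by (auto simp: Q_def)
    have s: "?N #> s = \<one>\<^bsub>?A\<^esub>" using A_one xs that by blast
    have "?N #> x \<in> carrier ?A" using q.hom_closed[of x] xs by simp
    then have "?N #> (x \<otimes> s) = ?N #> x" "?N #> (s \<otimes> x) = ?N #> x"
      using q.hom_mult[of x s] q.hom_mult[of s x] xs s q.H.r_one q.H.l_one
      by (simp_all del: mult_FactGroup one_FactGroup)
    then show "x \<otimes> s \<in> Q" "s \<otimes> x \<in> Q" using xs subgroup.m_closed[OF Ss] by (simp_all add: Q_def)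
  qed
  have Qtot: "x \<in> ?N \<or> x \<in> Q \<or> inv x \<in> Q" if x: "x \<in> ?S" for x
  proof -
    have "inv\<^bsub>?A\<^esub> (?N #> x) = ?N #> inv x"
      using q.hom_inv[of x] x m_inv_consistent[OF Ss x] by simp
    then show ?thesis
      using bspec[OF C(4) q.hom_closed[of x]] x A_one[OF x] subgroup.m_inv_closed[OF Ss x]
      unfolding Q_def by simp
  qed
  have Q_N: "x \<notin> ?N" if "x \<in> Q" for x
    using that C(3) A_one[of x] unfolding Q_def by fastforce
  show ?case
  proof (intro exI[of _ "P \<union> Q"] conjI ballI)
    show "P \<union> Q \<subseteq> carrier G" using P(1) QS SG by auto
    show "x \<otimes> y \<in> P \<union> Q" if "x \<in> P \<union> Q" "y \<in> P \<union> Q" for x y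
      using that P(2,3) Qm QS by blast
    show "x \<otimes> s \<in> P \<union> Q" "s \<otimes> x \<in> P \<union> Q" if "x \<in> P \<union> Q" "s \<in> ?N" for x s
      using that P(3) QN NS by blast+
    show "(P \<union> Q) \<inter> ?N = {}" using P(4) NS Q_N by blast
    show "x \<in> ?N \<or> x \<in> P \<union> Q \<or> inv x \<in> P \<union> Q" if "x \<in> carrier G" for x
      using that P(5) Qtot by blast
  qed
qed

lemma (in group) left_orderable_rational_quotient: "left_orderable (G Mod rational_derived G n)"
proof -
  let ?N = "rational_derived G n"
  obtain P where P: "P \<subseteq> carrier G" "\<forall>x\<in>P. \<forall>y\<in>P. x \<otimes> y \<in> P"
    "\<forall>x\<in>P. \<forall>s\<in>?N. x \<otimes> s \<in> P \<and> s \<otimes> x \<in> P" "P \<inter> ?N = {}"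
    "\<forall>x\<in>carrier G. x \<in> ?N \<or> x \<in> P \<or> inv x \<in> P"
    using rational_derived_cone[of n] by (elim exE conjE)
  interpret q: group_hom G "G Mod ?N" "\<lambda>x. ?N #> x"
    by (rule group_hom_coset_map[OF rational_derived_normal])
  show ?thesis
    unfolding left_orderable_def
  proof (intro exI[of _ "(\<lambda>x. ?N #> x) ` P"] conjI ballI)
    show "(\<lambda>x. ?N #> x) ` P \<subseteq> carrier (G Mod ?N)" using P(1) q.hom_closed by blast
    fix C D assume "C \<in> (\<lambda>x. ?N #> x) ` P" "D \<in> (\<lambda>x. ?N #> x) ` P"
    then obtain x y where xy: "x \<in> P" "C = ?N #> x" "y \<in> P" "D = ?N #> y" by blast
    have "x \<in> carrier G" "y \<in> carrier G" using xy P(1) by auto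
    then have "C \<otimes>\<^bsub>G Mod ?N\<^esub> D = ?N #> (x \<otimes> y)" by (simp only: q.hom_mult xy(2,4))
    then show "C \<otimes>\<^bsub>G Mod ?N\<^esub> D \<in> (\<lambda>x. ?N #> x) ` P" using xy P(2) by blast
  next
    have "?N #> x \<noteq> ?N" if "x \<in> P" for x
      using that P(1,4) coset_eq_self_iff[OF rational_derived_subgroup, of x n] by blast
    then show "\<one>\<^bsub>G Mod ?N\<^esub> \<notin> (\<lambda>x. ?N #> x) ` P" by auto
  next
    fix C assume "C \<in> carrier (G Mod ?N)"
    then obtain x where x: "x \<in> carrier G" "C = ?N #> x" by (auto simp: carrier_FactGroup)
    have "inv\<^bsub>G Mod ?N\<^esub> C = ?N #> inv x" using q.hom_inv[OF x(1)] x(2) by simp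
    moreover have "x \<in> ?N \<Longrightarrow> C = \<one>\<^bsub>G Mod ?N\<^esub>"
      using coset_eq_self_iff[OF rational_derived_subgroup x(1), of n] x(2) by simp
    ultimately show "C = \<one>\<^bsub>G Mod ?N\<^esub> \<or> C \<in> (\<lambda>x. ?N #> x) ` P \<or> inv\<^bsub>G Mod ?N\<^esub> C \<in> (\<lambda>x. ?N #> x) ` P"
      using P(5) x by blast
  qed
qed

text \<open>Downward induction on \<open>j\<close> from the trivial group at \<open>j = n\<close>;
  each step enlarges the subgroup by an abelian quotient. The case \<open>j = 0\<close> gives the
  whole group ring, and \<open>j = 1\<close> will give the subring over which the degree is
  measured.\<close>

theorem (in group) right_ore_domain_rational_quotient:
  assumes "j \<le> n"
  shows "right_ore_domain (group_ring ((G Mod rational_derived G n)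
    \<lparr>carrier := (\<lambda>x. rational_derived G n #> x) ` rational_derived G j\<rparr>))"
  using assms
proof (induction j rule: inc_induct)
  case base
  let ?N = "rational_derived G n"
  let ?Q = "G Mod ?N"
  interpret q: group_hom G ?Q "\<lambda>x. ?N #> x"
    by (rule group_hom_coset_map[OF rational_derived_normal])
  have S: "(\<lambda>x. ?N #> x) ` ?N = {\<one>\<^bsub>?Q\<^esub>}"
  proof -
    have "?N #> x = ?N" if "x \<in> ?N" for x
      using that coset_eq_self_iff[OF rational_derived_subgroup rational_derived_carrier] by simp
    then have "(\<lambda>x. ?N #> x) ` ?N = (\<lambda>x. ?N) ` ?N" by (intro image_cong) simp_all
    also have "\<dots> = {?N}" using subgroup.one_closed[OF rational_derived_subgroup[of n]] by (intro image_constant)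
    finally show ?thesis by simp
  qed
  show ?case
    unfolding S
  proof (rule right_ore_domain_group_ringI[OF q.H.group_axioms left_orderable_rational_quotient q.H.triv_subgroup])
    fix a b :: "'a set \<Rightarrow>\<^sub>0 int"
    assume ab: "Poly_Mapping.keys a \<subseteq> {\<one>\<^bsub>?Q\<^esub>}" "Poly_Mapping.keys b \<subseteq> {\<one>\<^bsub>?Q\<^esub>}" "a \<noteq> 0" "b \<noteq> 0"
    have "a \<otimes>\<^bsub>group_ring ?Q\<^esub> b = b \<otimes>\<^bsub>group_ring ?Q\<^esub> a"
    proof (rule additive_frag_eq[OF ab(1), of "\<lambda>a. a \<otimes>\<^bsub>group_ring ?Q\<^esub> b"])
      fix x assume "x \<in> {\<one>\<^bsub>?Q\<^esub>}"
      then show "frag_of x \<otimes>\<^bsub>group_ring ?Q\<^esub> b = b \<otimes>\<^bsub>group_ring ?Q\<^esub> frag_of x"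
        by (intro additive_frag_eq[OF ab(2), of "\<lambda>b. frag_of x \<otimes>\<^bsub>group_ring ?Q\<^esub> b"])
          (simp_all add: group_ring_mult_diff)
    qed (simp_all add: group_ring_mult_diff)
    then show "\<exists>c d. Poly_Mapping.keys c \<subseteq> {\<one>\<^bsub>?Q\<^esub>} \<and> Poly_Mapping.keys d \<subseteq> {\<one>\<^bsub>?Q\<^esub>} \<and> c \<noteq> 0 \<and> d \<noteq> 0 \<and>
        a \<otimes>\<^bsub>group_ring ?Q\<^esub> c = b \<otimes>\<^bsub>group_ring ?Q\<^esub> d"
      using ab by (intro exI[of _ b] exI[of _ a]) auto
  qed
next
  case (step j)
  let ?N = "rational_derived G n"
  let ?Q = "G Mod ?N"
  interpret q: group_hom G ?Q "\<lambda>x. ?N #> x"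
    by (rule group_hom_coset_map[OF rational_derived_normal])
  have sg: "subgroup ((\<lambda>x. ?N #> x) ` rational_derived G i) ?Q" for i
    by (rule q.subgroup_img_is_subgroup[OF rational_derived_subgroup])
  show ?case
  proof (rule group_ring_ore_step[OF q.H.group_axioms left_orderable_rational_quotient sg sg _ _ step.IH])
    show "(\<lambda>x. ?N #> x) ` rational_derived G (Suc j) \<subseteq> (\<lambda>x. ?N #> x) ` rational_derived G j"
      by (intro image_mono rational_derived_antimono) simp
    fix C D assume "C \<in> (\<lambda>x. ?N #> x) ` rational_derived G j" "D \<in> (\<lambda>x. ?N #> x) ` rational_derived G j"
    then obtain x y where xy: "x \<in> rational_derived G j" "C = ?N #> x" "y \<in> rational_derived G j" "D = ?N #> y"
      by blast
    then have cl: "x \<in> carrier G" "y \<in> carrier G" using rational_derived_carrier by auto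
    have "C \<otimes>\<^bsub>?Q\<^esub> D \<otimes>\<^bsub>?Q\<^esub> inv\<^bsub>?Q\<^esub> C \<otimes>\<^bsub>?Q\<^esub> inv\<^bsub>?Q\<^esub> D = ?N #> (x \<otimes> y \<otimes> inv x \<otimes> inv y)"
      using xy(2,4) cl by (simp only: q.hom_mult q.hom_inv m_closed inv_closed)
    then show "C \<otimes>\<^bsub>?Q\<^esub> D \<otimes>\<^bsub>?Q\<^esub> inv\<^bsub>?Q\<^esub> C \<otimes>\<^bsub>?Q\<^esub> inv\<^bsub>?Q\<^esub> D \<in> (\<lambda>x. ?N #> x) ` rational_derived G (Suc j)"
      using rational_derived_commutator[OF xy(1,3)] by blast
  qed
qed

section \<open>The module structure on the abelianised kernel\<close>

lemma (in group) inv_cancel: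
  assumes "x \<in> carrier G" "y \<in> carrier G"
  shows "inv x \<otimes> (x \<otimes> y) = y" "x \<otimes> (inv x \<otimes> y) = y"
  using assms by (simp_all flip: m_assoc)

context comm_group
begin

text \<open>The homomorphic extension of \<open>f\<close> to the free abelian group, in the shape
  that \<open>act\<close> has in \<open>kernel_module\<close>.\<close>

definition frag_prod :: "('c \<Rightarrow> 'a) \<Rightarrow> ('c \<Rightarrow>\<^sub>0 int) \<Rightarrow> 'a" where
  "frag_prod f r = finprod G (\<lambda>x. f x [^] Poly_Mapping.lookup r x) (Poly_Mapping.keys r)"

lemma frag_prod_superset:
  assumes "finite T" "Poly_Mapping.keys r \<subseteq> T" "\<And>x. x \<in> T \<Longrightarrow> f x \<in> carrier G"
  shows "frag_prod f r = finprod G (\<lambda>x. f x [^] Poly_Mapping.lookup r x) T"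
  unfolding frag_prod_def
  using assms by (intro finprod_mono_neutral_cong_left) (auto simp: in_keys_iff)

lemma frag_prod_closed:
  assumes "Poly_Mapping.keys r \<subseteq> S" "\<And>x. x \<in> S \<Longrightarrow> f x \<in> carrier G"
  shows "frag_prod f r \<in> carrier G"
  unfolding frag_prod_def using assms by (intro finprod_closed) auto

lemma frag_prod_hom:
  assumes f: "\<And>x. x \<in> S \<Longrightarrow> f x \<in> carrier G"
  shows "frag_prod f \<in> hom (free_Abelian_group S) G"
proof (rule homI)
  fix r s assume rs: "r \<in> carrier (free_Abelian_group S)" "s \<in> carrier (free_Abelian_group S)"
  let ?T = "Poly_Mapping.keys r \<union> Poly_Mapping.keys s"
  have T: "f x \<in> carrier G" if "x \<in> ?T" for x using that rs f by auto
  have "frag_prod f (r + s) = finprod G (\<lambda>x. f x [^] Poly_Mapping.lookup (r + s) x) ?T"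
    using T keys_add_subset[of r ?T s] by (intro frag_prod_superset) auto
  also have "\<dots> = finprod G (\<lambda>x. f x [^] Poly_Mapping.lookup r x \<otimes> f x [^] Poly_Mapping.lookup s x) ?T"
    using T by (intro finprod_cong') (auto simp: lookup_add int_pow_mult)
  also have "\<dots> = finprod G (\<lambda>x. f x [^] Poly_Mapping.lookup r x) ?T \<otimes> finprod G (\<lambda>x. f x [^] Poly_Mapping.lookup s x) ?T"
    using T by (intro finprod_multf) auto
  also have "\<dots> = frag_prod f r \<otimes> frag_prod f s"
    using T by (subst (1 2) frag_prod_superset[of ?T]) auto
  finally show "frag_prod f (r \<otimes>\<^bsub>free_Abelian_group S\<^esub> s) = frag_prod f r \<otimes> frag_prod f s" by simp
qed (use frag_prod_closed f in auto)

lemma frag_prod_add: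
  assumes "\<And>x. x \<in> S \<Longrightarrow> f x \<in> carrier G" "Poly_Mapping.keys r \<subseteq> S" "Poly_Mapping.keys s \<subseteq> S"
  shows "frag_prod f (r + s) = frag_prod f r \<otimes> frag_prod f s"
  using hom_mult[OF frag_prod_hom[of S f]] assms by simp

lemma frag_prod_of: "f x \<in> carrier G \<Longrightarrow> frag_prod f (frag_of x) = f x"
  by (simp add: frag_prod_def finprod_singleton)

lemma frag_prod_zero: "frag_prod f 0 = \<one>"
  by (simp add: frag_prod_def)

lemma frag_hom_eq:
  assumes "f \<in> hom (free_Abelian_group S) G" "g \<in> hom (free_Abelian_group S) G"
    and eq: "\<And>x. x \<in> S \<Longrightarrow> f (frag_of x) = g (frag_of x)" and r: "Poly_Mapping.keys r \<subseteq> S"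
  shows "f r = g r"
proof -
  interpret f: group_hom "free_Abelian_group S" G f
    using assms(1) is_group by (simp add: group_hom_def group_hom_axioms_def)
  interpret g: group_hom "free_Abelian_group S" G g
    using assms(2) is_group by (simp add: group_hom_def group_hom_axioms_def)
  have d: "f (a - b) = f a \<otimes> inv (f b)" "g (a - b) = g a \<otimes> inv (g b)"
    if "Poly_Mapping.keys a \<subseteq> S" "Poly_Mapping.keys b \<subseteq> S" for a b
    using that f.hom_mult[of a "- b"] f.hom_inv[of b] g.hom_mult[of a "- b"] g.hom_inv[of b] by simp_all
  show ?thesis
    using r
  proof (rule free_Abelian_group_induct[where P = "\<lambda>r. f r = g r"])
    show "f 0 = g 0" using f.hom_one g.hom_one by simp
  qed (simp_all add: d eq)
qed

end

lemma carrier_kernel_module [simp]: "carrier (kernel_module G \<Gamma> \<phi>) = carrier (kernel_ab G \<Gamma> \<phi>)"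
  and mult_kernel_module [simp]: "x \<otimes>\<^bsub>kernel_module G \<Gamma> \<phi>\<^esub> y = x \<otimes>\<^bsub>kernel_ab G \<Gamma> \<phi>\<^esub> y"
  and one_kernel_module [simp]: "\<one>\<^bsub>kernel_module G \<Gamma> \<phi>\<^esub> = \<one>\<^bsub>kernel_ab G \<Gamma> \<phi>\<^esub>"
  by (simp_all add: kernel_module_def Let_def)

context group_hom
begin

abbreviation ker where "ker \<equiv> kernel G H h"
abbreviation Kab where "Kab \<equiv> kernel_ab G H h"
abbreviation KM where "KM \<equiv> kernel_module G H h"

definition cs :: "'a \<Rightarrow> 'a set" where "cs g = derived G ker #> g"

lemma ker_iff: "g \<in> ker \<longleftrightarrow> g \<in> carrier G \<and> h g = \<one>\<^bsub>H\<^esub>"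
  by (auto simp: kernel_def)

lemma derived_ker_normal: "derived G ker \<lhd> G"
  by (rule G.derived_is_normal[OF normal_kernel])

lemma derived_ker_subgroup: "subgroup (derived G ker) G"
  using derived_ker_normal by (rule normal_imp_subgroup)

lemma derived_ker_le: "derived G ker \<subseteq> ker"
  by (rule G.derived_incl[OF subset_refl subgroup_kernel])

lemma comm_group_Kab: "comm_group Kab"
  unfolding kernel_ab_def by (rule G.derived_quot_of_subgroup_is_comm_group[OF subgroup_kernel])

sublocale Kab: comm_group Kab by (rule comm_group_Kab)

lemma cs_group_hom: "group_hom (G\<lparr>carrier := ker\<rparr>) Kab cs"
proof -
  interpret K: group "G\<lparr>carrier := ker\<rparr>" by (rule G.subgroup_imp_group[OF subgroup_kernel])
  have "derived G ker \<lhd> G\<lparr>carrier := ker\<rparr>"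
    by (rule G.normal_in_subgroup[OF derived_ker_normal subgroup_kernel derived_ker_le])
  from K.group_hom_coset_map[OF this] show ?thesis
    unfolding kernel_ab_def cs_def by (simp add: r_coset_def)
qed

lemma cs_closed [simp]: "g \<in> ker \<Longrightarrow> cs g \<in> carrier Kab"
  using group_hom.hom_closed[OF cs_group_hom] by simp

lemma cs_mult: "\<lbrakk>g \<in> ker; k \<in> ker\<rbrakk> \<Longrightarrow> cs (g \<otimes> k) = cs g \<otimes>\<^bsub>Kab\<^esub> cs k"
  using group_hom.hom_mult[OF cs_group_hom, of g k] by simp

lemma cs_one: "cs \<one> = \<one>\<^bsub>Kab\<^esub>"
  using group_hom.hom_one[OF cs_group_hom] by simp

lemma cs_inv: "g \<in> ker \<Longrightarrow> cs (inv g) = inv\<^bsub>Kab\<^esub> cs g"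
  using group_hom.hom_inv[OF cs_group_hom, of g] G.m_inv_consistent[OF subgroup_kernel] by simp

lemma cs_eq_iff: "\<lbrakk>g \<in> carrier G; k \<in> carrier G\<rbrakk> \<Longrightarrow> cs g = cs k \<longleftrightarrow> g \<otimes> inv k \<in> derived G ker"
  using G.coset_eq_iff[OF derived_ker_subgroup] by (simp add: cs_def)

lemma Kab_cases:
  assumes "C \<in> carrier Kab" obtains g where "g \<in> ker" "C = cs g"
  using assms unfolding kernel_ab_def carrier_FactGroup cs_def by (auto simp: r_coset_def)

lemma ker_conj: "\<lbrakk>g \<in> ker; x \<in> carrier G\<rbrakk> \<Longrightarrow> inv x \<otimes> g \<otimes> x \<in> ker"
  by (simp add: ker_iff)

text \<open>Two lifts of one element differ by some \<open>c\<close> in the kernel, and conjugation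
  by \<open>c\<close> alters \<open>g\<close> only by a commutator of kernel elements. Conversely,
  the lift \<open>x\<close> alone reaches the whole coset, the commutator subgroup of the kernel
  being normal in \<open>G\<close>.\<close>

lemma conj_act_cs:
  assumes g: "g \<in> ker" and x: "x \<in> carrier G"
  shows "conj_act G h (cs g) (h x) = cs (inv x \<otimes> g \<otimes> x)"
proof -
  let ?D = "derived G ker"
  have gG: "g \<in> carrier G" using g by (simp add: ker_iff)
  have D: "z \<in> carrier G" if "z \<in> ?D" for z using subgroup.mem_carrier[OF derived_ker_subgroup that] .
  have conj: "z \<otimes> d \<otimes> inv z \<in> ?D" if "z \<in> carrier G" "d \<in> ?D" for z d
    using derived_ker_normal that by (auto simp: G.normal_inv_iff)
  have conj': "inv z \<otimes> d \<otimes> z \<in> ?D" if "z \<in> carrier G" "d \<in> ?D" for z d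
    using conj[of "inv z" d] that by simp
  have 1: "inv y \<otimes> k \<otimes> y \<in> cs (inv x \<otimes> g \<otimes> x)"
    if k: "k \<in> cs g" and y: "y \<in> carrier G" "h y = h x" for k y
  proof -
    obtain d where d: "d \<in> ?D" "k = d \<otimes> g" using k by (auto simp: cs_def r_coset_def)
    define c where "c = y \<otimes> inv x"
    have c: "c \<in> ker" "c \<in> carrier G" using x y by (auto simp: c_def ker_iff)
    have yc: "y = c \<otimes> x" using x y by (simp add: c_def G.m_assoc)
    have e: "inv c \<otimes> g \<otimes> inv (inv c) \<otimes> inv g \<in> ?D"
      using G.derived_set_mem[of "inv c" ker g] c g by (simp add: ker_iff)
    have "inv y \<otimes> k \<otimes> y = (inv x \<otimes> (inv c \<otimes> d \<otimes> c \<otimes> (inv c \<otimes> g \<otimes> inv (inv c) \<otimes> inv g)) \<otimes> x) \<otimes> (inv x \<otimes> g \<otimes> x)"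
      using c(2) x gG D[OF d(1)] by (simp add: yc d(2) G.inv_mult_group G.m_assoc G.inv_cancel)
    moreover have "inv x \<otimes> (inv c \<otimes> d \<otimes> c \<otimes> (inv c \<otimes> g \<otimes> inv (inv c) \<otimes> inv g)) \<otimes> x \<in> ?D"
      by (intro conj' x subgroup.m_closed[OF derived_ker_subgroup] c(2) d(1) e)
    ultimately show ?thesis unfolding cs_def r_coset_def by blast
  qed
  have 2: "z \<in> conj_act G h (cs g) (h x)" if z: "z \<in> cs (inv x \<otimes> g \<otimes> x)" for z
  proof -
    obtain d where d: "d \<in> ?D" "z = d \<otimes> (inv x \<otimes> g \<otimes> x)" using z by (auto simp: cs_def r_coset_def)
    have "z = inv x \<otimes> ((x \<otimes> d \<otimes> inv x) \<otimes> g) \<otimes> x"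
      using x gG D[OF d(1)] by (simp add: d(2) G.m_assoc G.inv_cancel)
    moreover have "(x \<otimes> d \<otimes> inv x) \<otimes> g \<in> cs g"
      using conj[OF x d(1)] unfolding cs_def r_coset_def by blast
    ultimately show ?thesis unfolding conj_act_def using x by blast
  qed
  show ?thesis
  proof (intro equalityI subsetI)
    fix z assume "z \<in> conj_act G h (cs g) (h x)"
    then show "z \<in> cs (inv x \<otimes> g \<otimes> x)" unfolding conj_act_def using 1 by blast
  qed (rule 2)
qed

lemma conj_act_closed:
  assumes "C \<in> carrier Kab" "\<gamma> \<in> h ` carrier G"
  shows "conj_act G h C \<gamma> \<in> carrier Kab"
proof -
  obtain g where "g \<in> ker" "C = cs g" using Kab_cases[OF assms(1)] .
  moreover obtain x where "x \<in> carrier G" "\<gamma> = h x" using assms(2) by blast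
  ultimately show ?thesis using conj_act_cs ker_conj cs_closed by simp
qed

lemma act_KM: "act KM C r = Kab.frag_prod (conj_act G h C) r"
  by (simp add: kernel_module_def Let_def Kab.frag_prod_def)

lemma act_KM_cs:
  assumes "g \<in> ker" "x \<in> carrier G"
  shows "act KM (cs g) (frag_of (h x)) = cs (inv x \<otimes> g \<otimes> x)"
  using assms by (simp add: act_KM Kab.frag_prod_of conj_act_cs ker_conj)

lemma act_KM_hom:
  assumes "C \<in> carrier Kab" "S \<subseteq> h ` carrier G"
  shows "act KM C \<in> hom (free_Abelian_group S) Kab"
proof -
  have "Kab.frag_prod (conj_act G h C) \<in> hom (free_Abelian_group S) Kab"
    by (rule Kab.frag_prod_hom) (use conj_act_closed assms in blast)
  moreover have "act KM C = Kab.frag_prod (conj_act G h C)" by (rule ext) (rule act_KM)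
  ultimately show ?thesis by simp
qed

text \<open>Stated for any subgroup of the image, so that it serves both the full group ring and the
  subring over the image of the fibre. The laws are additive in the scalars, hence can be checked on
  group elements.\<close>

lemma right_mod_kernel:
  assumes S: "subgroup S H" "S \<subseteq> h ` carrier G"
  shows "right_mod (group_ring (H\<lparr>carrier := S\<rparr>)) KM"
proof -
  let ?R = "group_ring (H\<lparr>carrier := S\<rparr>)"
  interpret S: group "H\<lparr>carrier := S\<rparr>" by (rule H.subgroup_imp_group[OF S(1)])
  interpret R: ring ?R by (rule group_ring_ring) (rule S.is_monoid)
  have M: "comm_group KM"
    by (rule comm_groupI) (use Kab.l_inv_ex in \<open>simp_all add: Kab.m_ac\<close>)
  have closed: "act KM C r \<in> carrier Kab" if "C \<in> carrier Kab" "Poly_Mapping.keys r \<subseteq> S" for C r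
    using hom_in_carrier[OF act_KM_hom[OF that(1) S(2)], of r] that by simp
  have mult: "act KM (C \<otimes>\<^bsub>Kab\<^esub> D) r = act KM C r \<otimes>\<^bsub>Kab\<^esub> act KM D r"
    if CD: "C \<in> carrier Kab" "D \<in> carrier Kab" and r: "Poly_Mapping.keys r \<subseteq> S" for C D r
  proof (rule Kab.frag_hom_eq[OF act_KM_hom[OF Kab.m_closed[OF CD] S(2)] _ _ r])
    show "(\<lambda>r. act KM C r \<otimes>\<^bsub>Kab\<^esub> act KM D r) \<in> hom (free_Abelian_group S) Kab"
    proof (rule homI)
      fix a b assume "a \<in> carrier (free_Abelian_group S)" "b \<in> carrier (free_Abelian_group S)"
      then show "act KM C (a \<otimes>\<^bsub>free_Abelian_group S\<^esub> b) \<otimes>\<^bsub>Kab\<^esub> act KM D (a \<otimes>\<^bsub>free_Abelian_group S\<^esub> b) =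
        act KM C a \<otimes>\<^bsub>Kab\<^esub> act KM D a \<otimes>\<^bsub>Kab\<^esub> (act KM C b \<otimes>\<^bsub>Kab\<^esub> act KM D b)"
        using Group.hom_mult[OF act_KM_hom[OF CD(1) S(2)]] Group.hom_mult[OF act_KM_hom[OF CD(2) S(2)]] closed CD
        by (simp add: Kab.m_ac)
    qed (use closed CD in simp)
    fix \<gamma> assume "\<gamma> \<in> S"
    then obtain x where x: "x \<in> carrier G" "\<gamma> = h x" using S(2) by blast
    obtain c d where c: "c \<in> ker" "C = cs c" "d \<in> ker" "D = cs d" using CD Kab_cases by metis
    have "c \<otimes> d \<in> ker" using c by (simp add: ker_iff)
    moreover have "inv x \<otimes> (c \<otimes> d) \<otimes> x = (inv x \<otimes> c \<otimes> x) \<otimes> (inv x \<otimes> d \<otimes> x)"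
      using c x by (simp add: ker_iff G.m_assoc G.inv_cancel)
    ultimately show "act KM (C \<otimes>\<^bsub>Kab\<^esub> D) (frag_of \<gamma>) = act KM C (frag_of \<gamma>) \<otimes>\<^bsub>Kab\<^esub> act KM D (frag_of \<gamma>)"
      using c x by (simp add: cs_mult[symmetric] act_KM_cs ker_conj del: act_KM)
  qed
  have add: "act KM C (r + s) = act KM C r \<otimes>\<^bsub>Kab\<^esub> act KM C s"
    if "C \<in> carrier Kab" "Poly_Mapping.keys r \<subseteq> S" "Poly_Mapping.keys s \<subseteq> S" for C r s
    using Group.hom_mult[OF act_KM_hom[OF that(1) S(2)], of r s] that by simp
  have mult_keys: "Poly_Mapping.keys (r \<otimes>\<^bsub>?R\<^esub> s) \<subseteq> S"
    if "Poly_Mapping.keys r \<subseteq> S" "Poly_Mapping.keys s \<subseteq> S" for r s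
    using R.m_closed[of r s] that by simp
  have assoc: "act KM C (r \<otimes>\<^bsub>?R\<^esub> s) = act KM (act KM C r) s"
    if C: "C \<in> carrier Kab" and r: "Poly_Mapping.keys r \<subseteq> S" and s: "Poly_Mapping.keys s \<subseteq> S" for C r s
  proof (rule Kab.frag_hom_eq[OF _ _ _ r])
    show "(\<lambda>r. act KM C (r \<otimes>\<^bsub>?R\<^esub> s)) \<in> hom (free_Abelian_group S) Kab"
      by (rule homI) (use C s mult_keys closed add in \<open>simp_all add: group_ring_mult_add\<close>)
    show "(\<lambda>r. act KM (act KM C r) s) \<in> hom (free_Abelian_group S) Kab"
      by (rule homI) (use C s closed add mult in simp_all)
    fix \<gamma> assume g: "\<gamma> \<in> S"
    then have g': "Poly_Mapping.keys (frag_of \<gamma>) \<subseteq> S" by simp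
    show "act KM C (frag_of \<gamma> \<otimes>\<^bsub>?R\<^esub> s) = act KM (act KM C (frag_of \<gamma>)) s"
    proof (rule Kab.frag_hom_eq[OF _ act_KM_hom[OF closed[OF C g'] S(2)] _ s])
      show "(\<lambda>s. act KM C (frag_of \<gamma> \<otimes>\<^bsub>?R\<^esub> s)) \<in> hom (free_Abelian_group S) Kab"
        by (rule homI) (use C g' mult_keys closed add in \<open>simp_all add: group_ring_mult_add\<close>)
      fix \<delta> assume "\<delta> \<in> S"
      then obtain y where y: "y \<in> carrier G" "\<delta> = h y" using S(2) by blast
      obtain x where x: "x \<in> carrier G" "\<gamma> = h x" using S(2) g by blast
      obtain c where c: "c \<in> ker" "C = cs c" using C Kab_cases by metis
      have "\<gamma> \<otimes>\<^bsub>H\<^esub> \<delta> = h (x \<otimes> y)" using x y by simp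
      then have "act KM C (frag_of \<gamma> \<otimes>\<^bsub>?R\<^esub> frag_of \<delta>) = cs (inv (x \<otimes> y) \<otimes> c \<otimes> (x \<otimes> y))"
        using c x y act_KM_cs[of c "x \<otimes> y"] by simp
      also have "inv (x \<otimes> y) \<otimes> c \<otimes> (x \<otimes> y) = inv y \<otimes> (inv x \<otimes> c \<otimes> x) \<otimes> y"
        using c x y by (simp add: ker_iff G.m_assoc G.inv_mult_group)
      also have "cs \<dots> = act KM (act KM C (frag_of \<gamma>)) (frag_of \<delta>)"
        using c x y by (simp add: act_KM_cs ker_conj)
      finally show "act KM C (frag_of \<gamma> \<otimes>\<^bsub>?R\<^esub> frag_of \<delta>) = act KM (act KM C (frag_of \<gamma>)) (frag_of \<delta>)" .
    qed
  qed
  have one: "act KM C \<one>\<^bsub>?R\<^esub> = C" if C: "C \<in> carrier Kab" for C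
  proof -
    obtain c where c: "c \<in> ker" "C = cs c" using C Kab_cases by metis
    then show ?thesis using act_KM_cs[of c \<one>] by (simp add: ker_iff)
  qed
  interpret M: comm_group KM by (rule M)
  show ?thesis
    by unfold_locales (use closed mult add assoc one in simp_all)
qed

end

section \<open>Words and presented groups\<close>

fun weval :: "('a, 'b) monoid_scheme \<Rightarrow> (nat \<Rightarrow> 'a) \<Rightarrow> word \<Rightarrow> 'a" where
  "weval Q y [] = \<one>\<^bsub>Q\<^esub>"
| "weval Q y ((i, b) # w) = (if b then y i else inv\<^bsub>Q\<^esub> y i) \<otimes>\<^bsub>Q\<^esub> weval Q y w"

definition winv :: "word \<Rightarrow> word" where
  "winv w = rev (map (\<lambda>(i, b). (i, \<not> b)) w)"

lemma words_simps [simp]: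
  "[] \<in> words m" "(i, b) # w \<in> words m \<longleftrightarrow> i < m \<and> w \<in> words m"
  "u @ v \<in> words m \<longleftrightarrow> u \<in> words m \<and> v \<in> words m"
  by (auto simp: words_def)

lemma winv_simps [simp]: "winv [] = []" "winv ((i, b) # w) = winv w @ [(i, \<not> b)]"
  by (simp_all add: winv_def)

lemma winv_words [simp]: "w \<in> words m \<Longrightarrow> winv w \<in> words m"
  by (induction w) auto

lemma words_mono: "\<lbrakk>w \<in> words m; m \<le> n\<rbrakk> \<Longrightarrow> w \<in> words n"
  by (induction w) auto

context group
begin

lemma weval_closed:
  assumes "\<And>i. i < m \<Longrightarrow> y i \<in> carrier G" "w \<in> words m"
  shows "weval G y w \<in> carrier G"
  using assms(2) by (induction w) (auto simp: assms(1))

lemma weval_append: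
  assumes "\<And>i. i < m \<Longrightarrow> y i \<in> carrier G" "u \<in> words m" "v \<in> words m"
  shows "weval G y (u @ v) = weval G y u \<otimes> weval G y v"
  using assms(2)
  by (induction u) (auto simp: assms(1,3) m_assoc weval_closed[of m y, OF assms(1)])

lemma weval_winv:
  assumes "\<And>i. i < m \<Longrightarrow> y i \<in> carrier G" "w \<in> words m"
  shows "weval G y (winv w) = inv (weval G y w)"
  using assms(2)
proof (induction w)
  case (Cons a w)
  obtain i b where a: "a = (i, b)" by (cases a)
  have cl: "y i \<in> carrier G" "weval G y w \<in> carrier G" "i < m" "w \<in> words m"
    using Cons.prems weval_closed[OF assms(1)] assms(1) by (auto simp: a)
  show ?case using cl Cons.IH by (subst a, simp add: a weval_append[of m y, OF assms(1)] inv_mult_group)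
qed simp

end

lemma (in group_hom) hom_weval:
  assumes "\<And>i. i < m \<Longrightarrow> y i \<in> carrier G" "w \<in> words m"
  shows "h (weval G y w) = weval H (\<lambda>i. h (y i)) w"
  using assms(2)
  by (induction w) (auto simp: assms(1) G.weval_closed[of m y, OF assms(1)])

lemma weval_cong:
  assumes "\<And>i. i < m \<Longrightarrow> y i = z i" "w \<in> words m"
  shows "weval Q y w = weval Q z w"
  using assms(2) by (induction w) (auto simp: assms(1))

lemma deletion_step_words:
  assumes "(u, v) \<in> deletion_step m R" "R \<subseteq> words m"
  shows "u \<in> words m" "v \<in> words m"
  using assms unfolding deletion_step_def by auto

lemma pres_rel_words:
  assumes "(u, v) \<in> pres_rel m R" "R \<subseteq> words m" "u \<in> words m"
  shows "v \<in> words m"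
  using assms(1) unfolding pres_rel_def
proof (induction rule: rtrancl_induct)
  case (step y z)
  then show ?case using deletion_step_words[OF _ assms(2)] by blast
qed (rule assms(3))

lemma pres_rel_refl [simp]: "(u, u) \<in> pres_rel m R"
  by (simp add: pres_rel_def)

lemma pres_rel_sym: "(u, v) \<in> pres_rel m R \<Longrightarrow> (v, u) \<in> pres_rel m R"
  unfolding pres_rel_def by (rule symD[OF sym_rtrancl[OF sym_Un_converse]])

lemma pres_rel_trans: "\<lbrakk>(u, v) \<in> pres_rel m R; (v, w) \<in> pres_rel m R\<rbrakk> \<Longrightarrow> (u, w) \<in> pres_rel m R"
  unfolding pres_rel_def by (rule rtrancl_trans)

lemma deletion_step_context:
  assumes "(u, v) \<in> deletion_step m R" "p \<in> words m" "q \<in> words m"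
  shows "(p @ u @ q, p @ v @ q) \<in> deletion_step m R"
proof -
  obtain a s b where *: "u = a @ s @ b" "v = a @ b" "a \<in> words m" "b \<in> words m"
    "s \<in> R \<union> {[(i, b), (i, \<not> b)] | i b. i < m}"
    using assms(1) unfolding deletion_step_def by blast
  have "p @ u @ q = (p @ a) @ s @ (b @ q)" "p @ v @ q = (p @ a) @ (b @ q)"
    "p @ a \<in> words m" "b @ q \<in> words m"
    using * assms(2,3) by simp_all
  then show ?thesis unfolding deletion_step_def using *(5) by blast
qed

lemma pres_rel_context:
  assumes "(u, v) \<in> pres_rel m R" "p \<in> words m" "q \<in> words m"
  shows "(p @ u @ q, p @ v @ q) \<in> pres_rel m R"
  using assms(1) unfolding pres_rel_def
proof (induction rule: rtrancl_induct)
  case (step y z)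
  then have "(p @ y @ q, p @ z @ q) \<in> deletion_step m R \<union> (deletion_step m R)\<inverse>"
    using deletion_step_context[OF _ assms(2,3)] by blast
  then show ?case using step.IH by (rule rtrancl_into_rtrancl[rotated])
qed simp

lemma pres_rel_append:
  assumes "(u, u') \<in> pres_rel m R" "(v, v') \<in> pres_rel m R" "u' \<in> words m" "v \<in> words m"
  shows "(u @ v, u' @ v') \<in> pres_rel m R"
  using pres_rel_trans[of "u @ v" "u' @ v" m R "u' @ v'"]
    pres_rel_context[OF assms(1), of "[]" v] pres_rel_context[OF assms(2), of u' "[]"] assms(3,4)
  by simp

lemma pres_rel_delete:
  assumes "s \<in> R \<union> {[(i, b), (i, \<not> b)] | i b. i < m}" "p \<in> words m" "q \<in> words m"
  shows "(p @ s @ q, p @ q) \<in> pres_rel m R"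
  unfolding pres_rel_def deletion_step_def using assms by blast

definition cls :: "nat \<Rightarrow> word set \<Rightarrow> word \<Rightarrow> word set" where
  "cls m R w = pres_rel m R `` {w}"

lemma cls_eq_iff: "cls m R u = cls m R v \<longleftrightarrow> (u, v) \<in> pres_rel m R"
proof
  assume eq: "cls m R u = cls m R v"
  have "v \<in> cls m R v" by (simp add: cls_def)
  then have "v \<in> cls m R u" by (simp only: eq)
  then show "(u, v) \<in> pres_rel m R" by (simp add: cls_def)
next
  assume uv: "(u, v) \<in> pres_rel m R"
  show "cls m R u = cls m R v"
  proof (intro equalityI subsetI)
    show "w \<in> cls m R v" if "w \<in> cls m R u" for w
      using that pres_rel_trans[OF pres_rel_sym[OF uv], of w] by (simp add: cls_def)
    show "w \<in> cls m R u" if "w \<in> cls m R v" for w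
      using that pres_rel_trans[OF uv, of w] by (simp add: cls_def)
  qed
qed

section \<open>Presented groups and their universal property\<close>

locale presentation =
  fixes m :: nat and R :: "word set"
  assumes relators: "R \<subseteq> words m"
begin

abbreviation P where "P \<equiv> presented_group m R"

lemma carrier_P: "carrier P = cls m R ` words m"
  by (auto simp: presented_group_def quotient_def cls_def)

lemma cls_closed [simp]: "w \<in> words m \<Longrightarrow> cls m R w \<in> carrier P"
  by (simp add: carrier_P)

lemma P_cases:
  assumes "C \<in> carrier P" obtains w where "w \<in> words m" "C = cls m R w"
  using assms by (auto simp: carrier_P)

lemma one_P: "\<one>\<^bsub>P\<^esub> = cls m R []"
  by (simp add: presented_group_def cls_def)

lemma mult_P:
  assumes "u \<in> words m" "v \<in> words m"
  shows "cls m R u \<otimes>\<^bsub>P\<^esub> cls m R v = cls m R (u @ v)"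
proof -
  have eq: "cls m R (u' @ v') = cls m R (u @ v)" if "u' \<in> cls m R u" "v' \<in> cls m R v" for u' v'
  proof -
    have r: "(u, u') \<in> pres_rel m R" "(v, v') \<in> pres_rel m R" using that by (simp_all add: cls_def)
    have "u' \<in> words m" using pres_rel_words[OF r(1) relators assms(1)] .
    from pres_rel_append[OF r this assms(2)] show ?thesis by (simp add: cls_eq_iff pres_rel_sym)
  qed
  have ne: "cls m R w \<noteq> {}" for w
    using pres_rel_refl[of w m R] unfolding cls_def by blast
  have "cls m R u \<otimes>\<^bsub>P\<^esub> cls m R v = (\<Union>u'\<in>cls m R u. \<Union>v'\<in>cls m R v. cls m R (u' @ v'))"
    by (simp add: presented_group_def cls_def)
  also have "\<dots> = (\<Union>u'\<in>cls m R u. \<Union>v'\<in>cls m R v. cls m R (u @ v))"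
    by (intro SUP_cong refl eq)
  also have "\<dots> = cls m R (u @ v)" using ne by simp
  finally show ?thesis .
qed

lemma winv_left: "w \<in> words m \<Longrightarrow> (winv w @ w, []) \<in> pres_rel m R"
proof (induction w)
  case (Cons a w)
  obtain i b where a: "a = (i, b)" by (cases a)
  have "[(i, \<not> b), (i, b)] \<in> R \<union> {[(i, b), (i, \<not> b)] | i b. i < m}"
    using Cons.prems a by (auto intro!: exI[of _ i] exI[of _ "\<not> b"])
  from pres_rel_delete[OF this, of "winv w" w] have
    1: "(winv w @ [(i, \<not> b), (i, b)] @ w, winv w @ w) \<in> pres_rel m R"
    using Cons.prems a by simp
  have "(winv w @ w, []) \<in> pres_rel m R" using Cons by (simp add: a)
  from pres_rel_trans[OF 1 this] show ?case by (simp add: a)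
qed simp

lemma group_P: "group P"
proof (rule groupI)
  fix C D assume "C \<in> carrier P" "D \<in> carrier P"
  then show "C \<otimes>\<^bsub>P\<^esub> D \<in> carrier P" by (elim P_cases) (simp add: mult_P)
next
  fix C D E assume "C \<in> carrier P" "D \<in> carrier P" "E \<in> carrier P"
  then show "C \<otimes>\<^bsub>P\<^esub> D \<otimes>\<^bsub>P\<^esub> E = C \<otimes>\<^bsub>P\<^esub> (D \<otimes>\<^bsub>P\<^esub> E)" by (elim P_cases) (simp add: mult_P)
next
  fix C assume "C \<in> carrier P"
  then obtain w where w: "w \<in> words m" "C = cls m R w" by (rule P_cases)
  then show "\<one>\<^bsub>P\<^esub> \<otimes>\<^bsub>P\<^esub> C = C" by (simp add: mult_P one_P)
  have "cls m R (winv w) \<otimes>\<^bsub>P\<^esub> C = \<one>\<^bsub>P\<^esub>"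
    using w winv_left by (simp add: mult_P one_P cls_eq_iff)
  then show "\<exists>D\<in>carrier P. D \<otimes>\<^bsub>P\<^esub> C = \<one>\<^bsub>P\<^esub>" using w by (intro bexI[of _ "cls m R (winv w)"]) simp_all
qed (simp add: one_P)

sublocale P: group P by (rule group_P)

definition gen :: "nat \<Rightarrow> word set" where "gen i = cls m R [(i, True)]"

lemma gen_closed [simp]: "i < m \<Longrightarrow> gen i \<in> carrier P"
  by (simp add: gen_def)

lemma inv_cls: "w \<in> words m \<Longrightarrow> inv\<^bsub>P\<^esub> cls m R w = cls m R (winv w)"
  by (rule P.inv_equality) (simp_all add: mult_P one_P cls_eq_iff winv_left)

lemma weval_gen: "w \<in> words m \<Longrightarrow> weval P gen w = cls m R w"
proof (induction w)
  case (Cons a w)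
  obtain i b where a: "a = (i, b)" by (cases a)
  have "(if b then gen i else inv\<^bsub>P\<^esub> gen i) = cls m R [(i, b)]"
    using Cons.prems by (auto simp: a gen_def inv_cls)
  then show ?case using Cons by (auto simp: a mult_P split: if_splits)
qed (simp add: one_P)

lemma relator_trivial: "r \<in> R \<Longrightarrow> cls m R r = \<one>\<^bsub>P\<^esub>"
  using pres_rel_delete[of r R m "[]" "[]"] by (simp add: one_P cls_eq_iff)

lemma weval_respects:
  assumes "group Q" and y: "\<And>i. i < m \<Longrightarrow> y i \<in> carrier Q"
    and R: "\<And>r. r \<in> R \<Longrightarrow> weval Q y r = \<one>\<^bsub>Q\<^esub>" and uv: "(u, v) \<in> pres_rel m R"
  shows "weval Q y u = weval Q y v"
proof -
  interpret Q: group Q by fact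
  have del: "weval Q y u = weval Q y v" if uv: "(u, v) \<in> deletion_step m R" for u v
  proof -
    obtain p s q where *: "u = p @ s @ q" "v = p @ q" "p \<in> words m" "q \<in> words m"
      "s \<in> R \<union> {[(i, b), (i, \<not> b)] | i b. i < m}"
      using uv unfolding deletion_step_def by blast
    have s: "s \<in> words m" "weval Q y s = \<one>\<^bsub>Q\<^esub>" using *(5) R relators y by auto
    show ?thesis
      using * s by (simp add: Q.weval_append[of m y, OF y] Q.weval_closed[of m y, OF y])
  qed
  show ?thesis
    using uv unfolding pres_rel_def
  proof (induction rule: rtrancl_induct)
    case (step a b)
    then show ?case using del[of a b] del[of b a] by auto
  qed simp
qed

definition lift :: "('a, 'b) monoid_scheme \<Rightarrow> (nat \<Rightarrow> 'a) \<Rightarrow> word set \<Rightarrow> 'a" where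
  "lift Q y C = weval Q y (SOME w. w \<in> words m \<and> C = cls m R w)"

lemma
  assumes "group Q" and y: "\<And>i. i < m \<Longrightarrow> y i \<in> carrier Q"
    and R: "\<And>r. r \<in> R \<Longrightarrow> weval Q y r = \<one>\<^bsub>Q\<^esub>"
  shows lift_cls: "w \<in> words m \<Longrightarrow> lift Q y (cls m R w) = weval Q y w"
    and lift_hom: "group_hom P Q (lift Q y)"
proof -
  interpret Q: group Q by fact
  have cls: "lift Q y (cls m R w) = weval Q y w" if w: "w \<in> words m" for w
  proof -
    define v where "v = (SOME v. v \<in> words m \<and> cls m R w = cls m R v)"
    have "v \<in> words m \<and> cls m R w = cls m R v" unfolding v_def by (rule someI[of _ w]) (simp add: w)
    then have "(w, v) \<in> pres_rel m R" by (simp add: cls_eq_iff)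
    then show ?thesis
      unfolding lift_def v_def[symmetric] using weval_respects[OF assms] by simp
  qed
  then show "w \<in> words m \<Longrightarrow> lift Q y (cls m R w) = weval Q y w" .
  show "group_hom P Q (lift Q y)"
  proof (intro group_hom.intro group_hom_axioms.intro group_P \<open>group Q\<close> homI)
    fix C D assume "C \<in> carrier P" "D \<in> carrier P"
    then show "lift Q y (C \<otimes>\<^bsub>P\<^esub> D) = lift Q y C \<otimes>\<^bsub>Q\<^esub> lift Q y D"
      by (elim P_cases) (simp add: mult_P cls Q.weval_append[of m y, OF y])
  next
    fix C assume "C \<in> carrier P"
    then show "lift Q y C \<in> carrier Q"
      by (elim P_cases) (simp add: cls Q.weval_closed[of m y, OF y])
  qed
qed

lemma finite_presentation_P: "finite R \<Longrightarrow> finite_presentation P m R"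
  unfolding finite_presentation_def using relators iso_set_refl by (auto simp: is_iso_def)

end

section \<open>Fox calculus\<close>

text \<open>Since modules are right modules, the derivations satisfy \<open>D(uv) = D(u) v + D(v)\<close>.\<close>

fun fox :: "('a, 'b) monoid_scheme \<Rightarrow> (nat \<Rightarrow> 'a) \<Rightarrow> nat \<Rightarrow> word \<Rightarrow> ('a \<Rightarrow>\<^sub>0 int)" where
  "fox \<Gamma> x j [] = 0"
| "fox \<Gamma> x j ((k, b) # v) = (if k = j then (if b then frag_of (weval \<Gamma> x v)
      else - frag_of (inv\<^bsub>\<Gamma>\<^esub> x k \<otimes>\<^bsub>\<Gamma>\<^esub> weval \<Gamma> x v)) else 0) + fox \<Gamma> x j v"

locale fox_setup = group \<Gamma> for \<Gamma> :: "('a, 'b) monoid_scheme" (structure) +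
  fixes x :: "nat \<Rightarrow> 'a" and d :: nat
  assumes letters: "i < d \<Longrightarrow> x i \<in> carrier \<Gamma>"
begin

abbreviation Z where "Z \<equiv> group_ring \<Gamma>"
abbreviation ev where "ev \<equiv> weval \<Gamma> x"
abbreviation D where "D \<equiv> fox \<Gamma> x"
definition W where "W = ev ` words d"

sublocale Z: ring Z by (rule group_ring_ring) (rule is_monoid)

lemma ev_closed [simp]: "w \<in> words d \<Longrightarrow> ev w \<in> carrier \<Gamma>"
  by (rule weval_closed[OF letters])

lemma ev_append: "\<lbrakk>u \<in> words d; v \<in> words d\<rbrakk> \<Longrightarrow> ev (u @ v) = ev u \<otimes> ev v"
  by (rule weval_append[OF letters])

lemma ev_winv: "w \<in> words d \<Longrightarrow> ev (winv w) = inv ev w"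
  by (rule weval_winv[OF letters])

lemma W_subgroup: "subgroup W \<Gamma>"
proof (rule subgroupI)
  show "W \<noteq> {}" unfolding W_def using words_simps(1)[of d] by blast
  show "inv a \<in> W" if "a \<in> W" for a
    using that unfolding W_def by (auto simp: ev_winv[symmetric])
  show "a \<otimes> b \<in> W" if "a \<in> W" "b \<in> W" for a b
    using that unfolding W_def by (auto simp: ev_append[symmetric])
qed (auto simp: W_def)

lemma W_carrier: "a \<in> W \<Longrightarrow> a \<in> carrier \<Gamma>"
  using subgroup.mem_carrier[OF W_subgroup] .

lemma ev_W [simp]: "w \<in> words d \<Longrightarrow> ev w \<in> W"
  by (simp add: W_def)

lemma letter_W [simp]: "i < d \<Longrightarrow> x i \<in> W"
  using ev_W[of "[(i, True)]"] letters by simp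

lemma W_m_closed [simp]: "\<lbrakk>a \<in> W; b \<in> W\<rbrakk> \<Longrightarrow> a \<otimes> b \<in> W"
  and W_inv_closed [simp]: "a \<in> W \<Longrightarrow> inv a \<in> W"
  and W_one [simp]: "\<one> \<in> W"
  using W_subgroup by (auto intro: subgroup.m_closed subgroup.m_inv_closed subgroup.one_closed)

lemma fox_keys: "w \<in> words d \<Longrightarrow> Poly_Mapping.keys (D j w) \<subseteq> W"
proof (induction w)
  case (Cons a w)
  obtain k b where a: "a = (k, b)" by (cases a)
  show ?case unfolding a fox.simps
    using Cons by (intro keys_add_subset) (auto simp: a)
qed simp

lemma fox_closed: "w \<in> words d \<Longrightarrow> D j w \<in> carrier Z"
  using fox_keys[of w j] W_carrier by auto

lemma fox_append:
  assumes "u \<in> words d" "v \<in> words d"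
  shows "D j (u @ v) = D j u \<otimes>\<^bsub>Z\<^esub> frag_of (ev v) + D j v"
  using assms(1)
proof (induction u)
  case (Cons a u)
  obtain k b where a: "a = (k, b)" by (cases a)
  have cl: "k < d" "u \<in> words d" "x k \<in> carrier \<Gamma>" "ev u \<in> carrier \<Gamma>" "ev v \<in> carrier \<Gamma>"
    using Cons.prems assms(2) letters by (auto simp: a)
  show ?case
    using cl Cons.IH assms(2)
    by (auto simp: a group_ring_mult_add group_ring_mult_minus group_ring_mult_zero ev_append m_assoc)
qed (simp add: group_ring_mult_zero)

text \<open>Deleting an inner pair of inverse letters does not change a derivative, so the
  derivative of \<open>winv w @ w\<close> is zero; the product rule then gives the formula.\<close>

lemma fox_winv_append:
  assumes "w \<in> words d"
  shows "D j (winv w) \<otimes>\<^bsub>Z\<^esub> frag_of (ev w) = - D j w"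
proof -
  have "D j (winv w @ w) = 0"
    using assms
  proof (induction w)
    case (Cons a w)
    obtain k b where a: "a = (k, b)" by (cases a)
    have cl: "k < d" "w \<in> words d" "x k \<in> carrier \<Gamma>" "ev w \<in> carrier \<Gamma>"
      using Cons.prems letters by (auto simp: a)
    let ?s = "[(k, \<not> b), (k, b)]"
    have s: "D j (?s @ w) = D j w" "ev (?s @ w) = ev w"
      using cl by (auto simp: inv_cancel)
    have "D j (winv (a # w) @ a # w) = D j (winv w @ (?s @ w))" by (simp add: a)
    also have "\<dots> = D j (winv w) \<otimes>\<^bsub>Z\<^esub> frag_of (ev w) + D j w"
      using cl by (subst fox_append) (simp_all only: s winv_words words_simps)
    also have "\<dots> = D j (winv w @ w)" using cl by (simp add: fox_append)
    finally show ?case using Cons.IH cl by simp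
  qed simp
  then show ?thesis using assms by (simp add: fox_append eq_neg_iff_add_eq_0)
qed

text \<open>Makes the derivatives functions on the free group, although they are computed on
  words.\<close>

lemma fox_respects:
  assumes "(u, v) \<in> pres_rel d {}" shows "D j u = D j v"
proof -
  have del: "D j u = D j v" if uv: "(u, v) \<in> deletion_step d {}" for u v
  proof -
    obtain p k b q where *: "u = p @ [(k, b), (k, \<not> b)] @ q" "v = p @ q" "p \<in> words d" "q \<in> words d" "k < d"
      using uv unfolding deletion_step_def by blast
    have s: "D j ([(k, b), (k, \<not> b)] @ q) = D j q" "ev ([(k, b), (k, \<not> b)] @ q) = ev q"
      using * letters[OF *(5)] by (auto simp: inv_cancel)
    have "D j u = D j p \<otimes>\<^bsub>Z\<^esub> frag_of (ev q) + D j q"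
      unfolding *(1) using * by (subst fox_append) (simp_all only: s words_simps)
    then show ?thesis using * by (simp add: fox_append)
  qed
  show ?thesis
    using assms unfolding pres_rel_def
  proof (induction rule: rtrancl_induct)
    case (step a b)
    then show ?case using del[of a b] del[of b a] by auto
  qed simp
qed

text \<open>By the product rule the outer terms are \<open>D j (winv v)\<close> times
  \<open>ev v\<close> and \<open>D j v\<close>, which cancel. Conjugation of loops thus becomes the
  right module action on Fox coordinates.\<close>

lemma fox_conj:
  assumes "w \<in> words d" "v \<in> words d" "ev w = \<one>"
  shows "D j (winv v @ w @ v) = D j w \<otimes>\<^bsub>Z\<^esub> frag_of (ev v)"
  using assms fox_winv_append[OF assms(2), of j]
  by (simp add: fox_append ev_append)

lemma fox_loops:
  assumes "u \<in> words d" "v \<in> words d" "ev v = \<one>"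
  shows "D j (u @ v) = D j u + D j v"
  using assms fox_closed[OF assms(1), of j] Z.r_one[of "D j u"] by (simp add: fox_append)

lemma fox_loop_winv:
  assumes "w \<in> words d" "ev w = \<one>" shows "D j (winv w) = - D j w"
  using fox_winv_append[OF assms(1), of j] assms(2) fox_closed[of "winv w" j] assms(1)
    Z.r_one[of "D j (winv w)"] by simp

text \<open>The fundamental formula of Fox calculus: the path spelled by \<open>w\<close> in the
  Cayley graph has its end minus its start as boundary. In particular the coordinates of a loop form
  a cycle.\<close>

lemma fox_fundamental:
  assumes "w \<in> words d"
  shows "(\<Sum>j<d. (frag_of (x j) - frag_of \<one>) \<otimes>\<^bsub>Z\<^esub> D j w) = frag_of (ev w) - frag_of \<one>"
  using assms
proof (induction w)
  case Nil
  then show ?case by (simp add: group_ring_mult_zero)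
next
  case (Cons a w)
  obtain k b where a: "a = (k, b)" by (cases a)
  have cl: "k < d" "w \<in> words d" "x k \<in> carrier \<Gamma>" "ev w \<in> carrier \<Gamma>"
    using Cons.prems letters by (auto simp: a)
  define e where "e = (if b then frag_of (ev w) else - frag_of (inv x k \<otimes> ev w))"
  have D: "D j (a # w) = (if k = j then e else 0) + D j w" for j by (simp add: a e_def)
  have "(\<Sum>j<d. (frag_of (x j) - frag_of \<one>) \<otimes>\<^bsub>Z\<^esub> D j (a # w)) =
    (\<Sum>j<d. if k = j then (frag_of (x k) - frag_of \<one>) \<otimes>\<^bsub>Z\<^esub> e else 0) +
    (\<Sum>j<d. (frag_of (x j) - frag_of \<one>) \<otimes>\<^bsub>Z\<^esub> D j w)"
    unfolding D group_ring_mult_add sum.distrib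
    by (intro arg_cong2[of _ _ _ _ "(+)"] sum.cong refl) (auto simp: group_ring_mult_zero)
  also have "\<dots> = (frag_of (x k) - frag_of \<one>) \<otimes>\<^bsub>Z\<^esub> e + (frag_of (ev w) - frag_of \<one>)"
    using cl Cons.IH by simp
  also have "(frag_of (x k) - frag_of \<one>) \<otimes>\<^bsub>Z\<^esub> e = frag_of (ev (a # w)) - frag_of (ev w)"
    using cl by (auto simp: e_def a group_ring_mult_diff group_ring_mult_minus inv_cancel)
  finally show ?case by simp
qed

text \<open>Conversely, a family killed by the boundary \<open>e\<^sub>j \<mapsto> x\<^sub>j - 1\<close> comes from a loop in the Cayley
  graph: the edge \<open>e\<^sub>j \<gamma>\<close> is closed up along chosen words for its end points.\<close>

lemma fox_realization:
  assumes y: "\<And>j. j < d \<Longrightarrow> Poly_Mapping.keys (y j) \<subseteq> W"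
    and cycle: "(\<Sum>j<d. (frag_of (x j) - frag_of \<one>) \<otimes>\<^bsub>Z\<^esub> y j) = 0"
  shows "\<exists>w\<in>words d. ev w = \<one> \<and> (\<forall>j<d. D j w = y j)"
proof -
  have "\<forall>\<gamma>\<in>W. \<exists>w. w \<in> words d \<and> ev w = \<gamma>" unfolding W_def by blast
  from bchoice[OF this] obtain s where s: "\<And>\<gamma>. \<gamma> \<in> W \<Longrightarrow> s \<gamma> \<in> words d" "\<And>\<gamma>. \<gamma> \<in> W \<Longrightarrow> ev (s \<gamma>) = \<gamma>"
    by blast
  \<comment> \<open>\<open>\<sigma> i\<close> extends the coordinates of the chosen paths linearly.
    Closing up an edge costs \<sigma> of its boundary, so for a cycle the total correction is
    zero.\<close>
  define \<sigma> where "\<sigma> i = frag_extend (\<lambda>\<gamma>. D i (s \<gamma>))" for i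
  have \<sigma>_add: "\<sigma> i (a + b) = \<sigma> i a + \<sigma> i b" "\<sigma> i (a - b) = \<sigma> i a - \<sigma> i b" "\<sigma> i 0 = 0"
    "\<sigma> i (frag_of \<gamma>) = D i (s \<gamma>)" for i a b \<gamma>
    by (simp_all add: \<sigma>_def frag_extend_add frag_extend_diff)
  define loopy where "loopy f \<longleftrightarrow> (\<exists>w\<in>words d. ev w = \<one> \<and> (\<forall>i<d. D i w = f i))" for f
  have loopy_add: "loopy (\<lambda>i. f i + g i)" if fg: "loopy f" "loopy g" for f g
  proof -
    obtain u where u: "u \<in> words d" "ev u = \<one>" "\<forall>i<d. D i u = f i" using fg(1) unfolding loopy_def by blast
    obtain v where v: "v \<in> words d" "ev v = \<one>" "\<forall>i<d. D i v = g i" using fg(2) unfolding loopy_def by blast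
    show ?thesis unfolding loopy_def
      using u v by (intro bexI[of _ "u @ v"]) (simp_all add: fox_loops ev_append)
  qed
  have loopy_minus: "loopy (\<lambda>i. - f i)" if f: "loopy f" for f
  proof -
    obtain u where u: "u \<in> words d" "ev u = \<one>" "\<forall>i<d. D i u = f i" using f unfolding loopy_def by blast
    show ?thesis unfolding loopy_def
      using u by (intro bexI[of _ "winv u"]) (simp_all add: fox_loop_winv ev_winv)
  qed
  have loopy_zero: "loopy (\<lambda>i. 0)" unfolding loopy_def by (intro bexI[of _ "[]"]) simp_all
  have loopy_cong: "loopy g" if "loopy f" "\<And>i. i < d \<Longrightarrow> f i = g i" for f g
    using that unfolding loopy_def by auto
  have edge: "loopy (\<lambda>i. (if i = j then e else 0) - \<sigma> i ((frag_of (x j) - frag_of \<one>) \<otimes>\<^bsub>Z\<^esub> e))"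
    if j: "j < d" and e: "Poly_Mapping.keys e \<subseteq> W" for j e
  proof (rule free_Abelian_group_induct[of e W], goal_cases)
    case 1
    then show ?case using e .
  next
    case 2
    then show ?case using loopy_zero by (simp add: group_ring_mult_zero \<sigma>_add)
  next
    case (3 a b)
    show ?case
      using loopy_add[OF 3(3) loopy_minus[OF 3(4)]]
      by (rule loopy_cong) (simp add: group_ring_mult_diff \<sigma>_add)
  next
    case (4 \<gamma>)
    have g: "s \<gamma> \<in> words d" "ev (s \<gamma>) = \<gamma>" "s (x j \<otimes> \<gamma>) \<in> words d" "ev (s (x j \<otimes> \<gamma>)) = x j \<otimes> \<gamma>"
      "\<gamma> \<in> carrier \<Gamma>" "x j \<in> carrier \<Gamma>"
      using 4 j s letters W_carrier by auto
    let ?p = "(j, True) # s \<gamma>" and ?a = "s (x j \<otimes> \<gamma>)"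
    have p: "?p \<in> words d" "ev ?p = ev ?a" using g j by auto
    have ev: "ev (winv ?a @ ?p) = \<one>"
      using g p by (subst ev_append) (simp_all only: ev_winv winv_words p(2), simp_all)
    have D: "D i (winv ?a @ ?p) = - D i ?a + ((if i = j then frag_of \<gamma> else 0) + D i (s \<gamma>))" for i
    proof -
      have "D i (winv ?a @ ?p) = D i (winv ?a) \<otimes>\<^bsub>Z\<^esub> frag_of (ev ?a) + D i ?p"
        using g p by (simp only: fox_append winv_words p(2))
      also have "D i (winv ?a) \<otimes>\<^bsub>Z\<^esub> frag_of (ev ?a) = - D i ?a" by (rule fox_winv_append[OF g(3)])
      also have "D i ?p = (if i = j then frag_of \<gamma> else 0) + D i (s \<gamma>)" using g by auto
      finally show ?thesis .
    qed
    have "winv ?a @ ?p \<in> words d" using g p by simp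
    then have "loopy (\<lambda>i. - D i ?a + ((if i = j then frag_of \<gamma> else 0) + D i (s \<gamma>)))"
      unfolding loopy_def using ev D by blast
    then show ?case
      by (rule loopy_cong) (use g in \<open>simp_all add: group_ring_mult_diff \<sigma>_add\<close>)
  qed
  have "loopy (\<lambda>i. (if i < k then y i else 0) - \<sigma> i (\<Sum>j<k. (frag_of (x j) - frag_of \<one>) \<otimes>\<^bsub>Z\<^esub> y j))"
    if "k \<le> d" for k
    using that
  proof (induction k)
    case 0
    then show ?case using loopy_zero by (simp add: \<sigma>_add)
  next
    case (Suc k)
    have "loopy (\<lambda>i. ((if i < k then y i else 0) - \<sigma> i (\<Sum>j<k. (frag_of (x j) - frag_of \<one>) \<otimes>\<^bsub>Z\<^esub> y j)) +
      ((if i = k then y k else 0) - \<sigma> i ((frag_of (x k) - frag_of \<one>) \<otimes>\<^bsub>Z\<^esub> y k)))"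
      using Suc y by (intro loopy_add edge) auto
    then show ?case by (rule loopy_cong) (auto simp: \<sigma>_add less_Suc_eq)
  qed
  from this[of d] have "loopy (\<lambda>i. (if i < d then y i else 0))"
    using cycle by (simp add: \<sigma>_add)
  then show ?thesis unfolding loopy_def by auto
qed

end

lemma (in group_hom) fox_hom:
  assumes "\<And>i. i < d \<Longrightarrow> x i \<in> carrier G" "w \<in> words d"
  shows "fox H (\<lambda>i. h (x i)) j w = frag_extend (\<lambda>\<gamma>. frag_of (h \<gamma>)) (fox G x j w)"
  using assms(2)
proof (induction w)
  case (Cons a w)
  obtain k b where a: "a = (k, b)" by (cases a)
  have cl: "k < d" "w \<in> words d" "x k \<in> carrier G" "weval G x w \<in> carrier G"
    using Cons.prems assms(1) G.weval_closed[of d x w, OF assms(1)] by (auto simp: a)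
  show ?case
    using cl Cons.IH hom_weval[of d x w, OF assms(1)]
    by (auto simp: a frag_extend_add frag_extend_minus)
qed simp

section \<open>The Magnus embedding\<close>

text \<open>In the application the \<open>g i\<close> generate only part of \<open>G\<close>, so the
  statements are about words in them and about \<open>F.W\<close>, the subgroup of \<open>H\<close>
  that they reach.\<close>

locale magnus = group_hom G H h
  for G :: "('a, 'x) monoid_scheme" (structure) and H :: "('c, 'y) monoid_scheme" and h +
  fixes g :: "nat \<Rightarrow> 'a" and d :: nat
  assumes gens: "i < d \<Longrightarrow> g i \<in> carrier G"
begin

sublocale F: fox_setup H "\<lambda>i. h (g i)" d
  by unfold_locales (simp add: gens)

abbreviation eg where "eg \<equiv> weval G g"

lemma eg_closed [simp]: "w \<in> words d \<Longrightarrow> eg w \<in> carrier G"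
  by (rule G.weval_closed[OF gens])

lemma eg_append: "\<lbrakk>u \<in> words d; v \<in> words d\<rbrakk> \<Longrightarrow> eg (u @ v) = eg u \<otimes> eg v"
  by (rule G.weval_append[OF gens])

lemma eg_winv: "w \<in> words d \<Longrightarrow> eg (winv w) = inv eg w"
  by (rule G.weval_winv[OF gens])

lemma h_eg: "w \<in> words d \<Longrightarrow> h (eg w) = F.ev w"
  by (rule hom_weval[OF gens])

lemma W_image: "F.W = h ` eg ` words d"
  unfolding F.W_def image_image using h_eg by (intro image_cong) simp_all

lemma W_sub: "F.W \<subseteq> h ` carrier G"
  unfolding W_image by (intro image_mono) auto

text \<open>The empty word is forced at the neutral element, so that closing up does not alter a
  word which is already a loop.\<close>

definition sec :: "'c \<Rightarrow> word" where
  "sec \<gamma> = (if \<gamma> = \<one>\<^bsub>H\<^esub> then [] else (SOME w. w \<in> words d \<and> F.ev w = \<gamma>))"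

lemma sec: "\<gamma> \<in> F.W \<Longrightarrow> sec \<gamma> \<in> words d" "\<gamma> \<in> F.W \<Longrightarrow> F.ev (sec \<gamma>) = \<gamma>"
proof -
  assume "\<gamma> \<in> F.W"
  then have "\<exists>w. w \<in> words d \<and> F.ev w = \<gamma>" unfolding F.W_def by blast
  from someI_ex[OF this] show "sec \<gamma> \<in> words d" "F.ev (sec \<gamma>) = \<gamma>"
    unfolding sec_def by auto
qed

definition edge :: "nat \<Rightarrow> 'c \<Rightarrow> 'a set" where
  "edge j \<gamma> = cs (inv eg (sec (h (g j) \<otimes>\<^bsub>H\<^esub> \<gamma>)) \<otimes> g j \<otimes> eg (sec \<gamma>))"

text \<open>The inverse of the Magnus embedding: \<open>e\<^sub>j \<gamma>\<close> goes to the loop along the edge \<open>e\<^sub>j \<gamma>\<close>, closed up by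
  the chosen words for its end points.\<close>

definition T :: "(nat \<Rightarrow> ('c \<Rightarrow>\<^sub>0 int)) \<Rightarrow> 'a set" where
  "T y = finprod Kab (\<lambda>j. Kab.frag_prod (edge j) (y j)) {..<d}"

lemma loop_ker: "\<lbrakk>u \<in> words d; v \<in> words d; F.ev u = F.ev v\<rbrakk> \<Longrightarrow> inv eg u \<otimes> eg v \<in> ker"
  by (simp add: ker_iff h_eg)

lemma edge_ker:
  assumes "j < d" "\<gamma> \<in> F.W"
  shows "inv eg (sec (h (g j) \<otimes>\<^bsub>H\<^esub> \<gamma>)) \<otimes> g j \<otimes> eg (sec \<gamma>) \<in> ker"
proof -
  have "sec \<gamma> \<in> words d" "F.ev (sec \<gamma>) = \<gamma>" "sec (h (g j) \<otimes>\<^bsub>H\<^esub> \<gamma>) \<in> words d"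
    "F.ev (sec (h (g j) \<otimes>\<^bsub>H\<^esub> \<gamma>)) = h (g j) \<otimes>\<^bsub>H\<^esub> \<gamma>" "\<gamma> \<in> carrier H"
    using sec assms F.W_carrier by simp_all
  then show ?thesis using gens[OF assms(1)] by (simp add: ker_iff h_eg H.m_assoc)
qed

lemma edge_closed: "\<lbrakk>j < d; \<gamma> \<in> F.W\<rbrakk> \<Longrightarrow> edge j \<gamma> \<in> carrier Kab"
  unfolding edge_def by (rule cs_closed[OF edge_ker])

lemma frag_edge_closed: "\<lbrakk>j < d; Poly_Mapping.keys r \<subseteq> F.W\<rbrakk> \<Longrightarrow> Kab.frag_prod (edge j) r \<in> carrier Kab"
  by (rule Kab.frag_prod_closed[of _ F.W]) (simp_all add: edge_closed)

lemma T_closed: "(\<And>j. j < d \<Longrightarrow> Poly_Mapping.keys (y j) \<subseteq> F.W) \<Longrightarrow> T y \<in> carrier Kab"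
  unfolding T_def by (intro Kab.finprod_closed) (auto intro: frag_edge_closed)

lemma T_add:
  assumes "\<And>j. j < d \<Longrightarrow> Poly_Mapping.keys (y j) \<subseteq> F.W" "\<And>j. j < d \<Longrightarrow> Poly_Mapping.keys (z j) \<subseteq> F.W"
  shows "T (\<lambda>j. y j + z j) = T y \<otimes>\<^bsub>Kab\<^esub> T z"
proof -
  have "T (\<lambda>j. y j + z j) =
    finprod Kab (\<lambda>j. Kab.frag_prod (edge j) (y j) \<otimes>\<^bsub>Kab\<^esub> Kab.frag_prod (edge j) (z j)) {..<d}"
    unfolding T_def
  proof (rule Kab.finprod_cong'[OF refl])
    show "(\<lambda>j. Kab.frag_prod (edge j) (y j) \<otimes>\<^bsub>Kab\<^esub> Kab.frag_prod (edge j) (z j)) \<in> {..<d} \<rightarrow> carrier Kab"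
      using assms frag_edge_closed by auto
    fix j assume "j \<in> {..<d}"
    then show "Kab.frag_prod (edge j) (y j + z j) =
      Kab.frag_prod (edge j) (y j) \<otimes>\<^bsub>Kab\<^esub> Kab.frag_prod (edge j) (z j)"
      using assms edge_closed by (intro Kab.frag_prod_add[of F.W]) auto
  qed
  also have "\<dots> = T y \<otimes>\<^bsub>Kab\<^esub> T z"
    unfolding T_def using assms frag_edge_closed by (intro Kab.finprod_multf) auto
  finally show ?thesis .
qed

lemma T_zero: "T (\<lambda>j. 0) = \<one>\<^bsub>Kab\<^esub>"
  unfolding T_def by (intro Kab.finprod_one_eqI) (simp add: Kab.frag_prod_zero)

lemma T_cong:
  assumes "\<And>j. j < d \<Longrightarrow> y j = z j" "\<And>j. j < d \<Longrightarrow> Poly_Mapping.keys (z j) \<subseteq> F.W"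
  shows "T y = T z"
  unfolding T_def using assms by (intro Kab.finprod_cong') (auto intro: frag_edge_closed)

lemma T_minus:
  assumes "\<And>j. j < d \<Longrightarrow> Poly_Mapping.keys (y j) \<subseteq> F.W"
  shows "T (\<lambda>j. - y j) = inv\<^bsub>Kab\<^esub> T y"
proof -
  have "T (\<lambda>j. - y j) \<otimes>\<^bsub>Kab\<^esub> T y = \<one>\<^bsub>Kab\<^esub>"
    using T_add[of "\<lambda>j. - y j" y] assms by (simp add: T_zero)
  then show ?thesis
    using T_closed[of y] T_closed[of "\<lambda>j. - y j"] assms by (intro Kab.inv_equality[symmetric]) simp_all
qed

lemma T_single:
  assumes "k < d" "\<gamma> \<in> F.W"
  shows "T (\<lambda>j. if k = j then frag_of \<gamma> else 0) = edge k \<gamma>"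
proof -
  have "T (\<lambda>j. if k = j then frag_of \<gamma> else 0) =
    finprod Kab (\<lambda>j. if k = j then edge j \<gamma> else \<one>\<^bsub>Kab\<^esub>) {..<d}"
    unfolding T_def using assms edge_closed
    by (intro Kab.finprod_cong') (auto simp: Kab.frag_prod_of Kab.frag_prod_zero)
  also have "\<dots> = edge k \<gamma>"
    using assms edge_closed by (intro Kab.finprod_singleton) auto
  finally show ?thesis .
qed

text \<open>Telescoping: the closing word at the end of one edge is cancelled by the one at the
  start of the next. For a loop only the class of \<open>w\<close> remains, so it is recovered from
  its Fox coordinates.\<close>

lemma T_fox:
  assumes "w \<in> words d"
  shows "T (\<lambda>j. F.D j w) = cs (inv eg (sec (F.ev w)) \<otimes> eg w)"
  using assms
proof (induction w)
  case Nil
  then show ?case by (simp add: T_zero sec_def cs_one)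
next
  case (Cons a w)
  obtain k b where a: "a = (k, b)" by (cases a)
  have cl: "k < d" "w \<in> words d" "g k \<in> carrier G" "eg w \<in> carrier G" "F.ev w \<in> F.W"
    "h (g k) \<in> carrier H" "F.ev w \<in> carrier H" "F.ev (a # w) \<in> F.W"
    using Cons.prems gens F.ev_W[of "a # w"] by (auto simp: a)
  define e where "e = (if b then frag_of (F.ev w) else - frag_of (inv\<^bsub>H\<^esub> h (g k) \<otimes>\<^bsub>H\<^esub> F.ev w))"
  have e: "Poly_Mapping.keys e \<subseteq> F.W" using cl by (auto simp: e_def)
  have "T (\<lambda>j. F.D j (a # w)) = T (\<lambda>j. (if k = j then e else 0) + F.D j w)"
    using e F.fox_keys[OF cl(2)] by (intro T_cong keys_add_subset) (auto simp: a e_def)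
  also have "\<dots> = T (\<lambda>j. if k = j then e else 0) \<otimes>\<^bsub>Kab\<^esub> T (\<lambda>j. F.D j w)"
    using e F.fox_keys[OF cl(2)] by (intro T_add) auto
  also have "T (\<lambda>j. if k = j then e else 0) = cs (inv eg (sec (F.ev (a # w))) \<otimes> eg [a] \<otimes> eg (sec (F.ev w)))"
  proof (cases b)
    case True
    then have e': "e = frag_of (F.ev w)" by (simp add: e_def)
    show ?thesis using True cl T_single[of k "F.ev w"] unfolding e' by (simp add: a edge_def)
  next
    case False
    \<comment> \<open>An inverse letter runs backwards along the edge that starts at
      \<open>?\<gamma>\<close> and ends at \<open>F.ev w\<close>.\<close>
    let ?\<gamma> = "inv\<^bsub>H\<^esub> h (g k) \<otimes>\<^bsub>H\<^esub> F.ev w"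
    have g: "?\<gamma> \<in> F.W" "h (g k) \<otimes>\<^bsub>H\<^esub> ?\<gamma> = F.ev w" "F.ev (a # w) = ?\<gamma>"
      using cl False by (simp_all add: H.inv_cancel a)
    have s: "eg (sec ?\<gamma>) \<in> carrier G" "eg (sec (F.ev w)) \<in> carrier G"
      using sec(1)[OF g(1)] sec(1)[OF cl(5)] by simp_all
    have "T (\<lambda>j. if k = j then e else 0) = T (\<lambda>j. - (if k = j then frag_of ?\<gamma> else 0))"
      using g by (intro T_cong) (auto simp: e_def False)
    also have "\<dots> = inv\<^bsub>Kab\<^esub> edge k ?\<gamma>"
      using g cl T_single[of k ?\<gamma>] by (subst T_minus) auto
    also have "\<dots> = cs (inv (inv eg (sec (F.ev w)) \<otimes> g k \<otimes> eg (sec ?\<gamma>)))"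
      using edge_ker[OF cl(1) g(1)] unfolding edge_def g(2) by (simp add: cs_inv)
    also have "inv (inv eg (sec (F.ev w)) \<otimes> g k \<otimes> eg (sec ?\<gamma>)) =
      inv eg (sec ?\<gamma>) \<otimes> inv g k \<otimes> eg (sec (F.ev w))"
      using s cl by (simp add: G.inv_mult_group G.m_assoc)
    finally show ?thesis using cl False g(3) by (simp add: a)
  qed
  also have "T (\<lambda>j. F.D j w) = cs (inv eg (sec (F.ev w)) \<otimes> eg w)" using Cons by (simp add: a)
  also have "cs (inv eg (sec (F.ev (a # w))) \<otimes> eg [a] \<otimes> eg (sec (F.ev w))) \<otimes>\<^bsub>Kab\<^esub> cs (inv eg (sec (F.ev w)) \<otimes> eg w)
    = cs (inv eg (sec (F.ev (a # w))) \<otimes> eg (a # w))"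
  proof -
    have w1: "[a] \<in> words d" using Cons.prems by (simp add: a)
    have s: "sec (F.ev (a # w)) \<in> words d" "F.ev (sec (F.ev (a # w))) = F.ev (a # w)"
      "sec (F.ev w) \<in> words d" "F.ev (sec (F.ev w)) = F.ev w"
      using sec cl by simp_all
    have aw: "eg (a # w) = eg [a] \<otimes> eg w" using eg_append[OF w1 cl(2)] by simp
    have eva: "F.ev (a # w) = F.ev [a] \<otimes>\<^bsub>H\<^esub> F.ev w" using F.ev_append[OF w1 cl(2)] by simp
    have k1: "inv eg (sec (F.ev (a # w))) \<otimes> eg [a] \<otimes> eg (sec (F.ev w)) \<in> ker"
      using s w1 cl F.ev_closed[OF w1] eva unfolding ker_iff
      by (simp only: hom_mult hom_inv h_eg eg_closed G.m_closed G.inv_closed H.m_assoc H.inv_closed H.m_closed H.l_inv)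
    have k2: "inv eg (sec (F.ev w)) \<otimes> eg w \<in> ker" using s cl by (intro loop_ker) simp_all
    have "(inv eg (sec (F.ev (a # w))) \<otimes> eg [a] \<otimes> eg (sec (F.ev w))) \<otimes> (inv eg (sec (F.ev w)) \<otimes> eg w) =
      inv eg (sec (F.ev (a # w))) \<otimes> eg (a # w)"
      using eg_closed[OF s(1)] eg_closed[OF s(3)] eg_closed[OF w1] eg_closed[OF cl(2)]
      by (simp only: aw G.m_assoc G.m_closed G.inv_closed G.inv_cancel)
    then show ?thesis using cs_mult[OF k1 k2] by simp
  qed
  finally show ?case .
qed

text \<open>Valid whatever relations hold in \<open>G\<close>. What relations can spoil is the
  converse, that equal classes have equal Fox coordinates; see \<open>cs_fb_unique\<close>.\<close>

lemma magnus_injective: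
  assumes "w \<in> words d" "F.ev w = \<one>\<^bsub>H\<^esub>" "\<And>j. j < d \<Longrightarrow> F.D j w = 0"
  shows "cs (eg w) = \<one>\<^bsub>Kab\<^esub>"
proof -
  have "T (\<lambda>j. F.D j w) = T (\<lambda>j. 0)" by (rule T_cong) (simp_all add: assms(3))
  then show ?thesis using T_fox[OF assms(1)] assms by (simp add: T_zero sec_def)
qed

text \<open>Both sides are additive in \<open>r\<close>; for a group element the action is
  conjugation, and \<open>fox_conj\<close> applies.\<close>

lemma T_act:
  assumes w: "w \<in> words d" "F.ev w = \<one>\<^bsub>H\<^esub>" and r: "Poly_Mapping.keys r \<subseteq> F.W"
  shows "T (\<lambda>j. F.D j w \<otimes>\<^bsub>group_ring H\<^esub> r) = act KM (cs (eg w)) r"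
proof (rule Kab.frag_hom_eq[OF _ _ _ r])
  have kw: "eg w \<in> ker" using w by (simp add: ker_iff h_eg)
  show "act KM (cs (eg w)) \<in> hom (free_Abelian_group F.W) Kab"
    by (rule act_KM_hom[OF cs_closed[OF kw] W_sub])
  have keys: "Poly_Mapping.keys (F.D j w \<otimes>\<^bsub>group_ring H\<^esub> r) \<subseteq> F.W"
    if "Poly_Mapping.keys r \<subseteq> F.W" for j r
    using keys_group_ring_mult[OF F.fox_keys[OF w(1)] that F.W_m_closed] by simp
  show "(\<lambda>r. T (\<lambda>j. F.D j w \<otimes>\<^bsub>group_ring H\<^esub> r)) \<in> hom (free_Abelian_group F.W) Kab"
    by (rule homI) (simp_all add: keys T_closed T_add group_ring_mult_add)
  fix \<gamma> assume "\<gamma> \<in> F.W"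
  then obtain v where v: "v \<in> words d" "\<gamma> = F.ev v" unfolding F.W_def by blast
  have "F.D j w \<otimes>\<^bsub>group_ring H\<^esub> frag_of \<gamma> = F.D j (winv v @ w @ v)" for j
    using F.fox_conj[OF w(1) v(1) w(2), of j] v(2) by simp
  then have "T (\<lambda>j. F.D j w \<otimes>\<^bsub>group_ring H\<^esub> frag_of \<gamma>) = T (\<lambda>j. F.D j (winv v @ w @ v))" by simp
  also have "\<dots> = cs (inv eg (sec (F.ev (winv v @ w @ v))) \<otimes> eg (winv v @ w @ v))"
    using v w by (intro T_fox) simp
  also have "F.ev (winv v @ w @ v) = \<one>\<^bsub>H\<^esub>"
    using v w by (simp add: F.ev_append F.ev_winv)
  also have "cs (inv eg (sec \<one>\<^bsub>H\<^esub>) \<otimes> eg (winv v @ w @ v)) = cs (inv eg v \<otimes> eg w \<otimes> eg v)"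
    using v w by (simp add: sec_def eg_append eg_winv G.m_assoc)
  also have "\<dots> = act KM (cs (eg w)) (frag_of (h (eg v)))"
    by (rule act_KM_cs[symmetric]) (use kw v in simp_all)
  finally show "T (\<lambda>j. F.D j w \<otimes>\<^bsub>group_ring H\<^esub> frag_of \<gamma>) = act KM (cs (eg w)) (frag_of \<gamma>)"
    using v by (simp add: h_eg)
qed

end

text \<open>The exponent sum of the letter \<open>j\<close> is a homomorphism to the integers; it
  vanishes on roots of products of commutators and equals one here.\<close>

lemma free_generator_not_in_derived:
  assumes j: "j < d" shows "cls d {} [(j, True)] \<notin> rational_derived (presented_group d {}) 1"
proof
  interpret Fr: presentation d "{}" by unfold_locales simp
  let ?F = "presented_group d {}" and ?c = "cls d {} [(j, True)]"
  assume c: "?c \<in> rational_derived ?F 1"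
  define f where "f k = (if k = j then 1 else 0 :: int)" for k :: nat
  define h where "h = Fr.lift integer_group f"
  interpret h: group_hom ?F integer_group h
    unfolding h_def by (rule Fr.lift_hom) simp_all
  have hj: "h ?c = 1"
    unfolding h_def using j by (subst Fr.lift_cls) (simp_all add: f_def)
  obtain k :: int where k: "k \<noteq> 0" "?c [^]\<^bsub>?F\<^esub> k \<in> derived ?F (carrier ?F)"
    using c by (auto simp: rational_derived.simps(2))
  have "h ` derived ?F (carrier ?F) = derived integer_group (h ` carrier ?F)"
    by (rule h.derived_img[symmetric]) simp
  also have "\<dots> = {0}"
    using comm_group.derived_eq_singleton[OF abelian_integer_group, of "h ` carrier ?F"] by simp
  finally have "h (?c [^]\<^bsub>?F\<^esub> k) = 0" using k(2) by blast
  moreover have "h (?c [^]\<^bsub>?F\<^esub> k) = k"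
    using h.hom_int_pow[of ?c k] hj j by simp
  ultimately show False using k(1) by simp
qed

text \<open>A common right multiple \<open>(x\<^sub>0 - 1) c = (x\<^sub>j - 1) c'\<close> is the same thing as a cycle with the two
  coordinates \<open>c\<close> and \<open>-c'\<close>.\<close>

lemma (in fox_setup) fox_dual_loop:
  assumes ore: "right_ore_domain (group_ring (\<Gamma>\<lparr>carrier := W\<rparr>))" and j: "1 \<le> j" "j < d"
    and nontriv: "x 0 \<noteq> \<one>" "x j \<noteq> \<one>"
  shows "\<exists>w\<in>words d. ev w = \<one> \<and> D j w \<noteq> 0 \<and> (\<forall>k<d. 1 \<le> k \<and> k \<noteq> j \<longrightarrow> D k w = 0)"
proof -
  let ?R = "group_ring (\<Gamma>\<lparr>carrier := W\<rparr>)"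
  interpret R: right_ore_domain ?R by (rule ore)
  define u where "u k = frag_of (x k) - frag_of \<one>" for k
  have u: "u k \<in> nonzeros ?R" if k: "k < d" "x k \<noteq> \<one>" for k
  proof -
    have "u k \<noteq> 0" using k(2) unfolding u_def by (metis eq_iff_diff_eq_0 frag_of_eq)
    moreover have "Poly_Mapping.keys (u k) \<subseteq> W"
      unfolding u_def by (rule keys_diff_subset) (use k(1) in simp_all)
    ultimately show ?thesis by (simp add: nonzeros_def)
  qed
  obtain c c' where c: "c \<in> nonzeros ?R" "c' \<in> nonzeros ?R" "u 0 \<otimes>\<^bsub>?R\<^esub> c = u j \<otimes>\<^bsub>?R\<^esub> c'"
    using R.ore[OF u[of 0] u[of j]] j nontriv by auto
  have cW: "Poly_Mapping.keys c \<subseteq> W" "Poly_Mapping.keys c' \<subseteq> W" "c' \<noteq> 0"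
    using c by (simp_all add: nonzeros_def)
  define y where "y k = (if k = 0 then c else if k = j then - c' else 0)" for k
  have "\<exists>w\<in>words d. ev w = \<one> \<and> (\<forall>k<d. D k w = y k)"
  proof (rule fox_realization)
    show "Poly_Mapping.keys (y k) \<subseteq> W" if "k < d" for k
      using cW unfolding y_def by simp
    have "(\<Sum>k<d. u k \<otimes>\<^bsub>Z\<^esub> y k) =
      (\<Sum>k<d. (if k = 0 then u 0 \<otimes>\<^bsub>Z\<^esub> c else 0) + (if k = j then - (u j \<otimes>\<^bsub>Z\<^esub> c') else 0))"
      using j by (intro sum.cong refl) (auto simp: y_def group_ring_mult_zero group_ring_mult_minus)
    also have "\<dots> = u 0 \<otimes>\<^bsub>Z\<^esub> c - u j \<otimes>\<^bsub>Z\<^esub> c'"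
      using j by (simp add: sum.distrib)
    also have "\<dots> = 0" using c(3) by (simp add: group_ring_mult_restrict)
    finally show "(\<Sum>k<d. (frag_of (x k) - frag_of \<one>) \<otimes>\<^bsub>Z\<^esub> y k) = 0"
      by (simp only: u_def)
  qed
  then obtain w where w: "w \<in> words d" "ev w = \<one>" "\<forall>k<d. D k w = y k" by blast
  have "y j \<noteq> 0" using cW(3) j unfolding y_def by simp
  then show ?thesis using w j by (intro bexI[OF _ w(1)]) (simp add: y_def)
qed

section \<open>The degrees of a fibred group\<close>

text \<open>The fibre, i.e. the kernel of \<open>\<psi>\<close>, is the quotient of a free group on \<open>x\<^sub>0, \<dots>, x\<^sub>e\<close> with \<open>e = d - 1\<close>, times a
  central involution \<open>b\<close>, by relators deep in the rational derived series; \<open>t\<close> inverts every \<open>x\<^sub>i\<close>. The words \<open>\<rho> j\<close>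
  are relators which span the \<open>n\<close>th derived quotient of the free group up to torsion.\<close>

locale fibred_group = group G for G :: "('a, 'x) monoid_scheme" (structure) +
  fixes d n :: nat and x :: "nat \<Rightarrow> 'a" and t b :: 'a and \<psi> :: "'a \<Rightarrow> int" and \<rho> :: "nat \<Rightarrow> word"
  assumes x_closed: "i < d \<Longrightarrow> x i \<in> carrier G"
    and t_closed [simp]: "t \<in> carrier G" and b_closed [simp]: "b \<in> carrier G"
    and t_x: "i < d \<Longrightarrow> t \<otimes> x i \<otimes> inv t = inv x i"
    and b_x: "i < d \<Longrightarrow> b \<otimes> x i = x i \<otimes> b"
    and b_t: "b \<otimes> t = t \<otimes> b"
    and b_sq: "b \<otimes> b = \<one>"
    and \<psi>_hom: "\<psi> \<in> hom G integer_group" and \<psi>_t: "\<psi> t = 1"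
    and fibre: "\<lbrakk>g \<in> carrier G; \<psi> g = 0\<rbrakk> \<Longrightarrow> \<exists>w\<in>words d. \<exists>e::nat. g = weval G x w \<otimes> b [^] e"
    and free: "\<lbrakk>w \<in> words d; weval G x w \<otimes> b [^] (e::nat) = \<one>\<rbrakk> \<Longrightarrow>
      cls d {} w \<in> rational_derived (presented_group d {}) n"
    and \<rho>_words: "\<lbrakk>1 \<le> j; j < d\<rbrakk> \<Longrightarrow> \<rho> j \<in> words d"
    and \<rho>_trivial: "\<lbrakk>1 \<le> j; j < d\<rbrakk> \<Longrightarrow> weval G x (\<rho> j) = \<one>"
    and \<rho>_diag: "\<lbrakk>1 \<le> j; j < d\<rbrakk> \<Longrightarrow>
      fox (presented_group d {} Mod rational_derived (presented_group d {}) n)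
        (\<lambda>i. rational_derived (presented_group d {}) n #>\<^bsub>presented_group d {}\<^esub> cls d {} [(i, True)]) j (\<rho> j) \<noteq> 0"
    and \<rho>_off: "\<lbrakk>1 \<le> j; j < d; 1 \<le> i; i < d; i \<noteq> j\<rbrakk> \<Longrightarrow>
      fox (presented_group d {} Mod rational_derived (presented_group d {}) n)
        (\<lambda>i. rational_derived (presented_group d {}) n #>\<^bsub>presented_group d {}\<^esub> cls d {} [(i, True)]) i (\<rho> j) = 0"
    and n_pos: "1 \<le> n" and d_pos: "1 \<le> d"
begin

abbreviation F where "F \<equiv> presented_group d {}"
abbreviation N where "N i \<equiv> rational_derived F i"
abbreviation K where "K i \<equiv> rational_derived G (Suc i)"
abbreviation eg where "eg \<equiv> weval G x"
abbreviation cl where "cl \<equiv> cls d {}"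

sublocale Fr: presentation d "{}" by unfold_locales simp

definition \<iota> :: "word set \<Rightarrow> 'a" where "\<iota> = Fr.lift G x"

sublocale \<iota>: group_hom F G \<iota>
  unfolding \<iota>_def by (rule Fr.lift_hom) (use x_closed is_group in auto)

lemma \<iota>_cl: "w \<in> words d \<Longrightarrow> \<iota> (cl w) = eg w"
  unfolding \<iota>_def by (rule Fr.lift_cls) (use x_closed is_group in auto)

lemma eg_closed [simp]: "w \<in> words d \<Longrightarrow> eg w \<in> carrier G"
  by (rule weval_closed[OF x_closed])

lemma eg_append: "\<lbrakk>u \<in> words d; v \<in> words d\<rbrakk> \<Longrightarrow> eg (u @ v) = eg u \<otimes> eg v"
  by (rule weval_append[OF x_closed])

lemma eg_winv: "w \<in> words d \<Longrightarrow> eg (winv w) = inv eg w"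
  by (rule weval_winv[OF x_closed])

lemma commute_inv:
  assumes "c \<in> carrier G" "y \<in> carrier G" "c \<otimes> y = y \<otimes> c" shows "c \<otimes> inv y = inv y \<otimes> c"
proof -
  have "inv y \<otimes> (c \<otimes> y) \<otimes> inv y = inv y \<otimes> (y \<otimes> c) \<otimes> inv y" using assms(3) by simp
  then show ?thesis using assms(1,2) by (simp add: m_assoc inv_cancel)
qed

lemma commute_eg:
  assumes "c \<in> carrier G" "\<And>i. i < d \<Longrightarrow> c \<otimes> x i = x i \<otimes> c" "w \<in> words d"
  shows "c \<otimes> eg w = eg w \<otimes> c"
  using assms(3)
proof (induction w)
  case (Cons a w)
  obtain i \<beta> where a: "a = (i, \<beta>)" by (cases a)
  define y where "y = (if \<beta> then x i else inv x i)"
  have y: "y \<in> carrier G" "c \<otimes> y = y \<otimes> c" "i < d" "w \<in> words d" "eg (a # w) = y \<otimes> eg w"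
    using Cons.prems assms(1,2) x_closed commute_inv[of c "x i"] by (auto simp: a y_def)
  have "c \<otimes> (y \<otimes> eg w) = (c \<otimes> y) \<otimes> eg w" using y(1,4) assms(1) by (simp add: m_assoc)
  also have "\<dots> = y \<otimes> (c \<otimes> eg w)"
    by (subst y(2)) (use y(1,4) assms(1) in \<open>simp add: m_assoc\<close>)
  also have "\<dots> = y \<otimes> eg w \<otimes> c" using y(1,4) Cons.IH assms(1) by (simp add: m_assoc)
  finally show ?case using y by simp
qed (use assms(1) in simp)

lemma b_pow_comm:
  assumes "y \<in> carrier G" "b \<otimes> y = y \<otimes> b" shows "b [^] (e::nat) \<otimes> y = y \<otimes> b [^] e"
proof (induction e)
  case (Suc e)
  have "b [^] Suc e \<otimes> y = b [^] e \<otimes> (y \<otimes> b)" using assms by (simp add: m_assoc)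
  also have "\<dots> = y \<otimes> (b [^] e \<otimes> b)" using assms Suc by (simp flip: m_assoc)
  finally show ?case by simp
qed (use assms(1) in simp)

lemma b_eg: "w \<in> words d \<Longrightarrow> b [^] (e::nat) \<otimes> eg w = eg w \<otimes> b [^] e"
  by (rule b_pow_comm) (simp_all add: commute_eg b_x)

lemma b_pow_sq: "b [^] (e::nat) \<otimes> b [^] e = \<one>"
proof -
  have "b [^] e \<otimes> b [^] e = (b \<otimes> b) [^] e"
    by (subst pow_mult_distrib) simp_all
  then show ?thesis by (simp add: b_sq)
qed

lemma b_pow_inv: "inv (b [^] (e::nat)) = b [^] e"
  by (rule inv_equality[OF b_pow_sq]) simp_all

text \<open>The normal form of fibre elements. The exponent is not reduced modulo two, so the form
  is not unique; even exponents disappear by \<open>b_pow_sq\<close>.\<close>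

definition fb :: "word \<Rightarrow> nat \<Rightarrow> 'a" where "fb w e = eg w \<otimes> b [^] e"

lemma fb_closed [simp]: "w \<in> words d \<Longrightarrow> fb w e \<in> carrier G"
  by (simp add: fb_def)

lemma fb_mult: "\<lbrakk>u \<in> words d; v \<in> words d\<rbrakk> \<Longrightarrow> fb u e \<otimes> fb v e' = fb (u @ v) (e + e')"
proof -
  assume uv: "u \<in> words d" "v \<in> words d"
  have "fb u e \<otimes> fb v e' = eg u \<otimes> (b [^] e \<otimes> eg v) \<otimes> b [^] e'"
    using uv by (simp add: fb_def m_assoc)
  also have "\<dots> = fb (u @ v) (e + e')"
    using uv by (simp add: fb_def b_eg eg_append m_assoc nat_pow_mult)
  finally show ?thesis .
qed

lemma fb_inv: "w \<in> words d \<Longrightarrow> inv (fb w e) = fb (winv w) e"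
  by (simp add: fb_def inv_mult_group b_pow_inv eg_winv[symmetric] b_eg)

lemma fb_zero [simp]: "w \<in> words d \<Longrightarrow> fb w 0 = eg w"
  by (simp add: fb_def)

lemma fb_conj:
  assumes "w \<in> words d" "v \<in> words d"
  shows "inv (eg v) \<otimes> fb w e \<otimes> eg v = fb (winv v @ w @ v) e"
proof -
  have "inv (eg v) \<otimes> fb w e \<otimes> eg v = fb (winv v) 0 \<otimes> fb w e \<otimes> fb v 0"
    using assms by (simp add: eg_winv)
  then show ?thesis using assms by (simp add: fb_mult del: fb_zero)
qed

lemma free': "\<lbrakk>w \<in> words d; fb w e = \<one>\<rbrakk> \<Longrightarrow> cl w \<in> N n"
  unfolding fb_def by (rule free)

lemma \<psi>_mult: "\<lbrakk>y \<in> carrier G; z \<in> carrier G\<rbrakk> \<Longrightarrow> \<psi> (y \<otimes> z) = \<psi> y + \<psi> z"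
  using hom_mult[OF \<psi>_hom] by simp

sublocale \<psi>: group_hom G integer_group \<psi>
  using \<psi>_hom by (simp add: group_hom_def group_hom_axioms_def is_group)

lemma \<psi>_inv: "y \<in> carrier G \<Longrightarrow> \<psi> (inv y) = - \<psi> y"
  using \<psi>.hom_inv by simp

lemma \<psi>_one: "\<psi> \<one> = 0" using \<psi>.hom_one by simp

lemma \<psi>_x: "i < d \<Longrightarrow> \<psi> (x i) = 0"
proof -
  assume i: "i < d"
  have "\<psi> (t \<otimes> x i \<otimes> inv t) = \<psi> (inv x i)" using t_x[OF i] by simp
  then show ?thesis using x_closed[OF i] by (simp add: \<psi>_mult \<psi>_inv)
qed

lemma \<psi>_b: "\<psi> b = 0"
  using \<psi>_mult[of b b] by (simp add: b_sq \<psi>_one)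

lemma \<psi>_eg: "w \<in> words d \<Longrightarrow> \<psi> (eg w) = 0"
proof (induction w)
  case (Cons a w)
  obtain i \<beta> where a: "a = (i, \<beta>)" by (cases a)
  show ?case using Cons x_closed[of i] \<psi>_x[of i] by (auto simp: a \<psi>_mult \<psi>_inv)
qed (simp add: \<psi>_one)

lemma \<psi>_b_pow: "\<psi> (b [^] (e::nat)) = 0"
  by (induction e) (simp_all add: \<psi>_one \<psi>_mult \<psi>_b)

lemma \<psi>_fb: "w \<in> words d \<Longrightarrow> \<psi> (fb w e) = 0"
  by (simp add: fb_def \<psi>_mult \<psi>_eg \<psi>_b_pow)

lemma \<psi>_zero_iff: "g \<in> carrier G \<Longrightarrow> \<psi> g = 0 \<longleftrightarrow> (\<exists>w\<in>words d. \<exists>e. g = fb w e)"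
  using fibre[of g] \<psi>_fb unfolding fb_def by metis

lemma \<psi>_int_pow: "g \<in> carrier G \<Longrightarrow> \<psi> (g [^] (k::int)) = k * \<psi> g"
  using \<psi>.hom_int_pow[of g k] by simp

text \<open>\<open>[t, x\<^sub>i] = x\<^sub>i\<^sup>-\<^sup>2\<close>, so the fibre is 2-torsion in the abelianisation.\<close>

lemma fibre_square:
  assumes "w \<in> words d" shows "fb w e \<otimes> fb w e \<in> derived G (carrier G)"
proof -
  let ?D = "derived G (carrier G)"
  let ?A = "G Mod ?D"
  interpret A: comm_group ?A by (rule derived_quot_is_comm_group)
  interpret q: group_hom G ?A "\<lambda>g. ?D #> g" by (rule group_hom_coset_map[OF derived_self_is_normal])
  have D: "subgroup ?D G" by (rule normal_imp_subgroup[OF derived_self_is_normal])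
  define q where "q g = ?D #> g" for g
  have q_mult: "q (y \<otimes> z) = q y \<otimes>\<^bsub>?A\<^esub> q z" if "y \<in> carrier G" "z \<in> carrier G" for y z
    unfolding q_def by (rule q.hom_mult[OF that])
  have q_closed: "q y \<in> carrier ?A" if "y \<in> carrier G" for y
    unfolding q_def by (rule q.hom_closed[OF that])
  have q_one: "q y = \<one>\<^bsub>?A\<^esub> \<longleftrightarrow> y \<in> ?D" if "y \<in> carrier G" for y
    using coset_eq_self_iff[OF D that] by (simp add: q_def)
  have sq: "q (y \<otimes> z) \<otimes>\<^bsub>?A\<^esub> q (y \<otimes> z) = \<one>\<^bsub>?A\<^esub>"
    if "q y \<otimes>\<^bsub>?A\<^esub> q y = \<one>\<^bsub>?A\<^esub>" "q z \<otimes>\<^bsub>?A\<^esub> q z = \<one>\<^bsub>?A\<^esub>" "y \<in> carrier G" "z \<in> carrier G" for y z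
  proof -
    have "q (y \<otimes> z) \<otimes>\<^bsub>?A\<^esub> q (y \<otimes> z) = (q y \<otimes>\<^bsub>?A\<^esub> q y) \<otimes>\<^bsub>?A\<^esub> (q z \<otimes>\<^bsub>?A\<^esub> q z)"
      using q_closed[OF that(3)] q_closed[OF that(4)]
      by (simp only: q_mult[OF that(3,4)] A.m_ac A.m_closed)
    then show ?thesis by (simp only: that(1,2) A.l_one A.one_closed)
  qed
  have x_sq: "q (inv x i) \<otimes>\<^bsub>?A\<^esub> q (inv x i) = \<one>\<^bsub>?A\<^esub>" if i: "i < d" for i
  proof -
    have "inv x i \<otimes> inv x i = t \<otimes> x i \<otimes> inv t \<otimes> inv x i" using t_x[OF i] by simp
    also have "\<dots> \<in> ?D" using x_closed[OF i] by (intro derived_set_mem) simp_all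
    finally have "q (inv x i \<otimes> inv x i) = \<one>\<^bsub>?A\<^esub>" using q_one x_closed[OF i] by simp
    then show ?thesis using q_mult x_closed[OF i] by simp
  qed
  have sq_inv: "q (inv y) \<otimes>\<^bsub>?A\<^esub> q (inv y) = \<one>\<^bsub>?A\<^esub>"
    if "q y \<otimes>\<^bsub>?A\<^esub> q y = \<one>\<^bsub>?A\<^esub>" "y \<in> carrier G" for y
  proof -
    have "y \<otimes> y \<in> ?D" using that q_one[of "y \<otimes> y"] q_mult[of y y] by simp
    then have "inv y \<otimes> inv y \<in> ?D"
      using subgroup.m_inv_closed[OF D] that(2) by (metis inv_mult_group)
    then show ?thesis using q_one[of "inv y \<otimes> inv y"] q_mult[of "inv y" "inv y"] that(2) by simp
  qed
  have "q (eg w) \<otimes>\<^bsub>?A\<^esub> q (eg w) = \<one>\<^bsub>?A\<^esub>"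
    using assms
  proof (induction w)
    case Nil
    then show ?case using q_one[of \<one>] subgroup.one_closed[OF D] q_mult[of \<one> \<one>] by simp
  next
    case (Cons a w)
    obtain i \<beta> where a: "a = (i, \<beta>)" by (cases a)
    have i: "i < d" "w \<in> words d" using Cons.prems by (simp_all add: a)
    have "q (x i) \<otimes>\<^bsub>?A\<^esub> q (x i) = \<one>\<^bsub>?A\<^esub>" using sq_inv[OF x_sq[OF i(1)]] x_closed[OF i(1)] by simp
    then have "q (if \<beta> then x i else inv x i) \<otimes>\<^bsub>?A\<^esub> q (if \<beta> then x i else inv x i) = \<one>\<^bsub>?A\<^esub>"
      using x_sq[OF i(1)] by (cases \<beta>) (simp_all only: if_True if_False)
    moreover have "(if \<beta> then x i else inv x i) \<in> carrier G" using x_closed[OF i(1)] by simp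
    ultimately show ?case
      using sq[of "if \<beta> then x i else inv x i" "eg w"] Cons.IH i by (simp only: a weval.simps eg_closed)
  qed
  moreover have "q (b [^] e) \<otimes>\<^bsub>?A\<^esub> q (b [^] e) = \<one>\<^bsub>?A\<^esub>"
    using q_mult[of "b [^] e" "b [^] e"] q_one[of \<one>] subgroup.one_closed[OF D] by (simp only: b_pow_sq nat_pow_closed b_closed one_closed)
  ultimately have "q (fb w e) \<otimes>\<^bsub>?A\<^esub> q (fb w e) = \<one>\<^bsub>?A\<^esub>"
    unfolding fb_def using sq[of "eg w" "b [^] e"] assms by simp
  then show ?thesis using q_mult[of "fb w e" "fb w e"] q_one[of "fb w e \<otimes> fb w e"] assms by simp
qed

lemma \<psi>_derived: "g \<in> derived G (carrier G) \<Longrightarrow> \<psi> g = 0"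
proof -
  assume g: "g \<in> derived G (carrier G)"
  have "derived G (carrier G) \<subseteq> kernel G integer_group \<psi>"
    unfolding derived_def
    by (rule generate_subgroup_incl[OF _ \<psi>.subgroup_kernel]) (auto simp: kernel_def \<psi>_mult \<psi>_inv)
  then show ?thesis using g by (auto simp: kernel_def)
qed

text \<open>Squares in the fibre lie in the commutator subgroup by \<open>fibre_square\<close>, so
  the exponent 2 always works; conversely \<psi> takes values in a torsion-free abelian group. With
  the index shift built into \<open>K\<close>, the group \<Gamma> of level \<open>i\<close> is
  \<open>G Mod K i\<close>.\<close>

lemma K_0_iff: "g \<in> K 0 \<longleftrightarrow> g \<in> carrier G \<and> \<psi> g = 0"
proof
  assume "g \<in> K 0"
  then obtain k :: int where "g \<in> carrier G" "k \<noteq> 0" "g [^] k \<in> derived G (carrier G)"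
    by (auto simp: rational_derived.simps(2))
  then show "g \<in> carrier G \<and> \<psi> g = 0" using \<psi>_derived[of "g [^] k"] \<psi>_int_pow[of g k] by simp
next
  assume g: "g \<in> carrier G \<and> \<psi> g = 0"
  then obtain w e where "w \<in> words d" "g = fb w e" using \<psi>_zero_iff by blast
  then have "g [^] (2::nat) \<in> derived G (carrier G)" using fibre_square g by (simp add: numeral_2_eq_2)
  then have "g [^] (2::int) \<in> derived G (carrier G)" using int_pow_int[of G g 2] by simp
  then show "g \<in> K 0" using g by (auto simp: rational_derived.simps(2) intro!: exI[of _ 2])
qed

section \<open>Comparison with the rational derived series of the free group\<close>

definition fibN :: "nat \<Rightarrow> 'a set" where
  "fibN i = {g. \<exists>w e. w \<in> words d \<and> g = fb w e \<and> cl w \<in> N i}"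

lemma N_cases:
  assumes "f \<in> N i" obtains w where "w \<in> words d" "f = cl w"
  using Fr.P_cases[OF Fr.P.rational_derived_carrier[OF assms]] by metis

lemma N_carrier: "N i \<subseteq> carrier F"
  using Fr.P.rational_derived_carrier by blast

text \<open>The central involution drops out of commutators, where its exponents add up to an even
  number.\<close>

lemma derived_fibN: "derived G (fibN i) = \<iota> ` derived F (N i)"
proof
  have img: "derived G (\<iota> ` N i) = \<iota> ` derived F (N i)"
    by (rule \<iota>.derived_img[OF N_carrier])
  have "\<iota> ` N i \<subseteq> fibN i"
  proof
    fix g assume "g \<in> \<iota> ` N i"
    then obtain f where f: "f \<in> N i" "g = \<iota> f" by blast
    then obtain w where "w \<in> words d" "f = cl w" by (elim N_cases)
    then show "g \<in> fibN i" unfolding fibN_def using f \<iota>_cl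
      by (intro CollectI exI[of _ w] exI[of _ 0]) simp
  qed
  then show "\<iota> ` derived F (N i) \<subseteq> derived G (fibN i)"
    unfolding img[symmetric] by (rule mono_derived)
  have "derived_set G (fibN i) \<subseteq> derived_set G (\<iota> ` N i)"
  proof
    fix z assume "z \<in> derived_set G (fibN i)"
    then obtain g k where gk: "g \<in> fibN i" "k \<in> fibN i" "z = g \<otimes> k \<otimes> inv g \<otimes> inv k" by blast
    then obtain u e v e' where u: "u \<in> words d" "g = fb u e" "cl u \<in> N i"
      and v: "v \<in> words d" "k = fb v e'" "cl v \<in> N i"
      unfolding fibN_def by blast
    have "z = fb (u @ v @ winv u @ winv v) (e + e' + e + e')"
      using u v gk(3) by (simp add: fb_inv fb_mult)
    also have "e + e' + e + e' = 2 * (e + e')" by simp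
    also have "fb (u @ v @ winv u @ winv v) (2 * (e + e')) = eg (u @ v @ winv u @ winv v) \<otimes> b [^] (2 * (e + e'))"
      by (simp only: fb_def)
    also have "b [^] (2 * (e + e')) = \<one>"
      using b_pow_sq[of "e + e'"] unfolding mult_2 by (simp only: nat_pow_mult b_closed)
    finally have z: "z = eg u \<otimes> eg v \<otimes> inv (eg u) \<otimes> inv (eg v)"
      using u v by (simp add: eg_append eg_winv m_assoc)
    have "eg u \<in> \<iota> ` N i" "eg v \<in> \<iota> ` N i" using u v \<iota>_cl by (metis image_eqI)+
    then show "z \<in> derived_set G (\<iota> ` N i)" unfolding z by blast
  qed
  from mono_generate[OF this] show "derived G (fibN i) \<subseteq> \<iota> ` derived F (N i)"
    unfolding img[symmetric] by (simp only: derived_def)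
qed

lemma fb_square: "w \<in> words d \<Longrightarrow> fb w e \<otimes> fb w e = eg (w @ w)"
proof -
  assume w: "w \<in> words d"
  have "fb w e \<otimes> fb w e = eg (w @ w) \<otimes> (b [^] e \<otimes> b [^] e)"
    using w by (simp add: fb_mult) (simp add: fb_def nat_pow_mult)
  then show ?thesis using w by (simp add: b_pow_sq)
qed

text \<open>Doubling the exponent removes \<open>b\<close>, which brings powers in the fibre back to
  powers in \<open>F\<close>.\<close>

lemma fb_int_pow_even:
  assumes "w \<in> words d"
  shows "fb w e [^] (2 * k :: int) = \<iota> (cl w [^]\<^bsub>F\<^esub> (2 * k))"
proof -
  have sq: "y [^] (2::int) = y \<otimes> y" if "y \<in> carrier G" for y
    using that int_pow_int[of G y 2] by (simp add: numeral_2_eq_2)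
  have "fb w e [^] (2::int) = eg w [^] (2::int)"
    using assms by (simp add: sq fb_square eg_append)
  then have "fb w e [^] (2 * k) = eg w [^] (2 * k)"
    using assms by (metis int_pow_pow fb_closed eg_closed)
  also have "\<dots> = \<iota> (cl w [^]\<^bsub>F\<^esub> (2 * k))"
    using assms \<iota>.hom_int_pow[of "cl w" "2 * k"] \<iota>_cl by simp
  finally show ?thesis .
qed

text \<open>A relation between words in \<open>G\<close> holds in \<open>F\<close> only up to an
  error in \<open>N n\<close>. As long as \<open>Suc i \<le> n\<close>, this error lies in
  \<open>N (Suc i)\<close> and does no harm, which is why the comparison stops at
  \<open>n\<close>.\<close>

lemma K_eq: "i \<le> n \<Longrightarrow> K i = fibN i"
proof (induction i)
  case 0
  show ?case
  proof (intro equalityI subsetI)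
    fix g assume "g \<in> K 0"
    then have g: "g \<in> carrier G" "\<psi> g = 0" by (simp_all add: K_0_iff)
    then obtain w e where "w \<in> words d" "g = fb w e" using \<psi>_zero_iff by blast
    then show "g \<in> fibN 0" unfolding fibN_def by (intro CollectI exI[of _ w] exI[of _ e]) simp
  next
    fix g assume "g \<in> fibN 0"
    then obtain w e where "w \<in> words d" "g = fb w e" unfolding fibN_def by blast
    then show "g \<in> K 0" by (simp add: K_0_iff \<psi>_fb)
  qed
next
  case (Suc i)
  then have IH: "rational_derived G (Suc i) = fibN i" by simp
  have step: "rational_derived G (Suc (Suc i)) = {g \<in> fibN i. \<exists>k::int. k \<noteq> 0 \<and> g [^] k \<in> \<iota> ` derived F (N i)}"
    unfolding rational_derived.simps(2)[of G "Suc i"] IH derived_fibN ..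
  have Nstep: "N (Suc i) = {f \<in> N i. \<exists>k::int. k \<noteq> 0 \<and> f [^]\<^bsub>F\<^esub> k \<in> derived F (N i)}"
    by (rule rational_derived.simps(2))
  have dN: "derived F (N i) \<subseteq> N (Suc i)" by (rule Fr.P.derived_le_rational_derived)
  have dsub: "subgroup (derived F (N i)) F" by (rule Fr.P.derived_is_subgroup[OF N_carrier])
  show ?case
    unfolding step
  proof (intro equalityI subsetI)
    fix g assume g: "g \<in> {g \<in> fibN i. \<exists>k::int. k \<noteq> 0 \<and> g [^] k \<in> \<iota> ` derived F (N i)}"
    then obtain k :: int where k: "g \<in> fibN i" "k \<noteq> 0" "g [^] k \<in> \<iota> ` derived F (N i)" by blast
    then obtain w e where w: "w \<in> words d" "g = fb w e" "cl w \<in> N i" unfolding fibN_def by blast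
    obtain c where c: "c \<in> derived F (N i)" "g [^] k = \<iota> c" using k(3) by blast
    have cF: "c \<in> carrier F" using subgroup.mem_carrier[OF dsub c(1)] .
    have "fb w e [^] (2 * k) = (g [^] k) [^] (2::int)"
      using w int_pow_pow[of g k 2] by (simp add: mult.commute)
    also have "\<dots> = \<iota> (c [^]\<^bsub>F\<^esub> (2::int))" using c cF \<iota>.hom_int_pow[of c 2] by simp
    finally have e1: "\<iota> (cl w [^]\<^bsub>F\<^esub> (2 * k)) = \<iota> (c [^]\<^bsub>F\<^esub> (2::int))"
      using fb_int_pow_even[OF w(1)] by simp
    let ?f = "cl w [^]\<^bsub>F\<^esub> (2 * k)" and ?c = "c [^]\<^bsub>F\<^esub> (2::int)"
    have fc: "?f \<in> carrier F" "?c \<in> carrier F" using w cF by auto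
    \<comment> \<open>The quotient of the two elements dies in \<open>G\<close>, hence lies in
      \<open>N n\<close> by \<open>free'\<close>.\<close>
    obtain v where v: "v \<in> words d" "?f \<otimes>\<^bsub>F\<^esub> inv\<^bsub>F\<^esub> ?c = cl v"
      using Fr.P_cases[of "?f \<otimes>\<^bsub>F\<^esub> inv\<^bsub>F\<^esub> ?c"] fc by auto
    have "eg v = \<iota> (?f \<otimes>\<^bsub>F\<^esub> inv\<^bsub>F\<^esub> ?c)" using v \<iota>_cl by simp
    also have "\<dots> = \<one>" using fc e1 \<iota>.hom_closed[OF fc(2)] by (simp only: \<iota>.hom_mult \<iota>.hom_inv Fr.P.inv_closed r_inv)
    finally have "cl v \<in> N n" using free'[of v 0] v by simp
    then have "?f \<otimes>\<^bsub>F\<^esub> inv\<^bsub>F\<^esub> ?c \<in> N (Suc i)"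
      using v(2) Fr.P.rational_derived_antimono[OF Suc.prems] by auto
    moreover have "?c \<in> N (Suc i)"
      using Fr.P.int_pow_mem_subgroup[OF dsub c(1), of 2] dN by blast
    ultimately have "?f \<otimes>\<^bsub>F\<^esub> inv\<^bsub>F\<^esub> ?c \<otimes>\<^bsub>F\<^esub> ?c \<in> N (Suc i)"
      by (rule subgroup.m_closed[OF Fr.P.rational_derived_subgroup])
    then have "?f \<in> N (Suc i)" using fc by (simp add: Fr.P.m_assoc)
    then have "cl w \<in> N (Suc i)"
      using Fr.P.rational_derived_root[of "cl w" "2 * k" "Suc i"] k(2) w(1) by simp
    then show "g \<in> fibN (Suc i)"
      unfolding fibN_def using w by (intro CollectI exI[of _ w] exI[of _ e]) simp
  next
    fix g assume "g \<in> fibN (Suc i)"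
    then obtain w e where w: "w \<in> words d" "g = fb w e" "cl w \<in> N (Suc i)" unfolding fibN_def by blast
    then obtain k :: int where k: "cl w \<in> N i" "k \<noteq> 0" "cl w [^]\<^bsub>F\<^esub> k \<in> derived F (N i)"
      unfolding Nstep by blast
    have "cl w [^]\<^bsub>F\<^esub> (2 * k) = (cl w [^]\<^bsub>F\<^esub> k) [^]\<^bsub>F\<^esub> (2::int)"
      using w(1) Fr.P.int_pow_pow[of "cl w" k 2] by (simp add: mult.commute)
    then have "cl w [^]\<^bsub>F\<^esub> (2 * k) \<in> derived F (N i)"
      using Fr.P.int_pow_mem_subgroup[OF dsub k(3), of 2] by simp
    then have "g [^] (2 * k) \<in> \<iota> ` derived F (N i)"
      using fb_int_pow_even[OF w(1)] w(2) by blast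
    moreover have "g \<in> fibN i" unfolding fibN_def using w k by (intro CollectI exI[of _ w] exI[of _ e]) simp
    ultimately show "g \<in> {g \<in> fibN i. \<exists>k::int. k \<noteq> 0 \<and> g [^] k \<in> \<iota> ` derived F (N i)}"
      using k(2) by (intro CollectI conjI exI[of _ "2 * k"]) simp_all
  qed
qed

end

section \<open>The module at one level of the series\<close>

locale fibred_level = fibred_group +
  fixes i :: nat
  assumes i_le: "i \<le> n"
begin

abbreviation \<Gamma> where "\<Gamma> \<equiv> G Mod K i"
abbreviation \<phi> where "\<phi> \<equiv> (\<lambda>g. K i #> g)"

sublocale Mg: magnus G \<Gamma> \<phi> x d
  by (intro magnus.intro magnus_axioms.intro group_hom_coset_map rational_derived_normal x_closed)

abbreviation R where "R \<equiv> group_ring (\<Gamma>\<lparr>carrier := Mg.F.W\<rparr>)"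

lemma \<phi>_one_iff: "g \<in> carrier G \<Longrightarrow> \<phi> g = \<one>\<^bsub>\<Gamma>\<^esub> \<longleftrightarrow> g \<in> K i"
  using coset_eq_self_iff[OF rational_derived_subgroup, of g "Suc i"] by simp

lemma ker_eq: "Mg.ker = K i"
proof (intro equalityI subsetI)
  fix g assume "g \<in> Mg.ker"
  then have "g \<in> carrier G \<and> \<phi> g = \<one>\<^bsub>\<Gamma>\<^esub>" by (simp only: Mg.ker_iff)
  then show "g \<in> K i" using \<phi>_one_iff[of g] by blast
next
  fix g assume g: "g \<in> K i"
  then have "g \<in> carrier G" by (rule rational_derived_carrier)
  then show "g \<in> Mg.ker" using \<phi>_one_iff[of g] g by (simp only: Mg.ker_iff)
qed

lemma b_pow_K: "b [^] (e::nat) \<in> K k"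
proof -
  have "(b [^] e) [^] (2::int) = \<one>"
    using int_pow_int[of G "b [^] e" 2] b_pow_sq[of e] by (simp add: numeral_2_eq_2)
  then show ?thesis
    using rational_derived_root[of "b [^] e" 2 "Suc k"] subgroup.one_closed[OF rational_derived_subgroup[of "Suc k"]]
    by simp
qed

lemma \<phi>_fb: "w \<in> words d \<Longrightarrow> \<phi> (fb w e) = Mg.F.ev w"
proof -
  assume w: "w \<in> words d"
  have "\<phi> (fb w e) = \<phi> (eg w) \<otimes>\<^bsub>\<Gamma>\<^esub> \<phi> (b [^] e)" unfolding fb_def using w by (intro Mg.hom_mult) simp_all
  also have "\<phi> (b [^] e) = \<one>\<^bsub>\<Gamma>\<^esub>" using \<phi>_one_iff[of "b [^] e"] b_pow_K by simp
  finally show ?thesis using w Mg.H.r_one[OF Mg.hom_closed[OF eg_closed[OF w]]] by (simp only: Mg.h_eg)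
qed

text \<open>Since \<open>b\<close> lies in every term of the series, the letters alone reach the
  whole image of the fibre; this image is the kernel of the map from \<Gamma> to the
  integers.\<close>

lemma W_eq: "Mg.F.W = \<phi> ` K 0"
proof (intro equalityI subsetI)
  fix \<gamma> assume "\<gamma> \<in> Mg.F.W"
  then obtain w where w: "w \<in> words d" "\<gamma> = Mg.F.ev w" unfolding Mg.F.W_def by blast
  have "eg w \<in> K 0" using w by (simp add: K_0_iff \<psi>_eg)
  then show "\<gamma> \<in> \<phi> ` K 0" using w Mg.h_eg[OF w(1)] by (metis image_eqI)
next
  fix \<gamma> assume "\<gamma> \<in> \<phi> ` K 0"
  then obtain g where g: "g \<in> K 0" "\<gamma> = \<phi> g" by blast
  then obtain w e where "w \<in> words d" "g = fb w e" using \<psi>_zero_iff[of g] K_0_iff by blast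
  then show "\<gamma> \<in> Mg.F.W" using g \<phi>_fb by (simp only: Mg.F.ev_W)
qed

lemma right_ore_R: "right_ore_domain R"
  unfolding W_eq by (rule right_ore_domain_rational_quotient) simp

sublocale R: right_ore_domain R by (rule right_ore_R)

sublocale M: right_mod R Mg.KM
  by (rule Mg.right_mod_kernel[OF Mg.F.W_subgroup Mg.W_sub])

lemma R_carrier [simp]: "r \<in> carrier R \<longleftrightarrow> Poly_Mapping.keys r \<subseteq> Mg.F.W"
  by simp

lemma R_mult: "r \<otimes>\<^bsub>R\<^esub> s = r \<otimes>\<^bsub>group_ring \<Gamma>\<^esub> s"
  by (rule group_ring_mult_restrict)

lemma R_nonzeros: "r \<in> nonzeros R \<longleftrightarrow> Poly_Mapping.keys r \<subseteq> Mg.F.W \<and> r \<noteq> 0"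
  by (simp add: nonzeros_def)

lemma ev_one_iff: "w \<in> words d \<Longrightarrow> Mg.F.ev w = \<one>\<^bsub>\<Gamma>\<^esub> \<longleftrightarrow> eg w \<in> K i"
  using \<phi>_one_iff[of "eg w"] Mg.h_eg[of w] by simp

lemma fb_K_iff: "w \<in> words d \<Longrightarrow> fb w e \<in> K i \<longleftrightarrow> Mg.F.ev w = \<one>\<^bsub>\<Gamma>\<^esub>"
  using \<phi>_one_iff[of "fb w e"] \<phi>_fb[of w e] by simp

lemma Kab_rep:
  assumes "C \<in> carrier Mg.Kab"
  obtains w e where "w \<in> words d" "Mg.F.ev w = \<one>\<^bsub>\<Gamma>\<^esub>" "C = Mg.cs (fb w e)"
proof -
  obtain g where g: "g \<in> K i" "C = Mg.cs g" using Mg.Kab_cases[OF assms] ker_eq by metis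
  have "\<psi> g = 0" "g \<in> carrier G"
    using g(1) rational_derived_antimono[of 1 "Suc i"] K_0_iff[of g] by auto
  then obtain w e where "w \<in> words d" "g = fb w e" using \<psi>_zero_iff by blast
  then show thesis using that[of w e] g fb_K_iff by blast
qed

lemma fb_ker: "\<lbrakk>w \<in> words d; Mg.F.ev w = \<one>\<^bsub>\<Gamma>\<^esub>\<rbrakk> \<Longrightarrow> fb w e \<in> Mg.ker"
  using fb_K_iff ker_eq by simp

lemma cs_fb_mult:
  assumes "u \<in> words d" "Mg.F.ev u = \<one>\<^bsub>\<Gamma>\<^esub>" "v \<in> words d" "Mg.F.ev v = \<one>\<^bsub>\<Gamma>\<^esub>"
  shows "Mg.cs (fb u e) \<otimes>\<^bsub>Mg.Kab\<^esub> Mg.cs (fb v e') = Mg.cs (fb (u @ v) (e + e'))"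
  using Mg.cs_mult[OF fb_ker[OF assms(1,2)] fb_ker[OF assms(3,4)], of e e'] fb_mult[OF assms(1,3)] by simp

lemma act_cs_fb:
  assumes "w \<in> words d" "Mg.F.ev w = \<one>\<^bsub>\<Gamma>\<^esub>" "v \<in> words d"
  shows "act Mg.KM (Mg.cs (fb w e)) (frag_of (Mg.F.ev v)) = Mg.cs (fb (winv v @ w @ v) e)"
  using Mg.act_KM_cs[OF fb_ker[OF assms(1,2), of e] eg_closed[OF assms(3)]] fb_conj[OF assms(1,3), of e]
    Mg.h_eg[OF assms(3)] by simp

lemma two_nonzero: "frag_of \<one>\<^bsub>\<Gamma>\<^esub> + frag_of \<one>\<^bsub>\<Gamma>\<^esub> \<in> nonzeros R"
proof -
  have "Poly_Mapping.lookup (frag_of \<one>\<^bsub>\<Gamma>\<^esub> + frag_of \<one>\<^bsub>\<Gamma>\<^esub>) \<one>\<^bsub>\<Gamma>\<^esub> = 2"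
    by (simp add: lookup_add)
  then have "frag_of \<one>\<^bsub>\<Gamma>\<^esub> + frag_of \<one>\<^bsub>\<Gamma>\<^esub> \<noteq> 0" by (metis lookup_zero zero_neq_numeral)
  moreover have "Poly_Mapping.keys (frag_of \<one>\<^bsub>\<Gamma>\<^esub> + frag_of \<one>\<^bsub>\<Gamma>\<^esub>) \<subseteq> Mg.F.W"
    by (rule keys_add_subset) (use Mg.F.W_one in simp_all)
  ultimately show ?thesis by (simp only: R_nonzeros simp_thms)
qed

text \<open>The class of a power of \<open>b\<close> is annihilated by the nonzero scalar 2, so
  torsion may be tested on the word alone: if \<open>s\<close> kills the word, then \<open>s\<close>
  times 2 kills the element.\<close>

lemma torsion_b:
  assumes w: "w \<in> words d" "Mg.F.ev w = \<one>\<^bsub>\<Gamma>\<^esub>" and s: "s \<in> nonzeros R"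
    and z: "act Mg.KM (Mg.cs (eg w)) s = \<one>\<^bsub>Mg.KM\<^esub>"
  shows "\<exists>s'\<in>nonzeros R. act Mg.KM (Mg.cs (fb w e)) s' = \<one>\<^bsub>Mg.KM\<^esub>"
proof -
  define two where "two = frag_of \<one>\<^bsub>\<Gamma>\<^esub> + frag_of \<one>\<^bsub>\<Gamma>\<^esub>"
  have two: "two \<in> nonzeros R" unfolding two_def by (rule two_nonzero)
  have one: "frag_of \<one>\<^bsub>\<Gamma>\<^esub> = \<one>\<^bsub>R\<^esub>" by simp
  have twoR: "two = \<one>\<^bsub>R\<^esub> \<oplus>\<^bsub>R\<^esub> \<one>\<^bsub>R\<^esub>" unfolding two_def by simp
  have sR: "s \<in> carrier R" using s by (rule R.nonzeros_carrier)
  have bk: "b [^] e \<in> Mg.ker" unfolding ker_eq by (rule b_pow_K)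
  have wk: "eg w \<in> Mg.ker" unfolding ker_eq using w ev_one_iff by simp
  define z where "z = act Mg.KM (Mg.cs (b [^] e)) s"
  have bc: "Mg.cs (b [^] e) \<in> carrier Mg.KM" "Mg.cs (eg w) \<in> carrier Mg.KM"
    using Mg.cs_closed[OF bk] Mg.cs_closed[OF wk] by simp_all
  have zc: "z \<in> carrier Mg.KM" unfolding z_def by (rule M.act_closed[OF bc(1) sR])
  have "act Mg.KM (Mg.cs (fb w e)) s = act Mg.KM (Mg.cs (eg w) \<otimes>\<^bsub>Mg.KM\<^esub> Mg.cs (b [^] e)) s"
    unfolding fb_def using Mg.cs_mult[OF wk bk] by simp
  also have "\<dots> = z"
    unfolding M.act_mult[OF bc(2,1) sR] assms(4) z_def[symmetric] by (rule M.M.l_one[OF zc])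
  finally have 1: "act Mg.KM (Mg.cs (fb w e)) s = z" .
  have "act Mg.KM z two = z \<otimes>\<^bsub>Mg.KM\<^esub> z"
    unfolding twoR M.act_add[OF zc R.one_closed R.one_closed] M.act_one[OF zc] ..
  also have "\<dots> = act Mg.KM (Mg.cs (b [^] e) \<otimes>\<^bsub>Mg.KM\<^esub> Mg.cs (b [^] e)) s"
    unfolding z_def by (rule M.act_mult[OF bc(1) bc(1) sR, symmetric])
  also have "Mg.cs (b [^] e) \<otimes>\<^bsub>Mg.KM\<^esub> Mg.cs (b [^] e) = \<one>\<^bsub>Mg.KM\<^esub>"
    using Mg.cs_mult[OF bk bk] by (simp add: b_pow_sq Mg.cs_one)
  also have "act Mg.KM \<one>\<^bsub>Mg.KM\<^esub> s = \<one>\<^bsub>Mg.KM\<^esub>" by (rule M.act_one_left[OF sR])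
  finally have 2: "act Mg.KM z two = \<one>\<^bsub>Mg.KM\<^esub>" .
  have "Mg.cs (fb w e) \<in> carrier Mg.KM" using Mg.cs_closed[OF fb_ker[OF w]] by simp
  then have "act Mg.KM (Mg.cs (fb w e)) (s \<otimes>\<^bsub>R\<^esub> two) = \<one>\<^bsub>Mg.KM\<^esub>"
    using M.act_assoc[of "Mg.cs (fb w e)" s two] sR R.nonzeros_carrier[OF two] 1 2 by metis
  then show ?thesis using R.nonzeros_mult[OF s two] by blast
qed

lemma fox_R: "w \<in> words d \<Longrightarrow> Mg.F.D j w \<in> carrier R"
  using Mg.F.fox_keys by simp

definition u :: "nat \<Rightarrow> ('a set \<Rightarrow>\<^sub>0 int)" where "u j = frag_of (\<phi> (x j)) - frag_of \<one>\<^bsub>\<Gamma>\<^esub>"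

lemma u_carrier: "j < d \<Longrightarrow> u j \<in> carrier R"
  unfolding u_def R_carrier
  by (rule keys_diff_subset) (use Mg.F.letter_W Mg.F.W_one in \<open>simp_all add: keys_frag_of_eq\<close>)

text \<open>The source of the drop of the rank from \<open>d\<close> to \<open>d - 1\<close>: at
  level 0 the letters are trivial in \<Gamma> and the boundary map is zero, from level 1 on they are
  not. A trivial letter would lie in \<open>N 1\<close>, against its exponent sum.\<close>

lemma letter_nontrivial:
  assumes "1 \<le> i" "j < d" shows "\<phi> (x j) \<noteq> \<one>\<^bsub>\<Gamma>\<^esub>"
proof -
  have "x j \<notin> K i"
  proof
    assume "x j \<in> K i"
    then obtain w e where w: "w \<in> words d" "x j = fb w e" "cl w \<in> N i"
      using K_eq[OF i_le] unfolding fibN_def by blast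
    have xw: "[(j, True)] \<in> words d" "eg [(j, True)] = x j" using assms(2) x_closed by simp_all
    have "fb ([(j, True)] @ winv w) e = x j \<otimes> inv (fb w e)"
      using w(1) xw fb_mult[of "[(j, True)]" "winv w" 0 e] fb_inv[OF w(1)] by simp
    also have "\<dots> = \<one>" using w(2) x_closed[OF assms(2)] by (metis r_inv)
    finally have "cl ([(j, True)] @ winv w) \<in> N n" using free' w(1) xw by simp
    then have "cl ([(j, True)] @ winv w) \<in> N 1" using Fr.P.rational_derived_antimono[OF n_pos] by blast
    moreover have "cl w \<in> N 1" using w(3) Fr.P.rational_derived_antimono[OF assms(1)] by blast
    ultimately have "cl ([(j, True)] @ winv w) \<otimes>\<^bsub>F\<^esub> cl w \<in> N 1"
      by (rule subgroup.m_closed[OF Fr.P.rational_derived_subgroup])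
    moreover have "cl ([(j, True)] @ winv w) \<otimes>\<^bsub>F\<^esub> cl w = cl [(j, True)] \<otimes>\<^bsub>F\<^esub> (inv\<^bsub>F\<^esub> cl w \<otimes>\<^bsub>F\<^esub> cl w)"
      using w(1) xw by (simp only: Fr.inv_cls Fr.mult_P words_simps winv_words append_assoc)
    ultimately have "cl [(j, True)] \<in> N 1" using w(1) xw Fr.P.l_inv Fr.P.r_one by simp
    then show False using free_generator_not_in_derived[OF assms(2)] by simp
  qed
  then show ?thesis using \<phi>_one_iff[OF x_closed[OF assms(2)]] by simp
qed

lemma u_nonzero:
  assumes "1 \<le> i" "j < d" shows "u j \<in> nonzeros R"
proof -
  have "u j \<noteq> 0" using letter_nontrivial[OF assms] unfolding u_def by (metis eq_iff_diff_eq_0 frag_of_eq)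
  then show ?thesis using u_carrier[OF assms(2)] unfolding R_nonzeros R_carrier by simp
qed

lemma boundary_loop:
  assumes "w \<in> words d" "Mg.F.ev w = \<one>\<^bsub>\<Gamma>\<^esub>"
  shows "(\<Sum>j<d. u j \<otimes>\<^bsub>group_ring \<Gamma>\<^esub> Mg.F.D j w) = 0"
  using Mg.F.fox_fundamental[OF assms(1)] assms(2) unfolding u_def by simp

text \<open>A cycle is determined by its coordinates from 1 on, since \<open>u 0\<close> is not a
  zero divisor.\<close>

lemma boundary_zero_coord:
  assumes "1 \<le> i" "\<And>j. j < d \<Longrightarrow> y j \<in> carrier R" "(\<Sum>j<d. u j \<otimes>\<^bsub>group_ring \<Gamma>\<^esub> y j) = 0"
    and z: "\<And>j. \<lbrakk>1 \<le> j; j < d\<rbrakk> \<Longrightarrow> y j = 0"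
  shows "y 0 = 0"
proof -
  have "(\<Sum>j<d. u j \<otimes>\<^bsub>group_ring \<Gamma>\<^esub> y j) = (\<Sum>j<d. if j = 0 then u 0 \<otimes>\<^bsub>group_ring \<Gamma>\<^esub> y 0 else 0)"
    using z by (intro sum.cong refl) (auto simp: group_ring_mult_zero)
  also have "\<dots> = u 0 \<otimes>\<^bsub>group_ring \<Gamma>\<^esub> y 0" using d_pos by simp
  finally have e: "u 0 \<otimes>\<^bsub>R\<^esub> y 0 = \<zero>\<^bsub>R\<^esub>" using assms(3) by (simp add: R_mult)
  have u0: "u 0 \<in> nonzeros R" using u_nonzero[OF assms(1)] d_pos by simp
  have "u 0 = \<zero>\<^bsub>R\<^esub> \<or> y 0 = \<zero>\<^bsub>R\<^esub>"
    by (rule R.integral[OF e R.nonzeros_carrier[OF u0]]) (use assms(2) d_pos in simp)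
  then show ?thesis using u0 R_nonzeros by simp
qed

text \<open>Below level \<open>n\<close>, words of equal class differ in \<open>F\<close> by an
  element of \<open>N (Suc i)\<close>, some power of which is a product of commutators of loops.
  Derivatives are additive on loops, so they kill that power, and, the coefficients being
  torsion-free, the element itself.\<close>

lemma cs_fb_unique:
  assumes "i < n" and w: "w \<in> words d" "Mg.F.ev w = \<one>\<^bsub>\<Gamma>\<^esub>" and w': "w' \<in> words d" "Mg.F.ev w' = \<one>\<^bsub>\<Gamma>\<^esub>"
    and eq: "Mg.cs (fb w e) = Mg.cs (fb w' e')"
  shows "Mg.F.D j w = Mg.F.D j w'"
proof -
  have "fb w e \<otimes> inv (fb w' e') \<in> derived G (K i)"
    using Mg.cs_eq_iff[of "fb w e" "fb w' e'"] eq w w' ker_eq by simp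
  then have "fb (w @ winv w') (e + e') \<in> \<iota> ` derived F (N i)"
    unfolding K_eq[OF i_le] derived_fibN using w w' by (simp add: fb_inv fb_mult)
  then obtain c where c: "c \<in> derived F (N i)" "fb (w @ winv w') (e + e') = \<iota> c" by blast
  have dsub: "subgroup (derived F (N i)) F" by (rule Fr.P.derived_is_subgroup[OF N_carrier])
  obtain v where v: "v \<in> words d" "c = cl v" using Fr.P_cases[OF subgroup.mem_carrier[OF dsub c(1)]] by metis
  let ?w = "w @ winv w'"
  have ww: "?w \<in> words d" using w w' by simp
  have "fb (?w @ winv v) (e + e') = fb ?w (e + e') \<otimes> inv (eg v)"
    using ww v fb_mult[of ?w "winv v" "e + e'" 0] by (simp add: eg_winv)
  also have "\<dots> = \<one>" using c(2) v \<iota>_cl by simp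
  finally have "cl (?w @ winv v) \<in> N n" using free' ww v by simp
  then have "cl (?w @ winv v) \<in> N (Suc i)" using Fr.P.rational_derived_antimono[of "Suc i" n] assms(1) by auto
  moreover have "cl v \<in> N (Suc i)" using c v Fr.P.derived_le_rational_derived by blast
  ultimately have "cl (?w @ winv v) \<otimes>\<^bsub>F\<^esub> cl v \<in> N (Suc i)"
    by (rule subgroup.m_closed[OF Fr.P.rational_derived_subgroup])
  moreover have "cl (?w @ winv v) \<otimes>\<^bsub>F\<^esub> cl v = cl ?w \<otimes>\<^bsub>F\<^esub> (inv\<^bsub>F\<^esub> cl v \<otimes>\<^bsub>F\<^esub> cl v)"
    using v(1) ww by (simp only: Fr.inv_cls Fr.mult_P words_simps winv_words append_assoc)
  ultimately have "cl ?w \<in> N (Suc i)" using v(1) ww Fr.P.l_inv Fr.P.r_one by simp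
  then obtain k :: int where k: "k \<noteq> 0" "cl ?w [^]\<^bsub>F\<^esub> k \<in> derived F (N i)"
    by (auto simp: rational_derived.simps(2))
  \<comment> \<open>\<open>S\<close> consists of the loops of level \<open>i\<close>, on which the
    derivative is a homomorphism; it contains \<open>N i\<close>.\<close>
  define S where "S = {f \<in> carrier F. \<iota> f \<in> K i}"
  have S: "subgroup S F"
  proof (rule Fr.P.subgroupI)
    show "S \<noteq> {}" unfolding S_def using subgroup.one_closed[OF rational_derived_subgroup[of "Suc i"]] \<iota>.hom_one
      by (metis (mono_tags, lifting) empty_Collect_eq Fr.P.one_closed)
    show "inv\<^bsub>F\<^esub> f \<in> S" if "f \<in> S" for f
      using that subgroup.m_inv_closed[OF rational_derived_subgroup] by (simp add: S_def)
    show "f \<otimes>\<^bsub>F\<^esub> f' \<in> S" if "f \<in> S" "f' \<in> S" for f f'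
      using that subgroup.m_closed[OF rational_derived_subgroup] by (simp add: S_def)
  qed (simp add: S_def)
  have S_cl: "cl v \<in> S \<longleftrightarrow> Mg.F.ev v = \<one>\<^bsub>\<Gamma>\<^esub>" if "v \<in> words d" for v
    using that \<iota>_cl[OF that] ev_one_iff[OF that] by (simp add: S_def)
  have NS: "N i \<subseteq> S"
  proof
    fix f assume f: "f \<in> N i"
    then obtain v where v: "v \<in> words d" "f = cl v" by (rule N_cases)
    then have "eg v \<in> fibN i" unfolding fibN_def using f by (intro CollectI exI[of _ v] exI[of _ 0]) simp
    then show "f \<in> S" using S_cl[OF v(1)] ev_one_iff[OF v(1)] v(2) K_eq[OF i_le] by simp
  qed
  define \<mu> where "\<mu> f = Mg.F.D j (SOME w. w \<in> words d \<and> f = cl w)" for f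
  have \<mu>: "\<mu> (cl v) = Mg.F.D j v" if v: "v \<in> words d" for v
  proof -
    define v' where "v' = (SOME w. w \<in> words d \<and> cl v = cl w)"
    have "v' \<in> words d \<and> cl v = cl v'" unfolding v'_def by (rule someI[of _ v]) (simp add: v)
    then show ?thesis
      unfolding \<mu>_def v'_def[symmetric] using Mg.F.fox_respects[of v' v j] by (simp add: cls_eq_iff pres_rel_sym)
  qed
  interpret SF: group "F\<lparr>carrier := S\<rparr>" by (rule Fr.P.subgroup_imp_group[OF S])
  let ?Z = "free_Abelian_group UNIV :: ('a set \<Rightarrow>\<^sub>0 int) monoid"
  interpret \<mu>: group_hom "F\<lparr>carrier := S\<rparr>" ?Z \<mu>
  proof (intro group_hom.intro group_hom_axioms.intro SF.group_axioms group_free_Abelian_group homI)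
    fix f f' assume ff: "f \<in> carrier (F\<lparr>carrier := S\<rparr>)" "f' \<in> carrier (F\<lparr>carrier := S\<rparr>)"
    then have "f \<in> carrier F" "f' \<in> carrier F" by (simp_all add: S_def)
    then obtain v v' where v: "v \<in> words d" "f = cl v" "v' \<in> words d" "f' = cl v'"
      by (metis Fr.P_cases)
    then have "Mg.F.ev v' = \<one>\<^bsub>\<Gamma>\<^esub>" using ff S_cl[of v'] by simp
    then show "\<mu> (f \<otimes>\<^bsub>F\<lparr>carrier := S\<rparr>\<^esub> f') = \<mu> f \<otimes>\<^bsub>?Z\<^esub> \<mu> f'"
      using v by (simp add: Fr.mult_P \<mu> Mg.F.fox_loops)
  qed simp
  have der: "\<mu> f = 0" if "f \<in> derived F (N i)" for f
  proof -
    have "derived F (N i) = derived (F\<lparr>carrier := S\<rparr>) (N i)"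
      by (rule Fr.P.derived_consistent[OF NS S, symmetric])
    then have "\<mu> f \<in> \<mu> ` derived (F\<lparr>carrier := S\<rparr>) (N i)" using that by simp
    also have "\<dots> = derived ?Z (\<mu> ` N i)" by (rule \<mu>.derived_img[symmetric]) (simp add: NS)
    also have "\<dots> = {\<one>\<^bsub>?Z\<^esub>}"
      by (rule comm_group.derived_eq_singleton[OF abelian_free_Abelian_group]) auto
    finally show ?thesis by simp
  qed
  have wi: "Mg.F.ev (winv w') = \<one>\<^bsub>\<Gamma>\<^esub>"
    by (simp only: Mg.F.ev_winv[OF w'(1)] w'(2) Mg.H.inv_one)
  have "Mg.F.ev ?w = \<one>\<^bsub>\<Gamma>\<^esub>"
    by (simp only: Mg.F.ev_append[OF w(1) winv_words[OF w'(1)]] w(2) wi Mg.H.l_one Mg.H.one_closed)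
  then have wS: "cl ?w \<in> S" using S_cl[OF ww] by simp
  have "\<mu> (cl ?w [^]\<^bsub>F\<^esub> k) = frag_cmul k (\<mu> (cl ?w))"
    using \<mu>.hom_int_pow[of "cl ?w" k] wS Fr.P.int_pow_consistent[OF S wS, of k] by simp
  then have "frag_cmul k (\<mu> (cl ?w)) = 0" using der[OF k(2)] by simp
  then have "Mg.F.D j ?w = 0" using k(1) \<mu>[OF ww] by simp
  moreover have "Mg.F.D j ?w = Mg.F.D j w - Mg.F.D j w'"
    using Mg.F.fox_loops[OF w(1) winv_words[OF w'(1)] wi, of j] Mg.F.fox_loop_winv[OF w', of j] by simp
  ultimately show ?thesis by simp
qed

end

lemma fox_cong:
  assumes "\<And>i. i < m \<Longrightarrow> y i = z i" "w \<in> words m"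
  shows "fox \<Gamma> y j w = fox \<Gamma> z j w"
  using assms(2)
proof (induction w)
  case (Cons a w)
  obtain k b where a: "a = (k, b)" by (cases a)
  have w: "w \<in> words m" "k < m" using Cons.prems by (simp_all add: a)
  show ?case
    using Cons.IH[OF w(1)] assms(1)[OF w(2)] weval_cong[of m y z w \<Gamma>, OF assms(1) w(1)] by (auto simp: a)
qed simp

lemma frag_extend_inj_nonzero:
  assumes "inj_on f (Poly_Mapping.keys a)" "a \<noteq> 0"
  shows "frag_extend (\<lambda>x. frag_of (f x)) a \<noteq> 0"
proof -
  obtain x where x: "x \<in> Poly_Mapping.keys a" using assms(2) by fastforce
  have "Poly_Mapping.lookup (frag_extend (\<lambda>x. frag_of (f x)) a) (f x) =
    (\<Sum>y\<in>Poly_Mapping.keys a. if y = x then Poly_Mapping.lookup a x else 0)"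
    unfolding lookup_frag_extend
    using assms(1) x by (intro sum.cong refl) (auto simp: inj_on_eq_iff)
  also have "\<dots> = Poly_Mapping.lookup a x" using x by simp
  also have "\<dots> \<noteq> 0" using x by (simp add: in_keys_iff)
  finally show ?thesis by (metis lookup_zero)
qed

context fibred_level
begin

text \<open>A nonzero multiple of \<psi> has the same kernel, so every generator of the first
  cohomology leads to the same ring \<open>R\<close>.\<close>

lemma scaled_kernel:
  assumes \<psi>': "\<And>g. g \<in> carrier G \<Longrightarrow> \<psi>' g = c * \<psi> g" "c \<noteq> 0"
  shows "kernel \<Gamma> integer_group (factor_map G \<phi> \<psi>') = Mg.F.W"
proof -
  have factor: "factor_map G \<phi> \<psi>' (\<phi> g) = \<psi>' g" if g: "g \<in> carrier G" for g
  proof -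
    have "\<psi>' h = \<psi>' g" if h: "h \<in> carrier G" "\<phi> h = \<phi> g" for h
    proof -
      have "h \<otimes> inv g \<in> K i"
        using coset_eq_iff[OF rational_derived_subgroup h(1) g] h(2) by simp
      then have "h \<otimes> inv g \<in> K 0" using rational_derived_antimono[of 1 "Suc i"] by auto
      then have "\<psi> h = \<psi> g" using h(1) g by (simp add: K_0_iff \<psi>_mult \<psi>_inv)
      then show ?thesis using \<psi>'(1) h(1) g by simp
    qed
    then have "\<psi>' ` {h \<in> carrier G. \<phi> h = \<phi> g} = (\<lambda>_. \<psi>' g) ` {h \<in> carrier G. \<phi> h = \<phi> g}"
      by (intro image_cong) simp_all
    also have "\<dots> = {\<psi>' g}" using g by (intro image_constant[of g]) simp
    finally show ?thesis by (simp add: factor_map_def)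
  qed
  show ?thesis
  proof (intro equalityI subsetI)
    fix \<gamma> assume "\<gamma> \<in> kernel \<Gamma> integer_group (factor_map G \<phi> \<psi>')"
    then have \<gamma>: "\<gamma> \<in> carrier \<Gamma>" "factor_map G \<phi> \<psi>' \<gamma> = 0" by (simp_all add: kernel_def)
    then obtain g where g: "g \<in> carrier G" "\<gamma> = \<phi> g" unfolding carrier_FactGroup by blast
    then have "g \<in> K 0" using \<gamma>(2) factor \<psi>' by (simp add: K_0_iff)
    then show "\<gamma> \<in> Mg.F.W" unfolding W_eq g(2) by (rule imageI)
  next
    fix \<gamma> assume "\<gamma> \<in> Mg.F.W"
    then obtain g where g: "g \<in> K 0" "\<gamma> = \<phi> g" unfolding W_eq by blast
    then have "g \<in> carrier G" "\<psi> g = 0" by (simp_all add: K_0_iff)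
    then show "\<gamma> \<in> kernel \<Gamma> integer_group (factor_map G \<phi> \<psi>')"
      using g(2) factor[of g] \<psi>'(1)[of g] Mg.hom_closed[of g] by (simp add: kernel_def)
  qed
qed

lemma t_sq_comm:
  assumes "w \<in> words d" shows "(t \<otimes> t) \<otimes> fb w e = fb w e \<otimes> (t \<otimes> t)"
proof -
  have "(t \<otimes> t) \<otimes> x k = x k \<otimes> (t \<otimes> t)" if k: "k < d" for k
  proof -
    note xk = x_closed[OF k]
    have 1: "t \<otimes> x k = inv x k \<otimes> t"
    proof -
      have "t \<otimes> x k = t \<otimes> x k \<otimes> inv t \<otimes> t" using xk by (simp add: m_assoc)
      then show ?thesis by (simp only: t_x[OF k])
    qed
    have "x k \<otimes> t = x k \<otimes> (t \<otimes> x k) \<otimes> inv x k" using xk by (simp add: m_assoc)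
    also have "\<dots> = t \<otimes> inv x k" unfolding 1 using xk by (simp add: inv_cancel)
    finally have 2: "t \<otimes> inv x k = x k \<otimes> t" by simp
    have "(t \<otimes> t) \<otimes> x k = (t \<otimes> inv x k) \<otimes> t" using xk by (simp add: m_assoc 1)
    then show ?thesis unfolding 2 using xk by (simp add: m_assoc)
  qed
  then have 1: "(t \<otimes> t) \<otimes> eg w = eg w \<otimes> (t \<otimes> t)"
    using assms by (intro commute_eg) simp_all
  have "b \<otimes> (t \<otimes> t) = (t \<otimes> t) \<otimes> b" using b_t m_assoc b_closed t_closed by metis
  then have 2: "b [^] e \<otimes> (t \<otimes> t) = (t \<otimes> t) \<otimes> b [^] e" by (intro b_pow_comm) simp_all
  have "(t \<otimes> t) \<otimes> fb w e = ((t \<otimes> t) \<otimes> eg w) \<otimes> b [^] e"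
    unfolding fb_def using assms by (simp add: m_assoc)
  also have "\<dots> = eg w \<otimes> ((t \<otimes> t) \<otimes> b [^] e)" unfolding 1 using assms by (simp add: m_assoc)
  also have "\<dots> = fb w e \<otimes> (t \<otimes> t)" unfolding fb_def 2[symmetric] using assms by (simp add: m_assoc)
  finally show ?thesis .
qed

text \<open>\<open>t\<^sup>2\<close> centralises the fibre, so \<open>t\<^sup>2 - 1\<close> annihilates the whole module.\<close>

lemma r_rank_zero: "r_rank G \<Gamma> \<phi> = 0"
proof -
  have Gam: "\<Gamma>\<lparr>carrier := carrier \<Gamma>\<rparr> = \<Gamma>" by simp
  have "\<phi> ` carrier G = carrier \<Gamma>" by (simp add: carrier_FactGroup)
  then have ore: "right_ore_domain (group_ring \<Gamma>)"
    using right_ore_domain_rational_quotient[of 0 "Suc i"] by simp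
  have mod: "right_mod (group_ring \<Gamma>) Mg.KM"
    using Mg.right_mod_kernel[OF Mg.H.subgroup_self] \<open>\<phi> ` carrier G = carrier \<Gamma>\<close> by simp
  interpret M': right_mod "group_ring \<Gamma>" Mg.KM by (rule mod)
  define s where "s = frag_of (\<phi> (t \<otimes> t)) - frag_of (\<phi> \<one>)"
  have "\<phi> (t \<otimes> t) \<noteq> \<phi> \<one>"
  proof
    assume "\<phi> (t \<otimes> t) = \<phi> \<one>"
    then have "(t \<otimes> t) \<otimes> inv \<one> \<in> K i"
      by (rule iffD1[OF coset_eq_iff[OF rational_derived_subgroup m_closed[OF t_closed t_closed] one_closed]])
    then have "t \<otimes> t \<in> K i" by simp
    then have "t \<otimes> t \<in> K 0" using rational_derived_antimono[of 1 "Suc i"] by auto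
    then show False by (simp add: K_0_iff \<psi>_mult \<psi>_t)
  qed
  then have s0: "s \<noteq> 0" unfolding s_def by (metis eq_iff_diff_eq_0 frag_of_eq)
  have cl: "frag_of (\<phi> (t \<otimes> t)) \<in> carrier (group_ring \<Gamma>)" "frag_of (\<phi> \<one>) \<in> carrier (group_ring \<Gamma>)"
    using Mg.hom_closed[OF m_closed[OF t_closed t_closed]] Mg.hom_closed[OF one_closed]
    by (simp_all only: group_ring_simps(1) keys_frag_of_eq insert_subset empty_subsetI simp_thms)
  have s: "s = frag_of (\<phi> (t \<otimes> t)) \<oplus>\<^bsub>group_ring \<Gamma>\<^esub> (\<ominus>\<^bsub>group_ring \<Gamma>\<^esub> frag_of (\<phi> \<one>))"
    unfolding group_ring_a_inv[OF Mg.H.is_monoid cl(2)] by (simp add: s_def)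
  have sc: "s \<in> carrier (group_ring \<Gamma>)" unfolding s by (intro Mg.F.Z.a_closed Mg.F.Z.a_inv_closed cl)
  \<comment> \<open>For an empty dual system \<open>quotient_rank_eq\<close> asks only that every
    element be torsion.\<close>
  have "quotient_rank (group_ring \<Gamma>) Mg.KM = enat (card {})"
  proof (rule quotient_rank_eq[OF ore mod])
    fix C assume C: "C \<in> carrier Mg.KM"
    then obtain w e where w: "w \<in> words d" "Mg.F.ev w = \<one>\<^bsub>\<Gamma>\<^esub>" "C = Mg.cs (fb w e)" using Kab_rep[of C] by auto
    have k: "fb w e \<in> Mg.ker" by (rule fb_ker[OF w(1,2)])
    have conj: "inv (t \<otimes> t) \<otimes> fb w e \<otimes> (t \<otimes> t) = fb w e"
    proof -
      have "inv (t \<otimes> t) \<otimes> fb w e \<otimes> (t \<otimes> t) = inv (t \<otimes> t) \<otimes> (fb w e \<otimes> (t \<otimes> t))"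
        using w(1) by (intro m_assoc) simp_all
      also have "\<dots> = fb w e" unfolding t_sq_comm[OF w(1), symmetric] using w(1) by (intro inv_cancel) simp_all
      finally show ?thesis .
    qed
    have 1: "act Mg.KM C (frag_of (\<phi> (t \<otimes> t))) = C"
      unfolding w(3) using Mg.act_KM_cs[OF k, of "t \<otimes> t"] conj by simp
    have 2: "act Mg.KM C (frag_of (\<phi> \<one>)) = C"
      unfolding w(3) using Mg.act_KM_cs[OF k, of \<one>] w(1) by simp
    have "act Mg.KM C s = C \<otimes>\<^bsub>Mg.KM\<^esub> inv\<^bsub>Mg.KM\<^esub> C"
      unfolding s M'.act_add[OF C cl(1) Mg.F.Z.a_inv_closed[OF cl(2)]] M'.act_minus[OF C cl(2)] 1 2 ..
    also have "\<dots> = \<one>\<^bsub>Mg.KM\<^esub>" by (rule M.M.r_inv[OF C])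
    finally show "\<exists>s\<in>nonzeros (group_ring \<Gamma>). act Mg.KM C s = \<one>\<^bsub>Mg.KM\<^esub>"
      using sc s0 unfolding nonzeros_def by (intro bexI[of _ s]) simp_all
  qed simp_all
  then show ?thesis by (simp add: r_rank_def zero_enat_def)
qed

lemma nth_degree_eq:
  assumes "\<And>g. g \<in> carrier G \<Longrightarrow> \<psi>' g = c * \<psi> g" "c \<noteq> 0"
  shows "nth_degree G i \<psi>' = quotient_rank R Mg.KM"
  unfolding nth_degree_def degree_bar_def r_rank_zero
  by (subst scaled_kernel[OF assms]) simp_all

section \<open>Fox coordinates on the module and its rank at each level\<close>

definition DD :: "nat \<Rightarrow> 'a set \<Rightarrow> ('a set \<Rightarrow>\<^sub>0 int)" where
  "DD j C = Mg.F.D j (SOME w. w \<in> words d \<and> Mg.F.ev w = \<one>\<^bsub>\<Gamma>\<^esub> \<and> (\<exists>e. C = Mg.cs (fb w e)))"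

lemma DD_cs:
  assumes "i < n" "w \<in> words d" "Mg.F.ev w = \<one>\<^bsub>\<Gamma>\<^esub>"
  shows "DD j (Mg.cs (fb w e)) = Mg.F.D j w"
proof -
  define v where "v = (SOME v. v \<in> words d \<and> Mg.F.ev v = \<one>\<^bsub>\<Gamma>\<^esub> \<and> (\<exists>e'. Mg.cs (fb w e) = Mg.cs (fb v e')))"
  have "v \<in> words d \<and> Mg.F.ev v = \<one>\<^bsub>\<Gamma>\<^esub> \<and> (\<exists>e'. Mg.cs (fb w e) = Mg.cs (fb v e'))"
    unfolding v_def by (rule someI[of _ w]) (use assms in blast)
  then obtain e' where "v \<in> words d" "Mg.F.ev v = \<one>\<^bsub>\<Gamma>\<^esub>" "Mg.cs (fb w e) = Mg.cs (fb v e')" by blast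
  then show ?thesis
    unfolding DD_def v_def[symmetric] using cs_fb_unique[OF assms(1,2,3), of v e e' j] by simp
qed

lemma DD_mult:
  assumes "i < n" "C \<in> carrier Mg.Kab" "C' \<in> carrier Mg.Kab"
  shows "DD j (C \<otimes>\<^bsub>Mg.Kab\<^esub> C') = DD j C + DD j C'"
proof -
  obtain w e where w: "w \<in> words d" "Mg.F.ev w = \<one>\<^bsub>\<Gamma>\<^esub>" "C = Mg.cs (fb w e)" by (rule Kab_rep[OF assms(2)])
  obtain w' e' where w': "w' \<in> words d" "Mg.F.ev w' = \<one>\<^bsub>\<Gamma>\<^esub>" "C' = Mg.cs (fb w' e')" by (rule Kab_rep[OF assms(3)])
  have ww: "w @ w' \<in> words d" using w w' by simp
  have ev: "Mg.F.ev (w @ w') = \<one>\<^bsub>\<Gamma>\<^esub>"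
    by (simp only: Mg.F.ev_append[OF w(1) w'(1)] w(2) w'(2) Mg.H.l_one Mg.H.one_closed)
  show ?thesis
    unfolding w(3) w'(3) cs_fb_mult[OF w(1,2) w'(1,2)] DD_cs[OF assms(1) w(1,2)] DD_cs[OF assms(1) w'(1,2)]
      DD_cs[OF assms(1) ww ev] by (rule Mg.F.fox_loops[OF w(1) w'(1,2)])
qed

lemma DD_closed:
  assumes "i < n" "C \<in> carrier Mg.Kab" shows "DD j C \<in> carrier R"
proof -
  obtain w e where w: "w \<in> words d" "Mg.F.ev w = \<one>\<^bsub>\<Gamma>\<^esub>" "C = Mg.cs (fb w e)" by (rule Kab_rep[OF assms(2)])
  show ?thesis unfolding w(3) DD_cs[OF assms(1) w(1,2)] by (rule fox_R[OF w(1)])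
qed

lemma DD_act:
  assumes "i < n" "C \<in> carrier Mg.Kab" "Poly_Mapping.keys r \<subseteq> Mg.F.W"
  shows "DD j (act Mg.KM C r) = DD j C \<otimes>\<^bsub>R\<^esub> r"
proof -
  \<comment> \<open>The ring is viewed additively as a free abelian group, so that
    \<open>frag_hom_eq\<close> reduces the claim to single group elements.\<close>
  interpret A: comm_group "free_Abelian_group UNIV :: ('a set \<Rightarrow>\<^sub>0 int) monoid"
    by (rule abelian_free_Abelian_group)
  have hom: "act Mg.KM C \<in> hom (free_Abelian_group Mg.F.W) Mg.Kab"
    by (rule Mg.act_KM_hom[OF assms(2) Mg.W_sub])
  show ?thesis
  proof (rule A.frag_hom_eq[OF _ _ _ assms(3)])
    show "(\<lambda>r. DD j (act Mg.KM C r)) \<in> hom (free_Abelian_group Mg.F.W) (free_Abelian_group UNIV)"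
    proof (rule homI)
      fix r s assume rs: "r \<in> carrier (free_Abelian_group Mg.F.W)" "s \<in> carrier (free_Abelian_group Mg.F.W)"
      show "DD j (act Mg.KM C (r \<otimes>\<^bsub>free_Abelian_group Mg.F.W\<^esub> s)) =
        DD j (act Mg.KM C r) \<otimes>\<^bsub>free_Abelian_group UNIV\<^esub> DD j (act Mg.KM C s)"
        using DD_mult[OF assms(1) hom_in_carrier[OF hom rs(1)] hom_in_carrier[OF hom rs(2)], of j]
          Group.hom_mult[OF hom rs] by (simp only: mult_free_Abelian_group)
    qed simp
    show "(\<lambda>r. DD j C \<otimes>\<^bsub>R\<^esub> r) \<in> hom (free_Abelian_group Mg.F.W) (free_Abelian_group UNIV)"
      by (rule homI) (simp_all add: group_ring_mult_add)
    fix \<gamma> assume "\<gamma> \<in> Mg.F.W"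
    then obtain v where v: "v \<in> words d" "\<gamma> = Mg.F.ev v" unfolding Mg.F.W_def by blast
    obtain w e where w: "w \<in> words d" "Mg.F.ev w = \<one>\<^bsub>\<Gamma>\<^esub>" "C = Mg.cs (fb w e)" by (rule Kab_rep[OF assms(2)])
    have vw: "winv v @ w @ v \<in> words d" using v w by simp
    have "Mg.F.ev (winv v @ w @ v) = inv\<^bsub>\<Gamma>\<^esub> Mg.F.ev v \<otimes>\<^bsub>\<Gamma>\<^esub> (\<one>\<^bsub>\<Gamma>\<^esub> \<otimes>\<^bsub>\<Gamma>\<^esub> Mg.F.ev v)"
      using v w by (simp only: Mg.F.ev_append Mg.F.ev_winv words_simps winv_words simp_thms)
    also have "\<dots> = \<one>\<^bsub>\<Gamma>\<^esub>"
      by (simp only: Mg.H.l_one[OF Mg.F.ev_closed[OF v(1)]] Mg.H.l_inv[OF Mg.F.ev_closed[OF v(1)]])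
    finally have ev: "Mg.F.ev (winv v @ w @ v) = \<one>\<^bsub>\<Gamma>\<^esub>" .
    show "DD j (act Mg.KM C (frag_of \<gamma>)) = DD j C \<otimes>\<^bsub>R\<^esub> frag_of \<gamma>"
      unfolding w(3) v(2) act_cs_fb[OF w(1,2) v(1)] DD_cs[OF assms(1) vw ev] DD_cs[OF assms(1) w(1,2)] R_mult
      by (rule Mg.F.fox_conj[OF w(1) v(1) w(2)])
  qed
qed

text \<open>By \<open>magnus_injective\<close> the word part is trivial in the module, and
  \<open>torsion_b\<close> takes care of \<open>b\<close>.\<close>

lemma torsion_of_DD:
  assumes "i < n" "C \<in> carrier Mg.Kab" "\<And>j. j < d \<Longrightarrow> DD j C = 0"
  shows "\<exists>s\<in>nonzeros R. act Mg.KM C s = \<one>\<^bsub>Mg.KM\<^esub>"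
proof -
  obtain w e where w: "w \<in> words d" "Mg.F.ev w = \<one>\<^bsub>\<Gamma>\<^esub>" "C = Mg.cs (fb w e)" by (rule Kab_rep[OF assms(2)])
  have "Mg.cs (eg w) = \<one>\<^bsub>Mg.Kab\<^esub>"
    by (rule Mg.magnus_injective[OF w(1,2)]) (use assms(3) in \<open>simp only: w(3) DD_cs[OF assms(1) w(1,2)]\<close>)
  then have "act Mg.KM (Mg.cs (eg w)) \<one>\<^bsub>R\<^esub> = \<one>\<^bsub>Mg.KM\<^esub>"
    using M.act_one[of "\<one>\<^bsub>Mg.KM\<^esub>"] M.M.one_closed by (simp only: one_kernel_module)
  then show ?thesis unfolding w(3) by (rule torsion_b[OF w(1,2) R.one_nonzeros])
qed

text \<open>At level 0 every letter is itself a loop, and the derivatives of the letters form the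
  identity matrix.\<close>

lemma rank_bottom:
  assumes "i = 0" shows "quotient_rank R Mg.KM = enat d"
proof -
  have i: "i < n" using assms n_pos by simp
  have l: "[(j, True)] \<in> words d" "Mg.F.ev [(j, True)] = \<one>\<^bsub>\<Gamma>\<^esub>" if "j < d" for j
  proof -
    show w: "[(j, True)] \<in> words d" using that by simp
    have "eg [(j, True)] \<in> K i" using that x_closed \<psi>_x assms by (simp add: K_0_iff)
    then show "Mg.F.ev [(j, True)] = \<one>\<^bsub>\<Gamma>\<^esub>" using ev_one_iff[OF w] by simp
  qed
  have DD: "DD k (Mg.cs (fb [(j, True)] 0)) = (if j = k then frag_of \<one>\<^bsub>\<Gamma>\<^esub> else 0)" if "j < d" for j k
    unfolding DD_cs[OF i l[OF that]] by simp
  have "quotient_rank R Mg.KM = enat (card {..<d})"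
  proof (rule quotient_rank_eq[OF right_ore_R M.right_mod_axioms, of _ "\<lambda>j. Mg.cs (fb [(j, True)] 0)" DD])
    show "Mg.cs (fb [(j, True)] 0) \<in> carrier Mg.KM" if "j \<in> {..<d}" for j
      unfolding carrier_kernel_module using that by (intro Mg.cs_closed fb_ker l) simp_all
    show "DD j C \<in> carrier R" if "C \<in> carrier Mg.KM" for j C
      using DD_closed[OF i] that by (simp only: carrier_kernel_module)
    show "DD j (C \<otimes>\<^bsub>Mg.KM\<^esub> C') = DD j C \<oplus>\<^bsub>R\<^esub> DD j C'"
      if "C \<in> carrier Mg.KM" "C' \<in> carrier Mg.KM" for j C C'
      using DD_mult[OF i] that by (simp only: carrier_kernel_module mult_kernel_module group_ring_simps)
    show "DD j (act Mg.KM C r) = DD j C \<otimes>\<^bsub>R\<^esub> r" if "C \<in> carrier Mg.KM" "r \<in> carrier R" for j C r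
      using DD_act[OF i] that by (simp only: carrier_kernel_module R_carrier)
    show "\<exists>s\<in>nonzeros R. act Mg.KM C s = \<one>\<^bsub>Mg.KM\<^esub>"
      if "C \<in> carrier Mg.KM" "\<And>j. j \<in> {..<d} \<Longrightarrow> DD j C = \<zero>\<^bsub>R\<^esub>" for C
      by (rule torsion_of_DD[OF i]) (use that in simp_all)
    show "DD j (Mg.cs (fb [(j, True)] 0)) \<noteq> \<zero>\<^bsub>R\<^esub>" if "j \<in> {..<d}" for j
      using DD[of j j] that by simp
    show "DD j (Mg.cs (fb [(k, True)] 0)) = \<zero>\<^bsub>R\<^esub>" if "j \<in> {..<d}" "k \<in> {..<d}" "j \<noteq> k" for j k
      using DD[of k j] that by simp
  qed simp
  then show ?thesis by simp
qed

text \<open>The loops of \<open>fox_dual_loop\<close> are dual to the coordinates from 1 on, and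
  coordinate 0 depends on these by \<open>boundary_zero_coord\<close>.\<close>

lemma rank_middle:
  assumes "1 \<le> i" "i < n" shows "quotient_rank R Mg.KM = enat (d - 1)"
proof -
  have "\<exists>w\<in>words d. Mg.F.ev w = \<one>\<^bsub>\<Gamma>\<^esub> \<and> Mg.F.D j w \<noteq> 0 \<and>
    (\<forall>k<d. 1 \<le> k \<and> k \<noteq> j \<longrightarrow> Mg.F.D k w = 0)" if j: "1 \<le> j" "j < d" for j
    by (rule Mg.F.fox_dual_loop[OF right_ore_R j])
      (use letter_nontrivial[OF assms(1)] j in simp_all)
  then have "\<forall>j\<in>{1..<d}. \<exists>w. w \<in> words d \<and> Mg.F.ev w = \<one>\<^bsub>\<Gamma>\<^esub> \<and> Mg.F.D j w \<noteq> 0 \<and>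
    (\<forall>k<d. 1 \<le> k \<and> k \<noteq> j \<longrightarrow> Mg.F.D k w = 0)" by (meson atLeastLessThan_iff)
  from bchoice[OF this] obtain v where v: "\<forall>j\<in>{1..<d}. v j \<in> words d \<and> Mg.F.ev (v j) = \<one>\<^bsub>\<Gamma>\<^esub> \<and>
    Mg.F.D j (v j) \<noteq> 0 \<and> (\<forall>k<d. 1 \<le> k \<and> k \<noteq> j \<longrightarrow> Mg.F.D k (v j) = 0)" by blast
  have vw: "v j \<in> words d" "Mg.F.ev (v j) = \<one>\<^bsub>\<Gamma>\<^esub>" if "j \<in> {1..<d}" for j using v that by blast+
  have "quotient_rank R Mg.KM = enat (card {1..<d})"
  proof (rule quotient_rank_eq[OF right_ore_R M.right_mod_axioms, of _ "\<lambda>j. Mg.cs (fb (v j) 0)" DD])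
    show "Mg.cs (fb (v j) 0) \<in> carrier Mg.KM" if "j \<in> {1..<d}" for j
      using Mg.cs_closed[OF fb_ker[OF vw]] that by simp
    show "DD j C \<in> carrier R" if "C \<in> carrier Mg.KM" for j C
      using DD_closed[OF assms(2)] that by (simp only: carrier_kernel_module)
    show "DD j (C \<otimes>\<^bsub>Mg.KM\<^esub> C') = DD j C \<oplus>\<^bsub>R\<^esub> DD j C'"
      if "C \<in> carrier Mg.KM" "C' \<in> carrier Mg.KM" for j C C'
      using DD_mult[OF assms(2)] that by (simp only: carrier_kernel_module mult_kernel_module group_ring_simps)
    show "DD j (act Mg.KM C r) = DD j C \<otimes>\<^bsub>R\<^esub> r" if "C \<in> carrier Mg.KM" "r \<in> carrier R" for j C r
      using DD_act[OF assms(2)] that by (simp only: carrier_kernel_module R_carrier)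
    show "\<exists>s\<in>nonzeros R. act Mg.KM C s = \<one>\<^bsub>Mg.KM\<^esub>"
      if C: "C \<in> carrier Mg.KM" and z: "\<And>j. j \<in> {1..<d} \<Longrightarrow> DD j C = \<zero>\<^bsub>R\<^esub>" for C
    proof (rule torsion_of_DD[OF assms(2)])
      show CK: "C \<in> carrier Mg.Kab" using C by simp
      obtain w e where w: "w \<in> words d" "Mg.F.ev w = \<one>\<^bsub>\<Gamma>\<^esub>" "C = Mg.cs (fb w e)" by (rule Kab_rep[OF CK])
      have zw: "Mg.F.D k w = 0" if "1 \<le> k" "k < d" for k
        using z[of k] that unfolding w(3) DD_cs[OF assms(2) w(1,2)] by simp
      have "Mg.F.D 0 w = 0"
        by (rule boundary_zero_coord[OF assms(1) _ boundary_loop[OF w(1,2)] zw]) (rule fox_R[OF w(1)])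
      then show "DD j C = 0" if "j < d" for j
        unfolding w(3) DD_cs[OF assms(2) w(1,2)] using zw[of j] that by (cases "j = 0") simp_all
    qed
    show "DD j (Mg.cs (fb (v j) 0)) \<noteq> \<zero>\<^bsub>R\<^esub>" if "j \<in> {1..<d}" for j
      unfolding DD_cs[OF assms(2) vw[OF that]] using v that by simp
    show "DD j (Mg.cs (fb (v k) 0)) = \<zero>\<^bsub>R\<^esub>" if "j \<in> {1..<d}" "k \<in> {1..<d}" "j \<noteq> k" for j k
      unfolding DD_cs[OF assms(2) vw[OF that(2)]] using v that by simp
  qed simp
  then show ?thesis by simp
qed

lemma \<rho>_loop: "\<lbrakk>1 \<le> j; j < d\<rbrakk> \<Longrightarrow> Mg.F.ev (\<rho> j) = \<one>\<^bsub>\<Gamma>\<^esub>"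
  using ev_one_iff[OF \<rho>_words] \<rho>_trivial subgroup.one_closed[OF rational_derived_subgroup[of "Suc i"]] by simp

text \<open>The conditions on \<rho> were imposed over \<open>F Mod N n\<close>. At this level the
  kernel of the map from \<open>F\<close> to \<Gamma> is exactly \<open>N n\<close>, so that
  quotient embeds in \<Gamma> and nonzero derivatives stay nonzero.\<close>

lemma \<rho>_fox:
  assumes "i = n" "1 \<le> j" "j < d"
  shows "Mg.F.D j (\<rho> j) \<noteq> 0" "\<And>k. \<lbrakk>1 \<le> k; k < d; k \<noteq> j\<rbrakk> \<Longrightarrow> Mg.F.D k (\<rho> j) = 0"
proof -
  let ?Q = "F Mod N n"
  let ?q = "\<lambda>f. N n #>\<^bsub>F\<^esub> f"
  interpret q: group_hom F ?Q ?q
    by (rule Fr.P.group_hom_coset_map[OF Fr.P.rational_derived_normal])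
  interpret \<theta>: group_hom F \<Gamma> "\<phi> \<circ> \<iota>"
    by (intro group_hom.intro group_hom_axioms.intro Fr.group_P Mg.H.group_axioms
        Group.hom_compose[OF \<iota>.homh Mg.homh])
  have ker: "kernel F \<Gamma> (\<phi> \<circ> \<iota>) = N n"
  proof (intro equalityI subsetI)
    fix f assume "f \<in> kernel F \<Gamma> (\<phi> \<circ> \<iota>)"
    then have f: "f \<in> carrier F" "\<phi> (\<iota> f) = \<one>\<^bsub>\<Gamma>\<^esub>" by (simp_all add: kernel_def)
    then obtain w where w: "w \<in> words d" "f = cl w" using Fr.P_cases by blast
    then have "eg w \<in> fibN n" using f(2) \<phi>_one_iff[of "eg w"] K_eq[OF i_le] \<iota>_cl assms(1) by simp
    then obtain v e where v: "v \<in> words d" "eg w = fb v e" "cl v \<in> N n" unfolding fibN_def by blast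
    have "fb (w @ winv v) e = eg w \<otimes> inv (fb v e)"
      using w(1) v(1) fb_mult[of w "winv v" 0 e] by (simp add: fb_inv)
    also have "\<dots> = \<one>" unfolding v(2) using v(1) by simp
    finally have "cl (w @ winv v) \<in> N n" using free' w v by simp
    then have "cl (w @ winv v) \<otimes>\<^bsub>F\<^esub> cl v \<in> N n"
      using v(3) by (rule subgroup.m_closed[OF Fr.P.rational_derived_subgroup])
    moreover have "cl (w @ winv v) \<otimes>\<^bsub>F\<^esub> cl v = cl w \<otimes>\<^bsub>F\<^esub> (inv\<^bsub>F\<^esub> cl v \<otimes>\<^bsub>F\<^esub> cl v)"
      using v(1) w(1) by (simp only: Fr.inv_cls Fr.mult_P words_simps winv_words append_assoc)
    ultimately show "f \<in> N n" using v(1) w Fr.P.l_inv Fr.P.r_one by simp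
  next
    fix f assume f: "f \<in> N n"
    then obtain w where w: "w \<in> words d" "f = cl w" by (rule N_cases)
    then have "eg w \<in> fibN n" unfolding fibN_def using f by (intro CollectI exI[of _ w] exI[of _ 0]) simp
    then have "\<phi> (\<iota> f) = \<one>\<^bsub>\<Gamma>\<^esub>" using w \<phi>_one_iff[of "eg w"] K_eq[OF i_le] \<iota>_cl assms(1) by simp
    then show "f \<in> kernel F \<Gamma> (\<phi> \<circ> \<iota>)" using w by (simp add: kernel_def)
  qed
  define \<Theta> where "\<Theta> C = the_elem ((\<phi> \<circ> \<iota>) ` C)" for C
  have "\<Theta> \<in> hom ?Q \<Gamma>" using \<theta>.FactGroup_hom unfolding ker \<Theta>_def .
  then interpret \<Theta>: group_hom ?Q \<Gamma> \<Theta>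
    by (simp add: group_hom_def group_hom_axioms_def q.H.group_axioms Mg.H.group_axioms)
  have inj: "inj_on \<Theta> (carrier ?Q)" using \<theta>.FactGroup_inj_on unfolding ker \<Theta>_def .
  have \<Theta>_q: "\<Theta> (?q f) = \<phi> (\<iota> f)" if f: "f \<in> carrier F" for f
  proof -
    have "(\<phi> \<circ> \<iota>) y = \<phi> (\<iota> f)" if y: "y \<in> ?q f" for y
    proof -
      obtain z where z: "z \<in> N n" "y = z \<otimes>\<^bsub>F\<^esub> f" using y by (auto simp: r_coset_def)
      have zc: "z \<in> carrier F" "(\<phi> \<circ> \<iota>) z = \<one>\<^bsub>\<Gamma>\<^esub>" using z(1) unfolding ker[symmetric] kernel_def by simp_all
      have "(\<phi> \<circ> \<iota>) y = (\<phi> \<circ> \<iota>) z \<otimes>\<^bsub>\<Gamma>\<^esub> (\<phi> \<circ> \<iota>) f" unfolding z(2) by (rule \<theta>.hom_mult[OF zc(1) f])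
      also have "\<dots> = (\<phi> \<circ> \<iota>) f" unfolding zc(2) by (rule Mg.H.l_one[OF \<theta>.hom_closed[OF f]])
      finally show ?thesis by simp
    qed
    then have "(\<phi> \<circ> \<iota>) ` ?q f = (\<lambda>_. \<phi> (\<iota> f)) ` ?q f" by (intro image_cong) simp_all
    also have "\<dots> = {\<phi> (\<iota> f)}"
      by (rule image_constant[OF Fr.P.rcos_self[OF f Fr.P.rational_derived_subgroup]])
    finally show ?thesis by (simp add: \<Theta>_def)
  qed
  define y where "y k = ?q (cl [(k, True)])" for k
  have y: "y k \<in> carrier ?Q" "\<Theta> (y k) = \<phi> (x k)" if "k < d" for k
  proof -
    have l: "[(k, True)] \<in> words d" using that by simp
    show "y k \<in> carrier ?Q" unfolding y_def by (rule q.hom_closed[OF Fr.cls_closed[OF l]])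
    show "\<Theta> (y k) = \<phi> (x k)"
      unfolding y_def \<Theta>_q[OF Fr.cls_closed[OF l]] \<iota>_cl[OF l] using x_closed[OF that] by simp
  qed
  interpret FQ: fox_setup ?Q y d
    by (intro fox_setup.intro fox_setup_axioms.intro q.H.group_axioms y(1))
  have y_fun: "y = (\<lambda>k. ?q (cl [(k, True)]))" by (rule ext) (rule y_def)
  have w: "\<rho> j \<in> words d" using \<rho>_words assms by simp
  have D: "Mg.F.D k (\<rho> j) = frag_extend (\<lambda>\<gamma>. frag_of (\<Theta> \<gamma>)) (fox ?Q y k (\<rho> j))" for k
    using \<Theta>.fox_hom[of d y "\<rho> j" k, OF y(1) w] fox_cong[of d "\<lambda>k. \<Theta> (y k)" "\<lambda>k. \<phi> (x k)" "\<rho> j" \<Gamma> k] y(2) w by simp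
  have "inj_on \<Theta> (Poly_Mapping.keys (fox ?Q y j (\<rho> j)))"
    by (rule inj_on_subset[OF inj]) (use FQ.fox_closed[OF w, of j] in simp)
  then show "Mg.F.D j (\<rho> j) \<noteq> 0"
    unfolding D by (rule frag_extend_inj_nonzero) (unfold y_fun, rule \<rho>_diag[OF assms(2,3)])
  show "Mg.F.D k (\<rho> j) = 0" if "1 \<le> k" "k < d" "k \<noteq> j" for k
    unfolding D y_fun \<rho>_off[OF assms(2,3) that] by (rule frag_extend_0)
qed

text \<open>The derivatives are not functions on the module here: \<open>\<rho> j\<close> is trivial
  in \<open>G\<close> but has a nonzero derivative. Instead, the coordinates of a loop, multiplied
  by some \<open>s\<close>, are matched with a combination of those of the relators, and
  \<open>T\<close> carries this identity back to the module, where the relators are trivial.\<close>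

lemma rank_top:
  assumes "i = n" shows "quotient_rank R Mg.KM = 0"
proof -
  have i1: "1 \<le> i" using assms n_pos by simp
  let ?J = "{1..<d}"
  let ?Z = "group_ring \<Gamma>"
  have RZ: "r \<in> carrier ?Z" if "r \<in> carrier R" for r
    using that Mg.F.W_carrier by auto
  have "quotient_rank R Mg.KM = enat (card {})"
  proof (rule quotient_rank_eq[OF right_ore_R M.right_mod_axioms])
    fix C assume "C \<in> carrier Mg.KM"
    then have CK: "C \<in> carrier Mg.Kab" by simp
    obtain w e where w: "w \<in> words d" "Mg.F.ev w = \<one>\<^bsub>\<Gamma>\<^esub>" "C = Mg.cs (fb w e)" by (rule Kab_rep[OF CK])
    have \<rho>w: "\<rho> j \<in> words d" "Mg.F.ev (\<rho> j) = \<one>\<^bsub>\<Gamma>\<^esub>" "Mg.F.D j (\<rho> j) \<noteq> 0" if "j \<in> ?J" for j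
      using that \<rho>_words \<rho>_loop \<rho>_fox(1)[OF assms] by simp_all
    have "\<exists>s\<in>nonzeros R. \<exists>c. \<forall>j\<in>?J. c j \<in> carrier R \<and> Mg.F.D j w \<otimes>\<^bsub>R\<^esub> s = Mg.F.D j (\<rho> j) \<otimes>\<^bsub>R\<^esub> c j"
    proof (rule R.ore_common_denominator)
      show "Mg.F.D j (\<rho> j) \<in> nonzeros R" if "j \<in> ?J" for j
        using \<rho>w[OF that] Mg.F.fox_keys[of "\<rho> j" j] by (simp only: R_nonzeros simp_thms not_False_eq_True)
    qed (simp, rule fox_R[OF w(1)])
    then obtain s c where s: "s \<in> nonzeros R" and
      c: "\<forall>j\<in>?J. c j \<in> carrier R \<and> Mg.F.D j w \<otimes>\<^bsub>R\<^esub> s = Mg.F.D j (\<rho> j) \<otimes>\<^bsub>R\<^esub> c j" by blast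
    have cR: "c j \<in> carrier R" "Poly_Mapping.keys (c j) \<subseteq> Mg.F.W" if "j \<in> ?J" for j using c that by simp_all
    have sR: "s \<in> carrier R" "Poly_Mapping.keys s \<subseteq> Mg.F.W" using s by (simp_all add: R_nonzeros)
    define S where "S I k = (\<Sum>j\<in>I. Mg.F.D k (\<rho> j) \<otimes>\<^bsub>?Z\<^esub> c j)" for I k
    \<comment> \<open>A cycle whose coordinates from 1 on vanish by the choice of \<open>c\<close>;
      hence it is zero altogether.\<close>
    define y where "y k = Mg.F.D k w \<otimes>\<^bsub>?Z\<^esub> s - S ?J k" for k
    have prodW: "Poly_Mapping.keys (a \<otimes>\<^bsub>?Z\<^esub> a') \<subseteq> Mg.F.W"
      if "Poly_Mapping.keys a \<subseteq> Mg.F.W" "Poly_Mapping.keys a' \<subseteq> Mg.F.W" for a a'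
      by (rule keys_group_ring_mult[OF that]) (rule Mg.F.W_m_closed)
    have SW: "Poly_Mapping.keys (S I k) \<subseteq> Mg.F.W" if "I \<subseteq> ?J" for I k
      unfolding S_def
    proof (intro order_trans[OF keys_sum] UN_least prodW)
      fix j assume "j \<in> I"
      then have j: "j \<in> ?J" using that by blast
      show "Poly_Mapping.keys (Mg.F.D k (\<rho> j)) \<subseteq> Mg.F.W" by (rule Mg.F.fox_keys[OF \<rho>w(1)[OF j]])
      show "Poly_Mapping.keys (c j) \<subseteq> Mg.F.W" by (rule cR(2)[OF j])
    qed
    have yW: "y k \<in> carrier R" for k
      unfolding y_def R_carrier
      by (intro keys_diff_subset prodW Mg.F.fox_keys[OF w(1)] sR(2) SW subset_refl)
    have y0: "y k = 0" if k: "1 \<le> k" "k < d" for k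
    proof -
      have "S ?J k = (\<Sum>j\<in>?J. if j = k then Mg.F.D k (\<rho> k) \<otimes>\<^bsub>?Z\<^esub> c k else 0)"
        unfolding S_def
      proof (intro sum.cong refl)
        fix j assume j: "j \<in> ?J"
        show "Mg.F.D k (\<rho> j) \<otimes>\<^bsub>?Z\<^esub> c j = (if j = k then Mg.F.D k (\<rho> k) \<otimes>\<^bsub>?Z\<^esub> c k else 0)"
          using \<rho>_fox(2)[OF assms, of j k] j k by (simp add: group_ring_mult_zero)
      qed
      also have "\<dots> = Mg.F.D k (\<rho> k) \<otimes>\<^bsub>?Z\<^esub> c k" using k by simp
      also have "\<dots> = Mg.F.D k w \<otimes>\<^bsub>?Z\<^esub> s" using c k by (simp add: R_mult)
      finally show ?thesis by (simp add: y_def)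
    qed
    have bd: "(\<Sum>k<d. u k \<otimes>\<^bsub>?Z\<^esub> (Mg.F.D k v \<otimes>\<^bsub>?Z\<^esub> r)) = 0"
      if v: "v \<in> words d" "Mg.F.ev v = \<one>\<^bsub>\<Gamma>\<^esub>" and r: "r \<in> carrier R" for v r
    proof -
      have "(\<Sum>k<d. u k \<otimes>\<^bsub>?Z\<^esub> (Mg.F.D k v \<otimes>\<^bsub>?Z\<^esub> r)) = (\<Sum>k<d. u k \<otimes>\<^bsub>?Z\<^esub> Mg.F.D k v \<otimes>\<^bsub>?Z\<^esub> r)"
        by (intro sum.cong refl Mg.F.Z.m_assoc[symmetric] RZ u_carrier fox_R[OF v(1)] r) simp
      also have "\<dots> = 0" by (simp only: group_ring_mult_sum(1)[symmetric] boundary_loop[OF v] group_ring_mult_zero)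
      finally show ?thesis .
    qed
    have "(\<Sum>k<d. u k \<otimes>\<^bsub>?Z\<^esub> y k) = (\<Sum>k<d. u k \<otimes>\<^bsub>?Z\<^esub> (Mg.F.D k w \<otimes>\<^bsub>?Z\<^esub> s)) -
      (\<Sum>k<d. \<Sum>j\<in>?J. u k \<otimes>\<^bsub>?Z\<^esub> (Mg.F.D k (\<rho> j) \<otimes>\<^bsub>?Z\<^esub> c j))"
      unfolding y_def S_def group_ring_mult_diff group_ring_mult_sum sum_subtractf ..
    also have "(\<Sum>k<d. \<Sum>j\<in>?J. u k \<otimes>\<^bsub>?Z\<^esub> (Mg.F.D k (\<rho> j) \<otimes>\<^bsub>?Z\<^esub> c j)) =
      (\<Sum>j\<in>?J. \<Sum>k<d. u k \<otimes>\<^bsub>?Z\<^esub> (Mg.F.D k (\<rho> j) \<otimes>\<^bsub>?Z\<^esub> c j))" by (rule sum.swap)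
    also have "\<dots> = 0" by (intro sum.neutral ballI bd \<rho>w cR)
    finally have "(\<Sum>k<d. u k \<otimes>\<^bsub>?Z\<^esub> y k) = 0" using bd[OF w(1,2) sR(1)] by simp
    then have "y 0 = 0" using boundary_zero_coord[OF i1, of y] yW y0 by blast
    then have yz: "Mg.F.D k w \<otimes>\<^bsub>?Z\<^esub> s = S ?J k" if "k < d" for k
      using y0[of k] that by (cases "k = 0") (simp_all add: y_def)
    \<comment> \<open>\<open>T\<close> turns each relator term into the action of \<open>c j\<close>
      on the class of \<open>\<rho> j\<close>, which is trivial.\<close>
    have TS: "Mg.T (S I) = \<one>\<^bsub>Mg.Kab\<^esub>" if "I \<subseteq> ?J" for I
      using finite_subset[OF that finite_atLeastLessThan] that
    proof (induction I rule: finite_induct)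
      case empty
      have "S {} = (\<lambda>k. 0)" by (rule ext) (simp add: S_def)
      then show ?case by (simp only: Mg.T_zero)
    next
      case (insert j I)
      have j: "j \<in> ?J" and I: "I \<subseteq> ?J" using insert.prems by auto
      have "S (insert j I) = (\<lambda>k. Mg.F.D k (\<rho> j) \<otimes>\<^bsub>?Z\<^esub> c j + S I k)"
        by (rule ext) (simp add: S_def insert.hyps)
      then have "Mg.T (S (insert j I)) = Mg.T (\<lambda>k. Mg.F.D k (\<rho> j) \<otimes>\<^bsub>?Z\<^esub> c j) \<otimes>\<^bsub>Mg.Kab\<^esub> Mg.T (S I)"
        using Mg.T_add[of "\<lambda>k. Mg.F.D k (\<rho> j) \<otimes>\<^bsub>?Z\<^esub> c j" "S I"] prodW[OF Mg.F.fox_keys[OF \<rho>w(1)[OF j]] cR(2)[OF j]] SW[OF I]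
        by (simp only:)
      also have "Mg.T (\<lambda>k. Mg.F.D k (\<rho> j) \<otimes>\<^bsub>?Z\<^esub> c j) = act Mg.KM (Mg.cs (eg (\<rho> j))) (c j)"
        by (rule Mg.T_act[OF \<rho>w(1,2)[OF j] cR(2)[OF j]])
      also have "Mg.cs (eg (\<rho> j)) = \<one>\<^bsub>Mg.KM\<^esub>"
        using \<rho>_trivial[of j] j Mg.cs_one by simp
      also have "act Mg.KM \<one>\<^bsub>Mg.KM\<^esub> (c j) = \<one>\<^bsub>Mg.KM\<^esub>" by (rule M.act_one_left[OF cR(1)[OF j]])
      finally show ?case using insert.IH[OF I] Mg.Kab.l_one[OF Mg.Kab.one_closed] by (simp only: one_kernel_module)
    qed
    have "act Mg.KM (Mg.cs (eg w)) s = Mg.T (\<lambda>k. Mg.F.D k w \<otimes>\<^bsub>?Z\<^esub> s)"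
      by (rule Mg.T_act[OF w(1,2) sR(2), symmetric])
    also have "\<dots> = Mg.T (S ?J)" by (rule Mg.T_cong) (rule yz, assumption, rule SW[OF subset_refl])
    also have "\<dots> = \<one>\<^bsub>Mg.KM\<^esub>" using TS[OF subset_refl] by (simp only: one_kernel_module)
    finally have "act Mg.KM (Mg.cs (eg w)) s = \<one>\<^bsub>Mg.KM\<^esub>" .
    then show "\<exists>s\<in>nonzeros R. act Mg.KM C s = \<one>\<^bsub>Mg.KM\<^esub>"
      unfolding w(3) by (rule torsion_b[OF w(1,2) s])
  qed simp_all
  then show ?thesis by (simp add: zero_enat_def)
qed

end

context fibred_group
begin

theorem nth_degrees:
  assumes "\<And>g. g \<in> carrier G \<Longrightarrow> \<psi>' g = c * \<psi> g" "c \<noteq> 0"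
  shows "nth_degree G 0 \<psi>' = enat d"
    and "\<lbrakk>1 \<le> i; i < n\<rbrakk> \<Longrightarrow> nth_degree G i \<psi>' = enat (d - 1)"
    and "nth_degree G n \<psi>' = 0"
proof -
  interpret L0: fibred_level G d n x t b \<psi> \<rho> 0 by unfold_locales simp
  show "nth_degree G 0 \<psi>' = enat d" using L0.nth_degree_eq[OF assms] L0.rank_bottom by simp
next
  assume i: "1 \<le> i" "i < n"
  interpret Li: fibred_level G d n x t b \<psi> \<rho> i by unfold_locales (use i in simp)
  show "nth_degree G i \<psi>' = enat (d - 1)" using Li.nth_degree_eq[OF assms] Li.rank_middle[OF i] by simp
next
  interpret Ln: fibred_level G d n x t b \<psi> \<rho> n by unfold_locales simp
  show "nth_degree G n \<psi>' = 0" using Ln.nth_degree_eq[OF assms] Ln.rank_top by simp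
qed

end

section \<open>Homomorphisms to the integers and the first Betti number\<close>

context fibred_group
begin

text \<open>Each \<open>x i\<close> is conjugate to its inverse and \<open>b\<close> is an
  involution, so \<chi> vanishes on the fibre and is determined by its value at
  \<open>t\<close>.\<close>

lemma hom_int_eq:
  assumes \<chi>: "\<chi> \<in> hom G integer_group" and g: "g \<in> carrier G"
  shows "\<chi> g = \<chi> t * \<psi> g"
proof -
  interpret \<chi>: group_hom G integer_group \<chi>
    using \<chi> by (simp add: group_hom_def group_hom_axioms_def is_group)
  have mult: "\<chi> (y \<otimes> z) = \<chi> y + \<chi> z" if "y \<in> carrier G" "z \<in> carrier G" for y z
    using \<chi>.hom_mult[OF that] by simp
  have inv: "\<chi> (inv y) = - \<chi> y" if "y \<in> carrier G" for y
    using \<chi>.hom_inv[OF that] by simp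
  have one: "\<chi> \<one> = 0" using \<chi>.hom_one by simp
  have pow: "\<chi> (y [^] (k::int)) = k * \<chi> y" if "y \<in> carrier G" for y k
    using \<chi>.hom_int_pow[OF that, of k] by simp
  have x: "\<chi> (x i) = 0" if i: "i < d" for i
  proof -
    have "\<chi> (t \<otimes> x i \<otimes> inv t) = \<chi> (inv x i)" using t_x[OF i] by simp
    then show ?thesis using x_closed[OF i] by (simp add: mult inv)
  qed
  have b: "\<chi> b = 0" using mult[of b b] by (simp add: b_sq one)
  have b_pow: "\<chi> (b [^] (e::nat)) = 0" for e
    by (induction e) (simp_all add: one mult b)
  have eg: "\<chi> (eg w) = 0" if "w \<in> words d" for w
    using that
  proof (induction w)
    case (Cons a w)
    obtain i \<beta> where a: "a = (i, \<beta>)" by (cases a)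
    show ?case using Cons x_closed[of i] x[of i] by (auto simp: a mult inv)
  qed (simp add: one)
  let ?u = "g \<otimes> t [^] (- \<psi> g)"
  have "\<psi> ?u = 0" using g by (simp add: \<psi>_mult \<psi>_int_pow \<psi>_t)
  then obtain w e where w: "w \<in> words d" "?u = fb w e" using \<psi>_zero_iff[of ?u] g by auto
  have "\<chi> ?u = 0" unfolding w(2) fb_def using w(1) by (simp add: mult eg b_pow)
  then show ?thesis using g by (simp add: mult pow)
qed

lemma generator_scaled:
  assumes "generates_first_cohomology G \<psi>'"
  shows "\<exists>c. c \<noteq> 0 \<and> (\<forall>g\<in>carrier G. \<psi>' g = c * \<psi> g)"
proof -
  let ?H = "first_cohomology G"
  have \<psi>': "\<psi>' \<in> carrier ?H" "generate ?H {\<psi>'} = carrier ?H"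
    using assms by (simp_all add: generates_first_cohomology_def)
  have hom: "\<psi>' \<in> hom G integer_group" "\<psi>' \<in> extensional (carrier G)"
    using \<psi>'(1) by (simp_all add: first_cohomology_def)
  have eq: "\<psi>' g = \<psi>' t * \<psi> g" if "g \<in> carrier G" for g by (rule hom_int_eq[OF hom(1) that])
  have "\<psi>' t \<noteq> 0"
  proof
    \<comment> \<open>Then \<open>\<psi>'\<close> would be the neutral element and generate only
      itself, while \<psi> is a further element. The unit laws that this takes are verified
      directly.\<close>
    assume z: "\<psi>' t = 0"
    have one: "\<psi>' = \<one>\<^bsub>?H\<^esub>"
    proof (rule extensionalityI[OF hom(2)])
      show "\<one>\<^bsub>?H\<^esub> \<in> extensional (carrier G)" by (simp add: first_cohomology_def)
      show "\<psi>' g = \<one>\<^bsub>?H\<^esub> g" if "g \<in> carrier G" for g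
        using eq[OF that] z that by (simp add: first_cohomology_def)
    qed
    have one_carrier: "\<one>\<^bsub>?H\<^esub> \<in> carrier ?H" using \<psi>'(1) one by simp
    have mult_one: "\<one>\<^bsub>?H\<^esub> \<otimes>\<^bsub>?H\<^esub> f = f" if "f \<in> carrier ?H" for f
    proof (rule extensionalityI[of _ "carrier G"])
      show "\<one>\<^bsub>?H\<^esub> \<otimes>\<^bsub>?H\<^esub> f \<in> extensional (carrier G)" by (simp add: first_cohomology_def)
      show "f \<in> extensional (carrier G)" using that by (simp add: first_cohomology_def)
      show "(\<one>\<^bsub>?H\<^esub> \<otimes>\<^bsub>?H\<^esub> f) g = f g" if "g \<in> carrier G" for g
        using that by (simp add: first_cohomology_def)
    qed
    have inv_one: "inv\<^bsub>?H\<^esub> \<one>\<^bsub>?H\<^esub> = \<one>\<^bsub>?H\<^esub>"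
      unfolding m_inv_def
    proof (rule the_equality)
      show "\<one>\<^bsub>?H\<^esub> \<in> carrier ?H \<and> \<one>\<^bsub>?H\<^esub> \<otimes>\<^bsub>?H\<^esub> \<one>\<^bsub>?H\<^esub> = \<one>\<^bsub>?H\<^esub> \<and> \<one>\<^bsub>?H\<^esub> \<otimes>\<^bsub>?H\<^esub> \<one>\<^bsub>?H\<^esub> = \<one>\<^bsub>?H\<^esub>"
        using mult_one one_carrier by simp
      fix f assume "f \<in> carrier ?H \<and> \<one>\<^bsub>?H\<^esub> \<otimes>\<^bsub>?H\<^esub> f = \<one>\<^bsub>?H\<^esub> \<and> f \<otimes>\<^bsub>?H\<^esub> \<one>\<^bsub>?H\<^esub> = \<one>\<^bsub>?H\<^esub>"
      then show "f = \<one>\<^bsub>?H\<^esub>" using mult_one[of f] by simp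
    qed
    have gen: "f = \<one>\<^bsub>?H\<^esub>" if "f \<in> generate ?H {\<psi>'}" for f
      using that
    proof (induction rule: generate.induct)
      case (eng f f')
      then show ?case using mult_one[OF one_carrier] by (simp only:)
    qed (use one inv_one in auto)
    have "(\<lambda>g\<in>carrier G. \<psi> g) \<in> carrier ?H"
      unfolding first_cohomology_def using \<psi>_mult by (auto simp: hom_def)
    then have "(\<lambda>g\<in>carrier G. \<psi> g) = \<one>\<^bsub>?H\<^esub>" using gen \<psi>'(2) by blast
    then have "(\<lambda>g\<in>carrier G. \<psi> g) t = \<one>\<^bsub>?H\<^esub> t" by (rule fun_cong)
    then show False using \<psi>_t by (simp add: first_cohomology_def)
  qed
  then show ?thesis using eq by blast
qed

lemma first_betti_one: "first_betti G = 1"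
proof -
  let ?D = "derived G (carrier G)"
  let ?A = "G Mod ?D"
  interpret A: comm_group ?A by (rule derived_quot_is_comm_group)
  interpret q: group_hom G ?A "\<lambda>g. ?D #> g" by (rule group_hom_coset_map[OF derived_self_is_normal])
  define q where "q g = ?D #> g" for g
  have q_mult: "q (y \<otimes> z) = q y \<otimes>\<^bsub>?A\<^esub> q z" if "y \<in> carrier G" "z \<in> carrier G" for y z
    unfolding q_def by (rule q.hom_mult[OF that])
  have q_closed: "q y \<in> carrier ?A" if "y \<in> carrier G" for y
    unfolding q_def by (rule q.hom_closed[OF that])
  have q_pow: "q (y [^] (k::int)) = q y [^]\<^bsub>?A\<^esub> k" if "y \<in> carrier G" for y k
    unfolding q_def by (rule q.hom_int_pow[OF that])
  have D: "subgroup ?D G" by (rule normal_imp_subgroup[OF derived_self_is_normal])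
  have q_one: "q y = \<one>\<^bsub>?A\<^esub> \<longleftrightarrow> y \<in> ?D" if "y \<in> carrier G" for y
    using coset_eq_self_iff[OF D that] by (simp add: q_def)
  have q_onto: "\<exists>g\<in>carrier G. p = q g" if "p \<in> carrier ?A" for p
    using that by (auto simp: carrier_FactGroup q_def)
  have "Z_independent ?A {q t}"
    unfolding Z_independent_def
  proof (intro conjI allI impI ballI)
    show "{q t} \<subseteq> carrier ?A" using q_closed[OF t_closed] by simp
    fix c :: "'a set \<Rightarrow> int" and p
    assume fp: "finprod ?A (\<lambda>p. p [^]\<^bsub>?A\<^esub> c p) {q t} = \<one>\<^bsub>?A\<^esub>" and p: "p \<in> {q t}"
    have "q t [^]\<^bsub>?A\<^esub> c (q t) = \<one>\<^bsub>?A\<^esub>"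
      using fp A.finprod_insert[of "{}" "q t" "\<lambda>p. p [^]\<^bsub>?A\<^esub> c p"] q_closed[OF t_closed]
        A.int_pow_closed[OF q_closed[OF t_closed]] A.r_one by simp
    then have "t [^] c (q t) \<in> ?D" using q_pow[OF t_closed] q_one[OF int_pow_closed[OF t_closed]] by simp
    then have "\<psi> (t [^] c (q t)) = 0" by (rule \<psi>_derived)
    then show "c p = 0" using p by (simp add: \<psi>_int_pow \<psi>_t)
  qed simp
  moreover have "card B \<le> 1" if B: "Z_independent ?A B" for B
  proof (rule ccontr)
    assume "\<not> card B \<le> 1"
    have Bf: "finite B" "B \<subseteq> carrier ?A" and
      Bi: "\<And>c :: 'a set \<Rightarrow> int. finprod ?A (\<lambda>p. p [^]\<^bsub>?A\<^esub> c p) B = \<one>\<^bsub>?A\<^esub> \<Longrightarrow> \<forall>p\<in>B. c p = 0"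
      using B unfolding Z_independent_def by blast+
    obtain p r where pr: "p \<in> B" "r \<in> B" "p \<noteq> r"
      using \<open>\<not> card B \<le> 1\<close> Bf(1) by (metis card_le_Suc0_iff_eq One_nat_def)
    obtain g h where g: "g \<in> carrier G" "p = q g" and h: "h \<in> carrier G" "r = q h"
      using q_onto pr Bf(2) by (meson subsetD)
    \<comment> \<open>Coefficients with \<open>\<alpha> * \<psi> g + \<beta> * \<psi> h = 0\<close>;
      if both values vanish, the defaults 1 and 0 keep the pair nonzero.\<close>
    define \<alpha> where "\<alpha> = (if \<psi> g = 0 \<and> \<psi> h = 0 then 1 else \<psi> h)"
    define \<beta> where "\<beta> = (if \<psi> g = 0 \<and> \<psi> h = 0 then 0 else - \<psi> g)"
    have ab: "\<alpha> * \<psi> g + \<beta> * \<psi> h = 0" "\<alpha> \<noteq> 0 \<or> \<beta> \<noteq> 0" by (auto simp: \<alpha>_def \<beta>_def)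
    define v where "v = g [^] \<alpha> \<otimes> h [^] \<beta>"
    have v: "v \<in> carrier G" using g h by (simp add: v_def)
    have "\<psi> v = 0" unfolding v_def using g h ab(1) by (simp add: \<psi>_mult \<psi>_int_pow)
    then obtain w e where w: "w \<in> words d" "v = fb w e" using \<psi>_zero_iff[OF v] by blast
    then have "v \<otimes> v \<in> ?D" using fibre_square by simp
    then have vv: "q v \<otimes>\<^bsub>?A\<^esub> q v = \<one>\<^bsub>?A\<^esub>" using q_one[of "v \<otimes> v"] q_mult[OF v v] v by simp
    have pc: "p \<in> carrier ?A" "r \<in> carrier ?A" using pr Bf(2) by blast+
    have qv: "q v = p [^]\<^bsub>?A\<^esub> \<alpha> \<otimes>\<^bsub>?A\<^esub> r [^]\<^bsub>?A\<^esub> \<beta>"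
      unfolding v_def using g h by (simp only: q_mult q_pow int_pow_closed)
    \<comment> \<open>The coefficients are doubled because it is the square of \<open>v\<close> that
      lies in the commutator subgroup.\<close>
    define c where "c s = (if s = p then 2 * \<alpha> else if s = r then 2 * \<beta> else 0)" for s
    have "finprod ?A (\<lambda>s. s [^]\<^bsub>?A\<^esub> c s) B = finprod ?A (\<lambda>s. s [^]\<^bsub>?A\<^esub> c s) {p, r}"
      by (rule A.finprod_mono_neutral_cong_right[OF Bf(1)])
        (use pr Bf(2) in \<open>auto simp: c_def A.int_pow_closed simp del: one_FactGroup\<close>)
    also have "\<dots> = p [^]\<^bsub>?A\<^esub> c p \<otimes>\<^bsub>?A\<^esub> r [^]\<^bsub>?A\<^esub> c r"
      using pr(3) pc by (simp del: one_FactGroup mult_FactGroup)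
    also have "\<dots> = p [^]\<^bsub>?A\<^esub> (\<alpha> + \<alpha>) \<otimes>\<^bsub>?A\<^esub> r [^]\<^bsub>?A\<^esub> (\<beta> + \<beta>)"
      using pr(3) by (simp add: c_def del: mult_FactGroup)
    also have "\<dots> = q v \<otimes>\<^bsub>?A\<^esub> q v"
      unfolding qv by (simp only: A.int_pow_mult pc A.m_ac A.int_pow_closed A.m_closed)
    finally have "\<forall>s\<in>B. c s = 0" using Bi[of c] vv by simp
    then have "c p = 0" "c r = 0" using pr by blast+
    then show False using pr(3) ab(2) by (simp add: c_def)
  qed
  ultimately have "Sup {enat (card B) |B. Z_independent ?A B} = enat 1"
    by (intro antisym Sup_least Sup_upper) (auto intro!: exI[of _ "{q t}"])
  then show ?thesis by (simp add: first_betti_def abelian_rank_def one_enat_def)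
qed

end

section \<open>The examples\<close>

lemma (in group_hom) rational_derived_image:
  "g \<in> rational_derived G k \<Longrightarrow> h g \<in> rational_derived H k"
proof (induction k arbitrary: g)
  case (Suc k)
  obtain l :: int where g: "g \<in> rational_derived G k" and l: "l \<noteq> 0" "g [^]\<^bsub>G\<^esub> l \<in> derived G (rational_derived G k)"
    using Suc.prems by (auto simp: rational_derived.simps(2))
  have gc: "g \<in> carrier G" by (rule G.rational_derived_carrier[OF g])
  have "rational_derived G k \<subseteq> carrier G" using G.rational_derived_carrier by blast
  then have "h ` derived G (rational_derived G k) = derived H (h ` rational_derived G k)"
    by (rule derived_img[symmetric])
  also have "\<dots> \<subseteq> derived H (rational_derived H k)"
    using Suc.IH H.rational_derived_carrier by (intro H.mono_derived) blast+
  finally have "h (g [^]\<^bsub>G\<^esub> l) \<in> derived H (rational_derived H k)" using l(2) by blast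
  then have "h g [^]\<^bsub>H\<^esub> l \<in> derived H (rational_derived H k)" using hom_int_pow[OF gc] by simp
  then show ?case using Suc.IH[OF g] l(1) by (auto simp: rational_derived.simps(2))
qed simp

lemma (in group) weval_one:
  assumes "\<And>i. i < m \<Longrightarrow> y i = \<one>" "w \<in> words m" shows "weval G y w = \<one>"
  using assms(2) by (induction w) (auto simp: assms(1))

text \<open>Inverts every letter without reversing the word: the effect of conjugation by
  \<open>t\<close>.\<close>

definition flip :: "word \<Rightarrow> word" where "flip w = map (\<lambda>(i, \<beta>). (i, \<not> \<beta>)) w"

lemma flip_words [simp]: "flip w \<in> words m \<longleftrightarrow> w \<in> words m"
  by (induction w) (auto simp: flip_def)

lemma flip_flip [simp]: "flip (flip w) = w"
  by (induction w) (auto simp: flip_def)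

lemma (in group) weval_flip:
  assumes "\<And>i. i < m \<Longrightarrow> y i \<in> carrier G" "w \<in> words m"
  shows "weval G (\<lambda>i. inv y i) w = weval G y (flip w)"
  using assms(2) by (induction w) (auto simp: flip_def assms(1))

text \<open>The semidirect product of \<open>H\<close> with the group of order two acting through
  \<tau>; on Booleans, inequality is addition modulo two.\<close>

definition reflection_group :: "('a, 'b) monoid_scheme \<Rightarrow> ('a \<Rightarrow> 'a) \<Rightarrow> ('a \<times> bool) monoid" where
  "reflection_group H \<tau> = \<lparr>carrier = carrier H \<times> UNIV,
     monoid.mult = (\<lambda>(p, k) (r, l). (p \<otimes>\<^bsub>H\<^esub> (if k then \<tau> r else r), k \<noteq> l)),
     one = (\<one>\<^bsub>H\<^esub>, False)\<rparr>"

lemma (in group) reflection_group: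
  assumes "\<tau> \<in> hom G G" "\<And>g. g \<in> carrier G \<Longrightarrow> \<tau> (\<tau> g) = g"
  shows "group (reflection_group G \<tau>)"
proof -
  interpret \<tau>: group_hom G G \<tau> using assms(1) by (simp add: group_hom_def group_hom_axioms_def is_group)
  show ?thesis
  proof (rule groupI)
    fix p assume "p \<in> carrier (reflection_group G \<tau>)"
    then obtain g k where p: "p = (g, k)" "g \<in> carrier G" by (auto simp: reflection_group_def)
    show "\<exists>q\<in>carrier (reflection_group G \<tau>). q \<otimes>\<^bsub>reflection_group G \<tau>\<^esub> p = \<one>\<^bsub>reflection_group G \<tau>\<^esub>"
      using p by (intro bexI[of _ "(if k then \<tau> (inv g) else inv g, k)"])
        (auto simp: reflection_group_def simp flip: \<tau>.hom_mult)
  qed (auto simp: reflection_group_def m_assoc assms(2))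
qed

section \<open>The group defined by generators and relators\<close>

locale fibred_example =
  fixes d n :: nat and \<rho> :: "nat \<Rightarrow> word"
  assumes \<rho>_words: "\<lbrakk>1 \<le> j; j < d\<rbrakk> \<Longrightarrow> \<rho> j \<in> words d"
    and \<rho>_deep: "\<lbrakk>1 \<le> j; j < d\<rbrakk> \<Longrightarrow> cls d {} (\<rho> j) \<in> rational_derived (presented_group d {}) n"
    and d_pos: "1 \<le> d"
begin

text \<open>Generator \<open>d\<close> is \<open>t\<close> and generator \<open>Suc d\<close> is
  \<open>b\<close>. The second family includes the index \<open>d\<close>, so that \<open>b\<close>
  commutes with \<open>t\<close> as well.\<close>

definition Rel :: "word set" where
  "Rel = (\<lambda>j. [(d, True), (j, True), (d, False), (j, True)]) ` {..<d} \<union>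
     (\<lambda>j. [(Suc d, True), (j, True), (Suc d, False), (j, False)]) ` {..d} \<union>
     {[(Suc d, True), (Suc d, True)]} \<union> \<rho> ` {1..<d}"

lemma finite_Rel: "finite Rel"
  by (simp add: Rel_def)

lemma \<rho>_words': "\<lbrakk>1 \<le> j; j < d\<rbrakk> \<Longrightarrow> \<rho> j \<in> words (Suc (Suc d))"
  using words_mono[OF \<rho>_words] by simp

sublocale Pr: presentation "Suc (Suc d)" Rel
  by unfold_locales (auto simp: Rel_def \<rho>_words')

sublocale Fr: presentation d "{}" by unfold_locales simp

abbreviation G where "G \<equiv> presented_group (Suc (Suc d)) Rel"
abbreviation F where "F \<equiv> presented_group d {}"
abbreviation N where "N \<equiv> rational_derived F n"
abbreviation x where "x \<equiv> Pr.gen"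
abbreviation t where "t \<equiv> Pr.gen d"
abbreviation b where "b \<equiv> Pr.gen (Suc d)"

text \<open>Serves three targets: the integers for \<psi>, the parity group, and the semidirect
  product that bounds the kernel of the map from the free group.\<close>

lemma relators_hold:
  assumes Q: "group Q" and y: "\<And>i. i < Suc (Suc d) \<Longrightarrow> y i \<in> carrier Q"
    and tx: "\<And>i. i < d \<Longrightarrow> y d \<otimes>\<^bsub>Q\<^esub> y i \<otimes>\<^bsub>Q\<^esub> inv\<^bsub>Q\<^esub> y d = inv\<^bsub>Q\<^esub> y i"
    and bx: "\<And>i. i \<le> d \<Longrightarrow> y (Suc d) \<otimes>\<^bsub>Q\<^esub> y i = y i \<otimes>\<^bsub>Q\<^esub> y (Suc d)"
    and bb: "y (Suc d) \<otimes>\<^bsub>Q\<^esub> y (Suc d) = \<one>\<^bsub>Q\<^esub>"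
    and deep: "\<And>j. \<lbrakk>1 \<le> j; j < d\<rbrakk> \<Longrightarrow> weval Q y (\<rho> j) = \<one>\<^bsub>Q\<^esub>"
    and r: "r \<in> Rel"
  shows "weval Q y r = \<one>\<^bsub>Q\<^esub>"
proof -
  interpret Q: group Q by (rule Q)
  have yd: "y d \<in> carrier Q" "y (Suc d) \<in> carrier Q" using y by simp_all
  have 1: "weval Q y [(d, True), (j, True), (d, False), (j, True)] = \<one>\<^bsub>Q\<^esub>" if j: "j < d" for j
  proof -
    have "weval Q y [(d, True), (j, True), (d, False), (j, True)] =
      (y d \<otimes>\<^bsub>Q\<^esub> y j \<otimes>\<^bsub>Q\<^esub> inv\<^bsub>Q\<^esub> y d) \<otimes>\<^bsub>Q\<^esub> y j"
      using y[of j] yd j by (simp add: Q.m_assoc)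
    then show ?thesis using y[of j] j by (simp only: tx[OF j]) simp
  qed
  have 2: "weval Q y [(Suc d, True), (j, True), (Suc d, False), (j, False)] = \<one>\<^bsub>Q\<^esub>" if j: "j \<le> d" for j
  proof -
    have "weval Q y [(Suc d, True), (j, True), (Suc d, False), (j, False)] =
      (y (Suc d) \<otimes>\<^bsub>Q\<^esub> y j) \<otimes>\<^bsub>Q\<^esub> inv\<^bsub>Q\<^esub> y (Suc d) \<otimes>\<^bsub>Q\<^esub> inv\<^bsub>Q\<^esub> y j"
      using y[of j] yd j by (simp add: Q.m_assoc)
    also have "\<dots> = (y j \<otimes>\<^bsub>Q\<^esub> y (Suc d)) \<otimes>\<^bsub>Q\<^esub> inv\<^bsub>Q\<^esub> y (Suc d) \<otimes>\<^bsub>Q\<^esub> inv\<^bsub>Q\<^esub> y j"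
      by (simp only: bx[OF j])
    also have "\<dots> = \<one>\<^bsub>Q\<^esub>" using y[of j] yd j by (simp add: Q.m_assoc Q.inv_cancel)
    finally show ?thesis .
  qed
  have 3: "weval Q y [(Suc d, True), (Suc d, True)] = \<one>\<^bsub>Q\<^esub>"
    using yd bb by simp
  show ?thesis using r 1 2 3 deep unfolding Rel_def by (elim UnE imageE singletonE) auto
qed

lemma x_closed: "i < d \<Longrightarrow> x i \<in> carrier G" by simp

lemma t_x: "i < d \<Longrightarrow> t \<otimes>\<^bsub>G\<^esub> x i \<otimes>\<^bsub>G\<^esub> inv\<^bsub>G\<^esub> t = inv\<^bsub>G\<^esub> x i"
proof -
  assume i: "i < d"
  let ?r = "[(d, True), (i, True), (d, False), (i, True)]"
  have "?r \<in> Rel" using i by (simp add: Rel_def)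
  then have "weval G x ?r = \<one>\<^bsub>G\<^esub>" using i by (subst Pr.weval_gen) (simp_all only: Pr.relator_trivial, simp)
  then have "(t \<otimes>\<^bsub>G\<^esub> x i \<otimes>\<^bsub>G\<^esub> inv\<^bsub>G\<^esub> t) \<otimes>\<^bsub>G\<^esub> x i = \<one>\<^bsub>G\<^esub>"
    using i by (simp add: Pr.P.m_assoc)
  then show ?thesis using i by (intro Pr.P.inv_equality[symmetric]) simp_all
qed

lemma b_x: "i \<le> d \<Longrightarrow> b \<otimes>\<^bsub>G\<^esub> x i = x i \<otimes>\<^bsub>G\<^esub> b"
proof -
  assume i: "i \<le> d"
  let ?r = "[(Suc d, True), (i, True), (Suc d, False), (i, False)]"
  have "?r \<in> Rel" using i by (simp add: Rel_def)
  then have "weval G x ?r = \<one>\<^bsub>G\<^esub>" using i by (subst Pr.weval_gen) (simp_all only: Pr.relator_trivial, simp)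
  then have "(b \<otimes>\<^bsub>G\<^esub> x i) \<otimes>\<^bsub>G\<^esub> inv\<^bsub>G\<^esub> (x i \<otimes>\<^bsub>G\<^esub> b) = \<one>\<^bsub>G\<^esub>"
    using i by (simp add: Pr.P.m_assoc Pr.P.inv_mult_group)
  then show ?thesis using i Pr.P.inv_equality[of "b \<otimes>\<^bsub>G\<^esub> x i" "inv\<^bsub>G\<^esub> (x i \<otimes>\<^bsub>G\<^esub> b)"] by simp
qed

lemma b_sq: "b \<otimes>\<^bsub>G\<^esub> b = \<one>\<^bsub>G\<^esub>"
proof -
  let ?r = "[(Suc d, True), (Suc d, True)]"
  have "?r \<in> Rel" by (simp add: Rel_def)
  then have "weval G x ?r = \<one>\<^bsub>G\<^esub>" by (subst Pr.weval_gen) (simp_all only: Pr.relator_trivial, simp)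
  then show ?thesis by simp
qed

lemma \<rho>_trivial: "\<lbrakk>1 \<le> j; j < d\<rbrakk> \<Longrightarrow> weval G x (\<rho> j) = \<one>\<^bsub>G\<^esub>"
proof -
  assume j: "1 \<le> j" "j < d"
  have "\<rho> j \<in> Rel" using j by (simp add: Rel_def)
  then show ?thesis using Pr.weval_gen[OF \<rho>_words'[OF j]] Pr.relator_trivial by simp
qed

definition \<psi> :: "word set \<Rightarrow> int" where
  "\<psi> = Pr.lift integer_group (\<lambda>i. if i = d then 1 else 0)"

lemma
  shows \<psi>_group_hom: "group_hom G integer_group \<psi>"
    and \<psi>_cls: "w \<in> words (Suc (Suc d)) \<Longrightarrow> \<psi> (cls (Suc (Suc d)) Rel w) = weval integer_group (\<lambda>i. if i = d then 1 else 0) w"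
proof -
  let ?y = "\<lambda>i. if i = d then 1 else 0 :: int"
  interpret Z: group integer_group by simp
  have *: "weval integer_group ?y r = \<one>\<^bsub>integer_group\<^esub>" if "r \<in> Rel" for r
  proof (rule relators_hold[OF _ _ _ _ _ _ that])
    show "weval integer_group ?y (\<rho> j) = \<one>\<^bsub>integer_group\<^esub>" if "1 \<le> j" "j < d" for j
      by (rule Z.weval_one[OF _ \<rho>_words[OF that]]) simp
  qed auto
  show "group_hom G integer_group \<psi>" unfolding \<psi>_def
    by (rule Pr.lift_hom) (use * in simp_all)
  show "w \<in> words (Suc (Suc d)) \<Longrightarrow> \<psi> (cls (Suc (Suc d)) Rel w) = weval integer_group ?y w"
    unfolding \<psi>_def by (rule Pr.lift_cls) (use * in simp_all)
qed

lemma \<psi>_t: "\<psi> t = 1"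
  by (simp add: Pr.gen_def \<psi>_cls)

lemma \<psi>_word: "w \<in> words d \<Longrightarrow> \<psi> (weval G x w) = 0"
proof -
  assume w: "w \<in> words d"
  interpret Z: group integer_group by simp
  have "\<psi> (weval G x w) = weval integer_group (\<lambda>i. if i = d then 1 else 0) w"
    using words_mono[OF w, of "Suc (Suc d)"] by (simp add: Pr.weval_gen \<psi>_cls)
  also have "\<dots> = \<one>\<^bsub>integer_group\<^esub>" by (rule Z.weval_one[OF _ w]) simp
  finally show ?thesis by simp
qed

lemma weval_x_closed: "w \<in> words d \<Longrightarrow> weval G x w \<in> carrier G"
  by (rule Pr.P.weval_closed[OF x_closed])

lemma t_weval:
  assumes w: "w \<in> words d"
  shows "t \<otimes>\<^bsub>G\<^esub> weval G x w = weval G x (flip w) \<otimes>\<^bsub>G\<^esub> t"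
    and "inv\<^bsub>G\<^esub> t \<otimes>\<^bsub>G\<^esub> weval G x w = weval G x (flip w) \<otimes>\<^bsub>G\<^esub> inv\<^bsub>G\<^esub> t"
proof -
  have t: "t \<in> carrier G" by simp
  interpret c: group_hom G G "\<lambda>g. t \<otimes>\<^bsub>G\<^esub> g \<otimes>\<^bsub>G\<^esub> inv\<^bsub>G\<^esub> t"
    using Pr.P.conj_hom[OF t] by (simp add: group_hom_def group_hom_axioms_def Pr.group_P)
  have conj: "t \<otimes>\<^bsub>G\<^esub> weval G x v \<otimes>\<^bsub>G\<^esub> inv\<^bsub>G\<^esub> t = weval G x (flip v)" if v: "v \<in> words d" for v
  proof -
    have "t \<otimes>\<^bsub>G\<^esub> weval G x v \<otimes>\<^bsub>G\<^esub> inv\<^bsub>G\<^esub> t = weval G (\<lambda>i. t \<otimes>\<^bsub>G\<^esub> x i \<otimes>\<^bsub>G\<^esub> inv\<^bsub>G\<^esub> t) v"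
      by (rule c.hom_weval[OF x_closed v])
    also have "\<dots> = weval G (\<lambda>i. inv\<^bsub>G\<^esub> x i) v" by (rule weval_cong[OF t_x v])
    also have "\<dots> = weval G x (flip v)" by (rule Pr.P.weval_flip[OF x_closed v])
    finally show ?thesis .
  qed
  have *: "t \<otimes>\<^bsub>G\<^esub> weval G x v = weval G x (flip v) \<otimes>\<^bsub>G\<^esub> t" if v: "v \<in> words d" for v
    unfolding conj[OF v, symmetric] using weval_x_closed[OF v] t by (simp add: Pr.P.m_assoc)
  show "t \<otimes>\<^bsub>G\<^esub> weval G x w = weval G x (flip w) \<otimes>\<^bsub>G\<^esub> t" by (rule *[OF w])
  have fw: "weval G x (flip w) \<in> carrier G" "weval G x w \<in> carrier G" using w by (simp_all add: weval_x_closed)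
  have "weval G x w \<otimes>\<^bsub>G\<^esub> t = t \<otimes>\<^bsub>G\<^esub> weval G x (flip w)" using *[of "flip w"] w by simp
  then have "inv\<^bsub>G\<^esub> t \<otimes>\<^bsub>G\<^esub> (weval G x w \<otimes>\<^bsub>G\<^esub> t) \<otimes>\<^bsub>G\<^esub> inv\<^bsub>G\<^esub> t = inv\<^bsub>G\<^esub> t \<otimes>\<^bsub>G\<^esub> (t \<otimes>\<^bsub>G\<^esub> weval G x (flip w)) \<otimes>\<^bsub>G\<^esub> inv\<^bsub>G\<^esub> t"
    by simp
  then show "inv\<^bsub>G\<^esub> t \<otimes>\<^bsub>G\<^esub> weval G x w = weval G x (flip w) \<otimes>\<^bsub>G\<^esub> inv\<^bsub>G\<^esub> t"
    using fw t by (simp add: Pr.P.m_assoc Pr.P.inv_cancel)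
qed

lemma b_weval: "w \<in> words d \<Longrightarrow> b \<otimes>\<^bsub>G\<^esub> weval G x w = weval G x w \<otimes>\<^bsub>G\<^esub> b"
proof (induction w)
  case (Cons a w)
  obtain i \<beta> where a: "a = (i, \<beta>)" by (cases a)
  have i: "i < d" "w \<in> words d" "weval G x w \<in> carrier G" using Cons.prems by (auto simp: a weval_x_closed)
  define y where "y = (if \<beta> then x i else inv\<^bsub>G\<^esub> x i)"
  have y: "y \<in> carrier G" using i by (simp add: y_def)
  have "b \<otimes>\<^bsub>G\<^esub> inv\<^bsub>G\<^esub> x i = inv\<^bsub>G\<^esub> x i \<otimes>\<^bsub>G\<^esub> b"
  proof -
    have "inv\<^bsub>G\<^esub> x i \<otimes>\<^bsub>G\<^esub> (b \<otimes>\<^bsub>G\<^esub> x i) \<otimes>\<^bsub>G\<^esub> inv\<^bsub>G\<^esub> x i = inv\<^bsub>G\<^esub> x i \<otimes>\<^bsub>G\<^esub> (x i \<otimes>\<^bsub>G\<^esub> b) \<otimes>\<^bsub>G\<^esub> inv\<^bsub>G\<^esub> x i"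
      using b_x[of i] i by simp
    then show ?thesis using i by (simp add: Pr.P.m_assoc Pr.P.inv_cancel)
  qed
  then have by_comm: "b \<otimes>\<^bsub>G\<^esub> y = y \<otimes>\<^bsub>G\<^esub> b" using b_x[of i] i by (simp add: y_def)
  have "b \<otimes>\<^bsub>G\<^esub> (y \<otimes>\<^bsub>G\<^esub> weval G x w) = (b \<otimes>\<^bsub>G\<^esub> y) \<otimes>\<^bsub>G\<^esub> weval G x w"
    using y i by (simp add: Pr.P.m_assoc)
  also have "\<dots> = y \<otimes>\<^bsub>G\<^esub> (b \<otimes>\<^bsub>G\<^esub> weval G x w)" using y i by (simp add: by_comm Pr.P.m_assoc)
  also have "\<dots> = y \<otimes>\<^bsub>G\<^esub> weval G x w \<otimes>\<^bsub>G\<^esub> b" using y i Cons.IH by (simp add: Pr.P.m_assoc)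
  finally show ?case by (simp add: a y_def)
qed simp

lemma b_pow_t: "b [^]\<^bsub>G\<^esub> (e::nat) \<otimes>\<^bsub>G\<^esub> t = t \<otimes>\<^bsub>G\<^esub> b [^]\<^bsub>G\<^esub> e"
proof (induction e)
  case (Suc e)
  have "b [^]\<^bsub>G\<^esub> Suc e \<otimes>\<^bsub>G\<^esub> t = b [^]\<^bsub>G\<^esub> e \<otimes>\<^bsub>G\<^esub> (b \<otimes>\<^bsub>G\<^esub> t)" by (simp add: Pr.P.m_assoc)
  also have "\<dots> = (b [^]\<^bsub>G\<^esub> e \<otimes>\<^bsub>G\<^esub> t) \<otimes>\<^bsub>G\<^esub> b" using b_x[of d] by (simp add: Pr.P.m_assoc)
  also have "\<dots> = t \<otimes>\<^bsub>G\<^esub> b [^]\<^bsub>G\<^esub> Suc e" by (simp add: Suc Pr.P.m_assoc)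
  finally show ?case .
qed simp

text \<open>Collection to the right: \<open>b\<close> is central, and moving \<open>t\<close> or its
  inverse past a word flips the letters.\<close>

lemma normal_form:
  assumes "v \<in> words (Suc (Suc d))"
  shows "\<exists>w\<in>words d. \<exists>e::nat. \<exists>k::int. weval G x v = weval G x w \<otimes>\<^bsub>G\<^esub> b [^]\<^bsub>G\<^esub> e \<otimes>\<^bsub>G\<^esub> t [^]\<^bsub>G\<^esub> k"
  using assms
proof (induction v)
  case Nil
  show ?case by (intro bexI[of _ "[]"] exI[of _ 0]) simp_all
next
  case (Cons a v)
  obtain i \<beta> where a: "a = (i, \<beta>)" by (cases a)
  obtain w e k where w: "w \<in> words d" and v: "weval G x v = weval G x w \<otimes>\<^bsub>G\<^esub> b [^]\<^bsub>G\<^esub> (e::nat) \<otimes>\<^bsub>G\<^esub> t [^]\<^bsub>G\<^esub> (k::int)"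
    using Cons by (auto simp: a)
  have wc: "weval G x w \<in> carrier G" "weval G x (flip w) \<in> carrier G" using w by (simp_all add: weval_x_closed)
  have bc: "b [^]\<^bsub>G\<^esub> e \<in> carrier G" "b \<in> carrier G" "t \<in> carrier G" "t [^]\<^bsub>G\<^esub> k \<in> carrier G" by simp_all
  consider (x) "i < d" | (t) "i = d" | (b) "i = Suc d" using Cons.prems unfolding a by fastforce
  then show ?case
  proof cases
    case x
    then have "weval G x (a # v) = weval G x ((i, \<beta>) # w) \<otimes>\<^bsub>G\<^esub> b [^]\<^bsub>G\<^esub> e \<otimes>\<^bsub>G\<^esub> t [^]\<^bsub>G\<^esub> k"
      using wc bc by (simp add: a v Pr.P.m_assoc)
    then show ?thesis using x w by (intro bexI[of _ "(i, \<beta>) # w"] exI[of _ e] exI[of _ k]) simp_all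
  next
    case b
    have "inv\<^bsub>G\<^esub> b = b" by (rule Pr.P.inv_equality[OF b_sq]) simp_all
    then have "weval G x (a # v) = b \<otimes>\<^bsub>G\<^esub> (weval G x w \<otimes>\<^bsub>G\<^esub> b [^]\<^bsub>G\<^esub> e \<otimes>\<^bsub>G\<^esub> t [^]\<^bsub>G\<^esub> k)"
      by (simp add: a b v)
    also have "\<dots> = (b \<otimes>\<^bsub>G\<^esub> weval G x w) \<otimes>\<^bsub>G\<^esub> b [^]\<^bsub>G\<^esub> e \<otimes>\<^bsub>G\<^esub> t [^]\<^bsub>G\<^esub> k"
      using wc bc by (simp add: Pr.P.m_assoc)
    also have "\<dots> = weval G x w \<otimes>\<^bsub>G\<^esub> b [^]\<^bsub>G\<^esub> Suc e \<otimes>\<^bsub>G\<^esub> t [^]\<^bsub>G\<^esub> k"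
      using wc bc by (subst b_weval[OF w], subst Pr.P.nat_pow_Suc2) (simp_all add: Pr.P.m_assoc)
    finally show ?thesis using w by blast
  next
    case t
    define s where "s = (if \<beta> then t else inv\<^bsub>G\<^esub> t)"
    define l :: int where "l = (if \<beta> then 1 else -1)"
    have sc: "s \<in> carrier G" and sl: "s = t [^]\<^bsub>G\<^esub> l" by (simp_all add: s_def l_def Pr.P.int_pow_neg)
    have s_w: "s \<otimes>\<^bsub>G\<^esub> weval G x w = weval G x (flip w) \<otimes>\<^bsub>G\<^esub> s"
      using t_weval[OF w] by (simp add: s_def)
    have s_b: "s \<otimes>\<^bsub>G\<^esub> b [^]\<^bsub>G\<^esub> e = b [^]\<^bsub>G\<^esub> e \<otimes>\<^bsub>G\<^esub> s"
    proof -
      have "inv\<^bsub>G\<^esub> t \<otimes>\<^bsub>G\<^esub> (b [^]\<^bsub>G\<^esub> e \<otimes>\<^bsub>G\<^esub> t) \<otimes>\<^bsub>G\<^esub> inv\<^bsub>G\<^esub> t = inv\<^bsub>G\<^esub> t \<otimes>\<^bsub>G\<^esub> (t \<otimes>\<^bsub>G\<^esub> b [^]\<^bsub>G\<^esub> e) \<otimes>\<^bsub>G\<^esub> inv\<^bsub>G\<^esub> t"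
        by (simp only: b_pow_t)
      then have "inv\<^bsub>G\<^esub> t \<otimes>\<^bsub>G\<^esub> b [^]\<^bsub>G\<^esub> e = b [^]\<^bsub>G\<^esub> e \<otimes>\<^bsub>G\<^esub> inv\<^bsub>G\<^esub> t"
        using bc by (simp add: Pr.P.m_assoc Pr.P.inv_cancel)
      then show ?thesis using b_pow_t[of e] by (simp add: s_def)
    qed
    have "weval G x (a # v) = (s \<otimes>\<^bsub>G\<^esub> weval G x w) \<otimes>\<^bsub>G\<^esub> b [^]\<^bsub>G\<^esub> e \<otimes>\<^bsub>G\<^esub> t [^]\<^bsub>G\<^esub> k"
      using wc bc sc by (simp add: a t v s_def Pr.P.m_assoc)
    also have "\<dots> = weval G x (flip w) \<otimes>\<^bsub>G\<^esub> (s \<otimes>\<^bsub>G\<^esub> b [^]\<^bsub>G\<^esub> e) \<otimes>\<^bsub>G\<^esub> t [^]\<^bsub>G\<^esub> k"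
      using wc bc sc by (simp only: s_w Pr.P.m_assoc Pr.P.m_closed)
    also have "\<dots> = weval G x (flip w) \<otimes>\<^bsub>G\<^esub> b [^]\<^bsub>G\<^esub> e \<otimes>\<^bsub>G\<^esub> (s \<otimes>\<^bsub>G\<^esub> t [^]\<^bsub>G\<^esub> k)"
      using wc bc sc by (simp only: s_b Pr.P.m_assoc Pr.P.m_closed)
    also have "s \<otimes>\<^bsub>G\<^esub> t [^]\<^bsub>G\<^esub> k = t [^]\<^bsub>G\<^esub> (l + k)"
      unfolding sl using bc by (simp add: Pr.P.int_pow_mult)
    finally show ?thesis using w flip_words by blast
  qed
qed

lemma fibre:
  assumes "g \<in> carrier G" "\<psi> g = 0"
  shows "\<exists>w\<in>words d. \<exists>e::nat. g = weval G x w \<otimes>\<^bsub>G\<^esub> b [^]\<^bsub>G\<^esub> e"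
proof -
  interpret \<psi>: group_hom G integer_group \<psi> by (rule \<psi>_group_hom)
  have mult: "\<psi> (y \<otimes>\<^bsub>G\<^esub> z) = \<psi> y + \<psi> z" if "y \<in> carrier G" "z \<in> carrier G" for y z
    using \<psi>.hom_mult[OF that] by simp
  obtain v where v: "v \<in> words (Suc (Suc d))" "g = weval G x v"
    using Pr.P_cases[OF assms(1)] Pr.weval_gen by metis
  obtain w e k where w: "w \<in> words d" and g: "g = weval G x w \<otimes>\<^bsub>G\<^esub> b [^]\<^bsub>G\<^esub> (e::nat) \<otimes>\<^bsub>G\<^esub> t [^]\<^bsub>G\<^esub> (k::int)"
    using normal_form[OF v(1)] unfolding v(2) by blast
  have "\<psi> b = 0" using mult[of b b] \<psi>.hom_one by (simp add: b_sq)
  then have "\<psi> (b [^]\<^bsub>G\<^esub> e) = 0" using \<psi>.hom_int_pow[of b "int e"] by (simp add: int_pow_int)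
  moreover have "\<psi> (t [^]\<^bsub>G\<^esub> k) = k" using \<psi>.hom_int_pow[of t k] by (simp add: \<psi>_t)
  ultimately have "\<psi> g = k" using weval_x_closed[OF w] \<psi>_word[OF w] by (simp add: g mult)
  then have "g = weval G x w \<otimes>\<^bsub>G\<^esub> b [^]\<^bsub>G\<^esub> e" using assms(2) weval_x_closed[OF w] g by simp
  then show ?thesis using w by blast
qed

text \<open>Killing \<open>b\<close> and \<open>t\<^sup>2\<close> maps the example onto the semidirect product of \<open>F / N\<close> with the
  automorphism of order two which inverts the free generators.\<close>

lemma free:
  assumes w: "w \<in> words d" and triv: "weval G x w \<otimes>\<^bsub>G\<^esub> b [^]\<^bsub>G\<^esub> (e::nat) = \<one>\<^bsub>G\<^esub>"
  shows "cls d {} w \<in> N"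
proof -
  define \<tau> where "\<tau> = Fr.lift F (\<lambda>i. inv\<^bsub>F\<^esub> Fr.gen i)"
  have F: "group F" by (rule Fr.group_P)
  interpret \<tau>: group_hom F F \<tau>
    unfolding \<tau>_def by (rule Fr.lift_hom) (simp_all add: F)
  have \<tau>_cls: "\<tau> (cls d {} v) = cls d {} (flip v)" if v: "v \<in> words d" for v
  proof -
    have "\<tau> (cls d {} v) = weval F (\<lambda>i. inv\<^bsub>F\<^esub> Fr.gen i) v"
      unfolding \<tau>_def by (rule Fr.lift_cls) (simp_all add: F v)
    also have "\<dots> = weval F Fr.gen (flip v)" by (rule Fr.P.weval_flip[OF Fr.gen_closed v])
    also have "\<dots> = cls d {} (flip v)" by (rule Fr.weval_gen) (simp add: v)
    finally show ?thesis .
  qed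
  have \<tau>_\<tau>: "\<tau> (\<tau> f) = f" if "f \<in> carrier F" for f
    using Fr.P_cases[OF that] \<tau>_cls by (metis flip_flip flip_words)
  let ?A = "F Mod N"
  have N: "N \<lhd> F" by (rule Fr.P.rational_derived_normal)
  have Ns: "subgroup N F" by (rule Fr.P.rational_derived_subgroup)
  interpret A: group ?A by (rule normal.factorgroup_is_group[OF N])
  interpret q: group_hom F ?A "\<lambda>f. N #>\<^bsub>F\<^esub> f" by (rule Fr.P.group_hom_coset_map[OF N])
  have q\<tau>: "(\<lambda>f. N #>\<^bsub>F\<^esub> \<tau> f) \<in> hom F ?A"
    using Group.hom_compose[OF \<tau>.homh q.homh] by (simp add: comp_def)
  interpret q\<tau>: group_hom F ?A "\<lambda>f. N #>\<^bsub>F\<^esub> \<tau> f"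
    using q\<tau> F A.is_group by (simp add: group_hom_def group_hom_axioms_def)
  \<comment> \<open>Every endomorphism of \<open>F\<close> preserves the rational derived series, so
    inverting the generators descends to \<open>?A\<close>.\<close>
  have ker: "N \<subseteq> kernel F ?A (\<lambda>f. N #>\<^bsub>F\<^esub> \<tau> f)"
  proof
    fix f assume f: "f \<in> N"
    then have fc: "f \<in> carrier F" by (rule Fr.P.rational_derived_carrier)
    have "\<tau> f \<in> N" by (rule \<tau>.rational_derived_image[OF f])
    then show "f \<in> kernel F ?A (\<lambda>f. N #>\<^bsub>F\<^esub> \<tau> f)"
      using fc Fr.P.coset_eq_self_iff[OF Ns] by (simp add: kernel_def)
  qed
  obtain \<sigma> where \<sigma>: "\<sigma> \<in> hom ?A ?A" "\<And>f. f \<in> carrier F \<Longrightarrow> \<sigma> (N #>\<^bsub>F\<^esub> f) = N #>\<^bsub>F\<^esub> \<tau> f"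
    by (rule q\<tau>.FactGroup_universal_kernel[OF N ker]) blast
  have \<sigma>_\<sigma>: "\<sigma> (\<sigma> p) = p" if "p \<in> carrier ?A" for p
    using that \<sigma>(2) \<tau>_\<tau> by (auto simp: carrier_FactGroup)
  let ?S = "reflection_group ?A \<sigma>"
  interpret S: group ?S by (rule A.reflection_group[OF \<sigma>(1) \<sigma>_\<sigma>])
  define j where "j f = (N #>\<^bsub>F\<^esub> f, False)" for f
  interpret j: group_hom F ?S j
  proof (intro group_hom.intro group_hom_axioms.intro F S.is_group homI)
    show "j f \<in> carrier ?S" if "f \<in> carrier F" for f
      using q.hom_closed[OF that] by (simp add: j_def reflection_group_def)
    show "j (f \<otimes>\<^bsub>F\<^esub> f') = j f \<otimes>\<^bsub>?S\<^esub> j f'" if "f \<in> carrier F" "f' \<in> carrier F" for f f'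
      using q.hom_mult[OF that] by (simp add: j_def reflection_group_def)
  qed
  define y where "y i = (if i < d then j (Fr.gen i) else if i = d then (\<one>\<^bsub>?A\<^esub>, True) else \<one>\<^bsub>?S\<^esub>)" for i
  have y_word: "weval ?S y v = j (cls d {} v)" if v: "v \<in> words d" for v
  proof -
    have "weval ?S y v = weval ?S (\<lambda>i. j (Fr.gen i)) v" by (rule weval_cong[OF _ v]) (simp add: y_def)
    also have "\<dots> = j (weval F Fr.gen v)" by (rule j.hom_weval[OF Fr.gen_closed v, symmetric])
    finally show ?thesis using Fr.weval_gen[OF v] by simp
  qed
  have yd: "y d = (\<one>\<^bsub>?A\<^esub>, True)" "y (Suc d) = \<one>\<^bsub>?S\<^esub>" by (simp_all add: y_def)
  have y_closed: "y i \<in> carrier ?S" for i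
    using j.hom_closed[of "Fr.gen i"] A.one_closed S.one_closed unfolding y_def
    by (auto simp: reflection_group_def simp del: one_FactGroup)
  have "weval ?S y r = \<one>\<^bsub>?S\<^esub>" if "r \<in> Rel" for r
  proof (rule relators_hold[OF S.is_group y_closed _ _ _ _ that])
    show "y d \<otimes>\<^bsub>?S\<^esub> y i \<otimes>\<^bsub>?S\<^esub> inv\<^bsub>?S\<^esub> y d = inv\<^bsub>?S\<^esub> y i" if i: "i < d" for i
    proof -
      have gi: "Fr.gen i \<in> carrier F" using i by simp
      have "\<tau> (Fr.gen i) = inv\<^bsub>F\<^esub> Fr.gen i"
        using \<tau>_cls[of "[(i, True)]"] Fr.inv_cls[of "[(i, True)]"] i by (simp add: Fr.gen_def flip_def)
      then have \<sigma>i: "\<sigma> (N #>\<^bsub>F\<^esub> Fr.gen i) = N #>\<^bsub>F\<^esub> inv\<^bsub>F\<^esub> Fr.gen i" using \<sigma>(2)[OF gi] by simp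
      have "y d \<otimes>\<^bsub>?S\<^esub> y i = (\<one>\<^bsub>?A\<^esub> \<otimes>\<^bsub>?A\<^esub> (N #>\<^bsub>F\<^esub> inv\<^bsub>F\<^esub> Fr.gen i), True)"
        using i \<sigma>i by (simp add: yd(1) y_def j_def reflection_group_def)
      also have "\<dots> = ((N #>\<^bsub>F\<^esub> inv\<^bsub>F\<^esub> Fr.gen i) \<otimes>\<^bsub>?A\<^esub> \<one>\<^bsub>?A\<^esub>, True)"
        using q.hom_closed[OF Fr.P.inv_closed[OF gi]] by (simp only: A.l_one A.r_one)
      also have "\<dots> = j (inv\<^bsub>F\<^esub> Fr.gen i) \<otimes>\<^bsub>?S\<^esub> y d"
        by (simp add: yd(1) j_def reflection_group_def)
      finally have "y d \<otimes>\<^bsub>?S\<^esub> y i \<otimes>\<^bsub>?S\<^esub> inv\<^bsub>?S\<^esub> y d = j (inv\<^bsub>F\<^esub> Fr.gen i)"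
        using y_closed[of d] j.hom_closed[OF Fr.P.inv_closed[OF gi]] by (simp only: S.m_assoc S.r_inv S.r_one S.inv_closed)
      then show ?thesis using i gi by (simp add: y_def)
    qed
    show "weval ?S y (\<rho> i) = \<one>\<^bsub>?S\<^esub>" if i: "1 \<le> i" "i < d" for i
    proof -
      have "N #>\<^bsub>F\<^esub> cls d {} (\<rho> i) = N"
        using Fr.P.coset_eq_self_iff[OF Ns] \<rho>_words[OF i] \<rho>_deep[OF i] by simp
      then have "j (cls d {} (\<rho> i)) = \<one>\<^bsub>?S\<^esub>" by (simp add: j_def reflection_group_def)
      then show ?thesis by (simp only: y_word[OF \<rho>_words[OF i]])
    qed
  qed (use y_closed yd in simp_all)
  note y = S.is_group y_closed this
  interpret \<mu>: group_hom G ?S "Pr.lift ?S y" by (rule Pr.lift_hom[OF y])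
  have w': "w \<in> words (Suc (Suc d))" using words_mono[OF w] by simp
  have "Pr.lift ?S y b = \<one>\<^bsub>?S\<^esub>"
    unfolding Pr.gen_def by (subst Pr.lift_cls[OF y]) (simp_all add: yd)
  then have "Pr.lift ?S y (weval G x w \<otimes>\<^bsub>G\<^esub> b [^]\<^bsub>G\<^esub> e) = j (cls d {} w)"
    using weval_x_closed[OF w] j.hom_closed[OF Fr.cls_closed[OF w]] Pr.lift_cls[OF y w']
    by (simp add: Pr.weval_gen[OF w'] y_word[OF w] \<mu>.hom_nat_pow)
  then have "j (cls d {} w) = \<one>\<^bsub>?S\<^esub>" using triv \<mu>.hom_one by simp
  then have "N #>\<^bsub>F\<^esub> cls d {} w = N" by (simp add: j_def reflection_group_def)
  then show ?thesis using Fr.P.coset_eq_self_iff[OF Ns] w by simp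
qed

lemma fibred_group:
  assumes "1 \<le> n"
    and "\<And>j. \<lbrakk>1 \<le> j; j < d\<rbrakk> \<Longrightarrow>
      fox (F Mod N) (\<lambda>i. N #>\<^bsub>F\<^esub> cls d {} [(i, True)]) j (\<rho> j) \<noteq> 0"
    and "\<And>i j. \<lbrakk>1 \<le> j; j < d; 1 \<le> i; i < d; i \<noteq> j\<rbrakk> \<Longrightarrow>
      fox (F Mod N) (\<lambda>i. N #>\<^bsub>F\<^esub> cls d {} [(i, True)]) i (\<rho> j) = 0"
  shows "fibred_group G d n x t b \<psi> \<rho>"
proof -
  interpret \<psi>: group_hom G integer_group \<psi> by (rule \<psi>_group_hom)
  show ?thesis
    using assms
    by unfold_locales
      (simp_all add: t_x b_x b_sq \<psi>.homh \<psi>_t fibre free \<rho>_words \<rho>_trivial d_pos del: One_nat_def)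
qed

end

text \<open>Words whose class lies in \<open>N\<close> are the loops over \<open>F Mod N\<close>, so
  \<open>fox_dual_loop\<close> provides them; \<open>1 \<le> n\<close> keeps the letters nontrivial
  in that quotient.\<close>

lemma dual_relators:
  fixes d n :: nat
  defines "F \<equiv> presented_group d {}" and "N \<equiv> rational_derived (presented_group d {}) n"
  assumes "1 \<le> n"
  shows "\<exists>\<rho>. \<forall>j. 1 \<le> j \<and> j < d \<longrightarrow> \<rho> j \<in> words d \<and> cls d {} (\<rho> j) \<in> N \<and>
    fox (F Mod N) (\<lambda>i. N #>\<^bsub>F\<^esub> cls d {} [(i, True)]) j (\<rho> j) \<noteq> 0 \<and>
    (\<forall>i<d. 1 \<le> i \<and> i \<noteq> j \<longrightarrow> fox (F Mod N) (\<lambda>i. N #>\<^bsub>F\<^esub> cls d {} [(i, True)]) i (\<rho> j) = 0)"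
proof -
  interpret Fr: presentation d "{}" by unfold_locales simp
  interpret F: group F unfolding F_def by (rule Fr.group_P)
  let ?y = "\<lambda>i. N #>\<^bsub>F\<^esub> cls d {} [(i, True)]"
  have N: "N \<lhd> F" "subgroup N F"
    unfolding N_def F_def by (rule Fr.P.rational_derived_normal, rule Fr.P.rational_derived_subgroup)
  interpret A: group "F Mod N" by (rule normal.factorgroup_is_group[OF N(1)])
  interpret q: group_hom F "F Mod N" "\<lambda>f. N #>\<^bsub>F\<^esub> f" by (rule F.group_hom_coset_map[OF N(1)])
  have cF: "cls d {} w \<in> carrier F" if "w \<in> words d" for w using that by (simp add: F_def)
  interpret S: fox_setup "F Mod N" ?y d by unfold_locales (rule q.hom_closed, rule cF, simp)
  have ev: "S.ev w = N #>\<^bsub>F\<^esub> cls d {} w" if w: "w \<in> words d" for w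
  proof -
    have "S.ev w = N #>\<^bsub>F\<^esub> weval F (\<lambda>i. cls d {} [(i, True)]) w"
      by (rule q.hom_weval[symmetric, OF cF w]) simp
    also have "weval F (\<lambda>i. cls d {} [(i, True)]) w = cls d {} w"
      using Fr.weval_gen[OF w] unfolding F_def Fr.gen_def .
    finally show ?thesis .
  qed
  have W: "S.W = (\<lambda>f. N #>\<^bsub>F\<^esub> f) ` rational_derived F 0"
    unfolding S.W_def using ev by (auto simp: F_def Fr.carrier_P)
  have ore: "right_ore_domain (group_ring ((F Mod N)\<lparr>carrier := S.W\<rparr>))"
    unfolding W using F.right_ore_domain_rational_quotient[of 0 n] by (simp add: N_def F_def)
  have nontriv: "?y j \<noteq> \<one>\<^bsub>F Mod N\<^esub>" if j: "j < d" for j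
  proof
    assume "?y j = \<one>\<^bsub>F Mod N\<^esub>"
    then have "cls d {} [(j, True)] \<in> N" using F.coset_eq_self_iff[OF N(2) cF, of "[(j, True)]"] j by simp
    then have "cls d {} [(j, True)] \<in> rational_derived F 1"
      using F.rational_derived_antimono[OF assms(3)] unfolding N_def F_def by blast
    then show False using free_generator_not_in_derived[OF j] by (simp add: F_def)
  qed
  have "\<forall>j. \<exists>w. 1 \<le> j \<and> j < d \<longrightarrow> w \<in> words d \<and> cls d {} w \<in> N \<and> fox (F Mod N) ?y j w \<noteq> 0 \<and>
    (\<forall>i<d. 1 \<le> i \<and> i \<noteq> j \<longrightarrow> fox (F Mod N) ?y i w = 0)"
  proof (intro allI)
    fix j show "\<exists>w. 1 \<le> j \<and> j < d \<longrightarrow> w \<in> words d \<and> cls d {} w \<in> N \<and> fox (F Mod N) ?y j w \<noteq> 0 \<and>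
      (\<forall>i<d. 1 \<le> i \<and> i \<noteq> j \<longrightarrow> fox (F Mod N) ?y i w = 0)"
    proof (cases "1 \<le> j \<and> j < d")
      case True
      then obtain w where w: "w \<in> words d" "S.ev w = \<one>\<^bsub>F Mod N\<^esub>" "S.D j w \<noteq> 0"
        "\<forall>k<d. 1 \<le> k \<and> k \<noteq> j \<longrightarrow> S.D k w = 0"
        using S.fox_dual_loop[OF ore _ _ nontriv nontriv, of j] by auto
      have "cls d {} w \<in> N"
        using w(2) F.coset_eq_self_iff[OF N(2) cF[OF w(1)]] by (simp add: ev[OF w(1)])
      then show ?thesis using w by blast
    qed blast
  qed
  then show ?thesis by (rule choice)
qed

section \<open>The deficiency\<close>

text \<open>The modulus \<open>M\<close> is \<open>0\<close> for exponent sums and \<open>2\<close> for central signs.\<close>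

definition relator_additive :: "nat \<Rightarrow> word set \<Rightarrow> int \<Rightarrow> (word \<Rightarrow> int) \<Rightarrow> bool" where
  "relator_additive m R M f \<longleftrightarrow> (\<forall>p\<in>words m. \<forall>q\<in>words m.
     (\<forall>s\<in>R. M dvd f (p @ s @ q) - f (p @ q) - f s) \<and>
     (\<forall>i<m. \<forall>\<beta>. M dvd f (p @ [(i, \<beta>), (i, \<not> \<beta>)] @ q) - f (p @ q)))"

text \<open>A derivation from \<open>u\<close> to \<open>v\<close> records how often each relator is
  deleted minus how often it is inserted. One \<nu> serves every functional and every modulus, and
  thereby links exponent sums with central signs.\<close>

lemma pres_rel_multiplicities:
  assumes "(u, v) \<in> pres_rel m R" "finite R"
  shows "\<exists>\<nu> :: word \<Rightarrow> int. \<forall>M f. relator_additive m R M f \<longrightarrow> M dvd f u - f v - (\<Sum>r\<in>R. \<nu> r * f r)"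
  using assms(1) unfolding pres_rel_def
proof (induction rule: rtrancl_induct)
  case base
  show ?case by (rule exI[of _ "\<lambda>_. 0"]) simp
next
  case (step v w)
  have del: "\<exists>\<mu> :: word \<Rightarrow> int. \<forall>M f. relator_additive m R M f \<longrightarrow> M dvd f v - f w - (\<Sum>r\<in>R. \<mu> r * f r)"
    if vw: "(v, w) \<in> deletion_step m R" for v w
  proof -
    obtain p s q where *: "v = p @ s @ q" "w = p @ q" "p \<in> words m" "q \<in> words m"
      "s \<in> R \<union> {[(i, b), (i, \<not> b)] | i b. i < m}"
      using vw unfolding deletion_step_def by blast
    show ?thesis
    proof (cases "s \<in> R")
      case True
      have "(\<Sum>r\<in>R. of_bool (r = s) * f r) = f s" for f :: "word \<Rightarrow> int"
        using True assms(2) by (simp add: sum.delta)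
      then show ?thesis
        using True * by (intro exI[of _ "\<lambda>r. of_bool (r = s)"]) (auto simp: relator_additive_def)
    next
      case False
      then obtain i \<beta> where "s = [(i, \<beta>), (i, \<not> \<beta>)]" "i < m" using *(5) by blast
      then show ?thesis
        using * by (intro exI[of _ "\<lambda>_. 0"]) (auto simp: relator_additive_def)
    qed
  qed
  obtain \<nu> where \<nu>: "\<forall>M f. relator_additive m R M f \<longrightarrow> M dvd f u - f v - (\<Sum>r\<in>R. \<nu> r * f r)"
    using step.IH by blast
  have "\<exists>\<mu> :: word \<Rightarrow> int. \<forall>M f. relator_additive m R M f \<longrightarrow> M dvd f v - f w - (\<Sum>r\<in>R. \<mu> r * f r)"
    using step.hyps(2)
  proof
    assume "(v, w) \<in> (deletion_step m R)\<inverse>"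
    then obtain \<mu> where \<mu>: "\<forall>M f. relator_additive m R M f \<longrightarrow> M dvd f w - f v - (\<Sum>r\<in>R. \<mu> r * f r)"
      using del[of w v] by blast
    have "M dvd f v - f w - (\<Sum>r\<in>R. - \<mu> r * f r)" if "relator_additive m R M f" for M f
    proof -
      have "f v - f w - (\<Sum>r\<in>R. - \<mu> r * f r) = - (f w - f v - (\<Sum>r\<in>R. \<mu> r * f r))"
        by (simp add: sum_negf)
      then show ?thesis using \<mu> that by (simp only: dvd_minus_iff)
    qed
    then show ?thesis by (intro exI[of _ "\<lambda>r. - \<mu> r"]) blast
  qed (rule del)
  then obtain \<mu> where \<mu>: "\<forall>M f. relator_additive m R M f \<longrightarrow> M dvd f v - f w - (\<Sum>r\<in>R. \<mu> r * f r)"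
    by blast
  have "M dvd f u - f w - (\<Sum>r\<in>R. (\<nu> r + \<mu> r) * f r)" if "relator_additive m R M f" for M f
  proof -
    have "f u - f w - (\<Sum>r\<in>R. (\<nu> r + \<mu> r) * f r) =
      (f u - f v - (\<Sum>r\<in>R. \<nu> r * f r)) + (f v - f w - (\<Sum>r\<in>R. \<mu> r * f r))"
      by (simp add: distrib_right sum.distrib)
    then show ?thesis using \<nu> \<mu> that by (simp only: dvd_add)
  qed
  then show ?case by (intro exI[of _ "\<lambda>r. \<nu> r + \<mu> r"]) blast
qed

section \<open>Exponent sums and a Heisenberg extension\<close>

definition expo :: "nat \<Rightarrow> word \<Rightarrow> int" where
  "expo j = weval integer_group (\<lambda>i. if i = j then 1 else 0)"

lemma weval_integer_group:
  assumes "w \<in> words m" shows "weval integer_group c w = (\<Sum>j<m. expo j w * c j)"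
  using assms
proof (induction w)
  case (Cons a w)
  obtain i \<beta> where a: "a = (i, \<beta>)" by (cases a)
  have i: "i < m" "w \<in> words m" using Cons.prems by (simp_all add: a)
  have "(\<Sum>j<m. expo j (a # w) * c j) =
    (\<Sum>j<m. (if j = i then (if \<beta> then c i else - c i) else 0) + expo j w * c j)"
    by (intro sum.cong) (auto simp: a expo_def algebra_simps)
  also have "\<dots> = (if \<beta> then c i else - c i) + (\<Sum>j<m. expo j w * c j)"
    using i(1) by (simp add: sum.distrib)
  finally show ?case using Cons.IH i by (simp add: a)
qed (simp add: expo_def)

lemma weval_integer_append: "weval integer_group c (u @ v) = weval integer_group c u + weval integer_group c v"
  by (induction u) auto

lemma weval_integer_winv: "weval integer_group c (winv w) = - weval integer_group c w"
  by (induction w) (auto simp: weval_integer_append)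

lemma expo_relator_additive: "relator_additive m R 0 (expo j)"
  by (simp add: relator_additive_def expo_def weval_integer_append)

text \<open>Lets \<open>homogeneous_system\<close> solve linear equations over the integers.\<close>

lemma right_ore_domain_int: "right_ore_domain \<Z>"
proof -
  interpret int: ring \<Z> by (rule cring.axioms(1)[OF domain.axioms(1)[OF int.domain_axioms]])
  show ?thesis
  proof
    fix a b :: int assume "a \<in> nonzeros \<Z>" "b \<in> nonzeros \<Z>"
    then show "\<exists>c\<in>nonzeros \<Z>. \<exists>d\<in>nonzeros \<Z>. a \<otimes>\<^bsub>\<Z>\<^esub> c = b \<otimes>\<^bsub>\<Z>\<^esub> d"
      by (intro bexI[of _ b] bexI[of _ a]) simp_all
  qed auto
qed

definition parity_group :: "bool monoid" where
  "parity_group = \<lparr>carrier = UNIV, monoid.mult = (\<noteq>), one = False\<rparr>"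

text \<open>The central extension of \<int> times \<int>/2 by \<int>/2 with cocycle
  \<open>odd k \<and> a'\<close>. Lifts of \<open>(1, False)\<close> and \<open>(0, True)\<close>
  have the nontrivial central element as commutator.\<close>

definition heisenberg :: "(int \<times> bool \<times> bool) monoid" where
  "heisenberg = \<lparr>carrier = UNIV,
     monoid.mult = (\<lambda>(k, a, c) (k', a', c'). (k + k', a \<noteq> a', (c \<noteq> c') \<noteq> (odd k \<and> a'))),
     one = (0, False, False)\<rparr>"

lemma group_parity: "group parity_group"
  by (rule groupI) (auto simp: parity_group_def)

lemma group_heisenberg: "group heisenberg"
proof (rule groupI)
  fix p assume "p \<in> carrier heisenberg"
  obtain k a c where p: "p = (k, a, c)" by (cases p)
  show "\<exists>q\<in>carrier heisenberg. q \<otimes>\<^bsub>heisenberg\<^esub> p = \<one>\<^bsub>heisenberg\<^esub>"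
    by (rule bexI[of _ "(- k, a, c \<noteq> (odd k \<and> a))"]) (auto simp: p heisenberg_def)
qed (auto simp: heisenberg_def)

lemma heisenberg_mult:
  "(k, a, c) \<otimes>\<^bsub>heisenberg\<^esub> (k', a', c') = (k + k', a \<noteq> a', (c \<noteq> c') \<noteq> (odd k \<and> a'))"
  by (simp add: heisenberg_def)

text \<open>\<psi> and \<beta> send \<open>t\<close> and \<open>b\<close> to the standard generators
  of \<int> times \<int>/2, whose Heisenberg lifts do not commute; \<open>rigid\<close> says that
  the first cohomology is carried by \<open>t\<close>.\<close>

lemma (in group) relations_ge_generators:
  assumes t: "t \<in> carrier G" "\<psi> t = 1" "\<not> \<beta> t" and b: "b \<in> carrier G" "\<psi> b = 0" "\<beta> b"
    and bt: "b \<otimes> t = t \<otimes> b"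
    and \<psi>: "\<psi> \<in> hom G integer_group" and \<beta>: "\<beta> \<in> hom G parity_group"
    and rigid: "\<And>\<chi> g. \<lbrakk>\<chi> \<in> hom G integer_group; \<chi> t = 0; g \<in> carrier G\<rbrakk> \<Longrightarrow> \<chi> g = 0"
    and pres: "finite_presentation G m R"
  shows "m \<le> card R"
proof (rule ccontr)
  assume "\<not> m \<le> card R"
  have R: "finite R" "R \<subseteq> words m" using pres by (simp_all add: finite_presentation_def)
  interpret Pr: presentation m R by unfold_locales (rule R(2))
  obtain h where h: "h \<in> iso Pr.P G" using pres by (auto simp: finite_presentation_def is_iso_def)
  then have hb: "h \<in> hom Pr.P G" "bij_betw h (carrier Pr.P) (carrier G)" by (simp_all add: iso_def)
  interpret h: group_hom Pr.P G h
    using hb Pr.group_P is_group by (simp add: group_hom_def group_hom_axioms_def)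
  define y where "y = (\<lambda>i. h (Pr.gen i))"
  have y: "y i \<in> carrier G" if "i < m" for i using that by (simp add: y_def)
  have ev: "weval G y w = h (cls m R w)" if "w \<in> words m" for w
    using h.hom_weval[of m Pr.gen w] that by (simp add: y_def Pr.weval_gen)
  have lifts: "\<exists>w\<in>words m. weval G y w = g" if g: "g \<in> carrier G" for g
  proof -
    have "g \<in> h ` carrier Pr.P" using bij_betw_imp_surj_on[OF hb(2)] g by simp
    then obtain C where C: "C \<in> carrier Pr.P" "g = h C" by (elim imageE)
    from C(1) obtain w where "w \<in> words m" "C = cls m R w" by (rule Pr.P_cases)
    then show ?thesis using ev[of w] C(2) by (intro bexI[of _ w]) simp_all
  qed
  obtain wt where wt: "wt \<in> words m" "weval G y wt = t" using lifts[OF t(1)] by blast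
  obtain wb where wb: "wb \<in> words m" "weval G y wb = b" using lifts[OF b(1)] by blast
  define w where "w = wt @ wb @ winv wt @ winv wb"
  have w: "w \<in> words m" using wt wb by (simp add: w_def)
  have evw: "weval G y w = \<one>"
  proof -
    have "weval G y w = t \<otimes> (b \<otimes> (inv t \<otimes> inv b))"
      using wt wb by (simp add: w_def weval_append[of m y, OF y] weval_winv[of m y, OF y])
    also have "\<dots> = (t \<otimes> b) \<otimes> inv (b \<otimes> t)" using t b by (simp add: m_assoc inv_mult_group)
    also have "\<dots> = \<one>" using t b by (simp add: bt)
    finally show ?thesis .
  qed
  have "h (cls m R w) = h (cls m R [])" using ev[OF w] evw ev[of "[]"] by simp
  then have "cls m R w = cls m R []"
    by (rule inj_onD[OF bij_betw_imp_inj_on[OF hb(2)]]) (simp_all add: w)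
  then have "(w, []) \<in> pres_rel m R" by (simp add: cls_eq_iff)
  from pres_rel_multiplicities[OF this R(1)] obtain \<nu> where
    \<nu>: "\<And>M f. relator_additive m R M f \<Longrightarrow> M dvd f w - f [] - (\<Sum>r\<in>R. \<nu> r * f r)" by blast
  interpret H: group heisenberg by (rule group_heisenberg)
  interpret \<psi>: group_hom G integer_group \<psi>
    using \<psi> by (simp add: group_hom_def group_hom_axioms_def is_group)
  interpret \<beta>: group_hom G parity_group \<beta>
    using \<beta> group_parity by (simp add: group_hom_def group_hom_axioms_def is_group)
  have "fst \<in> hom heisenberg integer_group" by (auto simp: hom_def heisenberg_def)
  then interpret p: group_hom heisenberg integer_group fst
    by (simp add: group_hom_def group_hom_axioms_def H.is_group)
  have "(\<lambda>p. fst (snd p)) \<in> hom heisenberg parity_group" by (auto simp: hom_def heisenberg_def parity_group_def)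
  then interpret q: group_hom heisenberg parity_group "\<lambda>p. fst (snd p)"
    by (simp add: group_hom_def group_hom_axioms_def H.is_group group_parity)
  \<comment> \<open>An arbitrary lift of the generators. Relators evaluate into the centre, so the
    sign \<open>s\<close> of a word changes additively modulo two when a relator is
    inserted.\<close>
  define z where "z i = (\<psi> (y i), \<beta> (y i), False)" for i
  have z: "z i \<in> carrier heisenberg" for i by (simp add: heisenberg_def)
  define s where "s v = snd (snd (weval heisenberg z v))" for v
  have evz: "weval heisenberg z v = (\<psi> (weval G y v), \<beta> (weval G y v), s v)" if v: "v \<in> words m" for v
  proof -
    have "fst (weval heisenberg z v) = weval integer_group (\<lambda>i. \<psi> (y i)) v"
      using p.hom_weval[of m z, OF z v] by (simp add: z_def)
    also have "\<dots> = \<psi> (weval G y v)" by (rule \<psi>.hom_weval[of m y, OF y v, symmetric])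
    finally have 1: "fst (weval heisenberg z v) = \<psi> (weval G y v)" .
    have "fst (snd (weval heisenberg z v)) = weval parity_group (\<lambda>i. \<beta> (y i)) v"
      using q.hom_weval[of m z, OF z v] by (simp add: z_def)
    also have "\<dots> = \<beta> (weval G y v)" by (rule \<beta>.hom_weval[of m y, OF y v, symmetric])
    finally show ?thesis using 1 by (simp add: s_def prod_eq_iff)
  qed
  have one: "\<psi> \<one> = 0" "\<not> \<beta> \<one>" using \<psi>.hom_one \<beta>.hom_one by (simp_all add: parity_group_def)
  have rel: "weval heisenberg z r = (0, False, s r)" if "r \<in> R" for r
  proof -
    have "weval G y r = \<one>" using that R(2) ev[of r] Pr.relator_trivial[OF that] by auto
    then show ?thesis using evz[of r] that R(2) one by auto
  qed
  have "relator_additive m R 2 (\<lambda>v. of_bool (s v))"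
    unfolding relator_additive_def
  proof (intro ballI conjI allI impI)
    fix p q assume pq: "p \<in> words m" "q \<in> words m"
    { fix r assume r: "r \<in> R"
      then have "r \<in> words m" using R(2) by blast
      then have "weval heisenberg z (p @ r @ q) =
          weval heisenberg z p \<otimes>\<^bsub>heisenberg\<^esub> ((0, False, s r) \<otimes>\<^bsub>heisenberg\<^esub> weval heisenberg z q)"
        "weval heisenberg z (p @ q) = weval heisenberg z p \<otimes>\<^bsub>heisenberg\<^esub> weval heisenberg z q"
        using pq rel[OF r] by (simp_all add: H.weval_append[of m z, OF z])
      then have "s (p @ r @ q) = (s (p @ q) \<noteq> s r)"
        unfolding s_def[of "p @ r @ q"] s_def[of "p @ q"] evz[OF pq(1)] evz[OF pq(2)]
        by (auto simp: heisenberg_mult)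
      then show "2 dvd of_bool (s (p @ r @ q)) - of_bool (s (p @ q)) - (of_bool (s r) :: int)" by auto }
    fix i \<gamma> assume i: "i < m"
    have "weval heisenberg z (p @ [(i, \<gamma>), (i, \<not> \<gamma>)] @ q) = weval heisenberg z (p @ q)"
      using pq i z[of i] H.weval_closed[of m z q, OF z]
      by (auto simp: H.weval_append[of m z, OF z] H.inv_cancel)
    then show "2 dvd of_bool (s (p @ [(i, \<gamma>), (i, \<not> \<gamma>)] @ q)) - (of_bool (s (p @ q)) :: int)"
      by (simp add: s_def)
  qed
  from \<nu>[OF this] have par: "2 dvd of_bool (s w) - of_bool (s []) - (\<Sum>r\<in>R. \<nu> r * of_bool (s r))" .
  have "s w"
  proof -
    let ?T = "weval heisenberg z wt" and ?B = "weval heisenberg z wb"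
    have T: "?T = (1, False, s wt)" "?B = (0, True, s wb)" using evz wt wb t b by auto
    have c: "?T \<in> carrier heisenberg" "?B \<in> carrier heisenberg" by (simp_all add: heisenberg_def)
    have "weval heisenberg z w = ?T \<otimes>\<^bsub>heisenberg\<^esub> ?B \<otimes>\<^bsub>heisenberg\<^esub> inv\<^bsub>heisenberg\<^esub> (?B \<otimes>\<^bsub>heisenberg\<^esub> ?T)"
      using wt wb c by (simp add: w_def H.weval_append[of m z, OF z] H.weval_winv[of m z, OF z]
        H.inv_mult_group H.m_assoc)
    also have "?T \<otimes>\<^bsub>heisenberg\<^esub> ?B = (0, False, True) \<otimes>\<^bsub>heisenberg\<^esub> (?B \<otimes>\<^bsub>heisenberg\<^esub> ?T)"
      by (auto simp: T heisenberg_mult)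
    also have "\<dots> \<otimes>\<^bsub>heisenberg\<^esub> inv\<^bsub>heisenberg\<^esub> (?B \<otimes>\<^bsub>heisenberg\<^esub> ?T) = (0, False, True)"
    proof -
      have "(0, False, True) \<in> carrier heisenberg" by (simp add: heisenberg_def)
      then show ?thesis using c by (simp only: H.m_assoc H.r_inv H.r_one H.m_closed H.inv_closed)
    qed
    finally show ?thesis by (simp add: s_def)
  qed
  moreover have "\<not> s []" by (simp add: s_def heisenberg_def)
  ultimately have "odd (\<Sum>r\<in>R. \<nu> r * of_bool (s r))" using par by simp
  \<comment> \<open>Oddness of the sum yields a relator with nonzero multiplicity, which is the form
    in which it enters the linear algebra.\<close>
  then obtain r0 where r0: "r0 \<in> R" "\<nu> r0 \<noteq> 0"
    by (metis (no_types, lifting) sum.neutral mult_zero_left even_zero)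
  have ex0: "(\<Sum>r\<in>R. \<nu> r * expo j r) = 0" for j
  proof -
    have "expo j w = 0" "expo j [] = 0"
      by (simp_all add: w_def expo_def weval_integer_append weval_integer_winv)
    then show ?thesis using \<nu>[OF expo_relator_additive, of j] by simp
  qed
  \<comment> \<open>The equation of \<open>r0\<close> is exchanged for that of \<open>wt\<close>:
    the number of equations stays below \<open>m\<close>, and the solution will kill
    \<open>t\<close>.\<close>
  let ?E = "insert wt (R - {r0})"
  interpret Z: right_ore_domain \<Z> by (rule right_ore_domain_int)
  have "card ?E \<le> Suc (card (R - {r0}))" by (rule card_insert_le_m1) simp_all
  also have "\<dots> = card R" by (rule card.remove[OF R(1) r0(1), symmetric])
  finally have "card ?E < card {..<m}" using \<open>\<not> m \<le> card R\<close> by simp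
  then obtain c where c: "\<exists>j<m. c j \<noteq> 0" "\<forall>e\<in>?E. (\<Sum>j<m. expo j e * c j) = 0"
    using Z.homogeneous_system[of ?E "{..<m}" "\<lambda>e j. expo j e"] R(1)
    by (auto simp: int_finsum_eq)
  \<comment> \<open>The equation for \<open>r0\<close> was not imposed; it follows from
    \<open>ex0\<close> because \<open>\<nu> r0\<close> is nonzero.\<close>
  have cR: "weval integer_group c r = 0" if r: "r \<in> R" for r
  proof -
    have weq: "weval integer_group c r = (\<Sum>j<m. expo j r * c j)" if "r \<in> R" for r
      using that R(2) weval_integer_group by blast
    have "(\<Sum>r\<in>R. \<nu> r * weval integer_group c r) = (\<Sum>r\<in>R. \<nu> r * (\<Sum>j<m. expo j r * c j))"
      by (intro sum.cong refl) (simp add: weq)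
    also have "\<dots> = (\<Sum>j<m. (\<Sum>r\<in>R. \<nu> r * expo j r) * c j)"
      unfolding sum_distrib_left sum_distrib_right by (subst sum.swap) (simp add: mult.assoc)
    also have "\<dots> = 0" by (simp add: ex0)
    also have "(\<Sum>r\<in>R. \<nu> r * weval integer_group c r) =
      \<nu> r0 * weval integer_group c r0 + (\<Sum>r\<in>R - {r0}. \<nu> r * weval integer_group c r)"
      by (rule sum.remove[OF R(1) r0(1)])
    also have "(\<Sum>r\<in>R - {r0}. \<nu> r * weval integer_group c r) = 0"
      using c(2) weq by (intro sum.neutral) auto
    finally show ?thesis using r0(2) c(2) weq[OF r] r by (cases "r = r0") auto
  qed
  define \<chi> where "\<chi> = Pr.lift integer_group c"
  have \<chi>_cls: "\<chi> (cls m R v) = weval integer_group c v" if "v \<in> words m" for v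
    unfolding \<chi>_def by (rule Pr.lift_cls) (use cR that in simp_all)
  interpret \<chi>: group_hom Pr.P integer_group \<chi>
    unfolding \<chi>_def by (rule Pr.lift_hom) (use cR in simp_all)
  let ?k = "inv_into (carrier Pr.P) h"
  have k: "?k \<in> hom G Pr.P" using Pr.P.iso_set_sym[OF h] by (simp add: iso_def)
  have \<chi>k: "(\<lambda>g. \<chi> (?k g)) \<in> hom G integer_group"
    using Group.hom_compose[OF k \<chi>.homh] by (simp add: comp_def)
  have k_h: "?k (h C) = C" if "C \<in> carrier Pr.P" for C
    using hb(2) that by (simp add: bij_betw_def inv_into_f_f)
  have "\<chi> (?k t) = 0"
  proof -
    have "t = h (cls m R wt)" using ev[OF wt(1)] wt(2) by simp
    then have "?k t = cls m R wt" using k_h wt(1) by simp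
    then show ?thesis using \<chi>_cls[OF wt(1)] weval_integer_group[OF wt(1)] c(2) by simp
  qed
  have "c j = 0" if j: "j < m" for j
  proof -
    have "\<chi> (?k (h (Pr.gen j))) = 0"
      by (rule rigid[OF \<chi>k \<open>\<chi> (?k t) = 0\<close>]) (use j in simp)
    then show ?thesis using \<chi>_cls[of "[(j, True)]"] k_h[of "Pr.gen j"] j by (simp add: Pr.gen_def)
  qed
  then show False using c(1) by blast
qed

text \<open>The numbers of generators minus relators are negatives of natural numbers, so a greatest
  one exists, corresponding to the least natural number; only then does \<open>GREATEST\<close>
  denote a maximum.\<close>

lemma deficiency_nonpos:
  assumes "finite_presentation G m R"
    and "\<And>m R. finite_presentation G m R \<Longrightarrow> m \<le> card R"
  shows "deficiency G \<le> 0"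
proof -
  define P where "P k \<longleftrightarrow> (\<exists>m R. finite_presentation G m R \<and> k = int m - int (card R))" for k
  define l where "l = (LEAST l. P (- int l))"
  have neg: "\<exists>l. k = - int l" if "P k" for k
    using that assms(2) unfolding P_def by (intro exI[of _ "nat (- k)"]) force
  have "P (int m - int (card R))" using assms(1) unfolding P_def by blast
  then have "\<exists>l. P (- int l)" using neg by metis
  then have l: "P (- int l)" unfolding l_def by (rule LeastI_ex)
  have "deficiency G = - int l"
    unfolding deficiency_def P_def[symmetric]
  proof (rule Greatest_equality[of P, OF l])
    fix k assume k: "P k"
    then obtain l' where "k = - int l'" using neg by blast
    then show "k \<le> - int l" using k Least_le[of "\<lambda>l. P (- int l)" l'] by (simp add: l_def)
  qed
  then show ?thesis by simp
qed

text \<open>Counts the occurrences of \<open>b\<close> modulo two: every relator contains an even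
  number of them.\<close>

lemma (in fibred_example) parity_hom:
  "\<exists>\<beta>\<in>hom G parity_group. \<not> \<beta> t \<and> \<beta> b"
proof -
  let ?y = "\<lambda>i. i = Suc d"
  interpret Q: group parity_group by (rule group_parity)
  have inv: "inv\<^bsub>parity_group\<^esub> a = a" for a
    by (rule Q.inv_equality) (simp_all add: parity_group_def)
  have *: "weval parity_group ?y r = \<one>\<^bsub>parity_group\<^esub>" if "r \<in> Rel" for r
  proof (rule relators_hold[OF Q.is_group _ _ _ _ _ that])
    show "weval parity_group ?y (\<rho> j) = \<one>\<^bsub>parity_group\<^esub>" if "1 \<le> j" "j < d" for j
      by (rule Q.weval_one[OF _ \<rho>_words[OF that]]) (simp add: parity_group_def)
  qed (auto simp: parity_group_def inv[unfolded parity_group_def])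
  have y: "?y i \<in> carrier parity_group" for i by (simp add: parity_group_def)
  interpret \<beta>: group_hom G parity_group "Pr.lift parity_group ?y"
    by (rule Pr.lift_hom[OF Q.is_group y *])
  have "Pr.lift parity_group ?y (Pr.gen i) = weval parity_group ?y [(i, True)]" if "i < Suc (Suc d)" for i
    unfolding Pr.gen_def by (rule Pr.lift_cls[OF Q.is_group y *]) (use that in simp_all)
  then have "\<not> Pr.lift parity_group ?y t" "Pr.lift parity_group ?y b"
    by (simp_all add: parity_group_def)
  then show ?thesis using \<beta>.homh by blast
qed

theorem proposition2p5:
  fixes g n :: nat
  assumes "g \<ge> 1" and "n \<ge> 1"
  shows "\<exists>G :: word set monoid.
    finitely_presented G \<and>
    deficiency G \<le> 0 \<and> first_betti G = 1 \<and>
    (\<forall>\<psi>. generates_first_cohomology G \<psi> \<longrightarrow>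
       nth_degree G 0 \<psi> = enat (2 * g) \<and>
       (\<forall>i. 1 \<le> i \<and> i \<le> n - 1 \<longrightarrow> nth_degree G i \<psi> = enat (2 * g - 1)) \<and>
       nth_degree G n \<psi> = 0)"
proof -
  define d where "d = 2 * g"
  obtain \<rho> where \<rho>: "\<forall>j. 1 \<le> j \<and> j < d \<longrightarrow> \<rho> j \<in> words d \<and>
    cls d {} (\<rho> j) \<in> rational_derived (presented_group d {}) n \<and>
    fox (presented_group d {} Mod rational_derived (presented_group d {}) n)
      (\<lambda>i. rational_derived (presented_group d {}) n #>\<^bsub>presented_group d {}\<^esub> cls d {} [(i, True)]) j (\<rho> j) \<noteq> 0 \<and>
    (\<forall>i<d. 1 \<le> i \<and> i \<noteq> j \<longrightarrow>
      fox (presented_group d {} Mod rational_derived (presented_group d {}) n)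
        (\<lambda>i. rational_derived (presented_group d {}) n #>\<^bsub>presented_group d {}\<^esub> cls d {} [(i, True)]) i (\<rho> j) = 0)"
    using dual_relators[OF assms(2), of d] by (elim exE)
  interpret E: fibred_example d n \<rho>
    by unfold_locales (use \<rho> assms(1) in \<open>simp_all add: d_def\<close>)
  have fg: "fibred_group E.G d n E.x E.t E.b E.\<psi> \<rho>"
    by (rule E.fibred_group[OF assms(2)]) (use \<rho> in blast)+
  interpret fibred_group E.G d n E.x E.t E.b E.\<psi> \<rho> by (rule fg)
  have pres: "finite_presentation E.G (Suc (Suc d)) E.Rel"
    by (rule E.Pr.finite_presentation_P[OF E.finite_Rel])
  obtain \<beta> where \<beta>: "\<beta> \<in> hom E.G parity_group" "\<not> \<beta> E.t" "\<beta> E.b" using E.parity_hom by blast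
  have "m \<le> card R" if "finite_presentation E.G m R" for m R
  proof (rule group.relations_ge_generators[OF E.Pr.group_P t_closed \<psi>_t \<beta>(2) b_closed \<psi>_b \<beta>(3) b_t \<psi>_hom \<beta>(1) _ that])
    show "\<chi> h = 0" if "\<chi> \<in> hom E.G integer_group" "\<chi> E.t = 0" "h \<in> carrier E.G" for \<chi> h
      using hom_int_eq[OF that(1,3)] that(2) by simp
  qed
  then have "deficiency E.G \<le> 0" by (rule deficiency_nonpos[OF pres])
  moreover have "finitely_presented E.G"
    using pres E.Pr.group_P unfolding finitely_presented_def by blast
  moreover have "nth_degree E.G 0 \<psi>' = enat (2 * g) \<and>
      (\<forall>i. 1 \<le> i \<and> i \<le> n - 1 \<longrightarrow> nth_degree E.G i \<psi>' = enat (2 * g - 1)) \<and>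
      nth_degree E.G n \<psi>' = 0" if \<psi>': "generates_first_cohomology E.G \<psi>'" for \<psi>'
  proof -
    obtain c where c: "c \<noteq> 0" "\<And>h. h \<in> carrier E.G \<Longrightarrow> \<psi>' h = c * E.\<psi> h"
      using generator_scaled[OF \<psi>'] by blast
    have "nth_degree E.G i \<psi>' = enat (d - 1)" if "1 \<le> i" "i \<le> n - 1" for i
      by (rule nth_degrees(2)[OF c(2,1)]) (use that in simp_all)
    then show ?thesis using nth_degrees(1,3)[OF c(2,1)] by (simp add: d_def)
  qed
  ultimately show ?thesis using first_betti_one by blast
qed

end
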